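(* Let $N\in\mathbb{N}$ and $R>0$. The free pressure $\pi_R$ has the following properties. (1) $\pi_R(h)$ is convex on $(\mathcal{A}_R^{(N)})^{sa}$. (2) If $h_1,h_2\in(\mathcal{A}_R^{(N)})^{sa}$ and $h_1\le h_2$, then $\pi_R(h_1)\ge\pi_R(h_2)$. (3) $|\pi_R(h_1)-\pi_R(h_2)|\le\|h_1-h_2\|_R$ for all $h_1,h_2\in(\mathcal{A}_R^{(N)})^{sa}$. (4) If $R>R_1>0$ and $h\in(\mathcal{A}_R^{(N)})^{sa}$, then $\pi_{R_1}(r_{R,R_1}(h))\le\pi_R(h)$. (5) If $R,R_1>0$ and $h\in(\mathcal{A}_R^{(N)})^{sa}$, then $\pi_{R_1}(\rho_{R,R_1}(h))=\pi_R(h)+N\log(R_1/R)$. (6) Let $1\le L<N$, $h_1\in(\mathcal{A}_R^{(L)})^{sa}$ and $h_2\in(\mathcal{A}_R^{(N-L)})^{sa}$, and let $h_1+h_2\in(\mathcal{A}_R^{(N)})^{sa}$ be the sum formed by regarding $\mathcal{A}_R^{(L)}$ and $\mathcal{A}_R^{(N-L)}$ as $C^*$-subalgebras of $\mathcal{A}_R^{(N)}$. Then $\pi_R(h_1+h_2)\le\pi_R(h_1)+\pi_R(h_2)$. In particular, when $L=1$, $\pi_R(h_1+h_2)=\pi_R(h_1)+\pi_R(h_2)$.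
   Context: $M_n$ is the algebra of $n\times n$ complex matrices, $M_n^{sa}$ its selfadjoint part, $\mathrm{tr}_n$ the normalized trace, $\|\cdot\|$ the operator norm, $(M_n^{sa})_R:=\{A\in M_n^{sa}:\|A\|\le R\}$ and $(M_n^{sa})_R^N$ its $N$-fold Cartesian product. $\Lambda_n$ is the measure $d\Lambda_n(A):=2^{n(n-1)/2}\prod_{i=1}^n dA_{ii}\prod_{i<j}d(\mathrm{Re}\,A_{ij})\,d(\mathrm{Im}\,A_{ij})$ on $M_n^{sa}$, and $\Lambda_n^{\otimes N}$ is its $N$-fold product. $\mathbb{C}\langle X_1,\dots,X_N\rangle$ is the noncommutative polynomial $*$-algebra with $X_i^*=X_i$. For $R>0$ put $\|p\|_R:=\sup\{\|p(A_1,\dots,A_N)\|: A_i\in M_n^{sa},\ \|A_i\|\le R,\ n\in\mathbb{N}\}$, a $C^*$-norm, and let $\mathcal{A}_R^{(N)}$ be the corresponding $C^*$-completion (it is the $N$-fold full free product of $C([-R,R])$, with $X_i$ corresponding to the function $t\mapsto t$ in the $i$th copy); its norm is also written $\|\cdot\|_R$ and its selfadjoint part $(\mathcal{A}_R^{(N)})^{sa}$. For selfadjoint $a_1,\dots,a_N\in B(\mathcal{H})$ with $\|a_i\|\le R$, the map $p\mapsto p(a_1,\dots,a_N)$ extends to a $*$-homomorphism $h\in\mathcal{A}_R^{(N)}\mapsto h(a_1,\dots,a_N)\in B(\mathcal{H})$. Free pressure: for $h\in(\mathcal{A}_R^{(N)})^{sa}$, $$\pi_R(h):=\limsup_{n\to\infty}\Bigl(\frac1{n^2}\log\int_{(M_n^{sa})_R^N}\exp\bigl(-n^2\mathrm{tr}_n(h(A_1,\dots,A_N))\bigr)\,d\Lambda_n^{\otimes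 N}(A_1,\dots,A_N)+\frac N2\log n\Bigr).$$ (The number of variables, $N$, $L$ or $N-L$, is understood from the algebra containing $h$.) For $R_1<R$, $r_{R,R_1}:\mathcal{A}_R^{(N)}\to\mathcal{A}_{R_1}^{(N)}$ is the $*$-homomorphism induced by the restriction $f\mapsto f|_{[-R_1,R_1]}$ on each copy of $C([-R,R])$; it satisfies $r_{R,R_1}(p)=p$ for polynomials $p$. For $R,R_1>0$, $\rho_{R,R_1}:\mathcal{A}_R^{(N)}\to\mathcal{A}_{R_1}^{(N)}$ is the $*$-isomorphism induced by the dilation $f\mapsto f((R/R_1)\,\cdot)$; on polynomials, $\rho_{R,R_1}(p)(X_1,\dots,X_N)=p((R/R_1)X_1,\dots,(R/R_1)X_N)$. For $1\le L<N$, $\mathcal{A}_R^{(L)}$ and $\mathcal{A}_R^{(N-L)}$ are regarded as the $C^*$-subalgebras of $\mathcal{A}_R^{(N)}\cong\mathcal{A}_R^{(L)}\star\mathcal{A}_R^{(N-L)}$ generated by $X_1,\dots,X_L$ and by $X_{L+1},\dots,X_N$, respectively. *)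

theory Defs
  imports
    "HOL-Analysis.Analysis"
    "HOL-Library.Poly_Mapping"
    "Jordan_Normal_Form.Schur_Decomposition"
begin

section \<open>Selfadjoint matrices and the measure \<open>\<Lambda>\<^sub>n\<close>\<close>

definition vec_l2norm :: "complex Matrix.vec \<Rightarrow> real" where
  "vec_l2norm v = L2_set (\<lambda>i. cmod (vec_index v i)) {..<dim_vec v}"

definition op_norm :: "complex Matrix.mat \<Rightarrow> real" where
  "op_norm A = Sup {vec_l2norm (A *\<^sub>v v) |v. v \<in> carrier_vec (dim_col A) \<and> vec_l2norm v \<le> 1}"

definition ntrace :: "complex Matrix.mat \<Rightarrow> complex" where
  "ntrace A = (\<Sum>i<dim_row A. A $$ (i, i)) / of_nat (dim_row A)"

definition sa_mats :: "nat \<Rightarrow> complex Matrix.mat set" where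
  "sa_mats n = {A \<in> carrier_mat n n. mat_adjoint A = A}"

definition sa_ball :: "nat \<Rightarrow> real \<Rightarrow> complex Matrix.mat set" where
  "sa_ball n R = {A \<in> sa_mats n. op_norm A \<le> R}"

text \<open>
  \<open>N\<close>-tuples are functions on the index set \<open>{1..N}\<close>, so that the variables are
  \<open>X\<^sub>1, \<dots>, X\<^sub>N\<close>; matrix entries are indexed from \<open>0\<close> to \<open>n - 1\<close>.
\<close>

definition sa_tuples :: "nat \<Rightarrow> nat \<Rightarrow> real \<Rightarrow> (nat \<Rightarrow> complex Matrix.mat) set" where
  "sa_tuples N n R = {1..N} \<rightarrow>\<^sub>E sa_ball n R"

text \<open>
  The selfadjoint matrix with real coordinates \<open>x\<close>: the diagonal entries are \<open>x (i, i)\<close>, and for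
  \<open>i < j\<close> the real and imaginary parts of the \<open>(i, j)\<close> entry are \<open>x (i, j)\<close> and \<open>x (j, i)\<close>.
\<close>

definition sa_of_coords :: "nat \<Rightarrow> (nat \<times> nat \<Rightarrow> real) \<Rightarrow> complex Matrix.mat" where
  "sa_of_coords n x = Matrix.mat n n (\<lambda>(i, j).
     if i = j then complex_of_real (x (i, i))
     else if i < j then Complex (x (i, j)) (x (j, i))
     else Complex (x (j, i)) (- x (i, j)))"

definition Lambda :: "nat \<Rightarrow> complex Matrix.mat measure" where
  "Lambda n = scale_measure (2 ^ (n * (n - 1) div 2))
     (embed_measure (\<Pi>\<^sub>M ij \<in> {..<n} \<times> {..<n}. (lborel :: real measure)) (sa_of_coords n))"

section \<open>Noncommutative polynomials\<close>

text \<open>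
  The algebra of noncommutative polynomials is the monoid algebra over the complex numbers of the
  free monoid of words, written additively because \<open>Poly_Mapping\<close> multiplies polynomials by
  adding exponents.
\<close>

datatype ncword = NCWord (letters: "nat list")

instantiation ncword :: monoid_add
begin

definition zero_ncword :: ncword where "0 = NCWord []"

definition plus_ncword :: "ncword \<Rightarrow> ncword \<Rightarrow> ncword" where
  "v + w = NCWord (letters v @ letters w)"

instance
  by standard (simp_all add: zero_ncword_def plus_ncword_def)

end

type_synonym ncpoly = "ncword \<Rightarrow>\<^sub>0 complex"

definition ncpolys :: "nat \<Rightarrow> ncpoly set" where
  "ncpolys N = {p. \<forall>w \<in> Poly_Mapping.keys p. set (letters w) \<subseteq> {1..N}}"

definition ncconst :: "complex \<Rightarrow> ncpoly" where
  "ncconst c = Poly_Mapping.single 0 c"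

definition ncvar :: "nat \<Rightarrow> ncpoly" where
  "ncvar i = Poly_Mapping.single (NCWord [i]) 1"

definition ncpoly_star :: "ncpoly \<Rightarrow> ncpoly" where
  "ncpoly_star p =
     (\<Sum>w \<in> Poly_Mapping.keys p.
        Poly_Mapping.single (NCWord (rev (letters w))) (cnj (Poly_Mapping.lookup p w)))"

definition ncpoly_subst :: "(nat \<Rightarrow> ncpoly) \<Rightarrow> ncpoly \<Rightarrow> ncpoly" where
  "ncpoly_subst \<sigma> p =
     (\<Sum>w \<in> Poly_Mapping.keys p. ncconst (Poly_Mapping.lookup p w) * prod_list (map \<sigma> (letters w)))"

definition word_eval :: "nat \<Rightarrow> (nat \<Rightarrow> complex Matrix.mat) \<Rightarrow> ncword \<Rightarrow> complex Matrix.mat" where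
  "word_eval n A w = foldr (\<lambda>i M. A i * M) (letters w) (1\<^sub>m n)"

definition ncpoly_eval :: "nat \<Rightarrow> (nat \<Rightarrow> complex Matrix.mat) \<Rightarrow> ncpoly \<Rightarrow> complex Matrix.mat" where
  "ncpoly_eval n A p =
     Matrix.mat n n (\<lambda>ij. \<Sum>w \<in> Poly_Mapping.keys p. Poly_Mapping.lookup p w * (word_eval n A w $$ ij))"

definition ncpoly_norm :: "nat \<Rightarrow> real \<Rightarrow> ncpoly \<Rightarrow> real" where
  "ncpoly_norm N R p = Sup {op_norm (ncpoly_eval n A p) |n A. 1 \<le> n \<and> A \<in> sa_tuples N n R}"

section \<open>The completion\<close>

text \<open>
  The completion is the set of equivalence classes of Cauchy sequences of polynomials modulo null
  sequences. Its operations act on representatives and then saturate with respect to the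
  equivalence relation.
\<close>

definition nc_cauchy :: "nat \<Rightarrow> real \<Rightarrow> (nat \<Rightarrow> ncpoly) set" where
  "nc_cauchy N R = {s. (\<forall>k. s k \<in> ncpolys N) \<and>
     (\<forall>e>0. \<exists>m. \<forall>j\<ge>m. \<forall>k\<ge>m. ncpoly_norm N R (s j - s k) < e)}"

definition nc_rel :: "nat \<Rightarrow> real \<Rightarrow> ((nat \<Rightarrow> ncpoly) \<times> (nat \<Rightarrow> ncpoly)) set" where
  "nc_rel N R = {(s, t). s \<in> nc_cauchy N R \<and> t \<in> nc_cauchy N R \<and>
     (\<lambda>k. ncpoly_norm N R (s k - t k)) \<longlonglongrightarrow> 0}"

type_synonym nc_elem = "(nat \<Rightarrow> ncpoly) set"

definition nc_alg :: "nat \<Rightarrow> real \<Rightarrow> nc_elem set" where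
  "nc_alg N R = nc_cauchy N R // nc_rel N R"

text \<open>
  \<open>nc_map N R \<phi>\<close> is the extension by continuity, from any of the completions into
  \<open>nc_alg N R\<close>, of a bounded map \<open>\<phi>\<close> on polynomials.
\<close>

definition nc_map :: "nat \<Rightarrow> real \<Rightarrow> (ncpoly \<Rightarrow> ncpoly) \<Rightarrow> nc_elem \<Rightarrow> nc_elem" where
  "nc_map N R \<phi> h = nc_rel N R `` {\<phi> \<circ> s |s. s \<in> h}"

definition nc_map2 ::
    "nat \<Rightarrow> real \<Rightarrow> (ncpoly \<Rightarrow> ncpoly \<Rightarrow> ncpoly) \<Rightarrow> nc_elem \<Rightarrow> nc_elem \<Rightarrow> nc_elem" where
  "nc_map2 N R f g h = nc_rel N R `` {\<lambda>k. f (s k) (t k) |s t. s \<in> g \<and> t \<in> h}"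

definition nc_add :: "nat \<Rightarrow> real \<Rightarrow> nc_elem \<Rightarrow> nc_elem \<Rightarrow> nc_elem" where
  "nc_add N R = nc_map2 N R (+)"

definition nc_diff :: "nat \<Rightarrow> real \<Rightarrow> nc_elem \<Rightarrow> nc_elem \<Rightarrow> nc_elem" where
  "nc_diff N R = nc_map2 N R (-)"

definition nc_mult :: "nat \<Rightarrow> real \<Rightarrow> nc_elem \<Rightarrow> nc_elem \<Rightarrow> nc_elem" where
  "nc_mult N R = nc_map2 N R (*)"

definition nc_scale :: "nat \<Rightarrow> real \<Rightarrow> complex \<Rightarrow> nc_elem \<Rightarrow> nc_elem" where
  "nc_scale N R c = nc_map N R (\<lambda>p. ncconst c * p)"

definition nc_star :: "nat \<Rightarrow> real \<Rightarrow> nc_elem \<Rightarrow> nc_elem" where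
  "nc_star N R = nc_map N R ncpoly_star"

definition nc_norm :: "nat \<Rightarrow> real \<Rightarrow> nc_elem \<Rightarrow> real" where
  "nc_norm N R h = (THE r. \<forall>s \<in> h. (\<lambda>k. ncpoly_norm N R (s k)) \<longlonglongrightarrow> r)"

definition nc_sa :: "nat \<Rightarrow> real \<Rightarrow> nc_elem set" where
  "nc_sa N R = {h \<in> nc_alg N R. nc_star N R h = h}"

definition nc_le :: "nat \<Rightarrow> real \<Rightarrow> nc_elem \<Rightarrow> nc_elem \<Rightarrow> bool" where
  "nc_le N R g h \<longleftrightarrow> (\<exists>b \<in> nc_alg N R. nc_diff N R h g = nc_mult N R (nc_star N R b) b)"

text \<open>
  Evaluation at an \<open>N\<close>-tuple of selfadjoint \<open>n \<times> n\<close> matrices of norm at most \<open>R\<close>, the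
  extension by continuity of \<open>ncpoly_eval n A\<close>.
\<close>

definition nc_eval :: "nat \<Rightarrow> (nat \<Rightarrow> complex Matrix.mat) \<Rightarrow> nc_elem \<Rightarrow> complex Matrix.mat" where
  "nc_eval n A h = Matrix.mat n n (\<lambda>ij. THE z. \<forall>s \<in> h. (\<lambda>k. ncpoly_eval n A (s k) $$ ij) \<longlonglongrightarrow> z)"

text \<open>
  The restriction homomorphism into \<open>nc_alg N R\<^sub>1\<close> is the identity on polynomials, the dilation
  isomorphism \<open>nc_alg N R \<rightarrow> nc_alg N R\<^sub>1\<close> substitutes \<open>(R/R\<^sub>1) X\<^sub>i\<close> for \<open>X\<^sub>i\<close>, and the two
  embeddings of free factors into \<open>nc_alg N R\<close> send \<open>X\<^sub>i\<close> to \<open>X\<^sub>i\<close> and to \<open>X\<^sub>L\<^sub>+\<^sub>i\<close>,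
  respectively.
\<close>

definition nc_restrict :: "nat \<Rightarrow> real \<Rightarrow> nc_elem \<Rightarrow> nc_elem" where
  "nc_restrict N R\<^sub>1 = nc_map N R\<^sub>1 id"

definition nc_dilate :: "nat \<Rightarrow> real \<Rightarrow> real \<Rightarrow> nc_elem \<Rightarrow> nc_elem" where
  "nc_dilate N R R\<^sub>1 =
     nc_map N R\<^sub>1 (ncpoly_subst (\<lambda>i. ncconst (complex_of_real (R / R\<^sub>1)) * ncvar i))"

definition nc_embed_left :: "nat \<Rightarrow> real \<Rightarrow> nc_elem \<Rightarrow> nc_elem" where
  "nc_embed_left N R = nc_map N R id"

definition nc_embed_right :: "nat \<Rightarrow> nat \<Rightarrow> real \<Rightarrow> nc_elem \<Rightarrow> nc_elem" where
  "nc_embed_right L N R = nc_map N R (ncpoly_subst (\<lambda>i. ncvar (L + i)))"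

section \<open>Free pressure\<close>

text \<open>
  The trace is real for selfadjoint \<open>h\<close>, and \<open>Re\<close> only adjusts the type. The junk term at
  \<open>n = 0\<close> does not affect the limit superior, which is taken in the extended reals.
\<close>

definition free_pressure :: "nat \<Rightarrow> real \<Rightarrow> nc_elem \<Rightarrow> ereal" where
  "free_pressure N R h = limsup (\<lambda>n. ereal (
     1 / (real n)\<^sup>2 * ln (set_lebesgue_integral (\<Pi>\<^sub>M i \<in> {1..N}. Lambda n) (sa_tuples N n R)
        (\<lambda>A. exp (- ((real n)\<^sup>2 * Re (ntrace (nc_eval n A h))))))
     + real N / 2 * ln (real n)))"

end

theory Submission
  imports
    Defs
    "HOL-Probability.Probability"
    "HOL-Real_Asymp.Real_Asymp"
    "HOL-Combinatorics.Permutations"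
begin

text \<open>
  All inequalities already hold for each \<open>n\<close> between the logarithms of the partition functions:
  convexity is convexity of \<open>exp\<close>, the Lipschitz bound and monotonicity are pointwise bounds of the
  trace, dilation is a linear change of variables, and the partition function of a sum over two free
  factors is a product by Fubini. Two points need the asymptotics for a single matrix: differences of
  pressures only make sense once the pressure is finite, and additivity for \<open>L = 1\<close> needs an honest
  limit in the first summand. For one matrix and a polynomial potential, the Weyl integration
  formula turns the partition function into an explicit constant times a log-gas integral over
  \<open>[-R, R]\<^sup>n\<close>, where the logarithm of the maximal Boltzmann weight, divided by
  \<open>n (n - 1)\<close>, is decreasing in \<open>n\<close> (as for Fekete points) and hence converges.

  The Weyl formula is proved by induction on \<open>n\<close>, splitting off the largest eigenvalue: with the
  eigenvector in the affine chart \<open>(-Z, 1)\<close>, the remaining spectrum is that of a compression of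
  the matrix, a congruence with known Jacobian.
\<close>

unbundle no vec_syntax
no_notation Group.m_inv  ("inv\<index> _" [81] 80)

subsection \<open>Adjoints and unitary matrices\<close>

lemma mat_adjoint_dims [simp]:
  "dim_row (mat_adjoint A) = dim_col A" "dim_col (mat_adjoint A) = dim_row A"
  by (simp_all add: mat_adjoint_def)

lemma mat_adjoint_index [simp]:
  fixes A :: "complex Matrix.mat"
  assumes "i < dim_col A" "j < dim_row A"
  shows "mat_adjoint A $$ (i, j) = cnj (A $$ (j, i))"
  using assms by (simp add: mat_adjoint_def mat_of_rows_index)

lemma mat_adjoint_carrier [simp]: "A \<in> carrier_mat n m \<Longrightarrow> mat_adjoint A \<in> carrier_mat m n"
  by auto

lemma mat_adjoint_adjoint [simp]: "mat_adjoint (mat_adjoint A) = (A :: complex Matrix.mat)"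
  by (rule eq_matI) auto

lemma mat_adjoint_mult:
  fixes A B :: "complex Matrix.mat"
  assumes "A \<in> carrier_mat n m" "B \<in> carrier_mat m k"
  shows "mat_adjoint (A * B) = mat_adjoint B * mat_adjoint A"
  by (rule eq_matI) (use assms in \<open>auto simp: scalar_prod_def intro!: sum.cong\<close>)

lemma mat_adjoint_add:
  fixes A B :: "complex Matrix.mat"
  assumes "A \<in> carrier_mat n m" "B \<in> carrier_mat n m"
  shows "mat_adjoint (A + B) = mat_adjoint A + mat_adjoint B"
  by (rule eq_matI) (use assms in auto)

lemma mat_adjoint_one [simp]: "mat_adjoint (1\<^sub>m n :: complex Matrix.mat) = 1\<^sub>m n"
  by (rule eq_matI) auto

lemmas sq_assoc = assoc_mult_mat[of _ n n _ n _ n] for n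
lemmas sq_carrier = mult_carrier_mat[of _ n n _ n] for n

definition unitary_mat :: "nat \<Rightarrow> complex Matrix.mat \<Rightarrow> bool" where
  "unitary_mat n U \<longleftrightarrow> U \<in> carrier_mat n n \<and> mat_adjoint U * U = 1\<^sub>m n \<and> U * mat_adjoint U = 1\<^sub>m n"

lemma unitary_matD:
  assumes "unitary_mat n U"
  shows "U \<in> carrier_mat n n" "mat_adjoint U \<in> carrier_mat n n"
    "mat_adjoint U * U = 1\<^sub>m n" "U * mat_adjoint U = 1\<^sub>m n"
  using assms by (auto simp: unitary_mat_def)

lemma unitary_mat_adjoint: "unitary_mat n U \<Longrightarrow> unitary_mat n (mat_adjoint U)"
  by (auto simp: unitary_mat_def)

lemma unitary_matI:
  assumes U: "U \<in> carrier_mat n n" and "mat_adjoint U * U = 1\<^sub>m n"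
  shows "unitary_mat n U"
  using mat_mult_left_right_inverse[OF _ U assms(2)] assms by (auto simp: unitary_mat_def)

lemma unitary_mat_one [simp]: "unitary_mat n (1\<^sub>m n)"
  by (rule unitary_matI) auto

lemma unitary_mat_mult:
  assumes U: "unitary_mat n U" and V: "unitary_mat n V"
  shows "unitary_mat n (U * V)"
proof (rule unitary_matI)
  note [simp] = unitary_matD(1,2)[OF U] unitary_matD(1,2)[OF V]
  show "U * V \<in> carrier_mat n n"
    by (meson mult_carrier_mat unitary_matD(1)[OF U] unitary_matD(1)[OF V])
  have "mat_adjoint (U * V) * (U * V) = mat_adjoint V * mat_adjoint U * (U * V)"
    by (subst mat_adjoint_mult[of _ n n _ n]) auto
  also have "\<dots> = mat_adjoint V * ((mat_adjoint U * U) * V)"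
    by (simp add: sq_assoc[of _ n] sq_carrier[of _ n])
  also have "\<dots> = 1\<^sub>m n" by (simp add: unitary_matD[OF U] unitary_matD[OF V] left_mult_one_mat[of _ n n])
  finally show "mat_adjoint (U * V) * (U * V) = 1\<^sub>m n" .
qed

definition conj_by :: "complex Matrix.mat \<Rightarrow> complex Matrix.mat \<Rightarrow> complex Matrix.mat" where
  "conj_by U A = U * A * mat_adjoint U"

lemma conj_by_carrier [simp]:
  "U \<in> carrier_mat n n \<Longrightarrow> A \<in> carrier_mat n n \<Longrightarrow> conj_by U A \<in> carrier_mat n n"
  by (auto simp: conj_by_def)

lemma conj_by_mult:
  assumes U: "unitary_mat n U" and A: "A \<in> carrier_mat n n" and B: "B \<in> carrier_mat n n"
  shows "conj_by U (A * B) = conj_by U A * conj_by U B"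
proof -
  note c = unitary_matD(1,2)[OF U] A B
  have "conj_by U A * conj_by U B = U * A * (mat_adjoint U * U) * B * mat_adjoint U"
    unfolding conj_by_def using c by (simp add: sq_assoc[of _ n] sq_carrier[of _ n])
  also have "\<dots> = conj_by U (A * B)"
    unfolding conj_by_def unitary_matD(3)[OF U] using c
    by (simp add: sq_assoc[of _ n] sq_carrier[of _ n] left_mult_one_mat[of _ n n])
  finally show ?thesis by simp
qed

lemma conj_by_one [simp]: "unitary_mat n U \<Longrightarrow> conj_by U (1\<^sub>m n) = 1\<^sub>m n"
  using unitary_matD[of n U] by (auto simp: conj_by_def)

lemma conj_by_comp:
  assumes U: "U \<in> carrier_mat n n" and V: "V \<in> carrier_mat n n" and A: "A \<in> carrier_mat n n"
  shows "conj_by U (conj_by V A) = conj_by (U * V) A"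
proof -
  have "conj_by (U * V) A = U * V * A * (mat_adjoint V * mat_adjoint U)"
    unfolding conj_by_def by (subst mat_adjoint_mult[OF U V]) simp
  also have "\<dots> = conj_by U (conj_by V A)"
    unfolding conj_by_def using assms mat_adjoint_carrier[OF U] mat_adjoint_carrier[OF V]
    by (simp add: sq_assoc[of _ n] sq_carrier[of _ n])
  finally show ?thesis by simp
qed

lemma conj_by_inverse [simp]:
  assumes U: "unitary_mat n U" and A: "A \<in> carrier_mat n n"
  shows "conj_by (mat_adjoint U) (conj_by U A) = A" "conj_by U (conj_by (mat_adjoint U) A) = A"
proof -
  have "conj_by (1\<^sub>m n) A = A" using A by (auto simp: conj_by_def)
  then show "conj_by (mat_adjoint U) (conj_by U A) = A" "conj_by U (conj_by (mat_adjoint U) A) = A"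
    using conj_by_comp[of U n "mat_adjoint U" A] conj_by_comp[of "mat_adjoint U" n U A]
      unitary_matD[OF U] A by auto
qed

lemma conj_by_add:
  assumes U: "U \<in> carrier_mat n n" and A: "A \<in> carrier_mat n n" and B: "B \<in> carrier_mat n n"
  shows "conj_by U (A + B) = conj_by U A + conj_by U B"
proof -
  have "conj_by U (A + B) = (U * A + U * B) * mat_adjoint U"
    unfolding conj_by_def using mult_add_distrib_mat[OF U A B] by simp
  also have "\<dots> = conj_by U A + conj_by U B"
    unfolding conj_by_def
    using add_mult_distrib_mat[of "U * A" n n "U * B" "mat_adjoint U" n] assms by auto
  finally show ?thesis .
qed

lemma conj_by_smult:
  assumes U: "U \<in> carrier_mat n n" and A: "A \<in> carrier_mat n n"
  shows "conj_by U (c \<cdot>\<^sub>m A) = c \<cdot>\<^sub>m conj_by U A"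
  using assms unfolding conj_by_def
  by (simp add: mult_smult_distrib[of _ n n _ n] mult_smult_assoc_mat[of _ n n _ n] sq_carrier[of _ n])

lemma conj_by_minus:
  assumes U: "U \<in> carrier_mat n n" and A: "A \<in> carrier_mat n n" and B: "B \<in> carrier_mat n n"
  shows "conj_by U (A - B) = conj_by U A - conj_by U B"
proof -
  have "A - B = A + (-1) \<cdot>\<^sub>m B" "conj_by U A - conj_by U B = conj_by U A + (-1) \<cdot>\<^sub>m conj_by U B"
    using assms by (auto intro!: eq_matI simp: conj_by_def)
  then show ?thesis using assms by (simp add: conj_by_add conj_by_smult)
qed

lemma mat_adjoint_conj_by:
  assumes U: "U \<in> carrier_mat n n" and A: "A \<in> carrier_mat n n"
  shows "mat_adjoint (conj_by U A) = conj_by U (mat_adjoint A)"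
  using assms unfolding conj_by_def
  by (simp add: mat_adjoint_mult[of _ n n _ n] sq_assoc[of _ n] sq_carrier[of _ n])

lemma sa_mats_conj_by: "U \<in> carrier_mat n n \<Longrightarrow> A \<in> sa_mats n \<Longrightarrow> conj_by U A \<in> sa_mats n"
  by (auto simp: sa_mats_def mat_adjoint_conj_by)

lemma similar_conj_by:
  assumes U: "unitary_mat n U" and A: "A \<in> carrier_mat n n"
  shows "similar_mat (conj_by U A) A"
  unfolding similar_mat_def
  by (rule exI[of _ U], rule exI[of _ "mat_adjoint U"], rule similar_mat_witI[of _ _ n])
     (use unitary_matD[OF U] A in \<open>auto simp: conj_by_def\<close>)

lemma char_poly_conj_by:
  "unitary_mat n U \<Longrightarrow> A \<in> carrier_mat n n \<Longrightarrow> char_poly (conj_by U A) = char_poly A"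
  by (rule char_poly_similar[OF similar_conj_by])

lemma trace_mult_commute:
  fixes A B :: "complex Matrix.mat"
  assumes "A \<in> carrier_mat n m" "B \<in> carrier_mat m n"
  shows "(\<Sum>i<n. (A * B) $$ (i, i)) = (\<Sum>i<m. (B * A) $$ (i, i))"
proof -
  have "(\<Sum>i<n. (A * B) $$ (i, i)) = (\<Sum>i<n. \<Sum>j<m. A $$ (i, j) * B $$ (j, i))"
    using assms by (auto simp: scalar_prod_def atLeast0LessThan intro!: sum.cong)
  also have "\<dots> = (\<Sum>j<m. \<Sum>i<n. B $$ (j, i) * A $$ (i, j))"
    by (subst sum.swap) (simp add: mult.commute)
  also have "\<dots> = (\<Sum>i<m. (B * A) $$ (i, i))"
    using assms by (auto simp: scalar_prod_def atLeast0LessThan intro!: sum.cong)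
  finally show ?thesis .
qed

lemma trace_conj_by:
  assumes U: "unitary_mat n U" and A: "A \<in> carrier_mat n n"
  shows "(\<Sum>i<n. conj_by U A $$ (i, i)) = (\<Sum>i<n. A $$ (i, i))"
proof -
  have "(\<Sum>i<n. conj_by U A $$ (i, i)) = (\<Sum>i<n. (mat_adjoint U * (U * A)) $$ (i, i))"
    unfolding conj_by_def by (rule trace_mult_commute) (use unitary_matD[OF U] A in auto)
  also have "mat_adjoint U * (U * A) = A"
    using unitary_matD[OF U] A
    by (simp add: sq_assoc[of _ n, symmetric] sq_carrier[of _ n] left_mult_one_mat[of _ n n])
  finally show ?thesis .
qed

subsection \<open>The spectral theorem\<close>

definition real_diag :: "nat \<Rightarrow> (nat \<Rightarrow> real) \<Rightarrow> complex Matrix.mat" where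
  "real_diag n d = Matrix.mat n n (\<lambda>(i, j). if i = j then complex_of_real (d i) else 0)"

lemma real_diag_carrier [simp]: "real_diag n d \<in> carrier_mat n n"
  by (simp add: real_diag_def)

lemma real_diag_sa [simp]: "real_diag n d \<in> sa_mats n"
  unfolding sa_mats_def by (auto simp: real_diag_def intro!: eq_matI)

lemma real_diag_index [simp]:
  "i < n \<Longrightarrow> j < n \<Longrightarrow> real_diag n d $$ (i, j) = (if i = j then complex_of_real (d i) else 0)"
  by (simp add: real_diag_def)

lemma real_diag_dims [simp]: "dim_row (real_diag n d) = n" "dim_col (real_diag n d) = n"
  by (simp_all add: real_diag_def)

lemma real_diag_mult_left:
  assumes "A \<in> carrier_mat n m" "i < n" "j < m"
  shows "(real_diag n d * A) $$ (i, j) = d i * A $$ (i, j)"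
proof -
  have "(real_diag n d * A) $$ (i, j) = (\<Sum>k<n. (if i = k then d i else 0) * A $$ (k, j))"
    using assms by (auto simp: scalar_prod_def atLeast0LessThan intro!: sum.cong)
  also have "\<dots> = (\<Sum>k<n. if i = k then d i * A $$ (k, j) else 0)"
    by (intro sum.cong) auto
  finally show ?thesis using assms by simp
qed

lemma real_diag_mult_right:
  assumes "A \<in> carrier_mat m n" "i < m" "j < n"
  shows "(A * real_diag n d) $$ (i, j) = A $$ (i, j) * d j"
proof -
  have "(A * real_diag n d) $$ (i, j) = (\<Sum>k<n. A $$ (i, k) * (if k = j then d k else 0))"
    using assms by (auto simp: scalar_prod_def atLeast0LessThan intro!: sum.cong)
  also have "\<dots> = (\<Sum>k<n. if k = j then A $$ (i, k) * d k else 0)"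
    by (intro sum.cong) auto
  finally show ?thesis using assms by simp
qed

lemma real_diag_mult: "real_diag n d * real_diag n e = real_diag n (\<lambda>i. d i * e i)"
  by (rule eq_matI) (auto simp: real_diag_mult_left[of _ n n] simp del: index_mult_mat(1))

lemma real_diag_one: "real_diag n (\<lambda>_. 1) = 1\<^sub>m n"
  by (rule eq_matI) auto

lemma sa_matsD: 
  assumes "A \<in> sa_mats n"
  shows "A \<in> carrier_mat n n" "mat_adjoint A = A"
    "\<And>i j. i < n \<Longrightarrow> j < n \<Longrightarrow> A $$ (i, j) = cnj (A $$ (j, i))"
proof -
  show *: "A \<in> carrier_mat n n" "mat_adjoint A = A" using assms by (simp_all add: sa_mats_def)
  fix i j assume "i < n" "j < n"
  then have "mat_adjoint A $$ (i, j) = cnj (A $$ (j, i))" using *(1) by (intro mat_adjoint_index) auto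
  then show "A $$ (i, j) = cnj (A $$ (j, i))" by (simp only: *(2))
qed

lemma unitary_of_corthogonal:
  fixes ws :: "complex Matrix.vec list"
  assumes ws: "set ws \<subseteq> carrier_vec n" "corthogonal ws" "length ws = n"
  obtains U c where "unitary_mat n U" "\<And>i j. i < n \<Longrightarrow> j < n \<Longrightarrow> U $$ (i, j) = c j * (ws ! j) $ i"
proof -
  define c where "c j = complex_of_real (1 / sqrt (Re (ws ! j \<bullet>c ws ! j)))" for j
  define U where "U = Matrix.mat n n (\<lambda>(i, j). c j * (ws ! j) $ i)"
  have dim: "dim_vec (ws ! j) = n" if "j < n" for j
    using ws that by (metis carrier_vecD nth_mem subset_code(1))
  have ip: "ws ! j \<bullet>c ws ! k = (\<Sum>i<n. (ws ! j) $ i * cnj ((ws ! k) $ i))" if "j < n" "k < n" for j k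
    using dim[OF that(1)] dim[OF that(2)] by (auto simp: scalar_prod_def atLeast0LessThan intro!: sum.cong)
  have "mat_adjoint U * U = 1\<^sub>m n"
  proof (rule eq_matI)
    fix i j assume ij: "i < dim_row (1\<^sub>m n :: complex Matrix.mat)" "j < dim_col (1\<^sub>m n :: complex Matrix.mat)"
    then have ij: "i < n" "j < n" by auto
    have "(mat_adjoint U * U) $$ (i, j) = (\<Sum>k<n. cnj (c i * (ws ! i) $ k) * (c j * (ws ! j) $ k))"
      using ij by (auto simp: U_def scalar_prod_def atLeast0LessThan intro!: sum.cong)
    also have "\<dots> = cnj (c i) * c j * (\<Sum>k<n. (ws ! j) $ k * cnj ((ws ! i) $ k))"
      by (simp add: sum_distrib_left mult_ac)
    also have "\<dots> = cnj (c i) * c j * (ws ! j \<bullet>c ws ! i)" using ip[OF ij(2,1)] by simp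
    also have "\<dots> = (if i = j then 1 else 0)"
    proof (cases "i = j")
      case False
      then have "ws ! j \<bullet>c ws ! i = 0" using corthogonalD[OF ws(2)] ws(3) ij by simp
      then show ?thesis using False by simp
    next
      case True
      define r where "r = (\<Sum>k<n. (cmod ((ws ! i) $ k))\<^sup>2)"
      have r: "ws ! i \<bullet>c ws ! i = of_real r"
        unfolding ip[OF ij(1) ij(1)] r_def by (simp add: complex_norm_square del: of_real_power)
      have "ws ! i \<bullet>c ws ! i \<noteq> 0" using corthogonalD[OF ws(2)] ws(3) ij by simp
      moreover have "r \<ge> 0" unfolding r_def by (simp add: sum_nonneg)
      ultimately have r0: "r > 0" using r by auto
      have "cnj (c i) * c i = of_real ((1 / sqrt r) * (1 / sqrt r))" using r by (simp add: c_def del: real_sqrt_mult_self)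
      also have "(1 / sqrt r) * (1 / sqrt r) = 1 / r" using r0 by (simp add: field_simps)
      finally have "cnj (c i) * c i * of_real r = 1" using r0 by (simp flip: of_real_mult)
      then show ?thesis using True r by simp
    qed
    finally show "(mat_adjoint U * U) $$ (i, j) = 1\<^sub>m n $$ (i, j)" using ij by simp
  qed (auto simp: U_def)
  moreover have "U \<in> carrier_mat n n" by (simp add: U_def)
  ultimately have "unitary_mat n U" by (intro unitary_matI)
  then show ?thesis using that[of U c] by (simp add: U_def)
qed

lemma unitary_first_column:
  fixes v :: "complex Matrix.vec"
  assumes v: "v \<in> carrier_vec n" "v \<noteq> 0\<^sub>v n"
  obtains U c where "unitary_mat n U" "\<And>i. i < n \<Longrightarrow> U $$ (i, 0) = c * v $ i"
proof -
  interpret cof_vec_space n "TYPE(complex)" .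
  define b where "b = basis_completion v"
  define ws where "ws = gram_schmidt n b"
  from basis_completion[OF v, folded b_def]
  have span_b: "span (set b) = carrier_vec n" and dist_b: "distinct b" 
    and indep: "\<not> lin_dep (set b)" and b: "set b \<subseteq> carrier_vec n" and hdb: "hd b = v" 
    and len_b: "length b = n" by auto
  have n: "n \<noteq> 0"
  proof
    assume "n = 0"
    then have "v = 0\<^sub>v n" using v(1) by (intro eq_vecI) auto
    then show False using v(2) by simp
  qed
  then obtain vs where bv: "b = v # vs" using hdb len_b by (cases b) auto
  from gram_schmidt_result[OF b dist_b indep refl, folded ws_def]
  have ws: "set ws \<subseteq> carrier_vec n" "corthogonal ws" "length ws = n" by (auto simp: len_b)
  from gram_schmidt_hd[OF v(1), of vs, folded bv] have hdws: "ws ! 0 = v"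
    unfolding ws_def[symmetric] using ws(3) n by (cases ws) auto
  obtain U c where "unitary_mat n U" "\<And>i j. i < n \<Longrightarrow> j < n \<Longrightarrow> U $$ (i, j) = c j * (ws ! j) $ i"
    using unitary_of_corthogonal[OF ws] by blast
  then show ?thesis using that[of U "c 0"] hdws n by simp
qed

lemma unitary_block:
  assumes "unitary_mat n V"
  shows "unitary_mat (Suc n) (four_block_mat (1\<^sub>m 1) (0\<^sub>m 1 n) (0\<^sub>m n 1) V)" (is "unitary_mat _ ?W")
proof (rule unitary_matI)
  note V = unitary_matD[OF assms]
  show "?W \<in> carrier_mat (Suc n) (Suc n)" using V by auto
  have adj: "mat_adjoint ?W = four_block_mat (1\<^sub>m 1) (0\<^sub>m 1 n) (0\<^sub>m n 1) (mat_adjoint V)"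
    by (rule eq_matI) (use V in \<open>auto simp: index_mat_four_block(1)\<close>)
  show "mat_adjoint ?W * ?W = 1\<^sub>m (Suc n)"
    unfolding adj
    by (subst mult_four_block_mat[of _ 1 1 _ n _ n _ _ 1 _ n]) (use V in auto)
qed

theorem spectral_theorem:
  assumes "A \<in> sa_mats n"
  obtains U d where "unitary_mat n U" "A = conj_by U (real_diag n d)"
proof -
  have "\<exists>U d. unitary_mat n U \<and> A = conj_by U (real_diag n d)"
    using assms
  proof (induction n arbitrary: A)
    case 0
    then have "A = conj_by (1\<^sub>m 0) (real_diag 0 (\<lambda>_. 0))"
      by (auto simp: sa_mats_def conj_by_def intro!: eq_matI)
    then show ?case using unitary_mat_one by blast
  next
    case (Suc n)
    note A = sa_matsD[OF Suc.prems]
    obtain es where "char_poly A = (\<Prod> e \<leftarrow> es. [:- e, 1:])" "length es = Suc n"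
      using char_poly_factorized[OF A(1)] by auto
    then obtain e where "poly (char_poly A) e = 0"
      by (cases es) auto
    then have e: "eigenvalue A e" using eigenvalue_root_char_poly[OF A(1)] by simp
    define v where "v = find_eigenvector A e"
    have "eigenvector A v e" using find_eigenvector[OF A(1) e] by (simp add: v_def)
    then have v: "v \<in> carrier_vec (Suc n)" "v \<noteq> 0\<^sub>v (Suc n)" "A *\<^sub>v v = e \<cdot>\<^sub>v v"
      using A(1) by (auto simp: eigenvector_def)
    obtain U c where U: "unitary_mat (Suc n) U" and U0: "\<And>i. i < Suc n \<Longrightarrow> U $$ (i, 0) = c * v $ i"
      using unitary_first_column[OF v(1,2)] by blast
    note U' = unitary_matD[OF U]
    have AU: "(A * U) $$ (i, 0) = e * U $$ (i, 0)" if i: "i < Suc n" for i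
    proof -
      have "(A * U) $$ (i, 0) = (\<Sum>k<Suc n. A $$ (i, k) * U $$ (k, 0))"
        using i U'(1) A(1) by (auto simp: scalar_prod_def atLeast0LessThan simp del: sum.lessThan_Suc)
      also have "\<dots> = (\<Sum>k<Suc n. A $$ (i, k) * (c * v $ k))"
        by (rule sum.cong) (simp_all add: U0)
      also have "\<dots> = c * (\<Sum>k<Suc n. A $$ (i, k) * v $ k)" 
        unfolding sum_distrib_left by (rule sum.cong) (simp_all add: mult_ac)
      also have "(\<Sum>k<Suc n. A $$ (i, k) * v $ k) = (A *\<^sub>v v) $ i"
        using i A(1) v(1) by (auto simp: scalar_prod_def atLeast0LessThan simp del: sum.lessThan_Suc intro!: sum.cong)
      also have "\<dots> = e * v $ i" using v(1) i by (subst v(3)) auto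
      finally show ?thesis using U0[OF i] by simp
    qed
    define B where "B = conj_by (mat_adjoint U) A"
    have B: "B \<in> sa_mats (Suc n)" unfolding B_def using U' Suc.prems by (intro sa_mats_conj_by) auto
    have Beq: "B = mat_adjoint U * (A * U)" unfolding B_def conj_by_def using U' A(1)
      by (simp add: sq_assoc[of _ "Suc n"] sq_carrier[of _ "Suc n"])
    have B0: "B $$ (i, 0) = (if i = 0 then e else 0)" if i: "i < Suc n" for i
    proof -
      have "B $$ (i, 0) = (\<Sum>k<Suc n. mat_adjoint U $$ (i, k) * (A * U) $$ (k, 0))"
        unfolding Beq using i U'(1) A(1) by (auto simp: scalar_prod_def atLeast0LessThan simp del: sum.lessThan_Suc intro!: sum.cong)
      also have "\<dots> = e * (\<Sum>k<Suc n. mat_adjoint U $$ (i, k) * U $$ (k, 0))"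
        unfolding sum_distrib_left by (rule sum.cong) (simp_all add: AU del: index_mult_mat)
      also have "(\<Sum>k<Suc n. mat_adjoint U $$ (i, k) * U $$ (k, 0)) = (mat_adjoint U * U) $$ (i, 0)"
        using i U'(1) by (auto simp: scalar_prod_def atLeast0LessThan simp del: sum.lessThan_Suc intro!: sum.cong)
      finally show ?thesis unfolding U'(3) using i by simp
    qed
    have B0': "B $$ (0, i) = (if i = 0 then cnj e else 0)" if i: "i < Suc n" for i
      using sa_matsD(3)[OF B, of 0 i] B0[OF i] i by auto
    have ereal: "cnj e = e" using B0[of 0] B0'[of 0] by simp
    define C where "C = Matrix.mat n n (\<lambda>(i, j). B $$ (Suc i, Suc j))"
    have C: "C \<in> sa_mats n" unfolding sa_mats_def
    proof (safe intro!: eq_matI)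
      fix i j assume "i < dim_row C" "j < dim_col C"
      then show "mat_adjoint C $$ (i, j) = C $$ (i, j)"
        using sa_matsD(3)[OF B, of "Suc i" "Suc j"] by (simp add: C_def)
    qed (auto simp: C_def)
    obtain V d where V: "unitary_mat n V" and Cd: "C = conj_by V (real_diag n d)"
      using Suc.IH[OF C] by blast
    note V' = unitary_matD[OF V]
    define E where "E = Matrix.mat 1 1 (\<lambda>_. e)"
    define W where "W = four_block_mat (1\<^sub>m 1) (0\<^sub>m 1 n) (0\<^sub>m n 1) V"
    have W: "unitary_mat (Suc n) W" unfolding W_def by (rule unitary_block[OF V])
    have Bblock: "B = four_block_mat E (0\<^sub>m 1 n) (0\<^sub>m n 1) C"
      by (rule eq_matI) (use sa_matsD(1)[OF B] in \<open>auto simp: E_def C_def B0 B0' ereal\<close>)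
    define D where "D = real_diag (Suc n) (case_nat (Re e) d)"
    have Dblock: "D = four_block_mat E (0\<^sub>m 1 n) (0\<^sub>m n 1) (real_diag n d)"
      unfolding D_def E_def using ereal
      by (intro eq_matI) (auto simp: complex_eq_iff split: nat.split)
    have Wadj: "mat_adjoint W = four_block_mat (1\<^sub>m 1) (0\<^sub>m 1 n) (0\<^sub>m n 1) (mat_adjoint V)"
      unfolding W_def by (rule eq_matI) (use V' in auto)
    have "conj_by W D = B"
      unfolding conj_by_def Wadj unfolding W_def Dblock Bblock Cd conj_by_def
      apply (subst mult_four_block_mat[of _ 1 1 _ n _ n _ _ 1 _ n])
      using V' apply (simp_all add: E_def)[6]
      apply (subst mult_four_block_mat[of _ 1 1 _ n _ n _ _ 1 _ n])
      using V' apply (simp_all add: E_def)[6]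
      using V' by (auto simp: E_def intro!: cong_four_block_mat eq_matI)
    then have "A = conj_by U (conj_by W D)"
      unfolding B_def using U A(1) by (metis conj_by_inverse(2))
    also have "\<dots> = conj_by (U * W) D"
      by (rule conj_by_comp) (use U' unitary_matD[OF W] in \<open>auto simp: D_def\<close>)
    finally show ?case using unitary_mat_mult[OF U W] unfolding D_def by blast
  qed
  then show ?thesis using that by blast
qed

subsection \<open>Linear changes of variables in finite products\<close>

lemma (in product_sigma_finite) PiM_nn_integral_componentwise:
  assumes "finite I"
    and "\<And>i. i \<in> I \<Longrightarrow> T i \<in> measurable (M i) (M i)"
    and "\<And>i f. i \<in> I \<Longrightarrow> f \<in> borel_measurable (M i) \<Longrightarrow>
           (\<integral>\<^sup>+x. f (T i x) \<partial>M i) = k i * (\<integral>\<^sup>+x. f x \<partial>M i)"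
    and "f \<in> borel_measurable (Pi\<^sub>M I M)"
  shows "(\<integral>\<^sup>+x. f (\<lambda>i\<in>I. T i (x i)) \<partial>Pi\<^sub>M I M) = (\<Prod>i\<in>I. k i) * (\<integral>\<^sup>+x. f x \<partial>Pi\<^sub>M I M)"
  using assms
proof (induction I arbitrary: f rule: finite_induct)
  case empty
  then show ?case by (simp add: PiM_empty nn_integral_count_space_finite restrict_def)
next
  case (insert i I)
  note [measurable] = insert.prems(3)
  have T [measurable]: "T j \<in> measurable (M j) (M j)" if "j \<in> insert i I" for j
    using insert.prems(1)[OF that] .
  interpret I: finite_product_sigma_finite M I by standard (rule insert)
  have Tm: "(\<lambda>x. \<lambda>j\<in>insert i I. T j (x j)) \<in> measurable (Pi\<^sub>M (insert i I) M) (Pi\<^sub>M (insert i I) M)"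
    by (intro measurable_restrict measurable_compose[OF measurable_component_singleton, where g = "T _"]) (auto intro!: T)
  have upd: "(\<lambda>j\<in>insert i I. T j ((x(i := y)) j)) = (\<lambda>j\<in>I. T j (x j))(i := T i y)" for x y
    using insert(2) by (auto simp: restrict_def fun_eq_iff)
  have Tm': "(\<lambda>x. \<lambda>j\<in>I. T j (x j)) \<in> measurable (Pi\<^sub>M I M) (Pi\<^sub>M I M)"
    by (intro measurable_restrict measurable_compose[OF measurable_component_singleton, where g = "T _"]) (auto intro!: T)
  have fm: "(\<lambda>y. f (x(i := y))) \<in> borel_measurable (M i)" if "x \<in> space (Pi\<^sub>M I M)" for x
    using insert.prems(3) that
    by (auto intro!: measurable_compose[OF _ insert.prems(3)] measurable_fun_upd[where J = I] measurable_const)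
  have "(\<integral>\<^sup>+x. f (\<lambda>j\<in>insert i I. T j (x j)) \<partial>Pi\<^sub>M (insert i I) M)
      = (\<integral>\<^sup>+x. \<integral>\<^sup>+y. f ((\<lambda>j\<in>I. T j (x j))(i := T i y)) \<partial>M i \<partial>Pi\<^sub>M I M)"
    by (subst product_nn_integral_insert[OF insert(1,2)], rule measurable_compose[OF Tm insert.prems(3)])
       (simp only: upd)
  also have "\<dots> = (\<integral>\<^sup>+x. k i * (\<integral>\<^sup>+y. f ((\<lambda>j\<in>I. T j (x j))(i := y)) \<partial>M i) \<partial>Pi\<^sub>M I M)"
    by (intro nn_integral_cong insert.prems(2)[of i] fm measurable_space[OF Tm']) auto
  also have "\<dots> = k i * (\<integral>\<^sup>+x. (\<integral>\<^sup>+y. f ((\<lambda>j\<in>I. T j (x j))(i := y)) \<partial>M i) \<partial>Pi\<^sub>M I M)"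
  proof (intro nn_integral_cmult)
    have "(\<lambda>x. (\<integral>\<^sup>+y. f (x(i := y)) \<partial>M i)) \<in> borel_measurable (Pi\<^sub>M I M)"
      by (intro sigma_finite_measure.borel_measurable_nn_integral sigma_finite_measures)
         (auto simp: case_prod_beta' intro!: measurable_compose[OF measurable_add_dim insert.prems(3)])
    from measurable_compose[OF Tm' this]
    show "(\<lambda>x. (\<integral>\<^sup>+y. f ((\<lambda>j\<in>I. T j (x j))(i := y)) \<partial>M i)) \<in> borel_measurable (Pi\<^sub>M I M)" .
  qed
  also have "(\<integral>\<^sup>+x. (\<integral>\<^sup>+y. f ((\<lambda>j\<in>I. T j (x j))(i := y)) \<partial>M i) \<partial>Pi\<^sub>M I M)
     = (\<Prod>i\<in>I. k i) * (\<integral>\<^sup>+x. (\<integral>\<^sup>+y. f (x(i := y)) \<partial>M i) \<partial>Pi\<^sub>M I M)"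
  proof (rule insert.IH)
    show "(\<lambda>x. (\<integral>\<^sup>+y. f (x(i := y)) \<partial>M i)) \<in> borel_measurable (Pi\<^sub>M I M)"
      by (intro sigma_finite_measure.borel_measurable_nn_integral sigma_finite_measures)
         (auto simp: case_prod_beta' intro!: measurable_compose[OF measurable_add_dim insert.prems(3)])
  qed (use insert.prems in auto)
  also have "(\<integral>\<^sup>+x. (\<integral>\<^sup>+y. f (x(i := y)) \<partial>M i) \<partial>Pi\<^sub>M I M) = (\<integral>\<^sup>+x. f x \<partial>Pi\<^sub>M (insert i I) M)"
    by (subst product_nn_integral_insert) (use insert in auto)
  finally show ?case using insert by (simp add: mult.assoc)
qed

interpretation lborel_product: product_sigma_finite "\<lambda>_. lborel :: real measure"
  by standard

abbreviation lborel_PiM :: "'i set \<Rightarrow> ('i \<Rightarrow> real) measure" where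
  "lborel_PiM I \<equiv> \<Pi>\<^sub>M i\<in>I. (lborel :: real measure)"

lemma lborel_PiM_affine:
  fixes f :: "('i \<Rightarrow> real) \<Rightarrow> ennreal"
  assumes "finite I" "\<And>i. i \<in> I \<Longrightarrow> c i \<noteq> 0" "f \<in> borel_measurable (lborel_PiM I)"
  shows "(\<integral>\<^sup>+x. f x \<partial>lborel_PiM I)
    = ennreal (\<Prod>i\<in>I. \<bar>c i\<bar>) * (\<integral>\<^sup>+x. f (\<lambda>i\<in>I. t i + c i * x i) \<partial>lborel_PiM I)"
proof -
  have "(\<integral>\<^sup>+x. f (\<lambda>i\<in>I. t i + c i * x i) \<partial>lborel_PiM I)
    = (\<Prod>i\<in>I. ennreal (inverse \<bar>c i\<bar>)) * (\<integral>\<^sup>+x. f x \<partial>lborel_PiM I)"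
  proof (rule lborel_product.PiM_nn_integral_componentwise[where T = "\<lambda>i x. t i + c i * x"])
    fix i :: 'i and f :: "real \<Rightarrow> ennreal" assume i: "i \<in> I" and f: "f \<in> borel_measurable lborel"
    have "ennreal (inverse \<bar>c i\<bar>) * integral\<^sup>N lborel f
      = (ennreal (inverse \<bar>c i\<bar>) * ennreal \<bar>c i\<bar>) * (\<integral>\<^sup>+x. f (t i + c i * x) \<partial>lborel)"
      using nn_integral_real_affine[of f "c i" "t i"] f assms(2)[OF i] by (simp add: mult.assoc)
    also have "ennreal (inverse \<bar>c i\<bar>) * ennreal \<bar>c i\<bar> = 1"
      using assms(2)[OF i] by (simp flip: ennreal_mult)
    finally show "(\<integral>\<^sup>+x. f (t i + c i * x) \<partial>lborel) = ennreal (inverse \<bar>c i\<bar>) * integral\<^sup>N lborel f"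
      by simp
  qed (use assms in auto)
  moreover have "ennreal (\<Prod>i\<in>I. \<bar>c i\<bar>) * (\<Prod>i\<in>I. ennreal (inverse \<bar>c i\<bar>)) = 1"
  proof -
    have "(\<Prod>i\<in>I. \<bar>c i\<bar>) * (\<Prod>i\<in>I. inverse \<bar>c i\<bar>) = 1"
      by (subst prod.distrib[symmetric], rule prod.neutral) (use assms(2) in auto)
    then show ?thesis by (subst prod_ennreal) (simp_all add: prod_nonneg flip: ennreal_mult)
  qed
  ultimately show ?thesis by (simp flip: mult.assoc)
qed

lemma nn_integral_translate_swap:
  fixes M M' :: "'a measure" and tadd tsub :: "'a \<Rightarrow> 'a \<Rightarrow> 'a"
  assumes M: "sigma_finite_measure M" and M': "sigma_finite_measure M'" and sets: "sets M' = sets M"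
    and add [measurable]: "(\<lambda>(x, y). tadd x y) \<in> measurable (M \<Otimes>\<^sub>M M) M"
    and sub [measurable]: "(\<lambda>(x, y). tsub x y) \<in> measurable (M \<Otimes>\<^sub>M M) M"
    and tsub_tadd: "\<And>x y. x \<in> space M \<Longrightarrow> y \<in> space M \<Longrightarrow> tsub (tadd x y) y = x"
    and trans: "\<And>f x. f \<in> borel_measurable M \<Longrightarrow> x \<in> space M \<Longrightarrow> (\<integral>\<^sup>+y. f (tadd x y) \<partial>M) = (\<integral>\<^sup>+y. f y \<partial>M)"
    and refl: "\<And>f x. f \<in> borel_measurable M \<Longrightarrow> x \<in> space M \<Longrightarrow> (\<integral>\<^sup>+y. f (tsub x y) \<partial>M) = (\<integral>\<^sup>+y. f y \<partial>M)"
    and trans': "\<And>f y. f \<in> borel_measurable M \<Longrightarrow> y \<in> space M \<Longrightarrow> (\<integral>\<^sup>+x. f (tadd x y) \<partial>M') = (\<integral>\<^sup>+x. f x \<partial>M')"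
    and f [measurable]: "f \<in> borel_measurable M" and g [measurable]: "g \<in> borel_measurable M"
  shows "(\<integral>\<^sup>+x. f x \<partial>M') * (\<integral>\<^sup>+x. g x \<partial>M) = (\<integral>\<^sup>+x. g x \<partial>M') * (\<integral>\<^sup>+x. f x \<partial>M)"
proof -
  note [measurable_cong] = sets
  have sp: "space M' = space M" by (rule sets_eq_imp_space_eq[OF sets])
  interpret M: sigma_finite_measure M by fact
  interpret M': sigma_finite_measure M' by fact
  interpret P: pair_sigma_finite M M' ..
  have [measurable]: "f \<in> borel_measurable M'" "g \<in> borel_measurable M'" by measurable
  have am [measurable (raw)]: "(\<lambda>x. tadd (h x) (k x)) \<in> measurable N M"
    if "h \<in> measurable N M" "k \<in> measurable N M" for h k and N :: "('a \<times> 'a) measure"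
    using measurable_compose[OF measurable_Pair[OF that] add] by simp
  have sm [measurable (raw)]: "(\<lambda>x. tsub (h x) (k x)) \<in> measurable N M"
    if "h \<in> measurable N M" "k \<in> measurable N M" for h k and N :: "('a \<times> 'a) measure"
    using measurable_compose[OF measurable_Pair[OF that] sub] by simp
  have m1 [measurable]: "(\<lambda>(x, y). f x * g (tadd x y)) \<in> borel_measurable (M' \<Otimes>\<^sub>M M)"
    "(\<lambda>(y, x). f x * g (tadd x y)) \<in> borel_measurable (M \<Otimes>\<^sub>M M')"
    "(\<lambda>(y, x). f (tsub x y) * g x) \<in> borel_measurable (M \<Otimes>\<^sub>M M')"
    by measurable
  have am1: "(\<lambda>y. tadd x y) \<in> measurable M M" "(\<lambda>y. tsub x y) \<in> measurable M M"
     "(\<lambda>y. tsub y x) \<in> measurable M M" if "x \<in> space M" for x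
    using measurable_compose[OF measurable_Pair[OF measurable_const[OF that] measurable_ident] add]
     measurable_compose[OF measurable_Pair[OF measurable_const[OF that] measurable_ident] sub]
     measurable_compose[OF measurable_Pair[OF measurable_ident measurable_const[OF that]] sub]
    by (simp_all add: id_def)
  have "(\<integral>\<^sup>+x. f x \<partial>M') * (\<integral>\<^sup>+x. g x \<partial>M) = (\<integral>\<^sup>+x. \<integral>\<^sup>+y. f x * g (tadd x y) \<partial>M \<partial>M')"
  proof (subst nn_integral_multc[symmetric], measurable, intro nn_integral_cong)
    fix x assume "x \<in> space M'"
    then have x: "x \<in> space M" by (simp add: sp)
    have "f x * (\<integral>\<^sup>+x. g x \<partial>M) = f x * (\<integral>\<^sup>+y. g (tadd x y) \<partial>M)" by (subst trans[OF g x]) simp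
    also have "\<dots> = (\<integral>\<^sup>+y. f x * g (tadd x y) \<partial>M)"
      using measurable_compose[OF am1(1)[OF x] g] by (intro nn_integral_cmult[symmetric]) 
    finally show "f x * (\<integral>\<^sup>+x. g x \<partial>M) = (\<integral>\<^sup>+y. f x * g (tadd x y) \<partial>M)" .
  qed
  also have "\<dots> = (\<integral>\<^sup>+y. \<integral>\<^sup>+x. f x * g (tadd x y) \<partial>M' \<partial>M)"
    using P.Fubini'[of "\<lambda>y x. f x * g (tadd x y)"] m1(2) by simp
  also have "\<dots> = (\<integral>\<^sup>+y. \<integral>\<^sup>+x. f (tsub x y) * g x \<partial>M' \<partial>M)"
  proof (rule nn_integral_cong)
    fix y assume y: "y \<in> space M"
    have "(\<integral>\<^sup>+x. f x * g (tadd x y) \<partial>M') = (\<integral>\<^sup>+x. f (tsub (tadd x y) y) * g (tadd x y) \<partial>M')"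
      by (intro nn_integral_cong) (simp add: tsub_tadd y sp)
    also have "\<dots> = (\<integral>\<^sup>+x. f (tsub x y) * g x \<partial>M')"
      using measurable_compose[OF am1(3)[OF y] f] g
      by (intro trans'[of "\<lambda>x. f (tsub x y) * g x", OF _ y]) auto
    finally show "(\<integral>\<^sup>+x. f x * g (tadd x y) \<partial>M') = (\<integral>\<^sup>+x. f (tsub x y) * g x \<partial>M')" .
  qed
  also have "\<dots> = (\<integral>\<^sup>+x. \<integral>\<^sup>+y. f (tsub x y) * g x \<partial>M \<partial>M')"
    using P.Fubini'[of "\<lambda>y x. f (tsub x y) * g x"] m1(3) by simp
  also have "\<dots> = (\<integral>\<^sup>+x. g x * (\<integral>\<^sup>+x. f x \<partial>M) \<partial>M')"
  proof (intro nn_integral_cong)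
    fix x assume "x \<in> space M'"
    then have x: "x \<in> space M" by (simp add: sp)
    have "(\<integral>\<^sup>+y. f (tsub x y) * g x \<partial>M) = (\<integral>\<^sup>+y. f (tsub x y) \<partial>M) * g x"
      using measurable_compose[OF am1(2)[OF x] f] by (intro nn_integral_multc)
    also have "\<dots> = g x * (\<integral>\<^sup>+x. f x \<partial>M)" by (simp add: refl[OF f x] mult.commute)
    finally show "(\<integral>\<^sup>+y. f (tsub x y) * g x \<partial>M) = g x * (\<integral>\<^sup>+x. f x \<partial>M)" .
  qed
  also have "\<dots> = (\<integral>\<^sup>+x. g x \<partial>M') * (\<integral>\<^sup>+x. f x \<partial>M)"
    by (rule nn_integral_multc) measurable
  finally show ?thesis .
qed

lemma lborel_PiM_isometry:
  fixes I :: "'i set" and w :: "'i \<Rightarrow> real"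
  assumes I: "finite I"
    and T: "T \<in> measurable (lborel_PiM I) (lborel_PiM I)"
    and T': "T' \<in> measurable (lborel_PiM I) (lborel_PiM I)"
    and inv: "\<And>x. x \<in> extensional I \<Longrightarrow> T' (T x) = x" "\<And>x. x \<in> extensional I \<Longrightarrow> T (T' x) = x"
    and lin: "\<And>x y. x \<in> extensional I \<Longrightarrow> y \<in> extensional I \<Longrightarrow>
        T (\<lambda>i\<in>I. x i + y i) = (\<lambda>i\<in>I. T x i + T y i)"
    and w: "\<And>i. i \<in> I \<Longrightarrow> w i > 0"
    and iso: "\<And>x. x \<in> extensional I \<Longrightarrow> (\<Sum>i\<in>I. w i * (T x i)\<^sup>2) = (\<Sum>i\<in>I. w i * (x i)\<^sup>2)"
    and f: "f \<in> borel_measurable (lborel_PiM I)"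
  shows "(\<integral>\<^sup>+x. f (T x) \<partial>lborel_PiM I) = (\<integral>\<^sup>+x. f x \<partial>lborel_PiM I)"
proof -
  let ?M = "lborel_PiM I"
  define M' where "M' = distr ?M ?M T"
  have sp: "space ?M = extensional I" by (auto simp: space_PiM PiE_def)
  have ext: "T x \<in> extensional I" "T' x \<in> extensional I" if "x \<in> extensional I" for x
    using measurable_space[OF T, of x] measurable_space[OF T', of x] that by (simp_all add: sp)
  define tadd where "tadd x y = (\<lambda>i\<in>I. x i + y i)" for x y :: "'i \<Rightarrow> real"
  define tsub where "tsub x y = (\<lambda>i\<in>I. x i - y i)" for x y :: "'i \<Rightarrow> real"
  have am: "(\<lambda>(x, y). tadd x y) \<in> measurable (?M \<Otimes>\<^sub>M ?M) ?M"
    unfolding tadd_def by (auto simp: case_prod_beta' intro!: measurable_restrict borel_measurable_add measurable_compose[OF measurable_fst] measurable_compose[OF measurable_snd])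
  have sm: "(\<lambda>(x, y). tsub x y) \<in> measurable (?M \<Otimes>\<^sub>M ?M) ?M"
    unfolding tsub_def by (auto simp: case_prod_beta' intro!: measurable_restrict borel_measurable_diff measurable_compose[OF measurable_fst] measurable_compose[OF measurable_snd])
  interpret F: finite_product_sigma_finite "\<lambda>_. lborel :: real measure" I by standard (rule I)
  have sfM: "sigma_finite_measure ?M" by (rule F.sigma_finite_measure_axioms)
  have "distr M' ?M T' = ?M"
  proof -
    have "distr M' ?M T' = distr ?M ?M (T' \<circ> T)" unfolding M'_def using T T' by (subst distr_distr) auto
    also have "\<dots> = distr ?M ?M (\<lambda>x. x)"
      by (rule distr_cong) (auto simp: sp inv)
    finally show ?thesis by simp
  qed
  then have sfM': "sigma_finite_measure M'"
    by (intro sigma_finite_measure_distr[of M' ?M T']) (use T' sfM in \<open>auto simp: M'_def\<close>)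
  have trans: "(\<integral>\<^sup>+y. f (tadd x y) \<partial>?M) = (\<integral>\<^sup>+y. f y \<partial>?M)"
    if "f \<in> borel_measurable ?M" for f x
    using lborel_PiM_affine[OF I, of "\<lambda>_. 1" f x] that by (simp add: tadd_def)
  have refl: "(\<integral>\<^sup>+y. f (tsub x y) \<partial>?M) = (\<integral>\<^sup>+y. f y \<partial>?M)"
    if "f \<in> borel_measurable ?M" for f x
    using lborel_PiM_affine[OF I, of "\<lambda>_. -1" f x] that by (simp add: tsub_def)
  have comm: "tadd x y = tadd y x" for x y by (auto simp: tadd_def)
  have am1: "(\<lambda>y. tadd x y) \<in> measurable ?M ?M" "(\<lambda>y. tadd y x) \<in> measurable ?M ?M" for x
    unfolding tadd_def by (auto intro!: measurable_restrict borel_measurable_add)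
  have trans': "(\<integral>\<^sup>+x. f (tadd x y) \<partial>M') = (\<integral>\<^sup>+x. f x \<partial>M')"
    if f: "f \<in> borel_measurable ?M" and y: "y \<in> space ?M" for f y
  proof -
    have "(\<integral>\<^sup>+x. f (tadd x y) \<partial>M') = (\<integral>\<^sup>+x. f (tadd (T x) y) \<partial>?M)"
      unfolding M'_def using T measurable_compose[OF am1(2) f] by (subst nn_integral_distr) auto
    also have "\<dots> = (\<integral>\<^sup>+x. f (T (tadd (T' y) x)) \<partial>?M)"
      by (intro nn_integral_cong arg_cong[of _ _ f])
         (use lin inv ext y in \<open>auto simp: tadd_def sp fun_eq_iff restrict_def\<close>)
    also have "\<dots> = (\<integral>\<^sup>+x. f (T x) \<partial>?M)"
      using measurable_compose[OF T f] by (rule trans)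
    also have "\<dots> = (\<integral>\<^sup>+x. f x \<partial>M')"
      unfolding M'_def using T f by (subst nn_integral_distr) auto
    finally show ?thesis .
  qed
  define Q where "Q x = (\<Sum>i\<in>I. w i * (x i)\<^sup>2)" for x
  define g :: "('i \<Rightarrow> real) \<Rightarrow> ennreal" where "g x = (if Q x \<le> 1 then 1 else 0)" for x
  have Qm: "Q \<in> borel_measurable ?M" unfolding Q_def by measurable
  then have g: "g \<in> borel_measurable ?M" unfolding g_def by measurable
  have gT: "g (T x) = g x" if "x \<in> space ?M" for x
    using iso[of x] that by (simp add: g_def Q_def sp)
  have gM': "(\<integral>\<^sup>+x. g x \<partial>M') = (\<integral>\<^sup>+x. g x \<partial>?M)"
    unfolding M'_def using T g gT by (subst nn_integral_distr) (auto intro!: nn_integral_cong)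
  have eq: "(\<integral>\<^sup>+x. f x \<partial>M') * (\<integral>\<^sup>+x. g x \<partial>?M) = (\<integral>\<^sup>+x. g x \<partial>M') * (\<integral>\<^sup>+x. f x \<partial>?M)"
    by (rule nn_integral_translate_swap[OF sfM sfM' _ am sm])
       (use f g trans refl trans' in \<open>auto simp: M'_def tadd_def tsub_def sp fun_eq_iff extensional_def\<close>)
  define W where "W = 1 + (\<Sum>i\<in>I. w i + 1 / w i)"
  have "(\<Sum>i\<in>I. w i + 1 / w i) \<ge> 0"
    by (rule sum_nonneg, rule add_nonneg_nonneg) (use w in \<open>auto simp: less_imp_le\<close>)
  then have W1: "W \<ge> 1" unfolding W_def by linarith
  have wle: "w i \<le> W" "1 / w i \<le> W" if "i \<in> I" for i
  proof -
    have "w i + 1 / w i \<le> (\<Sum>i\<in>I. w i + 1 / w i)"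
      using w by (intro member_le_sum that I) (auto simp: less_imp_le)
    moreover have "w i > 0" "1 / w i > 0" using w[OF that] by auto
    ultimately show "w i \<le> W" "1 / w i \<le> W" unfolding W_def by linarith+
  qed
  have box: "(\<integral>\<^sup>+x. indicator (\<Pi>\<^sub>E i\<in>I. {a..b}) x \<partial>?M) = (\<Prod>i\<in>I. emeasure lborel {a..b})" for a b :: real
  proof -
    have "(\<Pi>\<^sub>E i\<in>I. {a..b}) \<in> sets ?M" by (intro sets_PiM_I_finite I) simp
    moreover have "emeasure ?M (\<Pi>\<^sub>E i\<in>I. {a..b}) = (\<Prod>i\<in>I. emeasure lborel {a..b})"
      by (rule lborel_product.emeasure_PiM[OF I]) simp
    ultimately show ?thesis by (simp only: nn_integral_indicator)
  qed
  have "(\<integral>\<^sup>+x. g x \<partial>?M) \<le> (\<integral>\<^sup>+x. indicator (\<Pi>\<^sub>E i\<in>I. {-W..W}) x \<partial>?M)"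
  proof (intro nn_integral_mono)
    fix x assume x: "x \<in> space ?M"
    show "g x \<le> indicator (\<Pi>\<^sub>E i\<in>I. {-W..W}) x"
    proof (cases "Q x \<le> 1")
      case True
      have "\<bar>x i\<bar> \<le> W" if i: "i \<in> I" for i
      proof -
        have "w i * (x i)\<^sup>2 \<le> Q x" unfolding Q_def
          using w by (intro member_le_sum i I) (simp_all add: less_imp_le)
        then have "(x i)\<^sup>2 \<le> 1 / w i" using True w[OF i] by (simp add: field_simps)
        also have "\<dots> \<le> W" using wle i by simp
        also have "\<dots> \<le> W\<^sup>2" using W1 by (simp add: power2_eq_square)
        finally have "\<bar>x i\<bar>\<^sup>2 \<le> W\<^sup>2" by simp
        then show ?thesis by (rule power2_le_imp_le) (use W1 in simp)
      qed
      then have "x \<in> (\<Pi>\<^sub>E i\<in>I. {-W..W})" using x by (force simp: sp PiE_def abs_le_iff)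
      then show ?thesis using True by (simp add: g_def)
    qed (simp add: g_def)
  qed
  also have "\<dots> = (\<Prod>i\<in>I. emeasure lborel {-W..W})" by (rule box)
  also have "\<dots> < \<top>" using W1 by (simp add: ennreal_power less_top[symmetric])
  finally have fin: "(\<integral>\<^sup>+x. g x \<partial>?M) \<noteq> \<top>" by simp
  define e where "e = 1 / (W * (1 + real (card I)))"
  have e0: "e > 0" unfolding e_def using W1 by simp
  have "W * (1 + real (card I)) \<ge> 1 * 1" using W1 by (intro mult_mono) auto
  then have e1: "e \<le> 1" unfolding e_def by simp
  have "0 < (\<Prod>i\<in>I. emeasure lborel {-e..e})" using e0 by (auto simp: zero_less_iff_neq_zero prod_zero_iff[OF I] simp del: prod_constant)
  also have "\<dots> = (\<integral>\<^sup>+x. indicator (\<Pi>\<^sub>E i\<in>I. {-e..e}) x \<partial>?M)"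
    by (rule box[symmetric])
  also have "\<dots> \<le> (\<integral>\<^sup>+x. g x \<partial>?M)"
  proof (intro nn_integral_mono)
    fix x assume x: "x \<in> space ?M"
    show "indicator (\<Pi>\<^sub>E i\<in>I. {-e..e}) x \<le> g x"
    proof (cases "x \<in> (\<Pi>\<^sub>E i\<in>I. {-e..e})")
      case True
      have "Q x \<le> (\<Sum>i\<in>I. W * e)" unfolding Q_def
      proof (rule sum_mono)
        fix i assume i: "i \<in> I"
        then have "\<bar>x i\<bar> \<le> e" using True by (auto simp: PiE_iff)
        then have "\<bar>x i\<bar>\<^sup>2 \<le> e\<^sup>2" by (intro power_mono) auto
        also have "e\<^sup>2 \<le> e" using e0 e1 by (simp add: power2_eq_square mult_left_le_one_le)
        finally have "(x i)\<^sup>2 \<le> e" by simp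
        then show "w i * (x i)\<^sup>2 \<le> W * e" using wle(1)[OF i] w[OF i] e0 W1 by (intro mult_mono) auto
      qed
      also have "\<dots> = real (card I) / (1 + real (card I))" unfolding e_def using W1 by simp
      also have "\<dots> \<le> 1" by (simp add: divide_le_eq)
      finally show ?thesis by (simp add: g_def indicator_def)
    qed simp
  qed
  finally have pos: "(\<integral>\<^sup>+x. g x \<partial>?M) \<noteq> 0" by simp
  have "(\<integral>\<^sup>+x. f (T x) \<partial>?M) = (\<integral>\<^sup>+x. f x \<partial>M')"
    unfolding M'_def using T f by (subst nn_integral_distr) auto
  also have "\<dots> = (\<integral>\<^sup>+x. f x \<partial>?M)"
  proof -
    have "(\<integral>\<^sup>+x. g x \<partial>?M) * (\<integral>\<^sup>+x. f x \<partial>M') = (\<integral>\<^sup>+x. g x \<partial>?M) * (\<integral>\<^sup>+x. f x \<partial>?M)"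
      using eq unfolding gM' by (subst mult.commute)
    then show ?thesis using fin pos unfolding ennreal_mult_cancel_left by blast
  qed
  finally show ?thesis .
qed

subsection \<open>Coordinates of selfadjoint matrices\<close>

abbreviation herm_lborel :: "nat \<Rightarrow> (nat \<times> nat \<Rightarrow> real) measure" where
  "herm_lborel n \<equiv> lborel_PiM ({..<n} \<times> {..<n})"

definition herm_coords :: "nat \<Rightarrow> complex Matrix.mat \<Rightarrow> nat \<times> nat \<Rightarrow> real" where
  "herm_coords n A = (\<lambda>(i, j)\<in>{..<n} \<times> {..<n}. if i \<le> j then Re (A $$ (i, j)) else Im (A $$ (j, i)))"

lemma sa_of_coords_dims [simp]:
  "dim_row (sa_of_coords n x) = n" "dim_col (sa_of_coords n x) = n" "sa_of_coords n x \<in> carrier_mat n n"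
  by (simp_all add: sa_of_coords_def)

lemma sa_of_coords_index:
  "i < n \<Longrightarrow> j < n \<Longrightarrow> sa_of_coords n x $$ (i, j) =
     (if i = j then complex_of_real (x (i, i))
     else if i < j then Complex (x (i, j)) (x (j, i))
     else Complex (x (j, i)) (- x (i, j)))"
  by (simp add: sa_of_coords_def)

lemma sa_of_coords_sa [simp]: "sa_of_coords n x \<in> sa_mats n"
  unfolding sa_mats_def by (auto intro!: eq_matI simp: sa_of_coords_index complex_eq_iff)

lemma herm_coords_sa_of_coords:
  "x \<in> extensional ({..<n} \<times> {..<n}) \<Longrightarrow> herm_coords n (sa_of_coords n x) = x"
  by (auto simp: herm_coords_def fun_eq_iff sa_of_coords_index extensional_def restrict_def)

lemma sa_of_coords_herm_coords:
  assumes A: "A \<in> sa_mats n"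
  shows "sa_of_coords n (herm_coords n A) = A"
proof (rule eq_matI)
  fix i j assume ij: "i < dim_row A" "j < dim_col A"
  then have ij: "i < n" "j < n" using sa_matsD(1)[OF A] by auto
  have "Re (A $$ (i, j)) = Re (A $$ (j, i))" "Im (A $$ (i, j)) = - Im (A $$ (j, i))" "Im (A $$ (i, i)) = 0"
    using arg_cong[OF sa_matsD(3)[OF A ij], of Re] arg_cong[OF sa_matsD(3)[OF A ij], of Im]
      arg_cong[OF sa_matsD(3)[OF A ij(1) ij(1)], of Im] by simp_all
  then show "sa_of_coords n (herm_coords n A) $$ (i, j) = A $$ (i, j)"
    using ij by (auto simp: sa_of_coords_index herm_coords_def complex_eq_iff)
qed (use sa_matsD(1)[OF A] in auto)

lemma herm_coords_extensional [simp]: "herm_coords n A \<in> extensional ({..<n} \<times> {..<n})"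
  by (simp add: herm_coords_def)

lemma space_lborel_PiM [simp]: "space (lborel_PiM I) = extensional I"
  by (auto simp: space_PiM PiE_def)

lemma sum_swap_symmetrize:
  fixes f g :: "nat \<times> nat \<Rightarrow> real"
  assumes "\<And>i j. i < n \<Longrightarrow> j < n \<Longrightarrow> f (i, j) + f (j, i) = g (i, j) + g (j, i)"
  shows "(\<Sum>p\<in>{..<n} \<times> {..<n}. f p) = (\<Sum>p\<in>{..<n} \<times> {..<n}. g p)"
proof -
  have sw: "(\<Sum>i<n. \<Sum>j<n. h (j, i)) = (\<Sum>p\<in>{..<n} \<times> {..<n}. h p)" for h :: "nat \<times> nat \<Rightarrow> real"
    by (subst sum.swap) (simp add: sum.cartesian_product)
  have "2 * (\<Sum>p\<in>{..<n} \<times> {..<n}. h p) = (\<Sum>i<n. \<Sum>j<n. h (i, j) + h (j, i))" for h :: "nat \<times> nat \<Rightarrow> real"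
    unfolding sum.distrib sw by (simp add: sum.cartesian_product case_prod_beta)
  moreover have "(\<Sum>i<n. \<Sum>j<n. f (i, j) + f (j, i)) = (\<Sum>i<n. \<Sum>j<n. g (i, j) + g (j, i))"
    using assms by (intro sum.cong) auto
  ultimately have "2 * (\<Sum>p\<in>{..<n} \<times> {..<n}. f p) = 2 * (\<Sum>p\<in>{..<n} \<times> {..<n}. g p)"
    by simp
  then show ?thesis by simp
qed

lemma sum_square_sa_of_coords:
  "(\<Sum>p\<in>{..<n} \<times> {..<n}. (if fst p = snd p then 1 else 2) * (x p)\<^sup>2)
    = Re (\<Sum>i<n. (sa_of_coords n x * sa_of_coords n x) $$ (i, i))"
proof -
  let ?A = "sa_of_coords n x"
  have "Re (\<Sum>i<n. (?A * ?A) $$ (i, i)) = Re (\<Sum>i<n. \<Sum>j<n. ?A $$ (i, j) * ?A $$ (j, i))"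
    by (intro arg_cong[of _ _ Re] sum.cong refl) (auto simp: scalar_prod_def atLeast0LessThan)
  also have "\<dots> = (\<Sum>p\<in>{..<n} \<times> {..<n}. (\<lambda>(i, j). Re (?A $$ (i, j) * ?A $$ (j, i))) p)"
    by (simp add: sum.cartesian_product case_prod_beta)
  also have "\<dots> = (\<Sum>p\<in>{..<n} \<times> {..<n}. (if fst p = snd p then 1 else 2) * (x p)\<^sup>2)"
    by (rule sum_swap_symmetrize)
       (auto simp: sa_of_coords_index power2_eq_square not_less complex_eq_iff)
  finally show ?thesis by simp
qed

lemma measurable_Complex [measurable]:
  "f \<in> borel_measurable M \<Longrightarrow> g \<in> borel_measurable M \<Longrightarrow> (\<lambda>x. Complex (f x) (g x)) \<in> borel_measurable M"
  by (simp add: borel_measurable_complex_iff)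

lemma measurable_cnj [measurable]:
  "f \<in> borel_measurable M \<Longrightarrow> (\<lambda>x. cnj (f x)) \<in> borel_measurable M"
  by (simp add: borel_measurable_complex_iff)

definition mat_measurable :: "'a measure \<Rightarrow> nat \<Rightarrow> nat \<Rightarrow> ('a \<Rightarrow> complex Matrix.mat) \<Rightarrow> bool" where
  "mat_measurable M n m A \<longleftrightarrow> (\<forall>x\<in>space M. A x \<in> carrier_mat n m) \<and>
     (\<forall>i<n. \<forall>j<m. (\<lambda>x. A x $$ (i, j)) \<in> borel_measurable M)"

lemma mat_measurableD:
  assumes "mat_measurable M n m A"
  shows "x \<in> space M \<Longrightarrow> A x \<in> carrier_mat n m"
    and "i < n \<Longrightarrow> j < m \<Longrightarrow> (\<lambda>x. A x $$ (i, j)) \<in> borel_measurable M"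
  using assms by (auto simp: mat_measurable_def)

lemma mat_measurable_const: "A \<in> carrier_mat n m \<Longrightarrow> mat_measurable M n m (\<lambda>_. A)"
  by (auto simp: mat_measurable_def)

lemma mat_measurable_mult:
  assumes A: "mat_measurable M n m A" and B: "mat_measurable M m k B"
  shows "mat_measurable M n k (\<lambda>x. A x * B x)"
  unfolding mat_measurable_def
proof safe
  fix i j assume ij: "i < n" "j < k"
  have "(\<lambda>x. \<Sum>l<m. A x $$ (i, l) * B x $$ (l, j)) \<in> borel_measurable M"
    using mat_measurableD(2)[OF A] mat_measurableD(2)[OF B] ij by measurable
  also have "?this \<longleftrightarrow> (\<lambda>x. (A x * B x) $$ (i, j)) \<in> borel_measurable M"
  proof (intro measurable_cong)
    fix x assume "x \<in> space M"
    then have "A x \<in> carrier_mat n m" "B x \<in> carrier_mat m k"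
      using mat_measurableD(1)[OF A] mat_measurableD(1)[OF B] by auto
    then show "(\<Sum>l<m. A x $$ (i, l) * B x $$ (l, j)) = (A x * B x) $$ (i, j)"
      using ij by (auto simp: scalar_prod_def atLeast0LessThan intro!: sum.cong)
  qed
  finally show "(\<lambda>x. (A x * B x) $$ (i, j)) \<in> borel_measurable M" .
qed (use mat_measurableD(1)[OF A] mat_measurableD(1)[OF B] mult_carrier_mat in blast)

lemma mat_measurable_pointwise:
  assumes A: "mat_measurable M n m A" and B: "mat_measurable M n m B"
    and C: "\<And>x. x \<in> space M \<Longrightarrow> C x \<in> carrier_mat n m"
    and CAB: "\<And>x i j. x \<in> space M \<Longrightarrow> i < n \<Longrightarrow> j < m \<Longrightarrow> C x $$ (i, j) = f (A x $$ (i, j)) (B x $$ (i, j))"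
    and f: "\<And>a b. a \<in> borel_measurable M \<Longrightarrow> b \<in> borel_measurable M \<Longrightarrow> (\<lambda>x. f (a x) (b x)) \<in> borel_measurable M"
  shows "mat_measurable M n m C"
  unfolding mat_measurable_def
proof safe
  fix i j assume ij: "i < n" "j < m"
  have "(\<lambda>x. f (A x $$ (i, j)) (B x $$ (i, j))) \<in> borel_measurable M"
    by (intro f mat_measurableD(2)[OF A ij] mat_measurableD(2)[OF B ij])
  then show "(\<lambda>x. C x $$ (i, j)) \<in> borel_measurable M"
    by (rule measurable_cong[THEN iffD1, rotated]) (simp add: CAB ij)
qed (rule C)

lemma mat_measurable_minus:
  "mat_measurable M n m A \<Longrightarrow> mat_measurable M n m B \<Longrightarrow> mat_measurable M n m (\<lambda>x. A x - B x)"
  by (rule mat_measurable_pointwise[where f = "(-)" and A = A and B = B])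
     (auto dest: mat_measurableD(1) intro!: minus_carrier_mat)

lemma mat_measurable_smult:
  assumes A: "mat_measurable M n m A" and c: "c \<in> borel_measurable M"
  shows "mat_measurable M n m (\<lambda>x. c x \<cdot>\<^sub>m A x)"
  unfolding mat_measurable_def
proof safe
  fix i j assume ij: "i < n" "j < m"
  have "(\<lambda>x. c x * A x $$ (i, j)) \<in> borel_measurable M"
    using mat_measurableD(2)[OF A ij] c by measurable
  then show "(\<lambda>x. (c x \<cdot>\<^sub>m A x) $$ (i, j)) \<in> borel_measurable M"
  proof (rule measurable_cong[THEN iffD1, rotated])
    fix x assume "x \<in> space M"
    from mat_measurableD(1)[OF A this] ij
    show "c x * A x $$ (i, j) = (c x \<cdot>\<^sub>m A x) $$ (i, j)" by auto
  qed
qed (auto dest: mat_measurableD(1)[OF A])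

lemma mat_measurable_adjoint:
  assumes A: "mat_measurable M n m A"
  shows "mat_measurable M m n (\<lambda>x. mat_adjoint (A x))"
  unfolding mat_measurable_def
proof safe
  fix i j assume ij: "i < m" "j < n"
  have "(\<lambda>x. cnj (A x $$ (j, i))) \<in> borel_measurable M"
    using mat_measurableD(2)[OF A ij(2,1)] by measurable
  then show "(\<lambda>x. mat_adjoint (A x) $$ (i, j)) \<in> borel_measurable M"
  proof (rule measurable_cong[THEN iffD1, rotated])
    fix x assume "x \<in> space M"
    from mat_measurableD(1)[OF A this] ij
    show "cnj (A x $$ (j, i)) = mat_adjoint (A x) $$ (i, j)" by auto
  qed
qed (auto dest: mat_measurableD(1)[OF A])

lemma mat_measurable_compose:
  "mat_measurable N n m A \<Longrightarrow> f \<in> measurable M N \<Longrightarrow> mat_measurable M n m (\<lambda>x. A (f x))"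
  unfolding mat_measurable_def by (auto dest: measurable_space intro: measurable_compose)

lemma mat_measurable_trace:
  "mat_measurable M n n A \<Longrightarrow> (\<lambda>x. \<Sum>i<n. A x $$ (i, i)) \<in> borel_measurable M"
  by (auto simp: mat_measurable_def intro!: borel_measurable_sum)

lemma mat_measurable_conj_by:
  "U \<in> carrier_mat n n \<Longrightarrow> mat_measurable M n n A \<Longrightarrow> mat_measurable M n n (\<lambda>x. conj_by U (A x))"
  unfolding conj_by_def by (intro mat_measurable_mult[where m = n] mat_measurable_const) auto

lemma mat_measurable_sa_of_coords: "mat_measurable (herm_lborel n) n n (sa_of_coords n)"
  unfolding mat_measurable_def
proof safe
  fix i j assume ij: "i < n" "j < n"
  have "(\<lambda>x. x p) \<in> borel_measurable (herm_lborel n)" if "p \<in> {..<n} \<times> {..<n}" for p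
    using measurable_component_singleton[OF that, of "\<lambda>_. lborel"] by simp
  from this[of "(i, i)"] this[of "(i, j)"] this[of "(j, i)"] ij
  show "(\<lambda>x. sa_of_coords n x $$ (i, j)) \<in> borel_measurable (herm_lborel n)"
    by (simp add: sa_of_coords_index)
qed auto

lemma measurable_herm_coords:
  assumes A: "mat_measurable M n n A"
  shows "(\<lambda>x. herm_coords n (A x)) \<in> measurable M (herm_lborel n)"
  unfolding herm_coords_def
proof (rule measurable_restrict, clarify)
  fix i j assume ij: "i < n" "j < n"
  show "(\<lambda>x. if i \<le> j then Re (A x $$ (i, j)) else Im (A x $$ (j, i))) \<in> measurable M lborel"
    using mat_measurableD(2)[OF A ij] mat_measurableD(2)[OF A ij(2,1)] by measurable
qed

abbreviation herm_borel :: "nat \<Rightarrow> (complex Matrix.mat \<Rightarrow> ennreal) \<Rightarrow> bool" where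
  "herm_borel n F \<equiv> (\<lambda>x. F (sa_of_coords n x)) \<in> borel_measurable (herm_lborel n)"

lemma herm_borel_compose:
  assumes F: "herm_borel n F" and A: "mat_measurable M n n A" and sa: "\<And>x. x \<in> space M \<Longrightarrow> A x \<in> sa_mats n"
  shows "(\<lambda>x. F (A x)) \<in> borel_measurable M"
proof -
  have "(\<lambda>x. F (sa_of_coords n (herm_coords n (A x)))) \<in> borel_measurable M"
    by (rule measurable_compose[OF measurable_herm_coords[OF A] F])
  then show ?thesis
    by (rule measurable_cong[THEN iffD1, rotated]) (simp add: sa_of_coords_herm_coords sa)
qed

lemma herm_coords_add:
  assumes "A \<in> carrier_mat n n" "B \<in> carrier_mat n n"
  shows "herm_coords n (A + B) = (\<lambda>p\<in>{..<n} \<times> {..<n}. herm_coords n A p + herm_coords n B p)"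
  using assms by (auto simp: herm_coords_def fun_eq_iff restrict_def)

lemma sa_of_coords_add:
  "sa_of_coords n (\<lambda>p\<in>{..<n} \<times> {..<n}. x p + y p) = sa_of_coords n x + sa_of_coords n y"
  by (rule eq_matI) (auto simp: sa_of_coords_index complex_eq_iff)

lemma nn_integral_conj_by:
  assumes U: "unitary_mat n U" and F: "herm_borel n F"
  shows "(\<integral>\<^sup>+x. F (conj_by U (sa_of_coords n x)) \<partial>herm_lborel n) = (\<integral>\<^sup>+x. F (sa_of_coords n x) \<partial>herm_lborel n)"
proof -
  let ?I = "{..<n} \<times> {..<n}"
  define T where "T V x = herm_coords n (conj_by V (sa_of_coords n x))" for V and x :: "nat \<times> nat \<Rightarrow> real"
  note c = unitary_matD(1,2)[OF U]
  have Tm: "T V \<in> measurable (herm_lborel n) (herm_lborel n)" if "V \<in> carrier_mat n n" for V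
    unfolding T_def
    by (intro measurable_herm_coords mat_measurable_conj_by that mat_measurable_sa_of_coords)
  have sT: "sa_of_coords n (T V x) = conj_by V (sa_of_coords n x)" if "V \<in> carrier_mat n n" for V x
    unfolding T_def by (intro sa_of_coords_herm_coords sa_mats_conj_by that) simp
  have "(\<integral>\<^sup>+x. F (sa_of_coords n (T U x)) \<partial>herm_lborel n) = (\<integral>\<^sup>+x. F (sa_of_coords n x) \<partial>herm_lborel n)"
  proof (rule lborel_PiM_isometry[where T' = "T (mat_adjoint U)" and w = "\<lambda>p. if fst p = snd p then 1 else 2"])
    fix x y :: "nat \<times> nat \<Rightarrow> real"
    show "T U (\<lambda>p\<in>?I. x p + y p) = (\<lambda>p\<in>?I. T U x p + T U y p)"
      unfolding T_def sa_of_coords_add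
      using c by (simp add: conj_by_add[of _ n] herm_coords_add)
    assume x: "x \<in> extensional ?I"
    have "T V (T W x) = x" if "unitary_mat n V" "W = mat_adjoint V" for V W
    proof -
      have W: "W \<in> carrier_mat n n" using that unitary_matD by auto
      have "T V (T W x) = herm_coords n (conj_by V (conj_by W (sa_of_coords n x)))"
        using sT[OF W] by (simp add: T_def)
      also have "conj_by V (conj_by W (sa_of_coords n x)) = sa_of_coords n x"
        using that by simp
      finally show ?thesis by (simp add: herm_coords_sa_of_coords x)
    qed
    from this[of U "mat_adjoint U"] this[of "mat_adjoint U" U] U unitary_mat_adjoint[OF U]
    show "T (mat_adjoint U) (T U x) = x" "T U (T (mat_adjoint U) x) = x" by simp_all
    show "(\<Sum>p\<in>?I. (if fst p = snd p then 1 else 2) * (T U x p)\<^sup>2)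
        = (\<Sum>p\<in>?I. (if fst p = snd p then 1 else 2) * (x p)\<^sup>2)"
      unfolding sum_square_sa_of_coords sT[OF c(1)]
      by (subst conj_by_mult[OF U, symmetric]) (simp_all add: trace_conj_by[OF U] mult_carrier_mat[of _ n n _ n])
  qed (use Tm[of U] Tm[of "mat_adjoint U"] c F in auto)
  then show ?thesis by (simp add: sT c)
qed

lemma nn_integral_herm_reflect:
  assumes F: "herm_borel n F"
  shows "(\<integral>\<^sup>+x. F (sa_of_coords n x) \<partial>herm_lborel n)
    = (\<integral>\<^sup>+x. F (complex_of_real \<mu> \<cdot>\<^sub>m 1\<^sub>m n - sa_of_coords n x) \<partial>herm_lborel n)"
proof -
  have "sa_of_coords n (\<lambda>p\<in>{..<n} \<times> {..<n}. (if fst p = snd p then \<mu> else 0) + (-1) * x p)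
     = complex_of_real \<mu> \<cdot>\<^sub>m 1\<^sub>m n - sa_of_coords n x" for x
    by (rule eq_matI) (auto simp: sa_of_coords_index complex_eq_iff)
  then show ?thesis
    using lborel_PiM_affine[OF _ _ F, of "\<lambda>_. -1" "\<lambda>p. if fst p = snd p then \<mu> else 0"] by simp
qed

lemma nn_integral_herm_diag_congruence:
  assumes F: "herm_borel n F" and d: "\<And>i. i < n \<Longrightarrow> d i > 0"
  shows "(\<integral>\<^sup>+x. F (sa_of_coords n x) \<partial>herm_lborel n)
    = ennreal ((\<Prod>i<n. d i) ^ (2 * n)) * (\<integral>\<^sup>+x. F (real_diag n d * sa_of_coords n x * real_diag n d) \<partial>herm_lborel n)"
proof -
  have eq: "sa_of_coords n (\<lambda>p\<in>{..<n} \<times> {..<n}. 0 + (d (fst p) * d (snd p)) * x p)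
     = real_diag n d * sa_of_coords n x * real_diag n d" for x
    by (rule eq_matI)
       (auto simp: sa_of_coords_index complex_eq_iff real_diag_mult_left[of _ n n] real_diag_mult_right[of _ n n]
          sq_carrier[of _ n] simp del: index_mult_mat(1))
  have "(\<Prod>p\<in>{..<n} \<times> {..<n}. \<bar>d (fst p) * d (snd p)\<bar>) = (\<Prod>i<n. \<Prod>j<n. d i * d j)"
    unfolding prod.cartesian_product using d
    by (intro prod.cong) (auto simp: abs_mult dest!: d)
  also have "\<dots> = (\<Prod>i<n. d i) ^ (2 * n)"
    by (simp add: prod.distrib mult_2 power_add prod_power_distrib)
  finally have k: "(\<Prod>p\<in>{..<n} \<times> {..<n}. \<bar>d (fst p) * d (snd p)\<bar>) = (\<Prod>i<n. d i) ^ (2 * n)" .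
  have nz: "d (fst p) * d (snd p) \<noteq> 0" if "p \<in> {..<n} \<times> {..<n}" for p
    using d[of "fst p"] d[of "snd p"] that by auto
  show ?thesis
    using lborel_PiM_affine[OF _ _ F, of "\<lambda>p. d (fst p) * d (snd p)" "\<lambda>_. 0", OF _ nz]
    unfolding eq k by simp
qed

lemma nn_integral_herm_congruence:
  assumes F: "herm_borel n F" and V: "unitary_mat n V" and g: "\<And>i. i < n \<Longrightarrow> g i > 0"
  defines "S \<equiv> conj_by V (real_diag n (\<lambda>i. sqrt (g i)))"
  shows "(\<integral>\<^sup>+x. F (sa_of_coords n x) \<partial>herm_lborel n)
    = ennreal ((\<Prod>i<n. g i) ^ n) * (\<integral>\<^sup>+x. F (S * sa_of_coords n x * S) \<partial>herm_lborel n)"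
proof -
  let ?D = "real_diag n (\<lambda>i. sqrt (g i))"
  note c = unitary_matD(1,2)[OF V]
  have S: "S \<in> sa_mats n" unfolding S_def by (intro sa_mats_conj_by c) simp
  have congr: "D * sa_of_coords n x * D \<in> sa_mats n" if D: "D \<in> sa_mats n" for D x
  proof -
    have "D * sa_of_coords n x * D = conj_by D (sa_of_coords n x)"
      using sa_matsD(2)[OF D] by (simp add: conj_by_def)
    then show ?thesis using sa_mats_conj_by[OF sa_matsD(1)[OF D]] by simp
  qed
  have mm: "mat_measurable (herm_lborel n) n n (\<lambda>x. D * sa_of_coords n x * D)" if "D \<in> carrier_mat n n" for D
    by (intro mat_measurable_mult[where m = n] mat_measurable_const mat_measurable_sa_of_coords that)
  have F1: "herm_borel n (\<lambda>A. F (conj_by V A))"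
    by (rule herm_borel_compose[OF F])
       (auto intro!: mat_measurable_conj_by mat_measurable_sa_of_coords c sa_mats_conj_by)
  have F2: "herm_borel n (\<lambda>A. F (conj_by V (?D * A * ?D)))"
    by (rule herm_borel_compose[OF F])
       (auto intro!: mat_measurable_conj_by mm c sa_mats_conj_by congr)
  have eq: "conj_by V (?D * conj_by (mat_adjoint V) A * ?D) = S * A * S" if A: "A \<in> carrier_mat n n" for A
    using c A unitary_mat_adjoint[OF V]
    by (simp add: conj_by_mult[OF V] conj_by_inverse[OF V] S_def sq_carrier[of _ n])
  have "(\<integral>\<^sup>+x. F (sa_of_coords n x) \<partial>herm_lborel n) = (\<integral>\<^sup>+x. F (conj_by V (sa_of_coords n x)) \<partial>herm_lborel n)"
    by (rule nn_integral_conj_by[OF V F, symmetric])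
  also have "\<dots> = ennreal ((\<Prod>i<n. sqrt (g i)) ^ (2 * n)) *
      (\<integral>\<^sup>+x. F (conj_by V (?D * sa_of_coords n x * ?D)) \<partial>herm_lborel n)"
    by (rule nn_integral_herm_diag_congruence[OF F1]) (simp add: g)
  also have "(\<Prod>i<n. sqrt (g i)) ^ (2 * n) = (\<Prod>i<n. g i) ^ n"
  proof -
    have "(\<Prod>i<n. sqrt (g i)) ^ 2 = (\<Prod>i<n. g i)"
      unfolding prod_power_distrib using g by (intro prod.cong) (auto simp: less_imp_le)
    then show ?thesis by (simp add: power_mult)
  qed
  also have "(\<integral>\<^sup>+x. F (conj_by V (?D * sa_of_coords n x * ?D)) \<partial>herm_lborel n)
     = (\<integral>\<^sup>+x. F (conj_by V (?D * conj_by (mat_adjoint V) (sa_of_coords n x) * ?D)) \<partial>herm_lborel n)"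
    by (rule nn_integral_conj_by[OF unitary_mat_adjoint[OF V] F2, symmetric])
  finally show ?thesis by (simp add: eq)
qed

subsection \<open>Coordinates of complex columns\<close>

definition col_idx :: "nat \<Rightarrow> (nat \<times> nat) set" where
  "col_idx n = {..<n} \<times> {n} \<union> {n} \<times> {..<n}"

definition col_mat :: "nat \<Rightarrow> (nat \<times> nat \<Rightarrow> real) \<Rightarrow> complex Matrix.mat" where
  "col_mat n x = Matrix.mat n 1 (\<lambda>(i, _). Complex (x (i, n)) (x (n, i)))"

definition col_coords :: "nat \<Rightarrow> complex Matrix.mat \<Rightarrow> nat \<times> nat \<Rightarrow> real" where
  "col_coords n Z = (\<lambda>(i, j)\<in>col_idx n. if j = n then Re (Z $$ (i, 0)) else Im (Z $$ (j, 0)))"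

lemma finite_col_idx [simp]: "finite (col_idx n)" by (simp add: col_idx_def)

lemma col_mat_dims [simp]: "dim_row (col_mat n x) = n" "dim_col (col_mat n x) = 1" "col_mat n x \<in> carrier_mat n 1"
    "col_mat n x \<in> carrier_mat n (Suc 0)"
  by (simp_all add: col_mat_def)

lemma col_mat_index [simp]: "i < n \<Longrightarrow> col_mat n x $$ (i, 0) = Complex (x (i, n)) (x (n, i))"
  by (simp add: col_mat_def)

lemma col_coords_col_mat: "x \<in> extensional (col_idx n) \<Longrightarrow> col_coords n (col_mat n x) = x"
  by (auto simp: col_coords_def fun_eq_iff extensional_def restrict_def) (auto simp: col_idx_def)

lemma col_mat_col_coords: "Z \<in> carrier_mat n 1 \<Longrightarrow> col_mat n (col_coords n Z) = Z"
  by (rule eq_matI) (auto simp: col_coords_def col_idx_def)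

lemma sum_col_idx: "(\<Sum>p\<in>col_idx n. f p) = (\<Sum>i<n. f (i, n) + f (n, i))" for f :: "nat \<times> nat \<Rightarrow> real"
proof -
  have "(\<Sum>p\<in>col_idx n. f p) = (\<Sum>p\<in>{..<n} \<times> {n}. f p) + (\<Sum>p\<in>{n} \<times> {..<n}. f p)"
    unfolding col_idx_def by (rule sum.union_disjoint) auto
  also have "\<dots> = (\<Sum>i<n. f (i, n)) + (\<Sum>i<n. f (n, i))"
    by (simp add: sum.cartesian_product')
  finally show ?thesis by (simp add: sum.distrib)
qed

lemma prod_col_idx: "(\<Prod>p\<in>col_idx n. f p) = (\<Prod>i<n. f (i, n) * f (n, i))" for f :: "nat \<times> nat \<Rightarrow> real"
proof -
  have "(\<Prod>p\<in>col_idx n. f p) = (\<Prod>p\<in>{..<n} \<times> {n}. f p) * (\<Prod>p\<in>{n} \<times> {..<n}. f p)"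
    unfolding col_idx_def by (rule prod.union_disjoint) auto
  also have "\<dots> = (\<Prod>i<n. f (i, n)) * (\<Prod>i<n. f (n, i))"
    by (simp add: prod.cartesian_product')
  finally show ?thesis by (simp add: prod.distrib)
qed

definition col_sq :: "nat \<Rightarrow> (nat \<times> nat \<Rightarrow> real) \<Rightarrow> real" where
  "col_sq n x = (\<Sum>i<n. (x (i, n))\<^sup>2 + (x (n, i))\<^sup>2)"

lemma col_sq_nonneg [simp]: "col_sq n x \<ge> 0"
  by (simp add: col_sq_def sum_nonneg)

lemma adjoint_col_mult_col:
  "(mat_adjoint (col_mat n x) * col_mat n x) $$ (0, 0) = complex_of_real (col_sq n x)"
proof -
  have "(mat_adjoint (col_mat n x) * col_mat n x) $$ (0, 0)
      = (\<Sum>i<n. cnj (Complex (x (i, n)) (x (n, i))) * Complex (x (i, n)) (x (n, i)))"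
    by (auto simp: scalar_prod_def atLeast0LessThan intro!: sum.cong)
  also have "\<dots> = complex_of_real (col_sq n x)"
    unfolding col_sq_def of_real_sum by (intro sum.cong) (auto simp: complex_eq_iff power2_eq_square)
  finally show ?thesis .
qed

lemma measurable_col_component:
  "i < n \<Longrightarrow> (\<lambda>x. x (i, n)) \<in> borel_measurable (lborel_PiM (col_idx n))"
  "i < n \<Longrightarrow> (\<lambda>x. x (n, i)) \<in> borel_measurable (lborel_PiM (col_idx n))"
proof -
  have "(\<lambda>x. x p) \<in> borel_measurable (lborel_PiM (col_idx n))" if "p \<in> col_idx n" for p
    using measurable_component_singleton[OF that, of "\<lambda>_. lborel"] by simp
  from this[of "(i, n)"] this[of "(n, i)"] 
  show "i < n \<Longrightarrow> (\<lambda>x. x (i, n)) \<in> borel_measurable (lborel_PiM (col_idx n))"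
    "i < n \<Longrightarrow> (\<lambda>x. x (n, i)) \<in> borel_measurable (lborel_PiM (col_idx n))"
    by (auto simp: col_idx_def)
qed

lemma measurable_col_sq [measurable]: "col_sq n \<in> borel_measurable (lborel_PiM (col_idx n))"
  unfolding col_sq_def using measurable_col_component by measurable

lemma mat_measurable_col_mat: "mat_measurable (lborel_PiM (col_idx n)) n 1 (col_mat n)"
  unfolding mat_measurable_def using measurable_col_component by auto

lemma measurable_col_coords:
  assumes A: "mat_measurable M n 1 A"
  shows "(\<lambda>x. col_coords n (A x)) \<in> measurable M (lborel_PiM (col_idx n))"
  unfolding col_coords_def
proof (rule measurable_restrict, clarify)
  fix i j assume ij: "(i, j) \<in> col_idx n"
  show "(\<lambda>x. if j = n then Re (A x $$ (i, 0)) else Im (A x $$ (j, 0))) \<in> measurable M lborel"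
    using mat_measurableD(2)[OF A, of i 0] mat_measurableD(2)[OF A, of j 0] ij
    by (auto simp: col_idx_def)
qed

abbreviation col_borel :: "nat \<Rightarrow> (complex Matrix.mat \<Rightarrow> ennreal) \<Rightarrow> bool" where
  "col_borel n F \<equiv> (\<lambda>x. F (col_mat n x)) \<in> borel_measurable (lborel_PiM (col_idx n))"

lemma nn_integral_col_unitary:
  assumes U: "unitary_mat n U" and F: "col_borel n F"
  shows "(\<integral>\<^sup>+x. F (U * col_mat n x) \<partial>lborel_PiM (col_idx n)) = (\<integral>\<^sup>+x. F (col_mat n x) \<partial>lborel_PiM (col_idx n))"
proof -
  define T where "T V x = col_coords n (V * col_mat n x)" for V and x :: "nat \<times> nat \<Rightarrow> real"
  note c = unitary_matD(1,2)[OF U]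
  have Tm: "T V \<in> measurable (lborel_PiM (col_idx n)) (lborel_PiM (col_idx n))" if "V \<in> carrier_mat n n" for V
    unfolding T_def
    by (intro measurable_col_coords mat_measurable_mult[where m = n] mat_measurable_const that mat_measurable_col_mat)
  have sT: "col_mat n (T V x) = V * col_mat n x" if "V \<in> carrier_mat n n" for V x
    unfolding T_def by (intro col_mat_col_coords mult_carrier_mat[OF that]) simp
  have cadd: "col_coords n (A + B) = (\<lambda>p\<in>col_idx n. col_coords n A p + col_coords n B p)"
    if "A \<in> carrier_mat n 1" "B \<in> carrier_mat n 1" for A B
    using that by (auto simp: col_coords_def fun_eq_iff restrict_def col_idx_def)
  have madd: "col_mat n (\<lambda>p\<in>col_idx n. x p + y p) = col_mat n x + col_mat n y" for x y
    by (rule eq_matI) (auto simp: col_idx_def complex_eq_iff)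
  have Vadd: "V * (col_mat n x + col_mat n y) = V * col_mat n x + V * col_mat n y" if "V \<in> carrier_mat n n" for V x y
    using mult_add_distrib_mat[OF that col_mat_dims(3) col_mat_dims(3)] .
  have "(\<integral>\<^sup>+x. F (col_mat n (T U x)) \<partial>lborel_PiM (col_idx n)) = (\<integral>\<^sup>+x. F (col_mat n x) \<partial>lborel_PiM (col_idx n))"
  proof (rule lborel_PiM_isometry[where T' = "T (mat_adjoint U)" and w = "\<lambda>_. 1"])
    fix x y :: "nat \<times> nat \<Rightarrow> real"
    show "T U (\<lambda>p\<in>col_idx n. x p + y p) = (\<lambda>p\<in>col_idx n. T U x p + T U y p)"
      unfolding T_def madd Vadd[OF c(1)]
      by (rule cadd) (auto intro!: mult_carrier_mat[OF c(1)])
    assume x: "x \<in> extensional (col_idx n)"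
    have "T V (T W x) = x" if "unitary_mat n V" "W = mat_adjoint V" for V W
    proof -
      have W: "W \<in> carrier_mat n n" using that unitary_matD by auto
      have "T V (T W x) = col_coords n (V * (W * col_mat n x))"
        using sT[OF W] by (simp add: T_def)
      also have "V * (W * col_mat n x) = (V * W) * col_mat n x"
        by (rule assoc_mult_mat[symmetric, of _ n n _ n _ 1]) (use that W unitary_matD in auto)
      also have "V * W = 1\<^sub>m n" using that unitary_matD by auto
      also have "1\<^sub>m n * col_mat n x = col_mat n x" by (rule left_mult_one_mat[of _ n 1]) simp
      finally show ?thesis by (simp add: col_coords_col_mat x)
    qed
    from this[of U "mat_adjoint U"] this[of "mat_adjoint U" U] U unitary_mat_adjoint[OF U]
    show "T (mat_adjoint U) (T U x) = x" "T U (T (mat_adjoint U) x) = x" by simp_all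
    have sq: "(\<Sum>p\<in>col_idx n. 1 * (x p)\<^sup>2) = Re ((mat_adjoint (col_mat n x) * col_mat n x) $$ (0, 0))" for x
      unfolding adjoint_col_mult_col by (simp add: sum_col_idx col_sq_def)
    have "mat_adjoint (U * col_mat n x) * (U * col_mat n x)
       = mat_adjoint (col_mat n x) * mat_adjoint U * (U * col_mat n x)"
      by (subst mat_adjoint_mult[OF c(1)]) auto
    also have "\<dots> = mat_adjoint (col_mat n x) * (mat_adjoint U * (U * col_mat n x))"
      by (rule assoc_mult_mat[of _ 1 n _ n _ 1]) (use c mult_carrier_mat[OF c(1) col_mat_dims(3)] in auto)
    also have "mat_adjoint U * (U * col_mat n x) = (mat_adjoint U * U) * col_mat n x"
      by (rule assoc_mult_mat[symmetric, of _ n n _ n _ 1]) (use c in auto)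
    also have "\<dots> = col_mat n x"
      unfolding unitary_matD(3)[OF U] by (rule left_mult_one_mat[of _ n 1]) simp
    finally show "(\<Sum>p\<in>col_idx n. 1 * (T U x p)\<^sup>2) = (\<Sum>p\<in>col_idx n. 1 * (x p)\<^sup>2)"
      unfolding sq sT[OF c(1)] by simp
  qed (use Tm[of U] Tm[of "mat_adjoint U"] c F in auto)
  then show ?thesis by (simp add: sT c)
qed

lemma nn_integral_col_scale:
  assumes F: "F \<in> borel_measurable (lborel_PiM (col_idx n))" and d: "\<And>i. i < n \<Longrightarrow> d i > 0"
  shows "(\<integral>\<^sup>+x. F x \<partial>lborel_PiM (col_idx n))
    = ennreal ((\<Prod>i<n. d i)\<^sup>2) * (\<integral>\<^sup>+x. F (\<lambda>(i, j)\<in>col_idx n. d (min i j) * x (i, j)) \<partial>lborel_PiM (col_idx n))"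
proof -
  let ?c = "\<lambda>p. d (min (fst p) (snd p))"
  have pos: "?c p > 0" if "p \<in> col_idx n" for p
    using that d by (auto simp: col_idx_def)
  have "(\<Prod>p\<in>col_idx n. \<bar>?c p\<bar>) = (\<Prod>i<n. \<bar>d i\<bar> * \<bar>d i\<bar>)"
    unfolding prod_col_idx by (intro prod.cong) auto
  also have "\<dots> = (\<Prod>i<n. d i)\<^sup>2"
    unfolding power2_eq_square prod.distrib[symmetric] using d by (intro prod.cong) auto
  finally have k: "(\<Prod>p\<in>col_idx n. \<bar>?c p\<bar>) = (\<Prod>i<n. d i)\<^sup>2" .
  have nz: "?c p \<noteq> 0" if "p \<in> col_idx n" for p using pos[OF that] by simp
  have eq: "(\<lambda>p\<in>col_idx n. 0 + ?c p * x p) = (\<lambda>(i, j)\<in>col_idx n. d (min i j) * x (i, j))" for x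
    by (auto simp: fun_eq_iff restrict_def)
  show ?thesis
    using lborel_PiM_affine[OF finite_col_idx _ F, of ?c "\<lambda>_. 0", OF nz] unfolding k eq .
qed

lemma col_mat_scale:
  "col_mat n (\<lambda>(i, j)\<in>col_idx n. d (min i j) * x (i, j)) = real_diag n d * col_mat n x"
proof (rule eq_matI)
  fix i j assume "i < dim_row (real_diag n d * col_mat n x)" "j < dim_col (real_diag n d * col_mat n x)"
  then have "i < n" "j = 0" by auto
  then show "col_mat n (\<lambda>(i, j)\<in>col_idx n. d (min i j) * x (i, j)) $$ (i, j) = (real_diag n d * col_mat n x) $$ (i, j)"
    by (subst real_diag_mult_left[of _ n 1]) (auto simp: col_idx_def complex_eq_iff)
qed auto

subsection \<open>Eigenvalues, definiteness and bordered matrices\<close>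

definition eig_prod :: "(real \<Rightarrow> ennreal) \<Rightarrow> complex Matrix.mat \<Rightarrow> ennreal" where
  "eig_prod \<phi> A = prod_mset (image_mset (\<lambda>z. \<phi> (Re z)) (proots (char_poly A)))"

lemma char_poly_real_diag: "char_poly (real_diag n d) = (\<Prod>i<n. [:- complex_of_real (d i), 1:])"
proof -
  have "upper_triangular (real_diag n d)" by auto
  then have "char_poly (real_diag n d) = (\<Prod>a\<leftarrow>diag_mat (real_diag n d). [:- a, 1:])"
    by (intro char_poly_upper_triangular[OF real_diag_carrier])
  also have "diag_mat (real_diag n d) = map (\<lambda>i. complex_of_real (d i)) [0..<n]"
    by (auto simp: diag_mat_def)
  finally show ?thesis
    using prod.distinct_set_conv_list[of "[0..<n]" "\<lambda>i. [:- complex_of_real (d i), 1:]"]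
    by (simp add: o_def atLeast0LessThan)
qed

lemma eig_prod_real_diag: "eig_prod \<phi> (real_diag n d) = (\<Prod>i<n. \<phi> (d i))"
proof -
  have "proots (\<Prod>i<n. [:- complex_of_real (d i), 1:]) = (\<Sum>i<n. proots [:- complex_of_real (d i), 1:])"
    by (rule proots_prod) auto
  also have "\<dots> = (\<Sum>i<n. {# complex_of_real (d i) #})" by simp
  also have "\<dots> = image_mset (\<lambda>i. complex_of_real (d i)) (mset_set {..<n})"
    by (induction n) (auto simp: lessThan_Suc)
  finally show ?thesis
    by (simp add: eig_prod_def char_poly_real_diag multiset.map_comp o_def prod_unfold_prod_mset)
qed

lemma eig_prod_cong_char_poly: "char_poly A = char_poly B \<Longrightarrow> eig_prod \<phi> A = eig_prod \<phi> B"
  by (simp add: eig_prod_def)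

lemma eig_prod_conj_by:
  "unitary_mat n U \<Longrightarrow> A \<in> carrier_mat n n \<Longrightarrow> eig_prod \<phi> (conj_by U A) = eig_prod \<phi> A"
  by (simp add: eig_prod_def char_poly_conj_by)

lemma char_poly_nonzero: "A \<in> carrier_mat n n \<Longrightarrow> char_poly A \<noteq> (0 :: complex poly)"
  using degree_monic_char_poly[of A n] by auto

lemma char_poly_block_upper:
  fixes A :: "complex Matrix.mat"
  assumes A: "A \<in> carrier_mat n n" and B: "B \<in> carrier_mat n m" and D: "D \<in> carrier_mat m m"
  shows "char_poly (four_block_mat A B (0\<^sub>m m n) D) = char_poly A * char_poly D"
proof -
  have "char_poly_matrix (four_block_mat A B (0\<^sub>m m n) D)
     = four_block_mat (char_poly_matrix A) (map_mat (\<lambda>a. [:- a:]) B) (0\<^sub>m m n) (char_poly_matrix D)"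
    by (rule eq_matI) (use assms in \<open>auto simp: char_poly_matrix_def\<close>)
  then show ?thesis
    unfolding char_poly_def using assms
    by (simp add: det_four_block_mat_lower_left_zero[of _ n _ m])
qed

definition border :: "complex Matrix.mat \<Rightarrow> complex Matrix.mat \<Rightarrow> real \<Rightarrow> complex Matrix.mat" where
  "border C Z a = four_block_mat C Z (mat_adjoint Z) (Matrix.mat 1 1 (\<lambda>_. complex_of_real a))"

lemma border_carrier [simp]:
  "C \<in> carrier_mat n n \<Longrightarrow> Z \<in> carrier_mat n 1 \<Longrightarrow> border C Z a \<in> carrier_mat (Suc n) (Suc n)"
  unfolding border_def by auto

lemma border_sa:
  assumes C: "C \<in> sa_mats n" and Z: "Z \<in> carrier_mat n 1"
  shows "border C Z a \<in> sa_mats (Suc n)"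
  unfolding sa_mats_def
proof safe
  have b: "border C Z a \<in> carrier_mat (Suc n) (Suc n)" by (rule border_carrier[OF sa_matsD(1)[OF C] Z])
  have dC: "dim_row C = n" "dim_col C = n" "dim_row Z = n" "dim_col Z = 1" using sa_matsD(1)[OF C] Z by auto
  show "mat_adjoint (border C Z a) = border C Z a"
  proof (rule eq_matI)
    fix i j assume "i < dim_row (border C Z a)" "j < dim_col (border C Z a)"
    then have ij: "i < Suc n" "j < Suc n" using b by auto
    have "mat_adjoint (border C Z a) $$ (i, j) = cnj (border C Z a $$ (j, i))"
      using ij b by (intro mat_adjoint_index) auto
    also have "\<dots> = border C Z a $$ (i, j)"
    proof (cases "i < n \<and> j < n")
      case True
      then have "cnj (C $$ (j, i)) = C $$ (i, j)" using sa_matsD(3)[OF C, of i j] by simp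
      then show ?thesis using True dC by (simp add: border_def)
    next
      case False
      then show ?thesis using ij dC by (auto simp: border_def)
    qed
    finally show "mat_adjoint (border C Z a) $$ (i, j) = border C Z a $$ (i, j)" .
  qed (use b in auto)
qed (use border_carrier[OF sa_matsD(1)[OF C] Z, of a] in simp)

definition quad :: "complex Matrix.mat \<Rightarrow> complex Matrix.mat \<Rightarrow> real" where
  "quad A Z = Re ((mat_adjoint Z * A * Z) $$ (0, 0))"

lemma quad_complex:
  assumes A: "A \<in> sa_mats n" and Z: "Z \<in> carrier_mat n 1"
  shows "(mat_adjoint Z * A * Z) $$ (0, 0) = complex_of_real (quad A Z)"
proof -
  note a = sa_matsD(1,2)[OF A]
  have "mat_adjoint (mat_adjoint Z * A * Z) = mat_adjoint Z * (mat_adjoint A * Z)"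
    using a Z mult_carrier_mat[OF mat_adjoint_carrier[OF Z] a(1)]
    by (simp add: mat_adjoint_mult[of _ 1 n _ 1] mat_adjoint_mult[of _ 1 n _ n])
  also have "\<dots> = mat_adjoint Z * A * Z"
    unfolding a(2) by (rule assoc_mult_mat[symmetric]) (use a Z in auto)
  finally have "mat_adjoint (mat_adjoint Z * A * Z) $$ (0, 0) = (mat_adjoint Z * A * Z) $$ (0, 0)" by simp
  then have "cnj ((mat_adjoint Z * A * Z) $$ (0, 0)) = (mat_adjoint Z * A * Z) $$ (0, 0)"
    using a Z by (subst (asm) mat_adjoint_index) auto
  then show ?thesis by (simp add: quad_def complex_eq_iff)
qed

lemma quad_real_diag:
  assumes Z: "Z \<in> carrier_mat n 1"
  shows "quad (real_diag n d) Z = (\<Sum>i<n. d i * (cmod (Z $$ (i, 0)))\<^sup>2)"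
proof -
  have "(mat_adjoint Z * real_diag n d * Z) $$ (0, 0)
      = (\<Sum>i<n. (mat_adjoint Z * real_diag n d) $$ (0, i) * Z $$ (i, 0))"
    using Z by (auto simp: scalar_prod_def atLeast0LessThan intro!: sum.cong)
  also have "\<dots> = (\<Sum>i<n. complex_of_real (d i * (cmod (Z $$ (i, 0)))\<^sup>2))"
    using Z by (intro sum.cong)
      (auto simp: real_diag_mult_right[of _ 1 n] complex_norm_square mult_ac simp del: index_mult_mat(1) of_real_power)
  finally show ?thesis by (simp add: quad_def)
qed

lemma quad_congruence:
  assumes A: "A \<in> carrier_mat n n" and S: "S \<in> carrier_mat n n" and Z: "Z \<in> carrier_mat n 1"
  shows "quad (mat_adjoint S * A * S) Z = quad A (S * Z)"
proof -
  note c = mat_adjoint_carrier[OF S] mat_adjoint_carrier[OF Z] mult_carrier_mat[OF S Z] A S Z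
    mult_carrier_mat[OF mat_adjoint_carrier[OF Z] mat_adjoint_carrier[OF S]]
  have "mat_adjoint (S * Z) * A * (S * Z) = mat_adjoint Z * mat_adjoint S * A * (S * Z)"
    by (subst mat_adjoint_mult[OF S Z]) simp
  also have "\<dots> = mat_adjoint Z * (mat_adjoint S * A * S) * Z"
    using c by (simp add: assoc_mult_mat[of _ 1 n _ n _ n] assoc_mult_mat[of _ 1 n _ n _ 1]
        assoc_mult_mat[of _ n n _ n _ 1] assoc_mult_mat[of _ n n _ n _ n] sq_carrier[of _ n] mult_carrier_mat[of _ n n _ 1])
  finally show ?thesis by (simp add: quad_def)
qed

text \<open>In the next lemma the vector \<open>(-Z, 1)\<close> spans the kernel of \<open>\<mu> - A\<close> for the bordered matrix
  \<open>A\<close>, and \<open>K (1 + Z Z*)\<close> is similar to the compression of \<open>\<mu> - A\<close> to the complement.\<close>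

lemma char_poly_border:
  assumes K: "K \<in> sa_mats n" and Z: "Z \<in> carrier_mat n 1"
  shows "char_poly (border (complex_of_real \<mu> \<cdot>\<^sub>m 1\<^sub>m n - K) (K * Z) (\<mu> - quad K Z))
    = char_poly (complex_of_real \<mu> \<cdot>\<^sub>m 1\<^sub>m n - K * (1\<^sub>m n + Z * mat_adjoint Z)) * [:- complex_of_real \<mu>, 1:]"
proof -
  let ?m = "complex_of_real \<mu>" and ?q = "complex_of_real (quad K Z)"
  note k = sa_matsD(1,2)[OF K]
  define Y where "Y = mat_adjoint Z"
  have Y: "Y \<in> carrier_mat 1 n" using Z by (simp add: Y_def)
  define A where "A = border (?m \<cdot>\<^sub>m 1\<^sub>m n - K) (K * Z) (\<mu> - quad K Z)"
  define P where "P = four_block_mat (1\<^sub>m n) (0\<^sub>m n 1) Y (1\<^sub>m 1)"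
  define Q where "Q = four_block_mat (1\<^sub>m n) (0\<^sub>m n 1) (- Y) (1\<^sub>m 1)"
  have KZ: "K * Z \<in> carrier_mat n 1" using k Z by auto
  have YK: "Y * K \<in> carrier_mat 1 n" using k Y by auto
  have mK: "?m \<cdot>\<^sub>m 1\<^sub>m n - K \<in> carrier_mat n n" "?m \<cdot>\<^sub>m 1\<^sub>m n - K * (1\<^sub>m n + Z * Y) \<in> carrier_mat n n"
    using k Y Z by (auto intro!: minus_carrier_mat mult_carrier_mat[of _ n n])
  have adj: "mat_adjoint (K * Z) = Y * K"
    using mat_adjoint_mult[OF k(1) Z] k(2) by (simp add: Y_def)
  have A: "A = four_block_mat (?m \<cdot>\<^sub>m 1\<^sub>m n - K) (K * Z) (Y * K) (Matrix.mat 1 1 (\<lambda>_. ?m - ?q))"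
    by (simp add: A_def border_def adj)
  have q: "Y * (K * Z) = Matrix.mat 1 1 (\<lambda>_. ?q)"
  proof -
    have "Y * (K * Z) = Y * K * Z" using k Y Z by (intro assoc_mult_mat[symmetric]) auto
    moreover have "(Y * K * Z) $$ (i, j) = ?q" if "i < 1" "j < 1" for i j
      using quad_complex[OF K Z] that by (simp add: Y_def del: index_mult_mat(1))
    ultimately show ?thesis
      using Y Z k by (intro eq_matI) (simp_all del: index_mult_mat(1))
  qed
  have YM: "Y * (?m \<cdot>\<^sub>m 1\<^sub>m n - K) = ?m \<cdot>\<^sub>m Y - Y * K"
    using k Y by (simp add: mult_minus_distrib_mat[of _ 1 n _ n] mult_smult_distrib[of _ 1 n _ n] right_mult_one_mat[of _ 1 n])
  have PA: "P * A = four_block_mat (?m \<cdot>\<^sub>m 1\<^sub>m n - K) (K * Z) (?m \<cdot>\<^sub>m Y) (?m \<cdot>\<^sub>m 1\<^sub>m 1)"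
    unfolding P_def A
    apply (subst mult_four_block_mat[of _ n n _ 1 _ 1 _ _ n _ 1])
    using k Y Z KZ YK mK apply simp_all[8]
    apply (rule cong_four_block_mat)
    subgoal using k Y YK by (intro eq_matI) (auto simp: left_mult_one_mat[of _ n n])
    subgoal using KZ by (intro eq_matI) (auto simp: left_mult_one_mat[of _ n 1])
    subgoal using k Y YK by (simp add: YM left_mult_one_mat[of _ 1 n]) (intro eq_matI, auto)
    subgoal unfolding q by (intro eq_matI) auto
    done
  have YmQ: "(?m \<cdot>\<^sub>m 1\<^sub>m n - K) * 1\<^sub>m n + K * Z * (- Y) = ?m \<cdot>\<^sub>m 1\<^sub>m n - K * (1\<^sub>m n + Z * Y)"
  proof -
    have "K * (1\<^sub>m n + Z * Y) = K + K * (Z * Y)"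
      using k Y Z by (subst mult_add_distrib_mat[of _ n n _ n]) (auto simp: right_mult_one_mat[of _ n n])
    moreover have "K * Z * (- Y) = - (K * (Z * Y))"
      using k Y Z KZ by (simp add: assoc_mult_mat[of K n n Z 1 Y n] uminus_mult_right_mat)
    ultimately show ?thesis using k Y Z KZ
      by (simp add: right_mult_one_mat[of _ n n]) (intro eq_matI, auto)
  qed
  have PAQ: "P * A * Q = four_block_mat (?m \<cdot>\<^sub>m 1\<^sub>m n - K * (1\<^sub>m n + Z * Y)) (K * Z) (0\<^sub>m 1 n) (?m \<cdot>\<^sub>m 1\<^sub>m 1)"
    unfolding PA Q_def
    apply (subst mult_four_block_mat[of _ n n _ 1 _ 1 _ _ n _ 1])
    using k Y Z KZ YK mK apply simp_all[8]
    apply (rule cong_four_block_mat)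
    subgoal by (rule YmQ)
    subgoal using KZ k by (intro eq_matI) (auto simp: right_mult_one_mat[of _ n 1])
    subgoal using Y by (simp add: right_mult_one_mat[of _ 1 n] mult_smult_assoc_mat[of _ 1 1 _ n]) (intro eq_matI, auto)
    subgoal using Y by (intro eq_matI) auto
    done
  have inv: "four_block_mat (1\<^sub>m n) (0\<^sub>m n 1) X (1\<^sub>m 1) * four_block_mat (1\<^sub>m n) (0\<^sub>m n 1) W (1\<^sub>m 1) = 1\<^sub>m (Suc n)"
    if XW: "X \<in> carrier_mat 1 n" "W \<in> carrier_mat 1 n" "X + W = 0\<^sub>m 1 n" for X W :: "complex Matrix.mat"
  proof -
    have "four_block_mat (1\<^sub>m n) (0\<^sub>m n 1) X (1\<^sub>m 1) * four_block_mat (1\<^sub>m n) (0\<^sub>m n 1) W (1\<^sub>m 1)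
       = four_block_mat (1\<^sub>m n) (0\<^sub>m n 1) (X + W) (1\<^sub>m 1)"
      apply (subst mult_four_block_mat[of _ n n _ 1 _ 1 _ _ n _ 1])
      using XW(1,2) apply simp_all[5]
      apply (rule cong_four_block_mat)
      using XW(1,2) by (simp_all add: left_mult_one_mat[of _ 1 n] right_mult_one_mat[of _ 1 n] right_mult_one_mat[of _ n n])
    also have "\<dots> = 1\<^sub>m (Suc n)" unfolding XW(3) by (rule eq_matI) auto
    finally show ?thesis .
  qed
  have PQ: "P * Q = 1\<^sub>m (Suc n)" "Q * P = 1\<^sub>m (Suc n)"
    unfolding P_def Q_def by (rule inv; use Y in \<open>auto intro!: eq_matI\<close>)+
  have "similar_mat (P * A * Q) A"
    unfolding similar_mat_def
    by (rule exI[of _ P], rule exI[of _ Q], rule similar_mat_witI[of _ _ "Suc n"])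
       (use PQ k Y Z KZ mK in \<open>auto simp: P_def Q_def A PAQ[unfolded P_def Q_def A]\<close>)
  then have "char_poly A = char_poly (P * A * Q)" by (simp add: char_poly_similar)
  also have "\<dots> = char_poly (?m \<cdot>\<^sub>m 1\<^sub>m n - K * (1\<^sub>m n + Z * Y)) * char_poly (?m \<cdot>\<^sub>m 1\<^sub>m 1)"
    unfolding PAQ by (rule char_poly_block_upper) (use k Y Z KZ mK in auto)
  also have "char_poly (?m \<cdot>\<^sub>m 1\<^sub>m 1) = [:- ?m, 1:]"
    by (simp add: char_poly_defs det_def sign_def)
  finally show ?thesis by (simp add: A_def Y_def)
qed

lemma det_one_plus_col:
  assumes Z: "Z \<in> carrier_mat n 1"
  shows "Determinant.det (1\<^sub>m n + Z * mat_adjoint Z) = 1 + (mat_adjoint Z * Z) $$ (0, 0)"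
proof -
  define Y where "Y = mat_adjoint Z"
  have Y: "Y \<in> carrier_mat 1 n" using Z by (simp add: Y_def)
  let ?L = "four_block_mat (1\<^sub>m n) (0\<^sub>m n 1) Y (1\<^sub>m 1)"
  let ?A = "four_block_mat (1\<^sub>m n + Z * Y) (- Z) (0\<^sub>m 1 n) (1\<^sub>m 1)"
  let ?B = "four_block_mat (1\<^sub>m n) (- Z) (0\<^sub>m 1 n) (1\<^sub>m 1 + Y * Z)"
  have c: "?L \<in> carrier_mat (Suc n) (Suc n)" "?A \<in> carrier_mat (Suc n) (Suc n)" "?B \<in> carrier_mat (Suc n) (Suc n)"
    using Y Z four_block_carrier_mat[of _ n n _ 1 1] by auto
  have "?A * ?L = four_block_mat (1\<^sub>m n) (- Z) Y (1\<^sub>m 1)"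
    apply (subst mult_four_block_mat[of _ n n _ 1 _ 1 _ _ n _ 1])
    using Y Z apply simp_all[8]
    apply (rule cong_four_block_mat)
    using Y Z apply (simp_all add: uminus_mult_left_mat left_mult_one_mat[of _ 1 n] right_mult_one_mat[of _ n n] right_mult_one_mat[of _ n 1])
    apply (auto intro!: eq_matI)
    done
  moreover have "?L * ?B = four_block_mat (1\<^sub>m n) (- Z) Y (1\<^sub>m 1)"
    apply (subst mult_four_block_mat[of _ n n _ 1 _ 1 _ _ n _ 1])
    using Y Z apply simp_all[8]
    apply (rule cong_four_block_mat)
    using Y Z apply (simp_all add: uminus_mult_right_mat left_mult_one_mat[of _ n 1] right_mult_one_mat[of _ 1 n])
    apply (auto intro!: eq_matI)
    done
  ultimately have "Determinant.det ?A * Determinant.det ?L = Determinant.det ?L * Determinant.det ?B"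
    using c by (metis Determinant.det_mult)
  moreover have "Determinant.det ?L = 1"
    using Y by (subst det_four_block_mat_upper_right_zero[of _ n _ 1]) auto
  moreover have "Determinant.det ?A = Determinant.det (1\<^sub>m n + Z * Y)"
    using Y Z by (subst det_four_block_mat_lower_left_zero[of _ n _ 1]) auto
  moreover have "Determinant.det ?B = Determinant.det (1\<^sub>m 1 + Y * Z)"
    using Y Z by (subst det_four_block_mat_lower_left_zero[of _ n _ 1]) auto
  moreover have "Determinant.det (1\<^sub>m 1 + Y * Z) = 1 + (Y * Z) $$ (0, 0)"
    using Y Z by (subst det_single) auto
  ultimately show ?thesis by (simp add: Y_def)
qed

lemma det_conj_by:
  "unitary_mat n U \<Longrightarrow> A \<in> carrier_mat n n \<Longrightarrow> Determinant.det (conj_by U A) = Determinant.det A"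
  by (rule det_similar[OF similar_conj_by])

lemma det_real_diag: "Determinant.det (real_diag n d) = complex_of_real (\<Prod>i<n. d i)"
proof -
  have "Determinant.det (real_diag n d) = prod_list (diag_mat (real_diag n d))"
    by (intro det_upper_triangular[OF _ real_diag_carrier]) auto
  also have "diag_mat (real_diag n d) = map (\<lambda>i. complex_of_real (d i)) [0..<n]"
    by (auto simp: diag_mat_def)
  finally show ?thesis
    using prod.distinct_set_conv_list[of "[0..<n]" "\<lambda>i. complex_of_real (d i)"]
    by (simp add: atLeast0LessThan)
qed

definition posdef :: "nat \<Rightarrow> complex Matrix.mat \<Rightarrow> bool" where
  "posdef n A \<longleftrightarrow> (\<forall>Z \<in> carrier_mat n 1. Z \<noteq> 0\<^sub>m n 1 \<longrightarrow> quad A Z > 0)"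

lemma posdef_congruence:
  assumes A: "A \<in> carrier_mat n n" and S: "S \<in> carrier_mat n n" and T: "T \<in> carrier_mat n n"
    and inv: "S * T = 1\<^sub>m n" "T * S = 1\<^sub>m n"
  shows "posdef n (mat_adjoint S * A * S) \<longleftrightarrow> posdef n A"
proof -
  have cancel: "X * (Y * Z) = Z" if "X * Y = 1\<^sub>m n" "X \<in> carrier_mat n n" "Y \<in> carrier_mat n n" "Z \<in> carrier_mat n 1"
    for X Y Z :: "complex Matrix.mat"
  proof -
    have "X * (Y * Z) = X * Y * Z" by (rule assoc_mult_mat[symmetric]) (use that in auto)
    then show ?thesis using that by (simp add: left_mult_one_mat[of _ n 1])
  qed
  have nz: "X * Z \<noteq> 0\<^sub>m n 1" if "Y * X = 1\<^sub>m n" "X \<in> carrier_mat n n" "Y \<in> carrier_mat n n" "Z \<in> carrier_mat n 1" "Z \<noteq> 0\<^sub>m n 1"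
    for X Y Z :: "complex Matrix.mat"
    using cancel[OF that(1,3,2,4)] that right_mult_zero_mat[OF that(3), of 1] by auto
  show ?thesis
    unfolding posdef_def
  proof safe
    fix Z :: "complex Matrix.mat" assume *: "\<forall>Z\<in>carrier_mat n 1. Z \<noteq> 0\<^sub>m n 1 \<longrightarrow> 0 < quad (mat_adjoint S * A * S) Z"
      and Z: "Z \<in> carrier_mat n 1" "Z \<noteq> 0\<^sub>m n 1"
    have TZ: "T * Z \<in> carrier_mat n 1" by (rule mult_carrier_mat[OF T Z(1)])
    have "0 < quad (mat_adjoint S * A * S) (T * Z)"
      using * nz[OF inv(1) T S Z] TZ by blast
    then show "0 < quad A Z" by (simp add: quad_congruence[OF A S TZ] cancel[OF inv(1) S T Z(1)])
  next
    fix Z :: "complex Matrix.mat" assume *: "\<forall>Z\<in>carrier_mat n 1. Z \<noteq> 0\<^sub>m n 1 \<longrightarrow> 0 < quad A Z"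
      and Z: "Z \<in> carrier_mat n 1" "Z \<noteq> 0\<^sub>m n 1"
    have "0 < quad A (S * Z)" using * nz[OF inv(2) S T Z] mult_carrier_mat[OF S Z(1)] by blast
    then show "0 < quad (mat_adjoint S * A * S) Z" by (simp add: quad_congruence[OF A S Z(1)])
  qed
qed

lemma posdef_conj_by:
  assumes U: "unitary_mat n U" and A: "A \<in> carrier_mat n n"
  shows "posdef n (conj_by U A) \<longleftrightarrow> posdef n A"
  using posdef_congruence[OF A, of "mat_adjoint U" U] unitary_matD[OF U] by (simp add: conj_by_def)

lemma posdef_real_diag: "posdef n (real_diag n d) \<longleftrightarrow> (\<forall>i<n. d i > 0)"
proof safe
  fix i assume pd: "posdef n (real_diag n d)" and i: "i < n"
  define Z where "Z = Matrix.mat n 1 (\<lambda>(k, _). if k = i then 1 else (0 :: complex))"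
  have Z: "Z \<in> carrier_mat n 1" by (simp add: Z_def)
  have "Z $$ (i, 0) \<noteq> 0\<^sub>m n 1 $$ (i, 0)" using i by (simp add: Z_def)
  then have "Z \<noteq> 0\<^sub>m n 1" by auto
  then have "0 < quad (real_diag n d) Z" using pd Z by (simp add: posdef_def)
  also have "\<dots> = (\<Sum>k<n. if k = i then d i else 0)"
    unfolding quad_real_diag[OF Z] by (intro sum.cong) (auto simp: Z_def)
  finally show "d i > 0" using i by simp
next
  assume d: "\<forall>i<n. d i > 0"
  show "posdef n (real_diag n d)" unfolding posdef_def
  proof safe
    fix Z :: "complex Matrix.mat" assume Z: "Z \<in> carrier_mat n 1" "Z \<noteq> 0\<^sub>m n 1"
    have "\<exists>i<n. Z $$ (i, 0) \<noteq> 0"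
    proof (rule ccontr)
      assume "\<not> ?thesis"
      then have "Z = 0\<^sub>m n 1" using Z(1) by (intro eq_matI) auto
      then show False using Z(2) by simp
    qed
    then obtain i where i: "i < n" "Z $$ (i, 0) \<noteq> 0" by blast
    then have "0 < (\<Sum>i<n. d i * (cmod (Z $$ (i, 0)))\<^sup>2)"
      using d by (intro sum_pos2[where i = i]) (auto intro!: mult_nonneg_nonneg simp: less_imp_le)
    then show "0 < quad (real_diag n d) Z" by (simp add: quad_real_diag[OF Z(1)])
  qed
qed

lemma mat_pow_conj_by:
  assumes U: "unitary_mat n U" and A: "A \<in> carrier_mat n n"
  shows "conj_by U A ^\<^sub>m k = conj_by U (A ^\<^sub>m k)"
  using unitary_matD(1)[OF U] A
  by (induction k) (simp_all add: conj_by_mult[OF U] U conj_by_def[of U A])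

lemma mat_pow_real_diag: "real_diag n d ^\<^sub>m k = real_diag n (\<lambda>i. d i ^ k)"
  by (induction k) (simp_all add: real_diag_one real_diag_mult mult.commute)

definition tr_pow :: "nat \<Rightarrow> complex Matrix.mat \<Rightarrow> nat \<Rightarrow> real" where
  "tr_pow n A k = Re (\<Sum>i<n. (A ^\<^sub>m k) $$ (i, i))"

lemma tr_pow_conj_diag:
  "unitary_mat n U \<Longrightarrow> tr_pow n (conj_by U (real_diag n d)) k = (\<Sum>i<n. d i ^ k)"
  by (simp add: tr_pow_def mat_pow_conj_by trace_conj_by mat_pow_real_diag)

lemma mat_measurable_cong:
  "(\<And>x. x \<in> space M \<Longrightarrow> A x = B x) \<Longrightarrow> mat_measurable M n m A \<longleftrightarrow> mat_measurable M n m B"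
  unfolding mat_measurable_def by (intro conj_cong ball_cong all_cong measurable_cong imp_cong) auto

lemma mat_measurable_pow:
  assumes A: "mat_measurable M n n A"
  shows "mat_measurable M n n (\<lambda>x. A x ^\<^sub>m k)"
proof (induction k)
  case 0
  have "mat_measurable M n n (\<lambda>x. 1\<^sub>m n)" by (rule mat_measurable_const) simp
  moreover have "A x ^\<^sub>m 0 = 1\<^sub>m n" if "x \<in> space M" for x using mat_measurableD(1)[OF A that] by auto
  ultimately show ?case by (simp cong: mat_measurable_cong)
next
  case (Suc k)
  then show ?case by (auto intro: mat_measurable_mult A)
qed

lemma measurable_tr_pow:
  "mat_measurable M n n A \<Longrightarrow> (\<lambda>x. tr_pow n (A x) k) \<in> borel_measurable M"
  unfolding tr_pow_def
  by (intro borel_measurable_Re mat_measurable_trace[THEN measurable_compose] mat_measurable_pow) auto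

lemma powers_bounded_iff:
  fixes d :: "nat \<Rightarrow> real"
  assumes q: "q > 0"
  shows "(\<forall>i<n. \<bar>d i\<bar> \<le> q) \<longleftrightarrow> (\<forall>k. (\<Sum>i<n. d i ^ (2 * k)) \<le> real n * q ^ (2 * k))"
proof safe
  fix k assume "\<forall>i<n. \<bar>d i\<bar> \<le> q"
  then have "d i ^ (2 * k) \<le> q ^ (2 * k)" if "i < n" for i
    using that power_mono[of "\<bar>d i\<bar>" q "2 * k"] by (simp add: power_even_abs)
  then have "(\<Sum>i<n. d i ^ (2 * k)) \<le> (\<Sum>i<n. q ^ (2 * k))" by (intro sum_mono) auto
  then show "(\<Sum>i<n. d i ^ (2 * k)) \<le> real n * q ^ (2 * k)" by simp
next
  fix i assume *: "\<forall>k. (\<Sum>i<n. d i ^ (2 * k)) \<le> real n * q ^ (2 * k)" and i: "i < n"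
  show "\<bar>d i\<bar> \<le> q"
  proof (rule ccontr)
    assume "\<not> \<bar>d i\<bar> \<le> q"
    then have "1 < (d i / q)\<^sup>2" using q by (simp add: one_less_power abs_square_less_1 power_divide)
      (metis abs_of_pos abs_le_square_iff linorder_not_less)
    then obtain k where "real n < ((d i / q)\<^sup>2) ^ k" using real_arch_pow by blast
    also have "((d i / q)\<^sup>2) ^ k = d i ^ (2 * k) / q ^ (2 * k)" by (simp only: power_mult power_divide)
    finally have "real n * q ^ (2 * k) < d i ^ (2 * k)"
      using q by (simp add: pos_less_divide_eq)
    moreover have "d i ^ (2 * k) \<le> (\<Sum>i<n. d i ^ (2 * k))"
      using i by (intro member_le_sum) (auto simp: power_mult)
    ultimately show False using spec[OF *, of k] by linarith
  qed
qed

lemma smult_one_minus_conj_diag: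
  assumes U: "unitary_mat n U"
  shows "complex_of_real c \<cdot>\<^sub>m 1\<^sub>m n - conj_by U (real_diag n d) = conj_by U (real_diag n (\<lambda>i. c - d i))"
proof -
  have "complex_of_real c \<cdot>\<^sub>m 1\<^sub>m n = conj_by U (complex_of_real c \<cdot>\<^sub>m 1\<^sub>m n)"
    using unitary_matD[OF U] by (simp add: conj_by_smult[of _ n] U)
  then have "complex_of_real c \<cdot>\<^sub>m 1\<^sub>m n - conj_by U (real_diag n d)
    = conj_by U (complex_of_real c \<cdot>\<^sub>m 1\<^sub>m n - real_diag n d)"
    using unitary_matD[OF U] by (simp add: conj_by_minus[of _ n])
  also have "complex_of_real c \<cdot>\<^sub>m 1\<^sub>m n - real_diag n d = real_diag n (\<lambda>i. c - d i)"
    by (rule eq_matI) auto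
  finally show ?thesis .
qed

text \<open>A countable criterion for definiteness, which makes it a measurable condition.\<close>

lemma posdef_iff_tr_pow:
  assumes A: "A \<in> sa_mats n"
  shows "posdef n A \<longleftrightarrow> (\<exists>c m :: nat. real c - 1 / (real m + 1) > 0 \<and>
    (\<forall>k. tr_pow n (complex_of_real (real c) \<cdot>\<^sub>m 1\<^sub>m n - A) (2 * k) \<le> real n * (real c - 1 / (real m + 1)) ^ (2 * k)))"
proof -
  obtain U d where U: "unitary_mat n U" and A: "A = conj_by U (real_diag n d)"
    using spectral_theorem[OF A] by blast
  have "posdef n A \<longleftrightarrow> (\<forall>i<n. d i > 0)"
    unfolding A by (simp add: posdef_conj_by[OF U] posdef_real_diag)
  also have "\<dots> \<longleftrightarrow> (\<exists>c m :: nat. real c - 1 / (real m + 1) > 0 \<and> (\<forall>i<n. \<bar>real c - d i\<bar> \<le> real c - 1 / (real m + 1)))"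
  proof safe
    assume d: "\<forall>i<n. 0 < d i"
    define b where "b = Min (insert 1 (d ` {..<n}))"
    have b: "b > 0" "\<And>i. i < n \<Longrightarrow> b \<le> d i" unfolding b_def using d by auto
    obtain m :: nat where m: "1 / (real m + 1) < b"
      using reals_Archimedean[OF b(1)] by (auto simp: inverse_eq_divide add.commute)
    obtain c :: nat where c: "Max (insert 2 (d ` {..<n})) < real c" using reals_Archimedean2 by blast
    have c': "2 < real c" "\<And>i. i < n \<Longrightarrow> d i < real c" using c by auto
    have m1: "1 / (real m + 1) \<le> 1" by simp
    have "\<bar>real c - d i\<bar> \<le> real c - 1 / (real m + 1)" if "i < n" for i
      using c'(2)[OF that] b(2)[OF that] m by linarith
    moreover have "real c - 1 / (real m + 1) > 0" using m1 c'(1) by linarith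
    ultimately show "\<exists>c m :: nat. real c - 1 / (real m + 1) > 0 \<and> (\<forall>i<n. \<bar>real c - d i\<bar> \<le> real c - 1 / (real m + 1))"
      by blast
  next
    fix c m :: nat and i assume "\<forall>i<n. \<bar>real c - d i\<bar> \<le> real c - 1 / (real m + 1)" "i < n"
    then have "\<bar>real c - d i\<bar> \<le> real c - 1 / (real m + 1)" by blast
    moreover have "1 / (real m + 1) > 0" by simp
    ultimately show "d i > 0" by linarith
  qed
  also have "\<dots> \<longleftrightarrow> (\<exists>c m :: nat. real c - 1 / (real m + 1) > 0 \<and>
    (\<forall>k. tr_pow n (complex_of_real (real c) \<cdot>\<^sub>m 1\<^sub>m n - A) (2 * k) \<le> real n * (real c - 1 / (real m + 1)) ^ (2 * k)))"
    unfolding A smult_one_minus_conj_diag[OF U] tr_pow_conj_diag[OF U]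
    using powers_bounded_iff[where n = n] by (intro ex_cong1 conj_cong refl) auto
  finally show ?thesis .
qed

lemma pred_posdef:
  assumes A: "mat_measurable M n n A" and sa: "\<And>x. x \<in> space M \<Longrightarrow> A x \<in> sa_mats n"
  shows "Measurable.pred M (\<lambda>x. posdef n (A x))"
proof -
  have [measurable]: "(\<lambda>x. tr_pow n (complex_of_real c \<cdot>\<^sub>m 1\<^sub>m n - A x) k) \<in> borel_measurable M" for c k
    by (intro measurable_tr_pow mat_measurable_minus mat_measurable_const A) auto
  have "Measurable.pred M (\<lambda>x. \<exists>c m :: nat. real c - 1 / (real m + 1) > 0 \<and>
    (\<forall>k. tr_pow n (complex_of_real (real c) \<cdot>\<^sub>m 1\<^sub>m n - A x) (2 * k) \<le> real n * (real c - 1 / (real m + 1)) ^ (2 * k)))"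
    by measurable
  then show ?thesis
    by (rule measurable_cong[THEN iffD1, rotated]) (simp add: posdef_iff_tr_pow[OF sa])
qed

lemma measurable_mat_det:
  assumes A: "mat_measurable M n n A"
  shows "(\<lambda>x. Determinant.det (A x)) \<in> borel_measurable M"
proof -
  have "(\<lambda>x. \<Sum>p\<in>{p. p permutes {0..<n}}. signof p * (\<Prod>i = 0..<n. A x $$ (i, p i))) \<in> borel_measurable M"
  proof (intro borel_measurable_sum borel_measurable_times borel_measurable_const borel_measurable_prod)
    fix p i assume "p \<in> {p. p permutes {0..<n}}" "i \<in> {0..<n}"
    then have "i < n" "p i < n" using permutes_in_image[of p "{0..<n}" i] by auto
    then show "(\<lambda>x. A x $$ (i, p i)) \<in> borel_measurable M" by (rule mat_measurableD(2)[OF A])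
  qed
  then show ?thesis
    by (rule measurable_cong[THEN iffD1, rotated])
       (use mat_measurableD(1)[OF A] in \<open>auto simp: Determinant.det_def\<close>)
qed

lemma similar_eig_prod:
  assumes "similar_mat A B"
  shows "eig_prod \<phi> A = eig_prod \<phi> B"
  by (rule eig_prod_cong_char_poly[OF char_poly_similar[OF assms]])

lemma eig_prod_border:
  assumes K: "K \<in> sa_mats n" and Z: "Z \<in> carrier_mat n 1"
  shows "eig_prod \<phi> (border (complex_of_real \<mu> \<cdot>\<^sub>m 1\<^sub>m n - K) (K * Z) (\<mu> - quad K Z))
    = \<phi> \<mu> * eig_prod \<phi> (complex_of_real \<mu> \<cdot>\<^sub>m 1\<^sub>m n - K * (1\<^sub>m n + Z * mat_adjoint Z))"
proof -
  have "complex_of_real \<mu> \<cdot>\<^sub>m 1\<^sub>m n - K * (1\<^sub>m n + Z * mat_adjoint Z) \<in> carrier_mat n n"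
    using sa_matsD(1)[OF K] Z by (auto intro!: minus_carrier_mat mult_carrier_mat[of _ n n])
  from char_poly_nonzero[OF this] show ?thesis
    unfolding eig_prod_def char_poly_border[OF K Z]
    by (subst proots_mult) (simp_all add: mult.commute)
qed

lemma scaled_one_minus_sa:
  "A \<in> sa_mats n \<Longrightarrow> complex_of_real \<mu> \<cdot>\<^sub>m 1\<^sub>m n - A \<in> sa_mats n"
proof -
  assume A: "A \<in> sa_mats n"
  obtain U d where "unitary_mat n U" "A = conj_by U (real_diag n d)"
    using spectral_theorem[OF A] by blast
  then show ?thesis
    using unitary_matD(1) by (auto simp: smult_one_minus_conj_diag intro: sa_mats_conj_by)
qed

definition gap_weight :: "nat \<Rightarrow> real \<Rightarrow> complex Matrix.mat \<Rightarrow> ennreal" where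
  "gap_weight n \<mu> B = (if posdef n (complex_of_real \<mu> \<cdot>\<^sub>m 1\<^sub>m n - B)
     then ennreal ((Re (Determinant.det (complex_of_real \<mu> \<cdot>\<^sub>m 1\<^sub>m n - B)))\<^sup>2) else 0)"

lemma measurable_gap_weight:
  assumes A: "mat_measurable M n n A" and sa: "\<And>x. x \<in> space M \<Longrightarrow> A x \<in> sa_mats n"
    and \<mu>: "\<mu> \<in> borel_measurable M"
  shows "(\<lambda>x. gap_weight n (\<mu> x) (A x)) \<in> borel_measurable M"
proof -
  have B: "mat_measurable M n n (\<lambda>x. complex_of_real (\<mu> x) \<cdot>\<^sub>m 1\<^sub>m n - A x)"
    using \<mu> by (intro mat_measurable_minus mat_measurable_smult mat_measurable_const A) auto
  note [measurable] = measurable_mat_det[OF B] pred_posdef[OF B scaled_one_minus_sa[OF sa]]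
  show ?thesis unfolding gap_weight_def by measurable
qed

text \<open>The integral over the compression: \<open>K \<mapsto> S K S\<close> with \<open>S\<^sup>2 = 1 + Z Z*\<close> has Jacobian
  \<open>(1 + |Z|\<^sup>2)\<^sup>n\<close>, and multiplies the squared determinant by \<open>(1 + |Z|\<^sup>2)\<^sup>2\<close>.\<close>

lemma nn_integral_border_compression:
  assumes F: "herm_borel n (eig_prod \<phi>)" and z: "Z = col_mat n z"
  shows "(\<integral>\<^sup>+x. gap_weight n \<mu> (sa_of_coords n x) * eig_prod \<phi> (border (sa_of_coords n x)
            ((complex_of_real \<mu> \<cdot>\<^sub>m 1\<^sub>m n - sa_of_coords n x) * Z)
            (\<mu> - quad (complex_of_real \<mu> \<cdot>\<^sub>m 1\<^sub>m n - sa_of_coords n x) Z)) \<partial>herm_lborel n)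
    * ennreal ((1 + col_sq n z) ^ (n + 2))
    = \<phi> \<mu> * (\<integral>\<^sup>+x. gap_weight n \<mu> (sa_of_coords n x) * eig_prod \<phi> (sa_of_coords n x) \<partial>herm_lborel n)"
    (is "?I * _ = _ * ?J")
proof -
  let ?m = "complex_of_real \<mu> \<cdot>\<^sub>m (1\<^sub>m n :: complex Matrix.mat)"
  define w where "w A = (if posdef n A then ennreal ((Re (Determinant.det A))\<^sup>2) else 0)" for A
  have gw: "gap_weight n \<mu> (?m - A) = w A" "gap_weight n \<mu> A = w (?m - A)" if "A \<in> sa_mats n" for A
  proof -
    have "?m - (?m - A) = A" using sa_matsD(1)[OF that] by (intro eq_matI) auto
    then show "gap_weight n \<mu> (?m - A) = w A" "gap_weight n \<mu> A = w (?m - A)"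
      by (simp_all add: gap_weight_def w_def)
  qed
  have Z: "Z \<in> carrier_mat n 1" by (simp add: z)
  define G where "G = 1\<^sub>m n + Z * mat_adjoint Z"
  have ZZ: "Z * mat_adjoint Z \<in> carrier_mat n n" using Z by auto
  have G: "G \<in> sa_mats n"
    unfolding sa_mats_def G_def using Z ZZ
    by (auto simp: mat_adjoint_add[of _ n n] mat_adjoint_mult[of _ n 1 _ n])
  obtain V g where V: "unitary_mat n V" and Gd: "G = conj_by V (real_diag n g)"
    using spectral_theorem[OF G] by blast
  note v = unitary_matD(1,2)[OF V]
  have "posdef n G" unfolding posdef_def
  proof safe
    fix Y :: "complex Matrix.mat" assume Y: "Y \<in> carrier_mat n 1" "Y \<noteq> 0\<^sub>m n 1"
    define W where "W = mat_adjoint Z * Y"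
    have W: "W \<in> carrier_mat 1 1" unfolding W_def using Y Z by auto
    have aY: "mat_adjoint Y \<in> carrier_mat 1 n" using Y by auto
    have "mat_adjoint Y * G * Y = mat_adjoint Y * 1\<^sub>m n * Y + mat_adjoint Y * (Z * mat_adjoint Z) * Y"
      unfolding G_def
      by (subst mult_add_distrib_mat[OF aY _ ZZ], simp)
         (rule add_mult_distrib_mat[of _ 1 n _ _ 1], use mult_carrier_mat[OF aY ZZ] aY Y in auto)
    also have "mat_adjoint Y * (Z * mat_adjoint Z) * Y = mat_adjoint Y * Z * (mat_adjoint Z * Y)"
      unfolding assoc_mult_mat[OF aY Z mat_adjoint_carrier[OF Z], symmetric]
      by (rule assoc_mult_mat[OF mult_carrier_mat[OF aY Z] mat_adjoint_carrier[OF Z] Y(1)])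
    also have "mat_adjoint Y * Z = mat_adjoint W"
      unfolding W_def using Y Z by (simp add: mat_adjoint_mult[of _ 1 n _ 1])
    finally have "quad G Y = quad (1\<^sub>m n) Y + Re ((mat_adjoint W * W) $$ (0, 0))"
      unfolding quad_def using Y W aY W_def[symmetric] by simp
    moreover have "(mat_adjoint W * W) $$ (0, 0) = complex_of_real ((cmod (W $$ (0, 0)))\<^sup>2)"
      using W by (simp add: scalar_prod_def complex_norm_square mult.commute del: of_real_power)
    moreover have "quad (1\<^sub>m n) Y > 0"
      using posdef_real_diag[of n "\<lambda>_. 1"] Y by (simp add: real_diag_one posdef_def)
    ultimately show "quad G Y > 0" by (simp add: add_pos_nonneg)
  qed
  then have g: "g i > 0" if "i < n" for i
    using that by (simp add: Gd posdef_conj_by[OF V] posdef_real_diag)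
  have detG: "(\<Prod>i<n. g i) = 1 + col_sq n z"
  proof -
    have "Determinant.det G = complex_of_real (\<Prod>i<n. g i)"
      by (simp add: Gd det_conj_by[OF V] det_real_diag)
    moreover have "Determinant.det G = 1 + complex_of_real (col_sq n z)"
      unfolding G_def det_one_plus_col[OF Z] unfolding z adjoint_col_mult_col by simp
    ultimately show ?thesis by (metis of_real_1 of_real_add of_real_eq_iff)
  qed
  define S where "S = conj_by V (real_diag n (\<lambda>i. sqrt (g i)))"
  define T where "T = conj_by V (real_diag n (\<lambda>i. 1 / sqrt (g i)))"
  have S: "S \<in> sa_mats n" "S \<in> carrier_mat n n" unfolding S_def using v by (auto intro!: sa_mats_conj_by)
  have T: "T \<in> carrier_mat n n" unfolding T_def using v by auto
  have diag1: "real_diag n (\<lambda>i. a i * b i) = real_diag n c" if "\<And>i. i < n \<Longrightarrow> a i * b i = c i" for a b c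
    using that by (intro eq_matI) auto
  have ST: "S * T = 1\<^sub>m n" "T * S = 1\<^sub>m n" and SS: "S * S = G"
    unfolding S_def T_def Gd
    using g v diag1[of "\<lambda>i. sqrt (g i)" "\<lambda>i. 1 / sqrt (g i)" "\<lambda>_. 1"] diag1[of "\<lambda>i. 1 / sqrt (g i)" "\<lambda>i. sqrt (g i)" "\<lambda>_. 1"]
      diag1[of "\<lambda>i. sqrt (g i)" "\<lambda>i. sqrt (g i)" g]
    by (simp_all add: conj_by_mult[OF V, symmetric] real_diag_mult real_diag_one V less_imp_le less_imp_neq[symmetric])
  have detS: "(Determinant.det S)\<^sup>2 = complex_of_real (1 + col_sq n z)"
  proof -
    have "(Determinant.det S)\<^sup>2 = Determinant.det (S * S)"
      by (simp add: Determinant.det_mult[OF S(2) S(2)] power2_eq_square)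
    then show ?thesis unfolding SS using detG by (simp add: Gd det_conj_by[OF V] det_real_diag)
  qed
  have sim: "similar_mat (?m - S * K * S) (?m - K * G)" if k: "K \<in> carrier_mat n n" for K
  proof -
    have m: "?m \<in> carrier_mat n n" by simp
    have KG: "K * G \<in> carrier_mat n n" using k sa_matsD(1)[OF G] by (rule mult_carrier_mat)
    have "S * (?m - K * G) * T = (S * ?m - S * (K * G)) * T"
      by (simp only: mult_minus_distrib_mat[OF S(2) m KG])
    also have "\<dots> = S * ?m * T - S * (K * G) * T"
      by (rule minus_mult_distrib_mat[OF _ _ T]) (use S(2) m KG in \<open>auto intro: mult_carrier_mat\<close>)
    also have "S * ?m * T = ?m"
      using S(2) T ST by (simp add: mult_smult_distrib[of _ n n _ n] mult_smult_assoc_mat[of _ n n _ n] right_mult_one_mat[of _ n n])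
    also have "S * (K * G) * T = S * K * S"
      unfolding SS[symmetric] using S(2) k T ST(1)
      by (simp add: sq_assoc[of _ n] sq_carrier[of _ n] right_mult_one_mat[of _ n n])
    finally have "?m - S * K * S = S * (?m - K * G) * T" by simp
    moreover have "S * K * S \<in> carrier_mat n n"
      by (rule mult_carrier_mat[OF mult_carrier_mat[OF S(2) k] S(2)])
    ultimately have "similar_mat_wit (?m - S * K * S) (?m - K * G) S T"
      using ST S(2) T KG by (intro similar_mat_witI[of _ _ n] minus_carrier_mat) auto
    then show ?thesis unfolding similar_mat_def by blast
  qed
  have key: "w (S * K * S) * eig_prod \<phi> (?m - S * K * S)
      = ennreal ((1 + col_sq n z)\<^sup>2) * (w K * eig_prod \<phi> (?m - K * G))" if K: "K \<in> sa_mats n" for K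
  proof -
    note k = sa_matsD(1)[OF K]
    have "posdef n (S * K * S) \<longleftrightarrow> posdef n K"
      using posdef_congruence[OF k S(2) T ST] sa_matsD(2)[OF S(1)] by simp
    moreover have "(Re (Determinant.det (S * K * S)))\<^sup>2 = (1 + col_sq n z)\<^sup>2 * (Re (Determinant.det K))\<^sup>2"
    proof -
      have "Determinant.det (S * K * S) = (Determinant.det S)\<^sup>2 * Determinant.det K"
        using S(2) k by (simp add: Determinant.det_mult[of _ n] sq_carrier[of _ n] power2_eq_square mult_ac)
      then show ?thesis unfolding detS by (simp add: power_mult_distrib)
    qed
    ultimately show ?thesis
      by (simp add: w_def similar_eig_prod[OF sim[OF k]] ennreal_mult mult.assoc)
  qed
  have wm: "herm_borel n w"
    using measurable_mat_det[OF mat_measurable_sa_of_coords] pred_posdef[OF mat_measurable_sa_of_coords]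
    unfolding w_def by measurable
  have mm: "mat_measurable (herm_lborel n) n n (\<lambda>x. ?m - sa_of_coords n x)"
    by (intro mat_measurable_minus mat_measurable_const mat_measurable_sa_of_coords) auto
  have Fm: "herm_borel n (\<lambda>A. eig_prod \<phi> (?m - A))"
    by (rule herm_borel_compose[OF F mm]) (auto intro!: scaled_one_minus_sa)
  have wFm: "herm_borel n (\<lambda>A. w A * eig_prod \<phi> (?m - A))"
    using wm Fm by measurable
  have GFm: "herm_borel n (\<lambda>A. eig_prod \<phi> (?m - A * G))"
  proof -
    have "(\<lambda>x. eig_prod \<phi> (?m - S * sa_of_coords n x * S)) \<in> borel_measurable (herm_lborel n)"
    proof (rule herm_borel_compose[OF F])
      show "mat_measurable (herm_lborel n) n n (\<lambda>x. ?m - S * sa_of_coords n x * S)"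
        by (intro mat_measurable_minus mat_measurable_const mat_measurable_mult[where m = n] mat_measurable_sa_of_coords S) auto
      fix x
      have "S * sa_of_coords n x * S = conj_by S (sa_of_coords n x)"
        using sa_matsD(2)[OF S(1)] by (simp add: conj_by_def)
      then have "S * sa_of_coords n x * S \<in> sa_mats n" by (simp add: sa_mats_conj_by S(2))
      then show "?m - S * sa_of_coords n x * S \<in> sa_mats n" by (rule scaled_one_minus_sa)
    qed
    then show ?thesis by (simp add: similar_eig_prod[OF sim])
  qed
  define H where "H K = \<phi> \<mu> * (w K * eig_prod \<phi> (?m - K * G))" for K
  have Hm: "herm_borel n H" unfolding H_def using wm GFm by measurable
  have Hm': "herm_borel n (\<lambda>A. H (?m - A))"
    by (rule herm_borel_compose[OF Hm mm]) (auto intro!: scaled_one_minus_sa)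
  have mmA: "?m - (?m - A) = A" if "A \<in> sa_mats n" for A
    using sa_matsD(1)[OF that] by (intro eq_matI) auto
  have "?I = (\<integral>\<^sup>+x. H (?m - sa_of_coords n x) \<partial>herm_lborel n)"
  proof (rule nn_integral_cong)
    fix x
    let ?K = "?m - sa_of_coords n x"
    have K: "?K \<in> sa_mats n" by (intro scaled_one_minus_sa) simp
    have "eig_prod \<phi> (border (?m - ?K) (?K * Z) (\<mu> - quad ?K Z)) = \<phi> \<mu> * eig_prod \<phi> (?m - ?K * G)"
      unfolding G_def by (rule eig_prod_border[OF K Z])
    then show "gap_weight n \<mu> (sa_of_coords n x) * eig_prod \<phi> (border (sa_of_coords n x)
       (?K * Z) (\<mu> - quad ?K Z)) = H ?K"
      by (simp add: mmA gw(2) H_def mult_ac)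
  qed
  also have "\<dots> = (\<integral>\<^sup>+x. H (?m - (?m - sa_of_coords n x)) \<partial>herm_lborel n)"
    by (rule nn_integral_herm_reflect[OF Hm'])
  also have "\<dots> = (\<integral>\<^sup>+x. \<phi> \<mu> * (w (sa_of_coords n x) * eig_prod \<phi> (?m - sa_of_coords n x * G)) \<partial>herm_lborel n)"
    by (simp add: mmA H_def)
  also have "\<dots> = \<phi> \<mu> * (\<integral>\<^sup>+x. w (sa_of_coords n x) * eig_prod \<phi> (?m - sa_of_coords n x * G) \<partial>herm_lborel n)"
    by (rule nn_integral_cmult[OF borel_measurable_times_ennreal[OF wm GFm]])
  finally have I: "?I = \<dots>" .
  have "?J = (\<integral>\<^sup>+x. w (sa_of_coords n x) * eig_prod \<phi> (?m - sa_of_coords n x) \<partial>herm_lborel n)"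
  proof -
    have "herm_borel n (\<lambda>A. gap_weight n \<mu> A * eig_prod \<phi> A)"
      using measurable_gap_weight[OF mat_measurable_sa_of_coords, of n "\<lambda>_. \<mu>"] F by simp
    from nn_integral_herm_reflect[OF this, of \<mu>] show ?thesis by (simp add: gw(1))
  qed
  also have "\<dots> = ennreal ((1 + col_sq n z) ^ n) *
     (\<integral>\<^sup>+x. w (S * sa_of_coords n x * S) * eig_prod \<phi> (?m - S * sa_of_coords n x * S) \<partial>herm_lborel n)"
    using nn_integral_herm_congruence[OF wFm V g] by (simp add: S_def detG)
  also have "\<dots> = ennreal ((1 + col_sq n z) ^ n) * (ennreal ((1 + col_sq n z)\<^sup>2) *
     (\<integral>\<^sup>+x. w (sa_of_coords n x) * eig_prod \<phi> (?m - sa_of_coords n x * G) \<partial>herm_lborel n))"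
    by (simp only: key[OF sa_of_coords_sa], subst nn_integral_cmult)
       (rule borel_measurable_times_ennreal[OF wm GFm], simp)
  also have "\<dots> = ennreal ((1 + col_sq n z) ^ (n + 2)) *
     (\<integral>\<^sup>+x. w (sa_of_coords n x) * eig_prod \<phi> (?m - sa_of_coords n x * G) \<partial>herm_lborel n)"
  proof -
    have "ennreal ((1 + col_sq n z) ^ (n + 2)) = ennreal ((1 + col_sq n z) ^ n) * ennreal ((1 + col_sq n z)\<^sup>2)"
      unfolding power_add by (rule ennreal_mult) (auto intro!: zero_le_power add_nonneg_nonneg)
    then show ?thesis by (simp only: mult.assoc)
  qed
  finally have J: "?J = \<dots>" .
  show ?thesis unfolding I J by (simp add: mult_ac)
qed

subsection \<open>The deflation formula\<close>

lemma nn_integral_substitution_halfline: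
  fixes f :: "real \<Rightarrow> ennreal" and g g' :: "real \<Rightarrow> real"
  assumes f [measurable]: "f \<in> borel_measurable borel"
    and deriv: "\<And>x. x > c \<Longrightarrow> (g has_real_derivative g' x) (at x)"
    and cont: "continuous_on {c<..} g'"
    and nonneg: "\<And>x. x > c \<Longrightarrow> g' x \<ge> 0"
    and low: "\<And>y. \<exists>x>c. g x \<le> y" and high: "\<And>y. \<exists>x>c. g x \<ge> y"
    and fg [measurable]: "(\<lambda>x. f (g x) * ennreal (g' x)) \<in> borel_measurable borel"
  shows "(\<integral>\<^sup>+x. f x \<partial>lborel) = (\<integral>\<^sup>+x. f (g x) * ennreal (g' x) * indicator {c<..} x \<partial>lborel)"
proof -
  define a where "a k = c + 1 / (real k + 2)" for k
  define b where "b k = c + 1 + real k" for k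
  have ab: "c < a k" "a k < b k" for k
  proof -
    have "1 / (real k + 2) > 0" "1 / (real k + 2) < 1" by (simp_all add: divide_less_eq)
    then show "c < a k" "a k < b k" unfolding a_def b_def by linarith+
  qed
  have mono: "g x \<le> g y" if "c < x" "x \<le> y" for x y
    using that deriv nonneg by (intro deriv_nonneg_imp_mono[of x y g g']) auto
  have amono: "a l \<le> a k" "b k \<le> b l" if "k \<le> l" for k l
    using that by (auto simp: a_def b_def frac_le)
  have a_small: "\<exists>k. a k \<le> x" if "x > c" for x
  proof -
    obtain k :: nat where "1 / (x - c) < real k" using reals_Archimedean2 by blast
    then have "1 / (real k + 2) \<le> x - c" using that by (simp add: field_simps)
    then show ?thesis unfolding a_def by (intro exI[of _ k]) simp
  qed
  have b_large: "\<exists>k. x \<le> b k" for x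
  proof -
    obtain k :: nat where "x - c < real k" using reals_Archimedean2 by blast
    then show ?thesis unfolding b_def by (intro exI[of _ k]) simp
  qed
  define M1 where "M1 = density lborel f"
  define M2 where "M2 = density lborel (\<lambda>x. f (g x) * ennreal (g' x))"
  have eq: "emeasure M1 {g (a k)..g (b k)} = emeasure M2 {a k..b k}" for k
  proof -
    have "emeasure M1 {g (a k)..g (b k)} = (\<integral>\<^sup>+x. f x * indicator {g (a k)..g (b k)} x \<partial>lborel)"
      by (simp add: M1_def emeasure_density)
    also have "\<dots> = (\<integral>\<^sup>+x. f (g x) * ennreal (g' x) * indicator {a k..b k} x \<partial>lborel)"
      using ab[of k] by (intro nn_integral_substitution_aux deriv continuous_on_subset[OF cont] nonneg) auto
    also have "\<dots> = emeasure M2 {a k..b k}" by (simp add: M2_def emeasure_density)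
    finally show ?thesis .
  qed
  have "(\<lambda>k. emeasure M1 {g (a k)..g (b k)}) \<longlonglongrightarrow> emeasure M1 (\<Union>k. {g (a k)..g (b k)})"
    using ab amono by (intro Lim_emeasure_incseq)
      (auto simp: M1_def incseq_def intro: order_trans[OF mono] order_trans[OF _ mono] less_trans[OF ab])
  moreover have "(\<Union>k. {g (a k)..g (b k)}) = UNIV"
  proof safe
    fix y
    obtain x1 x2 where x: "x1 > c" "g x1 \<le> y" "x2 > c" "g x2 \<ge> y" using low high by blast
    obtain k1 k2 where k: "a k1 \<le> x1" "x2 \<le> b k2" using a_small[OF x(1)] b_large by blast
    let ?k = "max k1 k2"
    have "a ?k \<le> x1" "x2 \<le> b ?k" using k amono[of k1 ?k] amono[of k2 ?k] by auto
    then have "g (a ?k) \<le> y" "y \<le> g (b ?k)"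
      using mono[of "a ?k" x1] mono[of x2 "b ?k"] ab x by (auto intro: order_trans)
    then show "y \<in> (\<Union>k. {g (a k)..g (b k)})" by auto
  qed simp
  moreover have "(\<lambda>k. emeasure M2 {a k..b k}) \<longlonglongrightarrow> emeasure M2 (\<Union>k. {a k..b k})"
    using amono by (intro Lim_emeasure_incseq) (auto simp: M2_def incseq_def intro: order_trans)
  moreover have "(\<Union>k. {a k..b k}) = {c<..}"
  proof safe
    fix x assume x: "c < x"
    obtain k1 k2 where k: "a k1 \<le> x" "x \<le> b k2" using a_small[OF x] b_large by blast
    then have "x \<in> {a (max k1 k2)..b (max k1 k2)}" using amono[of k1 "max k1 k2"] amono[of k2 "max k1 k2"] by auto
    then show "x \<in> (\<Union>k. {a k..b k})" by blast
  qed (use ab in \<open>auto intro: less_le_trans\<close>)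
  ultimately have "emeasure M1 UNIV = emeasure M2 {c<..}"
    unfolding eq using LIMSEQ_unique by metis
  then show ?thesis by (simp add: M1_def M2_def emeasure_density)
qed

lemma nn_integral_secular:
  fixes f :: "real \<Rightarrow> ennreal" and d s :: "nat \<Rightarrow> real"
  assumes f [measurable]: "f \<in> borel_measurable borel"
    and s: "\<And>i. i < n \<Longrightarrow> s i \<ge> 0" and c: "\<And>i. i < n \<Longrightarrow> d i \<le> c"
    and i0: "i0 < n" "d i0 = c" "s i0 > 0"
  shows "(\<integral>\<^sup>+x. f x \<partial>lborel) = (\<integral>\<^sup>+x. f (x - (\<Sum>i<n. s i / (x - d i)))
    * ennreal (1 + (\<Sum>i<n. s i / (x - d i)\<^sup>2)) * indicator {c<..} x \<partial>lborel)"
proof (rule nn_integral_substitution_halfline[OF f])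
  have nz: "x - d i \<noteq> 0" if "x > c" "i < n" for x i using c[OF that(2)] that(1) by simp
  show "((\<lambda>x. x - (\<Sum>i<n. s i / (x - d i))) has_real_derivative 1 + (\<Sum>i<n. s i / (x - d i)\<^sup>2)) (at x)" if "x > c" for x
  proof -
    have "((\<lambda>x. x - (\<Sum>i<n. s i / (x - d i))) has_real_derivative 1 - (\<Sum>i<n. - (s i / (x - d i)\<^sup>2))) (at x)"
      by (intro DERIV_diff DERIV_ident DERIV_sum)
         (use nz[OF that] in \<open>auto intro!: derivative_eq_intros simp: power2_eq_square\<close>)
    then show ?thesis by (simp add: sum_negf)
  qed
  show "continuous_on {c<..} (\<lambda>x. 1 + (\<Sum>i<n. s i / (x - d i)\<^sup>2))"
    using nz by (intro continuous_intros) auto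
  show "0 \<le> 1 + (\<Sum>i<n. s i / (x - d i)\<^sup>2)" if "x > c" for x
    using s by (intro add_nonneg_nonneg sum_nonneg) auto
  show "\<exists>x>c. x - (\<Sum>i<n. s i / (x - d i)) \<le> y" for y
  proof -
    define e where "e = min 1 (s i0 / (\<bar>c\<bar> + 1 + \<bar>y\<bar>))"
    have e: "e > 0" "e \<le> 1" unfolding e_def using i0 by auto
    have "s i0 / e \<ge> \<bar>c\<bar> + 1 + \<bar>y\<bar>"
    proof -
      have "e \<le> s i0 / (\<bar>c\<bar> + 1 + \<bar>y\<bar>)" by (simp add: e_def)
      then show ?thesis using e(1) by (simp add: field_simps add_pos_nonneg)
    qed
    moreover have "s i0 / (c + e - d i0) \<le> (\<Sum>i<n. s i / (c + e - d i))"
      using s c e i0(1) by (intro member_le_sum) (auto intro!: divide_nonneg_nonneg simp: add_increasing2)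
    ultimately have "c + e - (\<Sum>i<n. s i / (c + e - d i)) \<le> y" using i0(2) e(2) by simp
    then show ?thesis using e(1) by (intro exI[of _ "c + e"]) simp
  qed
  show "\<exists>x>c. x - (\<Sum>i<n. s i / (x - d i)) \<ge> y" for y
  proof -
    define x where "x = max (c + 1) (y + (\<Sum>i<n. s i))"
    have "(\<Sum>i<n. s i / (x - d i)) \<le> (\<Sum>i<n. s i)"
    proof (rule sum_mono)
      fix i assume "i \<in> {..<n}"
      then have "x - d i \<ge> 1" "s i \<ge> 0" using c[of i] s[of i] by (auto simp: x_def)
      then show "s i / (x - d i) \<le> s i" by (simp add: divide_le_eq mult_le_cancel_left1)
    qed
    then have "x - (\<Sum>i<n. s i / (x - d i)) \<ge> y" unfolding x_def by linarith
    then show ?thesis by (intro exI[of _ x]) (simp add: x_def)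
  qed
  show "(\<lambda>x. f (x - (\<Sum>i<n. s i / (x - d i))) * ennreal (1 + (\<Sum>i<n. s i / (x - d i)\<^sup>2))) \<in> borel_measurable borel"
    by measurable
qed

lemma nn_integral_gaussian:
  assumes t: "t > 0"
  shows "(\<integral>\<^sup>+x. ennreal (exp (- (t * x\<^sup>2))) \<partial>lborel) = ennreal (sqrt (pi / t))"
proof -
  define \<sigma> where "\<sigma> = 1 / sqrt (2 * t)"
  have \<sigma>: "\<sigma> > 0" "2 * \<sigma>\<^sup>2 = 1 / t" unfolding \<sigma>_def using t by (simp_all add: power_divide)
  have "exp (- (t * x\<^sup>2)) = sqrt (pi / t) * normal_density 0 \<sigma> x" for x
  proof -
    have "2 * pi * \<sigma>\<^sup>2 = pi / t" using arg_cong[OF \<sigma>(2), of "\<lambda>x. pi * x"] by (simp add: mult_ac)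
    then have "normal_density 0 \<sigma> x = 1 / sqrt (pi / t) * exp (- (x\<^sup>2 * t))"
      unfolding normal_density_def \<sigma>(2) by simp
    moreover have "sqrt (pi / t) > 0" using t by simp
    ultimately show ?thesis using t by (simp add: mult.commute)
  qed
  then have "(\<integral>\<^sup>+x. ennreal (exp (- (t * x\<^sup>2))) \<partial>lborel)
     = (\<integral>\<^sup>+x. ennreal (sqrt (pi / t)) * ennreal (normal_density 0 \<sigma> x) \<partial>lborel)"
    using t by (simp add: ennreal_mult)
  also have "\<dots> = ennreal (sqrt (pi / t)) * (\<integral>\<^sup>+x. ennreal (normal_density 0 \<sigma> x) \<partial>lborel)"
    by (rule nn_integral_cmult) measurable
  also have "(\<integral>\<^sup>+x. ennreal (normal_density 0 \<sigma> x) \<partial>lborel) = 1"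
    using \<sigma>(1) by (subst nn_integral_eq_integral) auto
  finally show ?thesis by simp
qed

lemma nn_integral_power_exp:
  assumes s: "s > 0"
  shows "(\<integral>\<^sup>+t. ennreal (t ^ n * exp (- (t * s))) * indicator {0..} t \<partial>lborel) = ennreal (fact n / s ^ (n + 1))"
proof -
  have "ennreal (fact n) = (\<integral>\<^sup>+x. ennreal (x ^ n * exp (- x)) * indicator {0..} x \<partial>lborel)"
    using nn_intergal_power_times_exp_Ici[of n] by simp
  also have "\<dots> = ennreal \<bar>s\<bar> * (\<integral>\<^sup>+x. ennreal ((0 + s * x) ^ n * exp (- (0 + s * x))) * indicator {0..} (0 + s * x) \<partial>lborel)"
    using s by (intro nn_integral_real_affine) auto
  also have "(\<integral>\<^sup>+x. ennreal ((0 + s * x) ^ n * exp (- (0 + s * x))) * indicator {0..} (0 + s * x) \<partial>lborel)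
     = (\<integral>\<^sup>+x. ennreal (s ^ n) * (ennreal (x ^ n * exp (- (x * s))) * indicator {0..} x) \<partial>lborel)"
    using s by (intro nn_integral_cong)
      (auto simp: indicator_def zero_le_mult_iff power_mult_distrib mult.assoc mult.commute[of _ s] simp flip: ennreal_mult'')
  also have "\<dots> = ennreal (s ^ n) * (\<integral>\<^sup>+x. ennreal (x ^ n * exp (- (x * s))) * indicator {0..} x \<partial>lborel)"
    by (rule nn_integral_cmult) measurable
  finally have "ennreal (fact n) = ennreal (s ^ (n + 1)) * (\<integral>\<^sup>+x. ennreal (x ^ n * exp (- (x * s))) * indicator {0..} x \<partial>lborel)"
    using s by (simp add: ennreal_mult mult.assoc)
  then have "ennreal (1 / s ^ (n + 1)) * ennreal (fact n)
     = (ennreal (1 / s ^ (n + 1)) * ennreal (s ^ (n + 1))) * (\<integral>\<^sup>+x. ennreal (x ^ n * exp (- (x * s))) * indicator {0..} x \<partial>lborel)"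
    by (simp only: mult.assoc)
  moreover have "ennreal (1 / s ^ (n + 1)) * ennreal (s ^ (n + 1)) = 1"
    using s by (simp flip: ennreal_mult)
  moreover have "ennreal (1 / s ^ (n + 1)) * ennreal (fact n) = ennreal (fact n / s ^ (n + 1))"
    using s by (simp flip: ennreal_mult)
  ultimately show ?thesis by simp
qed

lemma card_col_idx: "card (col_idx n) = 2 * n"
  unfolding col_idx_def by (subst card_Un_disjoint) (auto simp: card_cartesian_product)

text \<open>The volume of complex projective space in an affine chart.\<close>

lemma nn_integral_fubini_study:
  "(\<integral>\<^sup>+z. ennreal (1 / (1 + col_sq n z) ^ (n + 1)) \<partial>lborel_PiM (col_idx n)) = ennreal (pi ^ n / fact n)"
proof -
  let ?M = "lborel_PiM (col_idx n)"
  interpret F: finite_product_sigma_finite "\<lambda>_. lborel :: real measure" "col_idx n" by standard simp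
  interpret P: pair_sigma_finite ?M "lborel :: real measure" ..
  have q: "1 + col_sq n z > 0" for z using col_sq_nonneg[of n z] by linarith
  define f where "f z t = ennreal (t ^ n * exp (- (t * (1 + col_sq n z)))) * indicator {0..} t" for z t
  have fm: "(\<lambda>(z, t). f z t) \<in> borel_measurable (?M \<Otimes>\<^sub>M lborel)" unfolding f_def by measurable
  have inner: "(\<integral>\<^sup>+z. f z t \<partial>?M) = ennreal (pi ^ n) * (ennreal (exp (- t)) * indicator {0..} t)" if t: "t \<noteq> 0" for t
  proof (cases "t > 0")
    case True
    have "(\<integral>\<^sup>+z. f z t \<partial>?M) = (\<integral>\<^sup>+z. ennreal (t ^ n * exp (- t)) * (\<Prod>p\<in>col_idx n. ennreal (exp (- (t * (z p)\<^sup>2)))) \<partial>?M)"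
    proof (rule nn_integral_cong)
      fix z
      have "col_sq n z = (\<Sum>p\<in>col_idx n. (z p)\<^sup>2)" by (simp add: col_sq_def sum_col_idx)
      then have "exp (- (t * (1 + col_sq n z))) = exp (- t) * (\<Prod>p\<in>col_idx n. exp (- (t * (z p)\<^sup>2)))"
        by (simp add: exp_sum[symmetric] exp_add[symmetric] sum_negf sum_distrib_left distrib_left)
      then show "f z t = ennreal (t ^ n * exp (- t)) * (\<Prod>p\<in>col_idx n. ennreal (exp (- (t * (z p)\<^sup>2))))"
        using True by (simp add: f_def prod_ennreal prod_nonneg mult.assoc flip: ennreal_mult)
    qed
    also have "\<dots> = ennreal (t ^ n * exp (- t)) * (\<integral>\<^sup>+z. (\<Prod>p\<in>col_idx n. ennreal (exp (- (t * (z p)\<^sup>2)))) \<partial>?M)"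
      by (rule nn_integral_cmult) measurable
    also have "(\<integral>\<^sup>+z. (\<Prod>p\<in>col_idx n. ennreal (exp (- (t * (z p)\<^sup>2)))) \<partial>?M) = (\<Prod>p\<in>col_idx n. ennreal (sqrt (pi / t)))"
      by (subst lborel_product.product_nn_integral_prod) (auto simp: nn_integral_gaussian[OF True])
    also have "\<dots> = ennreal ((pi / t) ^ n)"
      using True by (simp add: card_col_idx power_mult ennreal_power)
    also have "ennreal (t ^ n * exp (- t)) * ennreal ((pi / t) ^ n) = ennreal (pi ^ n) * ennreal (exp (- t))"
      using True by (simp add: power_divide flip: ennreal_mult)
    finally show ?thesis using True by simp
  qed (use t in \<open>simp add: f_def\<close>)
  have e1: "(\<integral>\<^sup>+t. ennreal (exp (- t)) * indicator {0..} t \<partial>lborel) = 1"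
    using nn_integral_power_exp[of 1 0] by simp
  have "ennreal (fact n) * (\<integral>\<^sup>+z. ennreal (1 / (1 + col_sq n z) ^ (n + 1)) \<partial>?M)
     = (\<integral>\<^sup>+z. ennreal (fact n) * ennreal (1 / (1 + col_sq n z) ^ (n + 1)) \<partial>?M)"
    by (rule nn_integral_cmult[symmetric]) measurable
  also have "\<dots> = (\<integral>\<^sup>+z. \<integral>\<^sup>+t. f z t \<partial>lborel \<partial>?M)"
    using q by (intro nn_integral_cong) (simp add: f_def nn_integral_power_exp less_imp_le flip: ennreal_mult)
  also have "\<dots> = (\<integral>\<^sup>+t. \<integral>\<^sup>+z. f z t \<partial>?M \<partial>lborel)"
    using P.Fubini'[OF fm] by simp
  also have "\<dots> = (\<integral>\<^sup>+t. ennreal (pi ^ n) * (ennreal (exp (- t)) * indicator {0..} t) \<partial>lborel)"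
    using AE_lborel_singleton[of 0] by (intro nn_integral_cong_AE) (auto simp: inner elim!: eventually_mono)
  also have "\<dots> = ennreal (pi ^ n) * (\<integral>\<^sup>+t. ennreal (exp (- t)) * indicator {0..} t \<partial>lborel)"
    by (rule nn_integral_cmult) measurable
  finally have "ennreal (fact n) * (\<integral>\<^sup>+z. ennreal (1 / (1 + col_sq n z) ^ (n + 1)) \<partial>?M) = ennreal (pi ^ n)"
    by (simp add: e1)
  then have "ennreal (1 / fact n) * ennreal (fact n) * (\<integral>\<^sup>+z. ennreal (1 / (1 + col_sq n z) ^ (n + 1)) \<partial>?M)
     = ennreal (1 / fact n) * ennreal (pi ^ n)" by (simp add: mult.assoc)
  moreover have "ennreal (1 / fact n) * ennreal (fact n) = 1" by (simp flip: ennreal_mult)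
  moreover have "ennreal (1 / fact n) * ennreal (pi ^ n) = ennreal (pi ^ n / fact n)"
    by (simp flip: ennreal_mult)
  ultimately show ?thesis by simp
qed

lemma AE_lborel_PiM_nonzero:
  assumes I: "finite I" and i: "i \<in> I"
  shows "AE x in lborel_PiM I. x i \<noteq> 0"
proof -
  define A where "A j = (if j = i then {0} else (UNIV :: real set))" for j
  have "emeasure (lborel_PiM I) (Pi\<^sub>E I A) = (\<Prod>j\<in>I. emeasure lborel (A j))"
    by (rule lborel_product.emeasure_PiM[OF I]) (auto simp: A_def)
  also have "\<dots> = 0" using i I by (auto simp: A_def prod_zero_iff)
  finally have z: "emeasure (lborel_PiM I) (Pi\<^sub>E I A) = 0" .
  have "Pi\<^sub>E I A \<in> sets (lborel_PiM I)" by (intro sets_PiM_I_finite I) (auto simp: A_def)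
  then have "Pi\<^sub>E I A \<in> null_sets (lborel_PiM I)" using z by auto
  then show ?thesis
    by (rule AE_I') (auto simp: A_def PiE_iff extensional_def)
qed

lemma mat_measurable_border:
  assumes C: "mat_measurable M n n C" and Z: "mat_measurable M n 1 Z" and a: "a \<in> borel_measurable M"
  shows "mat_measurable M (Suc n) (Suc n) (\<lambda>x. border (C x) (Z x) (a x))"
  unfolding mat_measurable_def
proof safe
  fix i j assume ij: "i < Suc n" "j < Suc n"
  have "(\<lambda>x. if i < n then if j < n then C x $$ (i, j) else Z x $$ (i, 0)
         else if j < n then cnj (Z x $$ (j, 0)) else complex_of_real (a x)) \<in> borel_measurable M"
    using mat_measurableD(2)[OF C] mat_measurableD(2)[OF Z] a
    by (cases "i < n"; cases "j < n") (auto intro!: borel_measurable_of_real measurable_cnj)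
  then show "(\<lambda>x. border (C x) (Z x) (a x) $$ (i, j)) \<in> borel_measurable M"
  proof (rule measurable_cong[THEN iffD1, rotated])
    fix x assume x: "x \<in> space M"
    have "dim_row (C x) = n" "dim_col (C x) = n" "dim_row (Z x) = n" "dim_col (Z x) = 1"
      using mat_measurableD(1)[OF C x] mat_measurableD(1)[OF Z x] by auto
    then show "(if i < n then if j < n then C x $$ (i, j) else Z x $$ (i, 0)
         else if j < n then cnj (Z x $$ (j, 0)) else complex_of_real (a x)) = border (C x) (Z x) (a x) $$ (i, j)"
      using ij by (auto simp: border_def less_Suc_eq)
  qed
qed (use mat_measurableD(1)[OF C] mat_measurableD(1)[OF Z] border_carrier in blast)

lemma measurable_quad:
  assumes "mat_measurable M n n A" "mat_measurable M n 1 Z"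
  shows "(\<lambda>x. quad (A x) (Z x)) \<in> borel_measurable M"
  unfolding quad_def
  by (intro borel_measurable_Re[THEN measurable_compose[rotated]] mat_measurableD(2)[where n = 1 and m = 1]
      mat_measurable_mult[where m = n] mat_measurable_adjoint assms) auto

lemma nn_integral_herm_border:
  assumes F: "herm_borel (Suc n) F"
  shows "(\<integral>\<^sup>+x. F (sa_of_coords (Suc n) x) \<partial>herm_lborel (Suc n))
    = (\<integral>\<^sup>+x. \<integral>\<^sup>+y. \<integral>\<^sup>+a. F (border (sa_of_coords n x) (col_mat n y) a) \<partial>lborel \<partial>lborel_PiM (col_idx n) \<partial>herm_lborel n)"
proof -
  let ?I = "{..<n} \<times> {..<n}" and ?J = "insert (n, n) (col_idx n)"
  have IJ: "?I \<inter> ?J = {}" and nJ: "(n, n) \<notin> col_idx n" by (auto simp: col_idx_def)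
  have U: "{..<Suc n} \<times> {..<Suc n} = ?I \<union> ?J" by (auto simp: col_idx_def)
  have eq: "sa_of_coords (Suc n) (merge ?I ?J (x, y)) = border (sa_of_coords n x) (col_mat n y) (y (n, n))" for x y
    by (rule eq_matI)
       (auto simp: border_def sa_of_coords_index merge_def col_idx_def less_Suc_eq complex_eq_iff)
  have mm: "mat_measurable (lborel_PiM ?J) (Suc n) (Suc n) (\<lambda>y. border (sa_of_coords n x) (col_mat n y) (y (n, n)))" for x
  proof (intro mat_measurable_border mat_measurable_const)
    have c: "(\<lambda>x. x p) \<in> borel_measurable (lborel_PiM ?J)" if "p \<in> ?J" for p
      using measurable_component_singleton[OF that, of "\<lambda>_. lborel"] by simp
    show "mat_measurable (lborel_PiM ?J) n 1 (col_mat n)"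
      unfolding mat_measurable_def using c by (auto simp: col_idx_def)
    show "(\<lambda>y. y (n, n)) \<in> borel_measurable (lborel_PiM ?J)" by (rule c) simp
  qed simp
  have "(\<integral>\<^sup>+x. F (sa_of_coords (Suc n) x) \<partial>herm_lborel (Suc n))
    = (\<integral>\<^sup>+x. \<integral>\<^sup>+y. F (border (sa_of_coords n x) (col_mat n y) (y (n, n))) \<partial>lborel_PiM ?J \<partial>herm_lborel n)"
    using lborel_product.product_nn_integral_fold[OF IJ, of "\<lambda>x. F (sa_of_coords (Suc n) x)"] F
    unfolding U eq by simp
  also have "\<dots> = (\<integral>\<^sup>+x. \<integral>\<^sup>+y. \<integral>\<^sup>+a. F (border (sa_of_coords n x) (col_mat n y) a) \<partial>lborel \<partial>lborel_PiM (col_idx n) \<partial>herm_lborel n)"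
  proof (rule nn_integral_cong)
    fix x
    have colupd: "col_mat n (y((n, n) := a)) = col_mat n y" for y a by (auto simp: col_mat_def)
    have "(\<lambda>y. F (border (sa_of_coords n x) (col_mat n y) (y (n, n)))) \<in> borel_measurable (lborel_PiM ?J)"
      by (rule herm_borel_compose[OF F mm]) (auto intro!: border_sa)
    from lborel_product.product_nn_integral_insert[OF finite_col_idx nJ this]
    show "(\<integral>\<^sup>+y. F (border (sa_of_coords n x) (col_mat n y) (y (n, n))) \<partial>lborel_PiM ?J)
       = (\<integral>\<^sup>+y. \<integral>\<^sup>+a. F (border (sa_of_coords n x) (col_mat n y) a) \<partial>lborel \<partial>lborel_PiM (col_idx n))"
      by (simp add: colupd)
  qed
  finally show ?thesis .
qed

lemma unitary_border_block:
  assumes "unitary_mat n U"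
  defines "W \<equiv> four_block_mat U (0\<^sub>m n 1) (0\<^sub>m 1 n) (1\<^sub>m 1)"
  shows "unitary_mat (Suc n) W"
    and "C \<in> carrier_mat n n \<Longrightarrow> Z \<in> carrier_mat n 1 \<Longrightarrow>
      conj_by W (border C Z a) = border (conj_by U C) (U * Z) a"
proof -
  note U = unitary_matD[OF assms(1)]
  have adj: "mat_adjoint W = four_block_mat (mat_adjoint U) (0\<^sub>m n 1) (0\<^sub>m 1 n) (1\<^sub>m 1)"
    unfolding W_def by (rule eq_matI) (use U in auto)
  show "unitary_mat (Suc n) W"
  proof (rule unitary_matI)
    show "W \<in> carrier_mat (Suc n) (Suc n)" unfolding W_def using four_block_carrier_mat[OF U(1), of "1\<^sub>m 1" 1 1] by simp
    have "mat_adjoint W * W = four_block_mat (1\<^sub>m n) (0\<^sub>m n 1) (0\<^sub>m 1 n) (1\<^sub>m 1)"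
      unfolding adj unfolding W_def
      apply (subst mult_four_block_mat[of _ n n _ 1 _ 1 _ _ n _ 1])
      using U apply simp_all[5]
      apply (rule cong_four_block_mat)
      using U by (simp_all add: right_mult_zero_mat[of _ n n] left_mult_zero_mat[of _ n n])
    also have "\<dots> = 1\<^sub>m (Suc n)" by (rule eq_matI) auto
    finally show "mat_adjoint W * W = 1\<^sub>m (Suc n)" .
  qed
  assume C: "C \<in> carrier_mat n n" and Z: "Z \<in> carrier_mat n 1"
  have UZ: "U * Z \<in> carrier_mat n 1" by (rule mult_carrier_mat[OF U(1) Z])
  have aZ: "mat_adjoint Z \<in> carrier_mat 1 n" using Z by auto
  let ?a = "Matrix.mat 1 1 (\<lambda>_. complex_of_real a)"
  have 1: "W * border C Z a = four_block_mat (U * C) (U * Z) (mat_adjoint Z) ?a"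
    unfolding W_def border_def
    apply (subst mult_four_block_mat[of _ n n _ 1 _ 1 _ _ n _ 1])
    using U C Z aZ apply simp_all[8]
    apply (rule cong_four_block_mat)
    subgoal using right_add_zero_mat[OF mult_carrier_mat[OF U(1) C]] left_mult_zero_mat[OF aZ, of n] by simp
    subgoal using right_add_zero_mat[OF UZ] by simp
    subgoal using left_mult_zero_mat[OF C, of 1] left_mult_one_mat[OF aZ] left_add_zero_mat[OF aZ] by simp
    subgoal using left_mult_zero_mat[OF Z, of 1] left_mult_one_mat[of ?a 1 1] left_add_zero_mat[of ?a 1 1] by simp
    done
  show "conj_by W (border C Z a) = border (conj_by U C) (U * Z) a"
    unfolding conj_by_def adj 1 unfolding border_def
    apply (subst mult_four_block_mat[of _ n n _ 1 _ 1 _ _ n _ 1])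
    using U C UZ aZ apply (simp_all add: sq_carrier[of _ n])[8]
    apply (rule cong_four_block_mat)
    subgoal using right_add_zero_mat[OF sq_carrier[OF mult_carrier_mat[OF U(1) C] U(2)]]
        right_mult_zero_mat[OF UZ, of n] by simp
    subgoal using right_mult_one_mat[OF UZ] left_add_zero_mat[OF UZ]
        right_mult_zero_mat[OF mult_carrier_mat[OF U(1) C], of 1] by simp
    subgoal using mat_adjoint_mult[OF U(1) Z] right_add_zero_mat[OF mult_carrier_mat[OF aZ U(2)]]
        right_mult_zero_mat[of ?a 1 1 n] by simp
    subgoal using right_mult_zero_mat[OF aZ, of 1] right_mult_one_mat[of ?a 1 1] left_add_zero_mat[of ?a 1 1] by simp
    done
qed

lemma gap_weight_conj_diag:
  assumes U: "unitary_mat n U"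
  shows "gap_weight n \<mu> (conj_by U (real_diag n d))
    = (if \<forall>i<n. d i < \<mu> then ennreal ((\<Prod>i<n. \<mu> - d i)\<^sup>2) else 0)"
proof -
  have "Re (Determinant.det (conj_by U (real_diag n (\<lambda>i. \<mu> - d i)))) = (\<Prod>i<n. \<mu> - d i)"
    by (simp only: det_conj_by[OF U real_diag_carrier] det_real_diag Re_complex_of_real)
  moreover have "posdef n (conj_by U (real_diag n (\<lambda>i. \<mu> - d i))) \<longleftrightarrow> (\<forall>i<n. d i < \<mu>)"
    by (simp add: posdef_conj_by[OF U] posdef_real_diag)
  ultimately show ?thesis
    unfolding gap_weight_def smult_one_minus_conj_diag[OF U] by (simp only:)
qed

lemma gap_weight_real_diag:
  "gap_weight n \<mu> (real_diag n d) = (if \<forall>i<n. d i < \<mu> then ennreal ((\<Prod>i<n. \<mu> - d i)\<^sup>2) else 0)"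
proof -
  have "real_diag n d = conj_by (1\<^sub>m n) (real_diag n d)"
    by (simp add: conj_by_def left_mult_one_mat[of _ n n] right_mult_one_mat[of _ n n])
  then show ?thesis using gap_weight_conj_diag[OF unitary_mat_one] by metis
qed

lemma one_minus_real_diag:
  "complex_of_real \<mu> \<cdot>\<^sub>m 1\<^sub>m n - real_diag n d = real_diag n (\<lambda>i. \<mu> - d i)"
  by (rule eq_matI) auto

lemma pair_sigma_finite_lborel_PiM:
  "finite I \<Longrightarrow> pair_sigma_finite (lborel_PiM I) (lborel :: real measure)"
  unfolding pair_sigma_finite_def
  using finite_product_sigma_finite.axioms(1) lborel_product.sigma_finite lborel.sigma_finite_measure_axioms by blast

lemma mat_measurable_fst: "mat_measurable M n m A \<Longrightarrow> mat_measurable (M \<Otimes>\<^sub>M N) n m (\<lambda>p. A (fst p))"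
  by (rule mat_measurable_compose[OF _ measurable_fst])

lemma mat_measurable_snd: "mat_measurable N n m A \<Longrightarrow> mat_measurable (M \<Otimes>\<^sub>M N) n m (\<lambda>p. A (snd p))"
  by (rule mat_measurable_compose[OF _ measurable_snd])

text \<open>For a diagonal matrix \<open>D\<close> the corner entry is parametrized by the largest eigenvalue \<open>\<mu>\<close> via
  the secular equation, and the bordering column is rescaled by \<open>\<mu> - D\<close>.\<close>

lemma nn_integral_border_diag:
  assumes n: "n \<ge> 1" and F: "herm_borel (Suc n) F"
  shows "(\<integral>\<^sup>+y. \<integral>\<^sup>+a. F (border (real_diag n d) (col_mat n y) a) \<partial>lborel \<partial>lborel_PiM (col_idx n))
    = (\<integral>\<^sup>+\<mu>. \<integral>\<^sup>+z. gap_weight n \<mu> (real_diag n d) * ennreal (1 + col_sq n z) *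
        F (border (real_diag n d) ((complex_of_real \<mu> \<cdot>\<^sub>m 1\<^sub>m n - real_diag n d) * col_mat n z)
            (\<mu> - quad (complex_of_real \<mu> \<cdot>\<^sub>m 1\<^sub>m n - real_diag n d) (col_mat n z)))
        \<partial>lborel_PiM (col_idx n) \<partial>lborel)"
proof -
  let ?M = "lborel_PiM (col_idx n)" and ?D = "real_diag n d"
  interpret P: pair_sigma_finite ?M "lborel :: real measure"
    by (rule pair_sigma_finite_lborel_PiM) simp
  define c where "c = Max (d ` {..<n})"
  have c: "d i \<le> c" if "i < n" for i using that unfolding c_def by auto
  have "c \<in> d ` {..<n}" unfolding c_def using n by (intro Max_in) (auto simp: lessThan_empty_iff)
  then obtain i0 where i0: "i0 < n" "d i0 = c" by auto
  have gt: "(\<forall>i<n. d i < \<mu>) \<longleftrightarrow> c < \<mu>" for \<mu> using c i0 by (auto intro: le_less_trans)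
  define s where "s y i = (y (i, n))\<^sup>2 + (y (n, i))\<^sup>2" for y :: "nat \<times> nat \<Rightarrow> real" and i
  have sm [measurable]: "(\<lambda>y. s y i) \<in> borel_measurable ?M" if "i < n" for i
    unfolding s_def using measurable_col_component[OF that] by measurable
  define H where "H \<mu> y = F (border ?D (col_mat n y) (\<mu> - (\<Sum>i<n. s y i / (\<mu> - d i)))) *
     ennreal (1 + (\<Sum>i<n. s y i / (\<mu> - d i)\<^sup>2))" for \<mu> y
  have am: "(\<lambda>p. snd p - (\<Sum>i<n. s (fst p) i / (snd p - d i))) \<in> borel_measurable (?M \<Otimes>\<^sub>M lborel)"
    by (intro borel_measurable_diff borel_measurable_sum borel_measurable_divide measurable_compose[OF measurable_fst sm]) auto
  have bm: "(\<lambda>p. ennreal (1 + (\<Sum>i<n. s (fst p) i / (snd p - d i)\<^sup>2))) \<in> borel_measurable (?M \<Otimes>\<^sub>M lborel)"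
    by (intro measurable_compose[OF _ measurable_ennreal] borel_measurable_add borel_measurable_sum borel_measurable_divide borel_measurable_power borel_measurable_diff measurable_compose[OF measurable_fst sm]) auto
  have Hm: "(\<lambda>(y, \<mu>). H \<mu> y) \<in> borel_measurable (?M \<Otimes>\<^sub>M lborel)"
    unfolding H_def case_prod_beta'
    by (intro borel_measurable_times_ennreal bm herm_borel_compose[OF F] mat_measurable_border am
         mat_measurable_const mat_measurable_fst mat_measurable_col_mat)
       (auto intro!: border_sa)
  have Hind: "(\<lambda>(y, \<mu>). H \<mu> y * indicator {c<..} \<mu>) \<in> borel_measurable (?M \<Otimes>\<^sub>M lborel)"
    using Hm by measurable
  have "(\<integral>\<^sup>+y. \<integral>\<^sup>+a. F (border ?D (col_mat n y) a) \<partial>lborel \<partial>?M)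
     = (\<integral>\<^sup>+y. \<integral>\<^sup>+\<mu>. H \<mu> y * indicator {c<..} \<mu> \<partial>lborel \<partial>?M)"
  proof (rule nn_integral_cong_AE)
    have "AE y in ?M. y (i0, n) \<noteq> 0" using i0 by (intro AE_lborel_PiM_nonzero) (auto simp: col_idx_def)
    then show "AE y in ?M. (\<integral>\<^sup>+a. F (border ?D (col_mat n y) a) \<partial>lborel) = (\<integral>\<^sup>+\<mu>. H \<mu> y * indicator {c<..} \<mu> \<partial>lborel)"
    proof eventually_elim
      case (elim y)
      have "s y i0 > 0" using elim unfolding s_def by (intro add_pos_nonneg) auto
      moreover have "(\<lambda>a. F (border ?D (col_mat n y) a)) \<in> borel_measurable lborel"
        by (intro herm_borel_compose[OF F] mat_measurable_border mat_measurable_const) (auto intro!: border_sa)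
      ultimately show ?case
        unfolding H_def by (intro nn_integral_secular c) (use i0 in \<open>auto simp: s_def\<close>)
    qed
  qed
  also have "\<dots> = (\<integral>\<^sup>+\<mu>. \<integral>\<^sup>+y. H \<mu> y * indicator {c<..} \<mu> \<partial>?M \<partial>lborel)"
    using P.Fubini'[OF Hind] by simp
  also have "\<dots> = (\<integral>\<^sup>+\<mu>. \<integral>\<^sup>+z. gap_weight n \<mu> ?D * ennreal (1 + col_sq n z) *
        F (border ?D ((complex_of_real \<mu> \<cdot>\<^sub>m 1\<^sub>m n - ?D) * col_mat n z)
            (\<mu> - quad (complex_of_real \<mu> \<cdot>\<^sub>m 1\<^sub>m n - ?D) (col_mat n z))) \<partial>?M \<partial>lborel)"
  proof (rule nn_integral_cong)
    fix \<mu> :: real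
    show "(\<integral>\<^sup>+y. H \<mu> y * indicator {c<..} \<mu> \<partial>?M) = (\<integral>\<^sup>+z. gap_weight n \<mu> ?D * ennreal (1 + col_sq n z) *
        F (border ?D ((complex_of_real \<mu> \<cdot>\<^sub>m 1\<^sub>m n - ?D) * col_mat n z)
            (\<mu> - quad (complex_of_real \<mu> \<cdot>\<^sub>m 1\<^sub>m n - ?D) (col_mat n z))) \<partial>?M)"
    proof (cases "c < \<mu>")
      case False
      then show ?thesis by (simp add: gap_weight_real_diag gt)
    next
      case True
      define e where "e i = \<mu> - d i" for i
      have e: "e i > 0" if "i < n" for i using True gt that by (auto simp: e_def)
      have Hy: "H \<mu> \<in> borel_measurable ?M"
        using measurable_compose[OF measurable_Pair[OF measurable_ident measurable_const, of \<mu> lborel ?M] Hm] by simp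
      let ?T = "\<lambda>z. (\<lambda>(i, j)\<in>col_idx n. e (min i j) * z (i, j))"
      have key: "H \<mu> (?T z) = ennreal (1 + col_sq n z) *
           F (border ?D (real_diag n e * col_mat n z) (\<mu> - quad (real_diag n e) (col_mat n z)))" for z
      proof -
        have sT: "s (?T z) i = (e i)\<^sup>2 * s z i" if "i < n" for i
          using that by (simp add: s_def col_idx_def power_mult_distrib distrib_left)
        have "(\<Sum>i<n. s (?T z) i / (\<mu> - d i)) = (\<Sum>i<n. e i * s z i)"
        proof (rule sum.cong)
          fix i assume "i \<in> {..<n}"
          then have "i < n" by simp
          from sT[OF this] e[OF this] show "s (?T z) i / (\<mu> - d i) = e i * s z i"
            by (simp add: e_def[symmetric] power2_eq_square)
        qed simp
        also have "\<dots> = quad (real_diag n e) (col_mat n z)"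
          by (simp add: quad_real_diag s_def cmod_def complex_norm_square)
        finally have 1: "(\<Sum>i<n. s (?T z) i / (\<mu> - d i)) = quad (real_diag n e) (col_mat n z)" .
        have 2: "(\<Sum>i<n. s (?T z) i / (\<mu> - d i)\<^sup>2) = col_sq n z"
          unfolding col_sq_def
        proof (rule sum.cong)
          fix i assume "i \<in> {..<n}"
          then have "i < n" by simp
          from sT[OF this] e[OF this] show "s (?T z) i / (\<mu> - d i)\<^sup>2 = (z (i, n))\<^sup>2 + (z (n, i))\<^sup>2"
            by (simp add: e_def[symmetric] s_def)
        qed simp
        show ?thesis unfolding H_def 1 2 col_mat_scale by (rule mult.commute)
      qed
      have "(\<integral>\<^sup>+y. H \<mu> y * indicator {c<..} \<mu> \<partial>?M) = (\<integral>\<^sup>+y. H \<mu> y \<partial>?M)" using True by simp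
      also have "\<dots> = ennreal ((\<Prod>i<n. e i)\<^sup>2) * (\<integral>\<^sup>+z. H \<mu> (?T z) \<partial>?M)"
        by (rule nn_integral_col_scale[OF Hy e])
      also have "\<dots> = (\<integral>\<^sup>+z. ennreal ((\<Prod>i<n. e i)\<^sup>2) * H \<mu> (?T z) \<partial>?M)"
      proof (rule nn_integral_cmult[symmetric])
        have "?T \<in> measurable ?M ?M"
          by (rule measurable_restrict) (auto simp: case_prod_beta')
        from measurable_compose[OF this Hy] show "(\<lambda>z. H \<mu> (?T z)) \<in> borel_measurable ?M" .
      qed
      also have "\<dots> = (\<integral>\<^sup>+z. gap_weight n \<mu> ?D * ennreal (1 + col_sq n z) *
        F (border ?D ((complex_of_real \<mu> \<cdot>\<^sub>m 1\<^sub>m n - ?D) * col_mat n z)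
            (\<mu> - quad (complex_of_real \<mu> \<cdot>\<^sub>m 1\<^sub>m n - ?D) (col_mat n z))) \<partial>?M)"
      proof -
        have "gap_weight n \<mu> ?D = ennreal ((\<Prod>i<n. e i)\<^sup>2)"
          using True gt by (simp add: gap_weight_real_diag e_def)
        then show ?thesis unfolding key one_minus_real_diag e_def[symmetric] by (simp only: mult.assoc)
      qed
      finally show ?thesis .
    qed
  qed
  finally show ?thesis .
qed

lemma quad_conj_by:
  assumes U: "unitary_mat n U" and A: "A \<in> carrier_mat n n" and Z: "Z \<in> carrier_mat n 1"
  shows "quad (conj_by U A) (U * Z) = quad A Z"
proof -
  have "quad (mat_adjoint U * conj_by U A * U) Z = quad (conj_by U A) (U * Z)"
    by (rule quad_congruence) (use unitary_matD[OF U] A Z in auto)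
  moreover have "mat_adjoint U * conj_by U A * U = A"
    using conj_by_inverse(1)[OF U A] by (simp add: conj_by_def)
  ultimately show ?thesis by simp
qed

lemma nn_integral_border:
  assumes n: "n \<ge> 1" and F: "herm_borel (Suc n) F"
    and inv: "\<And>W A. unitary_mat (Suc n) W \<Longrightarrow> A \<in> carrier_mat (Suc n) (Suc n) \<Longrightarrow> F (conj_by W A) = F A"
    and C: "C \<in> sa_mats n"
  shows "(\<integral>\<^sup>+y. \<integral>\<^sup>+a. F (border C (col_mat n y) a) \<partial>lborel \<partial>lborel_PiM (col_idx n))
    = (\<integral>\<^sup>+\<mu>. \<integral>\<^sup>+z. gap_weight n \<mu> C * ennreal (1 + col_sq n z) *
        F (border C ((complex_of_real \<mu> \<cdot>\<^sub>m 1\<^sub>m n - C) * col_mat n z)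
            (\<mu> - quad (complex_of_real \<mu> \<cdot>\<^sub>m 1\<^sub>m n - C) (col_mat n z)))
        \<partial>lborel_PiM (col_idx n) \<partial>lborel)"
proof -
  let ?M = "lborel_PiM (col_idx n)"
  obtain U d where U: "unitary_mat n U" and Cd: "C = conj_by U (real_diag n d)"
    using spectral_theorem[OF C] by blast
  note u = unitary_matD[OF U]
  let ?D = "real_diag n d"
  have Finv: "F (border (conj_by U A) (U * Z) a) = F (border A Z a)"
    if "A \<in> carrier_mat n n" "Z \<in> carrier_mat n 1" for A Z a
    using inv[OF unitary_border_block(1)[OF U] border_carrier[OF that]] unitary_border_block(2)[OF U that] by simp
  have bm: "col_borel n (\<lambda>Z. \<integral>\<^sup>+a. F (border C Z a) \<partial>lborel)"
  proof -
    have "(\<lambda>p. F (border C (col_mat n (fst p)) (snd p))) \<in> borel_measurable (?M \<Otimes>\<^sub>M lborel)"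
      by (intro herm_borel_compose[OF F] mat_measurable_border mat_measurable_const mat_measurable_fst mat_measurable_col_mat)
         (use C sa_matsD(1)[OF C] in \<open>auto intro!: border_sa\<close>)
    then show ?thesis
      using lborel.borel_measurable_nn_integral[of "\<lambda>y a. F (border C (col_mat n y) a)" ?M] by (simp add: case_prod_beta')
  qed
  have "(\<integral>\<^sup>+y. \<integral>\<^sup>+a. F (border C (col_mat n y) a) \<partial>lborel \<partial>?M)
     = (\<integral>\<^sup>+y. \<integral>\<^sup>+a. F (border C (U * col_mat n y) a) \<partial>lborel \<partial>?M)"
    by (rule nn_integral_col_unitary[OF U bm, symmetric])
  also have "\<dots> = (\<integral>\<^sup>+y. \<integral>\<^sup>+a. F (border ?D (col_mat n y) a) \<partial>lborel \<partial>?M)"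
    unfolding Cd by (simp add: Finv)
  also have "\<dots> = (\<integral>\<^sup>+\<mu>. \<integral>\<^sup>+z. gap_weight n \<mu> ?D * ennreal (1 + col_sq n z) *
        F (border ?D ((complex_of_real \<mu> \<cdot>\<^sub>m 1\<^sub>m n - ?D) * col_mat n z)
            (\<mu> - quad (complex_of_real \<mu> \<cdot>\<^sub>m 1\<^sub>m n - ?D) (col_mat n z))) \<partial>?M \<partial>lborel)"
    by (rule nn_integral_border_diag[OF n F])
  also have "\<dots> = (\<integral>\<^sup>+\<mu>. \<integral>\<^sup>+z. gap_weight n \<mu> C * ennreal (1 + col_sq n z) *
        F (border C ((complex_of_real \<mu> \<cdot>\<^sub>m 1\<^sub>m n - C) * col_mat n z)
            (\<mu> - quad (complex_of_real \<mu> \<cdot>\<^sub>m 1\<^sub>m n - C) (col_mat n z))) \<partial>?M \<partial>lborel)"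
  proof (rule nn_integral_cong)
    fix \<mu> :: real
    let ?K = "complex_of_real \<mu> \<cdot>\<^sub>m 1\<^sub>m n - C"
    have K: "?K \<in> sa_mats n" by (rule scaled_one_minus_sa[OF C])
    define E where "E = real_diag n (\<lambda>i. \<mu> - d i)"
    have KE: "?K = conj_by U E" unfolding Cd smult_one_minus_conj_diag[OF U] E_def ..
    define G where "G Z = gap_weight n \<mu> C * ennreal (1 + Re ((mat_adjoint Z * Z) $$ (0, 0))) *
        F (border C (?K * Z) (\<mu> - quad ?K Z))" for Z
    have sq: "Re ((mat_adjoint (col_mat n z) * col_mat n z) $$ (0, 0)) = col_sq n z" for z
      by (simp only: adjoint_col_mult_col Re_complex_of_real)
    have quad1: "Re ((mat_adjoint Z * Z) $$ (0, 0)) = quad (1\<^sub>m n) Z" if "Z \<in> carrier_mat n 1" for Z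
      using that by (simp add: quad_def right_mult_one_mat[of _ 1 n])
    have Gm: "col_borel n G"
      unfolding G_def sq
      using measurable_col_sq
      by (intro borel_measurable_times_ennreal herm_borel_compose[OF F] mat_measurable_border mat_measurable_const
          mat_measurable_mult[where m = n] mat_measurable_col_mat borel_measurable_diff borel_measurable_const measurable_quad)
         (use C K sa_matsD(1)[OF K] sa_matsD(1)[OF C] in \<open>auto intro!: border_sa mult_carrier_mat[of _ n n] mat_measurable_col_mat[simplified]\<close>)
    have "(\<integral>\<^sup>+z. gap_weight n \<mu> C * ennreal (1 + col_sq n z) *
        F (border C (?K * col_mat n z) (\<mu> - quad ?K (col_mat n z))) \<partial>?M) = (\<integral>\<^sup>+z. G (col_mat n z) \<partial>?M)"
      unfolding G_def sq ..
    also have "\<dots> = (\<integral>\<^sup>+z. G (U * col_mat n z) \<partial>?M)"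
      by (rule nn_integral_col_unitary[OF U Gm, symmetric])
    also have "\<dots> = (\<integral>\<^sup>+z. gap_weight n \<mu> ?D * ennreal (1 + col_sq n z) *
        F (border ?D ((complex_of_real \<mu> \<cdot>\<^sub>m 1\<^sub>m n - ?D) * col_mat n z)
            (\<mu> - quad (complex_of_real \<mu> \<cdot>\<^sub>m 1\<^sub>m n - ?D) (col_mat n z))) \<partial>?M)"
    proof (rule nn_integral_cong)
      fix z
      let ?Z = "col_mat n z"
      have Z: "?Z \<in> carrier_mat n 1" and UZ: "U * ?Z \<in> carrier_mat n 1" and E: "E \<in> carrier_mat n n"
        using mult_carrier_mat[OF u(1) col_mat_dims(3)] by (simp_all add: E_def)
      have 1: "Re ((mat_adjoint (U * ?Z) * (U * ?Z)) $$ (0, 0)) = col_sq n z"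
        unfolding quad1[OF UZ] using quad_conj_by[OF U one_carrier_mat Z] quad1[OF Z] sq by (simp add: U)
      have "conj_by U E * (U * ?Z) = U * E * (mat_adjoint U * U) * ?Z"
        unfolding conj_by_def using u(1,2) E Z UZ
        by (simp add: assoc_mult_mat[of _ n n _ n _ 1] sq_carrier[of _ n] mult_carrier_mat[of _ n n _ 1] sq_assoc[of _ n])
      also have "\<dots> = U * (E * ?Z)"
        using u E Z by (simp add: right_mult_one_mat[of _ n n] sq_carrier[of _ n] assoc_mult_mat[of _ n n _ n _ 1])
      finally have 2: "?K * (U * ?Z) = U * (E * ?Z)" by (simp add: KE)
      have 3: "quad ?K (U * ?Z) = quad E ?Z" unfolding KE by (rule quad_conj_by[OF U E Z])
      have 4: "gap_weight n \<mu> C = gap_weight n \<mu> ?D" unfolding Cd gap_weight_conj_diag[OF U] gap_weight_real_diag ..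
      have "F (border C (U * (E * ?Z)) (\<mu> - quad E ?Z)) = F (border ?D (E * ?Z) (\<mu> - quad E ?Z))"
        unfolding Cd by (rule Finv) (auto intro!: mult_carrier_mat[OF E])
      then show "G (U * ?Z) = gap_weight n \<mu> ?D * ennreal (1 + col_sq n z) *
        F (border ?D ((complex_of_real \<mu> \<cdot>\<^sub>m 1\<^sub>m n - ?D) * ?Z)
            (\<mu> - quad (complex_of_real \<mu> \<cdot>\<^sub>m 1\<^sub>m n - ?D) ?Z))"
        unfolding G_def 1 2 3 4 one_minus_real_diag E_def[symmetric] by simp
    qed
    finally show "(\<integral>\<^sup>+z. gap_weight n \<mu> ?D * ennreal (1 + col_sq n z) *
        F (border ?D ((complex_of_real \<mu> \<cdot>\<^sub>m 1\<^sub>m n - ?D) * col_mat n z)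
            (\<mu> - quad (complex_of_real \<mu> \<cdot>\<^sub>m 1\<^sub>m n - ?D) (col_mat n z))) \<partial>?M)
      = (\<integral>\<^sup>+z. gap_weight n \<mu> C * ennreal (1 + col_sq n z) *
        F (border C (?K * col_mat n z) (\<mu> - quad ?K (col_mat n z))) \<partial>?M)" by simp
  qed
  finally show ?thesis .
qed

theorem deflation_formula:
  assumes n: "n \<ge> 1" and \<phi> [measurable]: "\<phi> \<in> borel_measurable borel"
    and Fn: "herm_borel n (eig_prod \<phi>)" and FSn: "herm_borel (Suc n) (eig_prod \<phi>)"
  shows "(\<integral>\<^sup>+x. eig_prod \<phi> (sa_of_coords (Suc n) x) \<partial>herm_lborel (Suc n))
    = ennreal (pi ^ n / fact n) * (\<integral>\<^sup>+\<mu>. \<phi> \<mu> *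
        (\<integral>\<^sup>+x. gap_weight n \<mu> (sa_of_coords n x) * eig_prod \<phi> (sa_of_coords n x) \<partial>herm_lborel n) \<partial>lborel)"
proof -
  let ?M = "herm_lborel n" and ?Z = "lborel_PiM (col_idx n)"
  let ?N = "(lborel :: real measure) \<Otimes>\<^sub>M ?Z"
  interpret Z: finite_product_sigma_finite "\<lambda>_. lborel :: real measure" "col_idx n" by standard simp
  interpret M: finite_product_sigma_finite "\<lambda>_. lborel :: real measure" "{..<n} \<times> {..<n}" by standard simp
  interpret LZ: pair_sigma_finite "lborel :: real measure" ?Z
    by (intro pair_sigma_finite.intro Z.sigma_finite_measure_axioms lborel.sigma_finite_measure_axioms)
  interpret P: pair_sigma_finite ?M ?N
    by (intro pair_sigma_finite.intro M.sigma_finite_measure_axioms LZ.P.sigma_finite_measure_axioms)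
  let ?k = "\<lambda>x \<mu>. complex_of_real \<mu> \<cdot>\<^sub>m 1\<^sub>m n - sa_of_coords n x"
  define f where "f x \<mu> z = gap_weight n \<mu> (sa_of_coords n x) * ennreal (1 + col_sq n z) *
      eig_prod \<phi> (border (sa_of_coords n x) (?k x \<mu> * col_mat n z) (\<mu> - quad (?k x \<mu>) (col_mat n z)))" for x \<mu> z
  have mu: "(\<lambda>p. fst (snd p)) \<in> borel_measurable (?M \<Otimes>\<^sub>M ?N)" by simp
  have Cm: "mat_measurable (?M \<Otimes>\<^sub>M ?N) n n (\<lambda>p. sa_of_coords n (fst p))"
    by (intro mat_measurable_fst mat_measurable_sa_of_coords)
  have Zm: "mat_measurable (?M \<Otimes>\<^sub>M ?N) n 1 (\<lambda>p. col_mat n (snd (snd p)))"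
    by (intro mat_measurable_snd[where A = "\<lambda>p. col_mat n (snd p)"] mat_measurable_snd mat_measurable_col_mat)
  have Km: "mat_measurable (?M \<Otimes>\<^sub>M ?N) n n (\<lambda>p. ?k (fst p) (fst (snd p)))"
    by (intro mat_measurable_minus mat_measurable_smult mat_measurable_const Cm borel_measurable_of_real mu) auto
  have k: "?k x \<mu> \<in> carrier_mat n n" for x \<mu>
    by (rule minus_carrier_mat) simp
  have sq: "(\<lambda>p. ennreal (1 + col_sq n (snd (snd p)))) \<in> borel_measurable (?M \<Otimes>\<^sub>M ?N)"
    by measurable
  have fm: "(\<lambda>p. f (fst p) (fst (snd p)) (snd (snd p))) \<in> borel_measurable (?M \<Otimes>\<^sub>M ?N)"
    unfolding f_def
    by (intro borel_measurable_times_ennreal measurable_gap_weight Cm mu sq herm_borel_compose[OF FSn]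
        mat_measurable_border mat_measurable_mult[where m = n] Km Zm borel_measurable_diff measurable_quad[where n = n])
       (auto intro!: border_sa mult_carrier_mat[OF k])
  have fm': "(\<lambda>p. f x (fst p) (snd p)) \<in> borel_measurable ?N" if "x \<in> space ?M" for x
    using measurable_compose[OF measurable_Pair[OF measurable_const[OF that] measurable_ident, of ?N] fm] by simp
  have fm'': "(\<lambda>x. f x \<mu> z) \<in> borel_measurable ?M" if "z \<in> space ?Z" for \<mu> z
  proof -
    have "(\<mu>, z) \<in> space ?N" using that by (simp add: space_pair_measure)
    from measurable_compose[OF measurable_Pair[OF measurable_ident measurable_const[OF this]] fm]
    show ?thesis by simp
  qed
  have "(\<integral>\<^sup>+x. eig_prod \<phi> (sa_of_coords (Suc n) x) \<partial>herm_lborel (Suc n))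
     = (\<integral>\<^sup>+x. \<integral>\<^sup>+\<mu>. \<integral>\<^sup>+z. f x \<mu> z \<partial>?Z \<partial>lborel \<partial>?M)"
    unfolding nn_integral_herm_border[OF FSn] f_def
    by (intro nn_integral_cong nn_integral_border[OF n FSn]) (auto intro: eig_prod_conj_by)
  also have "\<dots> = (\<integral>\<^sup>+x. \<integral>\<^sup>+p. f x (fst p) (snd p) \<partial>?N \<partial>?M)"
  proof (rule nn_integral_cong)
    fix x assume "x \<in> space ?M"
    from Z.nn_integral_fst[OF fm'[OF this]]
    show "(\<integral>\<^sup>+\<mu>. \<integral>\<^sup>+z. f x \<mu> z \<partial>?Z \<partial>lborel) = (\<integral>\<^sup>+p. f x (fst p) (snd p) \<partial>?N)" by simp
  qed
  also have "\<dots> = (\<integral>\<^sup>+p. \<integral>\<^sup>+x. f x (fst p) (snd p) \<partial>?M \<partial>?N)"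
    using P.Fubini'[of "\<lambda>x p. f x (fst p) (snd p)"] fm by (simp add: case_prod_beta')
  also have "\<dots> = (\<integral>\<^sup>+\<mu>. \<integral>\<^sup>+z. \<integral>\<^sup>+x. f x \<mu> z \<partial>?M \<partial>?Z \<partial>lborel)"
  proof -
    have "(\<lambda>p. \<integral>\<^sup>+x. f x (fst p) (snd p) \<partial>?M) \<in> borel_measurable ?N"
      using fm by (intro M.borel_measurable_nn_integral)
        (auto simp: case_prod_beta' intro!: measurable_compose[OF measurable_pair_swap', of "\<lambda>p. f (fst p) (fst (snd p)) (snd (snd p))", simplified])
    from Z.nn_integral_fst[OF this] show ?thesis by simp
  qed
  also have "\<dots> = (\<integral>\<^sup>+\<mu>. ennreal (pi ^ n / fact n) * (\<phi> \<mu> *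
        (\<integral>\<^sup>+x. gap_weight n \<mu> (sa_of_coords n x) * eig_prod \<phi> (sa_of_coords n x) \<partial>?M)) \<partial>lborel)"
  proof (rule nn_integral_cong)
    fix \<mu> :: real
    let ?J = "\<integral>\<^sup>+x. gap_weight n \<mu> (sa_of_coords n x) * eig_prod \<phi> (sa_of_coords n x) \<partial>?M"
    have "(\<integral>\<^sup>+x. f x \<mu> z \<partial>?M) = \<phi> \<mu> * ?J * ennreal (1 / (1 + col_sq n z) ^ (n + 1))" if z: "z \<in> space ?Z" for z
    proof -
      define q where "q = 1 + col_sq n z"
      have q: "q > 0" using col_sq_nonneg[of n z] unfolding q_def by linarith
      define g where "g x = gap_weight n \<mu> (sa_of_coords n x) *
         eig_prod \<phi> (border (sa_of_coords n x) (?k x \<mu> * col_mat n z) (\<mu> - quad (?k x \<mu>) (col_mat n z)))" for x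
      have fg: "f x \<mu> z = ennreal q * g x" for x unfolding f_def g_def q_def by (simp add: mult_ac)
      have gm: "g \<in> borel_measurable ?M"
      proof -
        have "g = (\<lambda>x. ennreal (1 / q) * f x \<mu> z)"
          unfolding fg using q by (auto simp: fun_eq_iff ennreal_mult[symmetric] mult.assoc[symmetric])
        then show ?thesis using fm''[OF z] by simp
      qed
      have comp: "(\<integral>\<^sup>+x. g x \<partial>?M) * ennreal (q ^ (n + 2)) = \<phi> \<mu> * ?J"
        unfolding g_def q_def by (rule nn_integral_border_compression[OF Fn refl])
      have "(\<integral>\<^sup>+x. f x \<mu> z \<partial>?M) = ennreal q * (\<integral>\<^sup>+x. g x \<partial>?M)"
        unfolding fg by (rule nn_integral_cmult[OF gm])
      also have "ennreal q = ennreal (q ^ (n + 2)) * ennreal (1 / q ^ (n + 1))"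
        using q by (simp flip: ennreal_mult)
      finally show ?thesis unfolding comp[symmetric] q_def by (simp only: mult_ac)
    qed
    then have "(\<integral>\<^sup>+z. \<integral>\<^sup>+x. f x \<mu> z \<partial>?M \<partial>?Z) = (\<integral>\<^sup>+z. \<phi> \<mu> * ?J * ennreal (1 / (1 + col_sq n z) ^ (n + 1)) \<partial>?Z)"
      by (rule nn_integral_cong)
    also have "\<dots> = \<phi> \<mu> * ?J * (\<integral>\<^sup>+z. ennreal (1 / (1 + col_sq n z) ^ (n + 1)) \<partial>?Z)"
      by (rule nn_integral_cmult) measurable
    also have "\<dots> = ennreal (pi ^ n / fact n) * (\<phi> \<mu> * ?J)"
      unfolding nn_integral_fubini_study by (rule mult.commute)
    finally show "(\<integral>\<^sup>+z. \<integral>\<^sup>+x. f x \<mu> z \<partial>?M \<partial>?Z) = ennreal (pi ^ n / fact n) * (\<phi> \<mu> * ?J)" .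
  qed
  also have "\<dots> = ennreal (pi ^ n / fact n) * (\<integral>\<^sup>+\<mu>. \<phi> \<mu> *
        (\<integral>\<^sup>+x. gap_weight n \<mu> (sa_of_coords n x) * eig_prod \<phi> (sa_of_coords n x) \<partial>?M) \<partial>lborel)"
  proof (rule nn_integral_cmult)
    have gm: "(\<lambda>p. gap_weight n (fst p) (sa_of_coords n (snd p)) * eig_prod \<phi> (sa_of_coords n (snd p)))
       \<in> borel_measurable (lborel \<Otimes>\<^sub>M ?M)"
      by (intro borel_measurable_times_ennreal measurable_gap_weight measurable_compose[OF measurable_snd Fn]
           mat_measurable_snd mat_measurable_sa_of_coords) auto
    have "(\<lambda>\<mu>. \<integral>\<^sup>+x. gap_weight n \<mu> (sa_of_coords n x) * eig_prod \<phi> (sa_of_coords n x) \<partial>?M) \<in> borel_measurable lborel"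
      using gm by (intro M.borel_measurable_nn_integral) (simp add: case_prod_beta')
    then show "(\<lambda>\<mu>. \<phi> \<mu> * (\<integral>\<^sup>+x. gap_weight n \<mu> (sa_of_coords n x) * eig_prod \<phi> (sa_of_coords n x) \<partial>?M)) \<in> borel_measurable lborel"
      by measurable
  qed
  finally show ?thesis .
qed

subsection \<open>The Weyl integration formula\<close>

definition weyl_density :: "nat \<Rightarrow> (nat \<Rightarrow> real) \<Rightarrow> ennreal" where
  "weyl_density n x = (\<Prod>j<n. \<Prod>i<j. if x i < x j then ennreal ((x j - x i)\<^sup>2) else 0)"

theorem weyl_integration_formula:
  assumes n: "n \<ge> 1" and \<phi>: "\<phi> \<in> borel_measurable borel" and F: "\<And>m. herm_borel m (eig_prod \<phi>)"
  shows "(\<integral>\<^sup>+x. eig_prod \<phi> (sa_of_coords n x) \<partial>herm_lborel n)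
    = ennreal (\<Prod>k<n. pi ^ k / fact k) *
      (\<integral>\<^sup>+x. (\<Prod>i<n. \<phi> (x i)) * weyl_density n x \<partial>lborel_PiM {..<n})"
  using n \<phi> F
proof (induction n arbitrary: \<phi> rule: nat_induct_at_least)
  case base
  have I: "{..<1::nat} \<times> {..<1::nat} = {(0, 0)}" "{..<1::nat} = {0}" by auto
  have "sa_of_coords 1 x = real_diag 1 (\<lambda>_. x (0, 0))" for x by (rule eq_matI) (auto simp: sa_of_coords_index)
  then have "(\<integral>\<^sup>+x. eig_prod \<phi> (sa_of_coords 1 x) \<partial>herm_lborel 1) = (\<integral>\<^sup>+x. \<phi> (x (0, 0)) \<partial>herm_lborel 1)"
    by (simp add: eig_prod_real_diag)
  also have "\<dots> = (\<integral>\<^sup>+x. \<phi> x \<partial>lborel)"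
    unfolding I(1) using base(1) by (intro lborel_product.product_nn_integral_singleton) simp
  also have "\<dots> = (\<integral>\<^sup>+x. \<phi> (x 0) \<partial>lborel_PiM {0::nat})"
    using base(1) by (intro lborel_product.product_nn_integral_singleton[symmetric]) simp
  finally show ?case by (simp add: weyl_density_def lessThan_Suc)
next
  case (Suc n \<phi>)
  note [measurable] = Suc.prems(1)
  define \<psi> where "\<psi> \<mu> x = \<phi> x * (if x < \<mu> then ennreal ((\<mu> - x)\<^sup>2) else 0)" for \<mu> x
  have \<psi>m: "\<psi> \<mu> \<in> borel_measurable borel" for \<mu> unfolding \<psi>_def by measurable
  have \<psi>: "eig_prod (\<psi> \<mu>) A = gap_weight m \<mu> A * eig_prod \<phi> A" if "A \<in> sa_mats m" for \<mu> A m
  proof -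
    obtain U d where U: "unitary_mat m U" and A: "A = conj_by U (real_diag m d)"
      using spectral_theorem[OF \<open>A \<in> sa_mats m\<close>] by blast
    have "(\<Prod>i<m. if d i < \<mu> then ennreal ((\<mu> - d i)\<^sup>2) else 0) = gap_weight m \<mu> A"
    proof (cases "\<forall>i<m. d i < \<mu>")
      case True
      then have "(\<Prod>i<m. if d i < \<mu> then ennreal ((\<mu> - d i)\<^sup>2) else 0) = (\<Prod>i<m. ennreal ((\<mu> - d i)\<^sup>2))"
        by (intro prod.cong) auto
      also have "\<dots> = ennreal ((\<Prod>i<m. \<mu> - d i)\<^sup>2)" by (simp add: prod_ennreal prod_power_distrib)
      finally show ?thesis using True by (simp add: A gap_weight_conj_diag[OF U])
    next
      case False
      then show ?thesis by (auto simp: A gap_weight_conj_diag[OF U] prod_zero_iff)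
    qed
    then show ?thesis
      by (simp add: A eig_prod_conj_by[OF U] eig_prod_real_diag \<psi>_def prod.distrib mult.commute)
  qed
  have \<psi>F: "herm_borel m (eig_prod (\<psi> \<mu>))" for m \<mu>
    using measurable_gap_weight[OF mat_measurable_sa_of_coords, of m "\<lambda>_. \<mu>"] Suc.prems(2)[of m]
    by (simp add: \<psi>[OF sa_of_coords_sa])
  have wm: "weyl_density m \<in> borel_measurable (lborel_PiM {..<m})" for m
    unfolding weyl_density_def
  proof (intro borel_measurable_prod_ennreal)
    fix j i assume ij: "j \<in> {..<m}" "i \<in> {..<j}"
    have "(\<lambda>x. x k) \<in> borel_measurable (lborel_PiM {..<m})" if "k < m" for k
      using measurable_component_singleton[of k "{..<m}" "\<lambda>_. lborel"] that by simp
    then have [measurable]: "(\<lambda>x. x i) \<in> borel_measurable (lborel_PiM {..<m})" "(\<lambda>x. x j) \<in> borel_measurable (lborel_PiM {..<m})"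
      using ij by auto
    show "(\<lambda>x. if x i < x j then ennreal ((x j - x i)\<^sup>2) else 0) \<in> borel_measurable (lborel_PiM {..<m})"
      by measurable
  qed
  have pm: "(\<lambda>x. \<Prod>i<m. \<phi> (x i)) \<in> borel_measurable (lborel_PiM {..<m})" for m
    by (intro borel_measurable_prod_ennreal measurable_compose[OF measurable_component_singleton]) auto
  let ?C = "ennreal (\<Prod>k<n. pi ^ k / fact k)"
  let ?g = "\<lambda>x. (\<Prod>i<Suc n. \<phi> (x i)) * weyl_density (Suc n) x"
  have upd: "?g (x(n := \<mu>)) = \<phi> \<mu> * ((\<Prod>i<n. \<psi> \<mu> (x i)) * weyl_density n x)" for x \<mu>
  proof -
    have "weyl_density (Suc n) (x(n := \<mu>)) = weyl_density n x * (\<Prod>i<n. if x i < \<mu> then ennreal ((\<mu> - x i)\<^sup>2) else 0)"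
      unfolding weyl_density_def prod.lessThan_Suc
      by (intro arg_cong2[of _ _ _ _ "(*)"] prod.cong refl) auto
    moreover have "(\<Prod>i<Suc n. \<phi> ((x(n := \<mu>)) i)) = (\<Prod>i<n. \<phi> (x i)) * \<phi> \<mu>"
      unfolding prod.lessThan_Suc by (intro arg_cong2[of _ _ _ _ "(*)"] prod.cong) auto
    ultimately show ?thesis by (simp add: \<psi>_def prod.distrib mult_ac)
  qed
  have "(\<integral>\<^sup>+x. eig_prod \<phi> (sa_of_coords (Suc n) x) \<partial>herm_lborel (Suc n))
    = ennreal (pi ^ n / fact n) * (\<integral>\<^sup>+\<mu>. \<phi> \<mu> *
        (\<integral>\<^sup>+x. eig_prod (\<psi> \<mu>) (sa_of_coords n x) \<partial>herm_lborel n) \<partial>lborel)"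
    using deflation_formula[OF Suc.hyps Suc.prems(1) Suc.prems(2) Suc.prems(2)] by (simp add: \<psi>[OF sa_of_coords_sa])
  also have "(\<integral>\<^sup>+\<mu>. \<phi> \<mu> * (\<integral>\<^sup>+x. eig_prod (\<psi> \<mu>) (sa_of_coords n x) \<partial>herm_lborel n) \<partial>lborel)
    = (\<integral>\<^sup>+\<mu>. ?C * (\<integral>\<^sup>+x. ?g (x(n := \<mu>)) \<partial>lborel_PiM {..<n}) \<partial>lborel)"
  proof (rule nn_integral_cong)
    fix \<mu> :: real
    have "(\<lambda>x. \<Prod>i<n. \<psi> \<mu> (x i)) \<in> borel_measurable (lborel_PiM {..<n})"
      by (intro borel_measurable_prod_ennreal measurable_compose[OF measurable_component_singleton]) (use \<psi>m in auto)
    then have "(\<lambda>x. (\<Prod>i<n. \<psi> \<mu> (x i)) * weyl_density n x) \<in> borel_measurable (lborel_PiM {..<n})"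
      using wm by measurable
    then show "\<phi> \<mu> * (\<integral>\<^sup>+x. eig_prod (\<psi> \<mu>) (sa_of_coords n x) \<partial>herm_lborel n)
      = ?C * (\<integral>\<^sup>+x. ?g (x(n := \<mu>)) \<partial>lborel_PiM {..<n})"
      unfolding Suc.IH[OF \<psi>m \<psi>F] upd by (simp add: nn_integral_cmult mult_ac)
  qed
  also have "\<dots> = ?C * (\<integral>\<^sup>+\<mu>. (\<integral>\<^sup>+x. ?g (x(n := \<mu>)) \<partial>lborel_PiM {..<n}) \<partial>lborel)"
  proof (rule nn_integral_cmult)
    have "?g \<in> borel_measurable (lborel_PiM (insert n {..<n}))"
      unfolding lessThan_Suc[symmetric] using wm[of "Suc n"] pm[of "Suc n"] by measurable
    from measurable_compose[OF measurable_compose[OF measurable_pair_swap' measurable_add_dim[of n "{..<n}" "\<lambda>_. lborel"]] this]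
    have "(\<lambda>(\<mu>, x). ?g (x(n := \<mu>))) \<in> borel_measurable (lborel \<Otimes>\<^sub>M lborel_PiM {..<n})"
      by (simp only: case_prod_beta' fst_conv snd_conv)
    then show "(\<lambda>\<mu>. \<integral>\<^sup>+x. ?g (x(n := \<mu>)) \<partial>lborel_PiM {..<n}) \<in> borel_measurable lborel"
      by (intro sigma_finite_measure.borel_measurable_nn_integral lborel_product.sigma_finite) auto
  qed
  also have "(\<integral>\<^sup>+\<mu>. (\<integral>\<^sup>+x. ?g (x(n := \<mu>)) \<partial>lborel_PiM {..<n}) \<partial>lborel) = (\<integral>\<^sup>+x. ?g x \<partial>lborel_PiM {..<Suc n})"
  proof -
    have gm: "?g \<in> borel_measurable (lborel_PiM (insert n {..<n}))"
      unfolding lessThan_Suc[symmetric] using wm[of "Suc n"] pm[of "Suc n"] by measurable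
    have "(\<integral>\<^sup>+x. ?g x \<partial>lborel_PiM (insert n {..<n})) = (\<integral>\<^sup>+\<mu>. (\<integral>\<^sup>+x. ?g (x(n := \<mu>)) \<partial>lborel_PiM {..<n}) \<partial>lborel)"
      by (rule lborel_product.product_nn_integral_insert_rev[OF _ _ gm]) auto
    then show ?thesis by (simp only: lessThan_Suc[symmetric])
  qed
  finally have *: "(\<integral>\<^sup>+x. eig_prod \<phi> (sa_of_coords (Suc n) x) \<partial>herm_lborel (Suc n))
     = ennreal (pi ^ n / fact n) * (?C * (\<integral>\<^sup>+x. ?g x \<partial>lborel_PiM {..<Suc n}))" .
  show ?case
  proof -
    have "ennreal (\<Prod>k<Suc n. pi ^ k / fact k) = ennreal (pi ^ n / fact n) * ?C"
      unfolding prod.lessThan_Suc by (subst mult.commute, rule ennreal_mult) (auto intro!: prod_nonneg)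
    then show ?thesis unfolding * by (simp only: mult.assoc)
  qed
qed

subsection \<open>Asymptotics of the eigenvalue integral\<close>

lemma ln_fact_lower: "ln (fact j) \<ge> real j * ln (real j) - real j"
proof (cases "j = 0")
  case False
  have "real j ^ j / fact j \<le> exp (real j)"
  proof -
    have s: "(\<lambda>k. real j ^ k / fact k) sums exp (real j)"
      using exp_converges[of "real j"] by (simp add: divide_inverse mult.commute)
    have "(\<Sum>k\<in>{j}. real j ^ k / fact k) \<le> suminf (\<lambda>k. real j ^ k / fact k)"
      by (rule sum_le_suminf[OF sums_summable[OF s]]) auto
    then show ?thesis using sums_unique[OF s] by simp
  qed
  then have "real j ^ j \<le> exp (real j) * fact j" by (simp add: divide_le_eq)
  then have "ln (real j ^ j) \<le> ln (exp (real j) * fact j)" using False by (intro ln_mono) auto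
  then show ?thesis using False by (simp add: ln_mult ln_realpow)
qed simp

locale confined_log_gas =
  fixes R L B :: real and p :: "real \<Rightarrow> real"
  assumes R: "R > 0" and L: "L \<ge> 0"
    and lip: "\<And>x y. \<bar>x\<bar> \<le> R \<Longrightarrow> \<bar>y\<bar> \<le> R \<Longrightarrow> \<bar>p x - p y\<bar> \<le> L * \<bar>x - y\<bar>"
    and bnd: "\<And>x. \<bar>x\<bar> \<le> R \<Longrightarrow> \<bar>p x\<bar> \<le> B"
    and p_borel [measurable]: "p \<in> borel_measurable borel"
begin

lemma B: "B \<ge> 0"
  using bnd[of 0] R by auto

definition q :: "real \<Rightarrow> real \<Rightarrow> real" where
  "q a b = \<bar>a - b\<bar> * exp (- (p a + p b) / 2)"

lemma q_sym: "q a b = q b a" by (simp add: q_def abs_minus_commute add.commute)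

lemma q_nonneg [simp]: "q a b \<ge> 0" by (simp add: q_def)

lemma q_le: "\<bar>a\<bar> \<le> R \<Longrightarrow> \<bar>b\<bar> \<le> R \<Longrightarrow> q a b \<le> 2 * R * exp B"
  unfolding q_def using bnd[of a] bnd[of b] R by (intro mult_mono) auto

definition W :: "nat set \<Rightarrow> (nat \<Rightarrow> real) \<Rightarrow> real" where
  "W I x = (\<Prod>i\<in>I. \<Prod>j\<in>I - {i}. q (x i) (x j))"

lemma W_nonneg [simp]: "W I x \<ge> 0"
  by (simp add: W_def prod_nonneg)

lemma W_reindex:
  assumes "bij_betw h I J"
  shows "W J x = W I (x \<circ> h)"
proof -
  have inj: "inj_on h I" and J: "J = h ` I" using assms by (auto simp: bij_betw_def)
  have "W J x = (\<Prod>i\<in>I. \<Prod>j\<in>J - {h i}. q (x (h i)) (x j))"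
    unfolding W_def by (rule prod.reindex_bij_betw[OF assms, symmetric])
  also have "\<dots> = (\<Prod>i\<in>I. \<Prod>j\<in>I - {i}. q (x (h i)) (x (h j)))"
  proof (rule prod.cong)
    fix i assume i: "i \<in> I"
    have "J - {h i} = h ` (I - {i})" using inj i unfolding J by (auto simp: inj_on_def)
    then show "(\<Prod>j\<in>J - {h i}. q (x (h i)) (x j)) = (\<Prod>j\<in>I - {i}. q (x (h i)) (x (h j)))"
      using prod.reindex[OF inj_on_subset[OF inj, of "I - {i}"], of "\<lambda>j. q (x (h i)) (x j)"]
      by (simp add: o_def Diff_subset)
  qed simp
  finally show ?thesis by (simp add: W_def)
qed

lemma W_lessThan: "W {..<n} x = (\<Prod>j<n. \<Prod>i<j. (q (x i) (x j))\<^sup>2)"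
proof (induction n)
  case 0
  then show ?case by (simp add: W_def)
next
  case (Suc n)
  have "(\<Prod>i<n. \<Prod>j\<in>{..<Suc n} - {i}. q (x i) (x j)) = (\<Prod>i<n. (\<Prod>j\<in>{..<n} - {i}. q (x i) (x j)) * q (x i) (x n))"
  proof (rule prod.cong)
    fix i assume "i \<in> {..<n}"
    then have "{..<Suc n} - {i} = insert n ({..<n} - {i})" by auto
    then show "(\<Prod>j\<in>{..<Suc n} - {i}. q (x i) (x j)) = (\<Prod>j\<in>{..<n} - {i}. q (x i) (x j)) * q (x i) (x n)"
      by simp
  qed simp
  moreover have "{..<Suc n} - {n} = {..<n}" by auto
  ultimately have "W {..<Suc n} x = W {..<n} x * (\<Prod>i<n. q (x i) (x n)) * (\<Prod>j<n. q (x n) (x j))"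
    by (simp add: W_def prod.distrib)
  also have "(\<Prod>j<n. q (x n) (x j)) = (\<Prod>i<n. q (x i) (x n))" by (simp add: q_sym)
  finally show ?case by (simp add: Suc power2_eq_square prod.distrib)
qed

lemma W_leave_one_out:
  assumes I: "finite I" "card I \<ge> 2"
  shows "(\<Prod>k\<in>I. W (I - {k}) x) = W I x ^ (card I - 2)"
proof -
  let ?S = "SIGMA i:I. I - {i}"
  let ?f = "\<lambda>(i, j). q (x i) (x j)"
  have sig: "W J x = (\<Prod>(i, j)\<in>(SIGMA i:J. J - {i}). q (x i) (x j))" if "finite J" for J
    unfolding W_def using that by (subst prod.Sigma) auto
  have "(\<Prod>k\<in>I. W (I - {k}) x) = (\<Prod>k\<in>I. \<Prod>s\<in>?S. if k \<noteq> fst s \<and> k \<noteq> snd s then ?f s else 1)"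
  proof (rule prod.cong)
    fix k assume k: "k \<in> I"
    have "W (I - {k}) x = (\<Prod>s\<in>(SIGMA i:I - {k}. I - {k} - {i}). ?f s)" using I by (intro sig) auto
    also have "\<dots> = (\<Prod>s\<in>{s \<in> ?S. k \<noteq> fst s \<and> k \<noteq> snd s}. ?f s)" by (rule prod.cong) auto
    also have "\<dots> = (\<Prod>s\<in>?S. if k \<noteq> fst s \<and> k \<noteq> snd s then ?f s else 1)"
      using I by (intro prod.inter_filter) auto
    finally show "W (I - {k}) x = \<dots>" .
  qed simp
  also have "\<dots> = (\<Prod>s\<in>?S. \<Prod>k\<in>I. if k \<noteq> fst s \<and> k \<noteq> snd s then ?f s else 1)"
    by (rule prod.swap)
  also have "\<dots> = (\<Prod>s\<in>?S. ?f s ^ (card I - 2))"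
  proof (rule prod.cong)
    fix s assume "s \<in> ?S"
    then have s: "fst s \<in> I" "snd s \<in> I" "fst s \<noteq> snd s" by auto
    have "(\<Prod>k\<in>I. if k \<noteq> fst s \<and> k \<noteq> snd s then ?f s else 1) = (\<Prod>k\<in>{k \<in> I. k \<noteq> fst s \<and> k \<noteq> snd s}. ?f s)"
      using I by (intro prod.inter_filter[symmetric]) auto
    also have "{k \<in> I. k \<noteq> fst s \<and> k \<noteq> snd s} = I - {fst s, snd s}" by auto
    finally have "(\<Prod>k\<in>I. if k \<noteq> fst s \<and> k \<noteq> snd s then ?f s else 1) = (\<Prod>k\<in>I - {fst s, snd s}. ?f s)" .
    moreover have "card (I - {fst s, snd s}) = card I - 2"
      using s I by (subst card_Diff_subset) auto
    ultimately show "(\<Prod>k\<in>I. if k \<noteq> fst s \<and> k \<noteq> snd s then ?f s else 1) = ?f s ^ (card I - 2)"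
      by (simp only: prod_constant)
  qed simp
  also have "\<dots> = (\<Prod>s\<in>?S. ?f s) ^ (card I - 2)" by (rule prod_power_distrib[symmetric])
  finally show ?thesis using sig[OF I(1)] by simp
qed

definition conf :: "nat \<Rightarrow> (nat \<Rightarrow> real) set" where
  "conf n = {x. \<forall>i<n. \<bar>x i\<bar> \<le> R}"

definition M :: "nat \<Rightarrow> real" where
  "M n = Sup (W {..<n} ` conf n)"

lemma W_le_const: "x \<in> conf n \<Longrightarrow> W {..<n} x \<le> (\<Prod>i<n. \<Prod>j\<in>{..<n} - {i}. 2 * R * exp B)"
  unfolding W_def by (intro prod_mono conjI prod_nonneg q_le) (auto simp: conf_def)

lemma W_le_M: "x \<in> conf n \<Longrightarrow> W {..<n} x \<le> M n"
  unfolding M_def by (intro cSup_upper bdd_aboveI2[of _ _ "\<Prod>i<n. \<Prod>j\<in>{..<n} - {i}. 2 * R * exp B"] W_le_const) auto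

lemma M_le: "(\<And>x. x \<in> conf n \<Longrightarrow> W {..<n} x \<le> c) \<Longrightarrow> M n \<le> c"
  unfolding M_def using R by (intro cSup_least) (auto simp: conf_def intro!: exI[of _ "\<lambda>_. 0"])

lemma ln_M_ge: 
  assumes n: "n \<ge> 1"
  shows "M n > 0" "ln (M n) \<ge> - (4 + \<bar>2 * ln (2 * R)\<bar> + 2 * B) * (real n)\<^sup>2"
proof -
  define x where "x i = - R + 2 * R * real i / real n" for i
  have xc: "x \<in> conf n"
    unfolding conf_def
  proof safe
    fix i assume "i < n"
    then have "2 * R * real i / real n \<le> 2 * R" "0 \<le> 2 * R * real i / real n" using R by (auto simp: field_simps)
    then show "\<bar>x i\<bar> \<le> R" unfolding x_def by linarith
  qed
  have qp: "q (x i) (x j) > 0" "ln ((q (x i) (x j))\<^sup>2) \<ge> 2 * ln (2 * R) + 2 * ln (real (j - i)) - 2 * ln (real n) - 2 * B"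
    if ij: "i < j" "j < n" for i j
  proof -
    have xx: "\<bar>x i - x j\<bar> = 2 * R * real (j - i) / real n"
      using ij R by (simp add: x_def of_nat_diff abs_if field_simps)
    have pos: "2 * R * real (j - i) / real n > 0" using ij R by simp
    show qp: "q (x i) (x j) > 0" unfolding q_def xx by (intro mult_pos_pos pos) simp
    have "ln ((q (x i) (x j))\<^sup>2) = 2 * ln (q (x i) (x j))" using qp by (simp add: ln_realpow)
    also have "ln (q (x i) (x j)) = ln (2 * R * real (j - i) / real n) - (p (x i) + p (x j)) / 2"
      unfolding q_def xx using pos by (subst ln_mult) (auto simp: field_simps)
    also have "ln (2 * R * real (j - i) / real n) = ln (2 * R) + ln (real (j - i)) - ln (real n)"
      using ij R n by (simp add: ln_div ln_mult)
    finally show "ln ((q (x i) (x j))\<^sup>2) \<ge> 2 * ln (2 * R) + 2 * ln (real (j - i)) - 2 * ln (real n) - 2 * B"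
      using bnd[of "x i"] bnd[of "x j"] xc ij by (auto simp: conf_def)
  qed
  have Wp: "W {..<n} x > 0" unfolding W_lessThan by (intro prod_pos ballI zero_less_power qp) auto
  then show Mp: "M n > 0" using W_le_M[OF xc] by linarith
  let ?c = "2 * ln (2 * R) - 2 * B"
  have row: "(\<Sum>i<j. ln ((q (x i) (x j))\<^sup>2)) \<ge> - (4 + \<bar>2 * ln (2 * R)\<bar> + 2 * B) * real n" if j: "j < n" for j
  proof -
    have s1: "(\<Sum>i<j. ln (real (j - i))) = ln (fact j)"
    proof -
      have "(\<Sum>i<j. ln (real (j - i))) = ln (\<Prod>i<j. real (j - i))"
        by (rule ln_prod[symmetric]) auto
      also have "(\<Prod>i<j. real (j - i)) = fact j"
        by (simp add: fact_prod_rev atLeast0LessThan)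
      finally show ?thesis .
    qed
    have s2: "(\<Sum>i<j. ln ((q (x i) (x j))\<^sup>2)) \<ge> (\<Sum>i<j. ?c - 2 * ln (real n) + 2 * ln (real (j - i)))"
      using qp(2) j by (intro sum_mono) (auto simp: algebra_simps)
    have "(\<Sum>i<j. ln ((q (x i) (x j))\<^sup>2)) \<ge> real j * ?c - 2 * real j * ln (real n) + 2 * ln (fact j)"
    proof -
      have "(\<Sum>i<j. A + 2 * f i) = real j * A + 2 * (\<Sum>i<j. f i)" for A and f :: "nat \<Rightarrow> real"
        by (simp add: sum.distrib sum_distrib_left)
      from this[of "?c - 2 * ln (real n)" "\<lambda>i. ln (real (j - i))"] show ?thesis
        using s1 s2 by (simp add: right_diff_distrib)
    qed
    moreover have "real j * ln (real j) - real j \<le> ln (fact j)" by (rule ln_fact_lower)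
    moreover have "real j * ln (real j) - real j * ln (real n) \<ge> - real n"
    proof (cases "j = 0")
      case False
      have "ln (real n / real j) \<le> real n / real j"
        using ln_le_minus_one[of "real n / real j"] False j by (simp add: divide_pos_pos)
      then have "real j * ln (real n / real j) \<le> real n" using False by (simp add: field_simps)
      then show ?thesis using False j by (simp add: ln_div algebra_simps)
    qed simp
    moreover have "real j * ?c \<ge> - (\<bar>2 * ln (2 * R)\<bar> + 2 * B) * real n"
    proof -
      have "\<bar>real j * ?c\<bar> \<le> real n * (\<bar>2 * ln (2 * R)\<bar> + 2 * B)"
        unfolding abs_mult using j B by (intro mult_mono) auto
      then show ?thesis by (simp add: algebra_simps)
    qed
    moreover have "real j \<le> real n" using j by simp
    ultimately show ?thesis by (simp add: algebra_simps)
  qed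
  have "- (4 + \<bar>2 * ln (2 * R)\<bar> + 2 * B) * (real n)\<^sup>2 = (\<Sum>j<n. - (4 + \<bar>2 * ln (2 * R)\<bar> + 2 * B) * real n)"
    by (simp add: power2_eq_square)
  also have "\<dots> \<le> (\<Sum>j<n. \<Sum>i<j. ln ((q (x i) (x j))\<^sup>2))" using row by (intro sum_mono) auto
  also have "\<dots> = ln (W {..<n} x)"
  proof -
    have "(\<Prod>i<j. (q (x i) (x j))\<^sup>2) > 0" if "j < n" for j
      using qp(1) that by (intro prod_pos ballI zero_less_power) auto
    moreover have "(q (x i) (x j))\<^sup>2 > 0" if "j < n" "i < j" for i j using qp(1)[OF that(2,1)] by (rule zero_less_power)
    ultimately have "ln (\<Prod>j<n. \<Prod>i<j. (q (x i) (x j))\<^sup>2) = (\<Sum>j<n. ln (\<Prod>i<j. (q (x i) (x j))\<^sup>2))"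
      and "\<And>j. j < n \<Longrightarrow> ln (\<Prod>i<j. (q (x i) (x j))\<^sup>2) = (\<Sum>i<j. ln ((q (x i) (x j))\<^sup>2))"
      by (auto intro!: ln_prod simp del: zero_less_power2 simp: less_imp_neq[symmetric])
    then show ?thesis unfolding W_lessThan by simp
  qed
  also have "\<dots> \<le> ln (M n)" using Wp W_le_M[OF xc] by (intro ln_mono) auto
  finally show "ln (M n) \<ge> - (4 + \<bar>2 * ln (2 * R)\<bar> + 2 * B) * (real n)\<^sup>2" .
qed

definition l :: "nat \<Rightarrow> real" where "l n = ln (M n) / (real n * (real n - 1))"

lemma l_decreasing:
  assumes n: "n \<ge> 2"
  shows "l (Suc n) \<le> l n"
proof -
  have sub: "W ({..<Suc n} - {k}) x \<le> M n" if x: "x \<in> conf (Suc n)" and k: "k < Suc n" for x k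
  proof -
    have "card ({..<Suc n} - {k}) = card {..<n}" using k by simp
    then obtain h where h: "bij_betw h {..<n} ({..<Suc n} - {k})"
      using finite_same_card_bij[of "{..<n}" "{..<Suc n} - {k}"] by auto
    have "x \<circ> h \<in> conf n" using x bij_betwE[OF h] by (auto simp: conf_def)
    then show ?thesis unfolding W_reindex[OF h] by (rule W_le_M)
  qed
  have Mp: "M n > 0" "M (Suc n) > 0" using ln_M_ge(1)[of n] ln_M_ge(1)[of "Suc n"] n by auto
  have pw: "W {..<Suc n} x ^ (n - 1) \<le> M n ^ Suc n" if x: "x \<in> conf (Suc n)" for x
  proof -
    have "W {..<Suc n} x ^ (n - 1) = (\<Prod>k<Suc n. W ({..<Suc n} - {k}) x)"
      using W_leave_one_out[of "{..<Suc n}" x] n by simp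
    also have "\<dots> \<le> (\<Prod>k<Suc n. M n)" using sub[OF x] by (intro prod_mono) auto
    finally show ?thesis by simp
  qed
  have n1: "n - 1 > 0" using n by simp
  have "M (Suc n) \<le> root (n - 1) (M n ^ Suc n)"
  proof (rule M_le)
    fix x assume "x \<in> conf (Suc n)"
    from pw[OF this] have "root (n - 1) (W {..<Suc n} x ^ (n - 1)) \<le> root (n - 1) (M n ^ Suc n)"
      using n1 by simp
    then show "W {..<Suc n} x \<le> root (n - 1) (M n ^ Suc n)"
      using n1 by (simp add: real_root_power_cancel)
  qed
  then have "ln (M (Suc n)) \<le> ln (root (n - 1) (M n ^ Suc n))" using Mp by (intro ln_mono) auto
  also have "\<dots> = real (Suc n) * ln (M n) / real (n - 1)"
  proof -
    have "ln (root (n - 1) (M n ^ Suc n)) = ln (M n ^ Suc n) / real (n - 1)"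
      by (rule ln_root) (use n1 Mp in auto)
    also have "ln (M n ^ Suc n) = real (Suc n) * ln (M n)" by (rule ln_realpow)
    finally show ?thesis .
  qed
  finally have "ln (M (Suc n)) \<le> real (Suc n) * ln (M n) / (real n - 1)" using n by (simp add: of_nat_diff)
  then have "ln (M (Suc n)) / (real (Suc n) * real n) \<le> (real (Suc n) * ln (M n) / (real n - 1)) / (real (Suc n) * real n)"
    by (rule divide_right_mono) simp
  also have "\<dots> = l n" using n by (simp add: l_def)
  finally show ?thesis by (simp add: l_def mult.commute)
qed

lemma l_convergent: "\<exists>\<kappa>. l \<longlonglongrightarrow> \<kappa>"
proof -
  let ?K = "4 + \<bar>2 * ln (2 * R)\<bar> + 2 * B"
  have "decseq (\<lambda>n. l (n + 2))"
    by (rule decseq_SucI) (simp add: l_decreasing)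
  moreover have "- 2 * ?K \<le> l (n + 2)" for n
  proof -
    let ?n = "n + 2"
    have "- ?K * (real ?n)\<^sup>2 \<le> ln (M ?n)" by (rule ln_M_ge) simp
    then have "- ?K * (real ?n)\<^sup>2 / (real ?n * (real ?n - 1)) \<le> l ?n"
      unfolding l_def by (rule divide_right_mono) simp
    moreover have "- ?K * (real ?n)\<^sup>2 / (real ?n * (real ?n - 1)) = - ?K * (real ?n / (real ?n - 1))"
    proof -
      have "a * N\<^sup>2 / (N * (N - 1)) = a * (N / (N - 1))" if "N \<noteq> 0" for a N :: real
        using that by (simp add: power2_eq_square)
      from this[of "real ?n" "- ?K"] show ?thesis by simp
    qed
    moreover have "?K * (real ?n / (real ?n - 1)) \<le> ?K * 2"
      using B by (intro mult_left_mono) (auto simp: divide_le_eq)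
    ultimately show ?thesis by linarith
  qed
  ultimately have "\<exists>\<kappa>. (\<lambda>n. l (n + 2)) \<longlonglongrightarrow> \<kappa>"
    using decseq_convergent by metis
  then show ?thesis using LIMSEQ_offset[of l 2] by blast
qed

definition Z :: "nat \<Rightarrow> ennreal" where
  "Z n = (\<integral>\<^sup>+x. (\<Prod>i<n. ennreal (exp (- (real n * p (x i)))) * indicator {-R..R} (x i)) * weyl_density n x \<partial>lborel_PiM {..<n})"

lemma W_eq: "W {..<n} x * exp (- (\<Sum>i<n. p (x i))) = (\<Prod>j<n. \<Prod>i<j. (x j - x i)\<^sup>2) * (\<Prod>i<n. exp (- (real n * p (x i))))"
proof -
  have s: "(\<Sum>j<n. \<Sum>i<j. p (x i) + p (x j)) = (real n - 1) * (\<Sum>i<n. p (x i))" for n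
    by (induction n) (simp_all add: sum.distrib algebra_simps)
  have q2: "(q a b)\<^sup>2 = (b - a)\<^sup>2 * exp (- (p a + p b))" for a b
  proof -
    have "(q a b)\<^sup>2 = (a - b)\<^sup>2 * (exp (- (p a + p b) / 2) * exp (- (p a + p b) / 2))"
      by (simp add: q_def power_mult_distrib power2_eq_square)
    also have "exp (- (p a + p b) / 2) * exp (- (p a + p b) / 2) = exp (- (p a + p b))"
      by (simp add: exp_add[symmetric] field_simps)
    finally show ?thesis by (simp add: power2_commute)
  qed
  have "W {..<n} x = (\<Prod>j<n. \<Prod>i<j. (x j - x i)\<^sup>2) * exp (- ((real n - 1) * (\<Sum>i<n. p (x i))))"
    unfolding W_lessThan q2 prod.distrib s[symmetric]
    by (simp only: sum_negf[symmetric] exp_sum finite_lessThan)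
  moreover have "(\<Prod>i<n. exp (- (real n * p (x i)))) = exp (- ((real n - 1) * (\<Sum>i<n. p (x i)))) * exp (- (\<Sum>i<n. p (x i)))"
    by (simp add: exp_sum[symmetric] exp_add[symmetric] sum_negf sum_distrib_left[symmetric] algebra_simps)
  ultimately show ?thesis by simp
qed

lemma weyl_density_le: "weyl_density n x \<le> ennreal (\<Prod>j<n. \<Prod>i<j. (x j - x i)\<^sup>2)"
  unfolding weyl_density_def
  by (subst prod_ennreal[symmetric], simp add: prod_nonneg, intro prod_mono_ennreal)
     (subst prod_ennreal[symmetric], simp, auto intro!: prod_mono_ennreal)

lemma weyl_density_increasing:
  "(\<And>i j. i < j \<Longrightarrow> j < n \<Longrightarrow> x i < x j) \<Longrightarrow> weyl_density n x = ennreal (\<Prod>j<n. \<Prod>i<j. (x j - x i)\<^sup>2)"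
  unfolding weyl_density_def
  by (subst prod_ennreal[symmetric], simp add: prod_nonneg, intro prod.cong)
     (auto simp: prod_ennreal[symmetric] intro!: prod.cong)

lemma Z_upper: "Z n \<le> ennreal ((2 * R) ^ n * exp (real n * B) * M n)"
proof -
  let ?A = "{..<n} \<rightarrow>\<^sub>E {-R..R}"
  have A: "?A \<in> sets (lborel_PiM {..<n})" by (intro sets_PiM_I_finite) auto
  have Mn: "M n \<ge> 0" using R by (intro order_trans[OF W_nonneg W_le_M[of "\<lambda>_. 0"]]) (auto simp: conf_def)
  have "Z n \<le> (\<integral>\<^sup>+x. ennreal (exp (real n * B) * M n) * indicator ?A x \<partial>lborel_PiM {..<n})"
    unfolding Z_def
  proof (rule nn_integral_mono)
    fix x assume x: "x \<in> space (lborel_PiM {..<n})"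
    show "(\<Prod>i<n. ennreal (exp (- (real n * p (x i)))) * indicator {-R..R} (x i)) * weyl_density n x
      \<le> ennreal (exp (real n * B) * M n) * indicator ?A x"
    proof (cases "x \<in> ?A")
      case False
      have "\<exists>i<n. x i \<notin> {-R..R}"
      proof (rule ccontr)
        assume "\<not> ?thesis"
        then have "x \<in> ?A" using x by (auto simp: PiE_iff simp del: atLeastAtMost_iff)
        then show False using False by contradiction
      qed
      then obtain i where "i < n" "x i \<notin> {-R..R}" by blast
      then have "(\<Prod>i<n. ennreal (exp (- (real n * p (x i)))) * indicator {-R..R} (x i)) = 0"
        by (intro prod_zero bexI[of _ i]) (auto simp del: atLeastAtMost_iff)
      then show ?thesis by (simp only: mult_zero_left zero_le)
    next
      case True
      then have xc: "\<bar>x i\<bar> \<le> R" if "i < n" for i using that by (auto simp: PiE_iff abs_le_iff minus_le_iff)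
      have "(\<Prod>i<n. ennreal (exp (- (real n * p (x i)))) * indicator {-R..R} (x i)) = (\<Prod>i<n. ennreal (exp (- (real n * p (x i)))))"
      proof (rule prod.cong)
        fix i assume "i \<in> {..<n}"
        then have "x i \<in> {-R..R}" by (rule PiE_mem[OF True])
        then show "ennreal (exp (- (real n * p (x i)))) * indicator {-R..R} (x i) = ennreal (exp (- (real n * p (x i))))"
          by (simp only: indicator_simps mult_1_right)
      qed simp
      then have "(\<Prod>i<n. ennreal (exp (- (real n * p (x i)))) * indicator {-R..R} (x i)) * weyl_density n x
         \<le> (\<Prod>i<n. ennreal (exp (- (real n * p (x i))))) * ennreal (\<Prod>j<n. \<Prod>i<j. (x j - x i)\<^sup>2)"
        by (simp only:) (rule mult_left_mono[OF weyl_density_le], rule zero_le)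
      also have "\<dots> = ennreal (W {..<n} x * exp (- (\<Sum>i<n. p (x i))))"
        unfolding W_eq by (simp add: prod_ennreal prod_nonneg mult.commute flip: ennreal_mult)
      also have "W {..<n} x * exp (- (\<Sum>i<n. p (x i))) \<le> M n * exp (real n * B)"
      proof (intro mult_mono W_le_M)
        have "- (\<Sum>i<n. p (x i)) \<le> (\<Sum>i<n. B)" unfolding sum_negf[symmetric]
          using bnd xc by (intro sum_mono) (auto simp: abs_le_iff)
        then show "exp (- (\<Sum>i<n. p (x i))) \<le> exp (real n * B)" by simp
      qed (use xc Mn in \<open>auto simp: conf_def\<close>)
      finally show ?thesis using True by (simp add: mult.commute ennreal_leI)
    qed
  qed
  also have "\<dots> = ennreal (exp (real n * B) * M n) * emeasure (lborel_PiM {..<n}) ?A"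
    using A by (rule nn_integral_cmult_indicator)
  also have "emeasure (lborel_PiM {..<n}) ?A = (\<Prod>i<n. emeasure lborel {-R..R})"
    by (rule lborel_product.emeasure_PiM) auto
  also have "\<dots> = ennreal ((2 * R) ^ n)" using R by (simp add: ennreal_power)
  finally show ?thesis using R Mn by (simp add: mult_ac flip: ennreal_mult)
qed

lemma sorted_reindex:
  fixes x :: "nat \<Rightarrow> real"
  obtains h where "bij_betw h {..<n} {..<n}" "\<And>i j. i \<le> j \<Longrightarrow> j < n \<Longrightarrow> x (h i) \<le> x (h j)"
proof -
  let ?xs = "map x [0..<n]"
  have "mset (sort ?xs) = mset ?xs" by simp
  then obtain h where h: "h permutes {..<length ?xs}" "permute_list h ?xs = sort ?xs"
    by (rule mset_eq_permutation)
  have hn: "h permutes {..<n}" using h(1) by simp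
  have nth: "sort ?xs ! i = x (h i)" if "i < n" for i
  proof -
    have "h i < n" using permutes_in_image[OF hn, of i] that by auto
    then show ?thesis using permute_list_nth[OF h(1), of i] that by (simp flip: h(2))
  qed
  have "x (h i) \<le> x (h j)" if "i \<le> j" "j < n" for i j
    using sorted_nth_mono[OF sorted_sort, of i j ?xs] that nth[of i] nth[of j] by simp
  then show ?thesis using that[of h] permutes_imp_bij[OF hn] by blast
qed

lemma Z_lower:
  assumes n: "n \<ge> 1" and \<delta>: "0 < \<delta>" "\<delta> < 1"
  shows "ennreal ((\<delta> * R / real n) ^ n * (1 - \<delta>) ^ (n * (n - 1)) * exp (- (2 * L * R * \<delta> * (real n)\<^sup>2)) * exp (- (real n * B)) * M n) \<le> Z n"
proof -
  define K where "K = (\<delta> * R / real n) ^ n * (1 - \<delta>) ^ (n * (n - 1)) * exp (- (2 * L * R * \<delta> * (real n)\<^sup>2)) * exp (- (real n * B))"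
  have K: "K > 0" unfolding K_def using \<delta> R n by (intro mult_pos_pos) auto
  have main: "ennreal (K * W {..<n} x0) \<le> Z n" if x0: "x0 \<in> conf n" for x0
  proof -
    obtain h where h: "bij_betw h {..<n} {..<n}" "\<And>i j. i \<le> j \<Longrightarrow> j < n \<Longrightarrow> x0 (h i) \<le> x0 (h j)"
      using sorted_reindex[of n x0] by blast
    define x where "x = x0 \<circ> h"
    have Wx: "W {..<n} x0 = W {..<n} x" unfolding x_def by (rule W_reindex[OF h(1)])
    have xc: "\<bar>x i\<bar> \<le> R" if "i < n" for i
      using x0 bij_betwE[OF h(1)] that by (auto simp: conf_def x_def)
    have xs: "x i \<le> x j" if "i \<le> j" "j < n" for i j using h(2)[OF that] by (simp add: x_def)
    define a where "a i = (1 - \<delta>) * x i + \<delta> * (R * (2 * real i / real n - 1))" for i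
    define b where "b i = a i + \<delta> * R / real n" for i
    let ?A = "\<Pi>\<^sub>E i\<in>{..<n}. {a i..b i}"
    have A: "?A \<in> sets (lborel_PiM {..<n})" by (intro sets_PiM_I_finite) auto
    have n0: "real n > 0" using n by simp
    have inR: "\<bar>y\<bar> \<le> R" "\<bar>y - x i\<bar> \<le> 2 * R * \<delta>" if y: "y \<in> {a i..b i}" and i: "i < n" for y i
    proof -
      define w where "w = (y - (1 - \<delta>) * x i) / \<delta>"
      have yw: "y = (1 - \<delta>) * x i + \<delta> * w" using \<delta> by (simp add: w_def)
      have "\<delta> * (R * (2 * real i / real n - 1)) \<le> \<delta> * w" "\<delta> * w \<le> \<delta> * (R * (2 * real i / real n - 1)) + \<delta> * (R / real n)"
        using y unfolding a_def b_def yw by auto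
      then have "\<delta> * (R * (2 * real i / real n - 1)) \<le> \<delta> * w" "\<delta> * w \<le> \<delta> * (R * (2 * real i / real n - 1) + R / real n)"
        by (simp_all add: distrib_left)
      then have w: "R * (2 * real i / real n - 1) \<le> w" "w \<le> R * (2 * real i / real n - 1) + R / real n"
        using \<delta> by simp_all
      have "R * (2 * real i / real n - 1) \<ge> - R" using R n0 by (simp add: field_simps)
      moreover have "R * (2 * real i / real n - 1) + R / real n = R * ((2 * real i + 1) / real n - 1)"
        using n0 by (simp add: field_simps)
      moreover have "(2 * real i + 1) / real n \<le> 2" using i by (simp add: divide_le_eq)
      then have "R * ((2 * real i + 1) / real n - 1) \<le> R * 1" using R by (intro mult_left_mono) auto
      ultimately have wR: "\<bar>w\<bar> \<le> R" using w by (simp add: abs_le_iff)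
      have "\<bar>y\<bar> \<le> \<bar>(1 - \<delta>) * x i\<bar> + \<bar>\<delta> * w\<bar>" unfolding yw by (rule abs_triangle_ineq)
      also have "\<dots> \<le> (1 - \<delta>) * R + \<delta> * R"
        unfolding abs_mult using \<delta> xc[OF i] wR by (intro add_mono mult_mono) auto
      finally show "\<bar>y\<bar> \<le> R" by (simp add: algebra_simps)
      have "y - x i = \<delta> * (w - x i)" unfolding yw by (simp add: algebra_simps)
      then have "\<bar>y - x i\<bar> = \<delta> * \<bar>w - x i\<bar>" using \<delta> by (simp add: abs_mult)
      also have "\<dots> \<le> \<delta> * (2 * R)" using \<delta> wR xc[OF i] by (intro mult_left_mono) auto
      finally show "\<bar>y - x i\<bar> \<le> 2 * R * \<delta>" by (simp add: mult_ac)
    qed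
    have gap: "y j - y i \<ge> (1 - \<delta>) * (x j - x i)" "y i < y j" if y: "y \<in> ?A" and ij: "i < j" "j < n" for y i j
    proof -
      have "y j \<ge> a j" "y i \<le> b i" using y ij by (auto simp: PiE_iff)
      then have "y j - y i \<ge> a j - b i" by simp
      also have "a j - b i = (1 - \<delta>) * (x j - x i) + \<delta> * R * (2 * (real j - real i) - 1) / real n"
        unfolding a_def b_def using n0 by (simp add: field_simps)
      finally have *: "y j - y i \<ge> (1 - \<delta>) * (x j - x i) + \<delta> * R * (2 * (real j - real i) - 1) / real n" .
      have "real j - real i \<ge> 1" using ij by simp
      then have **: "\<delta> * R * (2 * (real j - real i) - 1) / real n > 0" using \<delta> R n0 by simp
      have "(1 - \<delta>) * (x j - x i) \<ge> 0" using xs[of i j] ij \<delta> by simp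
      then show "y j - y i \<ge> (1 - \<delta>) * (x j - x i)" "y i < y j" using * ** by linarith+
    qed
    define c where "c = (1 - \<delta>) ^ (n * (n - 1)) * exp (- (2 * L * R * \<delta> * (real n)\<^sup>2)) * exp (- (real n * B)) * W {..<n} x"
    have c0: "c \<ge> 0" unfolding c_def using \<delta> by simp
    have "ennreal c * emeasure (lborel_PiM {..<n}) ?A = (\<integral>\<^sup>+y. ennreal c * indicator ?A y \<partial>lborel_PiM {..<n})"
      using A by (rule nn_integral_cmult_indicator[symmetric])
    also have "\<dots> \<le> Z n" unfolding Z_def
    proof (rule nn_integral_mono)
      fix y assume "y \<in> space (lborel_PiM {..<n})"
      show "ennreal c * indicator ?A y \<le> (\<Prod>i<n. ennreal (exp (- (real n * p (y i)))) * indicator {-R..R} (y i)) * weyl_density n y"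
      proof (cases "y \<in> ?A")
        case True
        have yR: "\<bar>y i\<bar> \<le> R" "\<bar>y i - x i\<bar> \<le> 2 * R * \<delta>" if "i < n" for i
          using inR[of "y i" i] True that by (auto simp: PiE_iff)
        have eqp: "(\<Prod>i<n. ennreal (exp (- (real n * p (y i)))) * indicator {-R..R} (y i)) = ennreal (\<Prod>i<n. exp (- (real n * p (y i))))"
        proof -
          have "y i \<in> {-R..R}" if "i < n" for i using yR(1)[OF that] by (auto simp: abs_le_iff)
          then have "(\<Prod>i<n. ennreal (exp (- (real n * p (y i)))) * indicator {-R..R} (y i)) = (\<Prod>i<n. ennreal (exp (- (real n * p (y i)))))"
            by (intro prod.cong) (auto simp del: atLeastAtMost_iff)
          then show ?thesis by (simp add: prod_ennreal)
        qed
        have eqw: "weyl_density n y = ennreal (\<Prod>j<n. \<Prod>i<j. (y j - y i)\<^sup>2)"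
          using gap(2)[OF True] by (rule weyl_density_increasing)
        have v: "(1 - \<delta>) ^ (n * (n - 1)) * (\<Prod>j<n. \<Prod>i<j. (x j - x i)\<^sup>2) \<le> (\<Prod>j<n. \<Prod>i<j. (y j - y i)\<^sup>2)"
        proof -
          have "(\<Prod>j<n. \<Prod>i<j. (1 - \<delta>)\<^sup>2) = (1 - \<delta>) ^ (n * (n - 1))"
          proof -
            have "(\<Prod>j<m. \<Prod>i<j. (1 - \<delta>)\<^sup>2) = (1 - \<delta>) ^ (m * (m - 1))" for m :: nat
            proof (induction m)
              case (Suc m)
              have "Suc m * (Suc m - 1) = m * (m - 1) + 2 * m" by (cases m) (auto simp: algebra_simps)
              then have "(1 - \<delta>) ^ (Suc m * (Suc m - 1)) = (1 - \<delta>) ^ (m * (m - 1)) * (1 - \<delta>) ^ (2 * m)"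
                by (simp only: power_add)
              moreover have "(\<Prod>i<m. (1 - \<delta>)\<^sup>2) = (1 - \<delta>) ^ (2 * m)" by (simp add: power_mult)
              ultimately show ?case unfolding prod.lessThan_Suc Suc by (simp only:)
            qed simp
            then show ?thesis .
          qed
          then have "(1 - \<delta>) ^ (n * (n - 1)) * (\<Prod>j<n. \<Prod>i<j. (x j - x i)\<^sup>2) = (\<Prod>j<n. \<Prod>i<j. ((1 - \<delta>) * (x j - x i))\<^sup>2)"
            by (simp only: power_mult_distrib prod.distrib)
          also have "\<dots> \<le> (\<Prod>j<n. \<Prod>i<j. (y j - y i)\<^sup>2)"
            using gap(1)[OF True] xs \<delta> by (intro prod_mono conjI prod_nonneg power_mono) auto
          finally show ?thesis .
        qed
        have e: "exp (- (2 * L * R * \<delta> * (real n)\<^sup>2)) * (\<Prod>i<n. exp (- (real n * p (x i)))) \<le> (\<Prod>i<n. exp (- (real n * p (y i))))"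
        proof -
          have "p (y i) \<le> p (x i) + L * (2 * R * \<delta>)" if "i < n" for i
            using lip[OF yR(1)[OF that] xc[OF that]] mult_left_mono[OF yR(2)[OF that] L] by linarith
          then have "(\<Sum>i<n. p (y i)) \<le> (\<Sum>i<n. p (x i) + L * (2 * R * \<delta>))" by (intro sum_mono) auto
          then have "real n * (\<Sum>i<n. p (y i)) \<le> real n * ((\<Sum>i<n. p (x i)) + real n * (L * (2 * R * \<delta>)))"
            by (intro mult_left_mono) (auto simp: sum.distrib)
          then have "- (2 * L * R * \<delta> * (real n)\<^sup>2) + - (real n * (\<Sum>i<n. p (x i))) \<le> - (real n * (\<Sum>i<n. p (y i)))"
            by (simp add: algebra_simps power2_eq_square)
          then have "exp (- (2 * L * R * \<delta> * (real n)\<^sup>2) + - (real n * (\<Sum>i<n. p (x i)))) \<le> exp (- (real n * (\<Sum>i<n. p (y i))))"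
            by simp
          moreover have "(\<Prod>i<n. exp (- (real n * p (z i)))) = exp (- (real n * (\<Sum>i<n. p (z i))))" for z
            by (simp add: exp_sum[symmetric] sum_negf sum_distrib_left)
          ultimately show ?thesis by (simp only: exp_add)
        qed
        have eB: "exp (- (real n * B)) * W {..<n} x \<le> W {..<n} x * exp (- (\<Sum>i<n. p (x i)))"
        proof -
          have "(\<Sum>i<n. p (x i)) \<le> (\<Sum>i<n. B)" using bnd xc by (intro sum_mono) (auto simp: abs_le_iff)
          then have "exp (- (real n * B)) \<le> exp (- (\<Sum>i<n. p (x i)))" by simp
          then show ?thesis using mult_right_mono[OF _ W_nonneg] by (metis mult.commute)
        qed
        have "c \<le> (1 - \<delta>) ^ (n * (n - 1)) * exp (- (2 * L * R * \<delta> * (real n)\<^sup>2)) * (W {..<n} x * exp (- (\<Sum>i<n. p (x i))))"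
          unfolding c_def mult.assoc using eB \<delta> by (intro mult_left_mono) auto
        also have "\<dots> = ((1 - \<delta>) ^ (n * (n - 1)) * (\<Prod>j<n. \<Prod>i<j. (x j - x i)\<^sup>2)) *
            (exp (- (2 * L * R * \<delta> * (real n)\<^sup>2)) * (\<Prod>i<n. exp (- (real n * p (x i)))))"
          unfolding W_eq by (simp only: mult_ac)
        also have "\<dots> \<le> (\<Prod>j<n. \<Prod>i<j. (y j - y i)\<^sup>2) * (\<Prod>i<n. exp (- (real n * p (y i))))"
          using v e by (intro mult_mono) (auto intro!: prod_nonneg mult_nonneg_nonneg)
        finally show ?thesis unfolding eqp eqw using True
          by (simp add: prod_nonneg mult.commute ennreal_leI flip: ennreal_mult)
      qed simp
    qed
    also have "emeasure (lborel_PiM {..<n}) ?A = (\<Prod>i<n. emeasure lborel {a i..b i})"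
      by (rule lborel_product.emeasure_PiM) auto
    also have "\<dots> = ennreal ((\<delta> * R / real n) ^ n)"
      using \<delta> R n0 by (simp add: b_def ennreal_power)
    finally show ?thesis
      using c0 \<delta> R n0 unfolding Wx by (simp add: K_def c_def mult_ac flip: ennreal_mult)
  qed
  show ?thesis
  proof (cases "Z n = \<top>")
    case False
    then obtain z where z: "Z n = ennreal z" "z \<ge> 0" by (cases "Z n") auto
    have "M n \<le> z / K"
      using main K z by (intro M_le) (simp add: pos_le_divide_eq mult.commute)
    then have "K * M n \<le> z" using K by (simp add: pos_le_divide_eq mult.commute)
    then show ?thesis unfolding z(1) K_def[symmetric] by (rule ennreal_leI)
  qed simp
qed

lemma Z_finite: "Z n < \<top>"
  using Z_upper[of n] by (auto simp: less_top[symmetric] top_unique)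

lemma Z_pos: 
  assumes "n \<ge> 1"
  shows "Z n > 0"
proof -
  have "0 < ennreal ((1 / 2 * R / real n) ^ n * (1 - 1 / 2) ^ (n * (n - 1)) * exp (- (2 * L * R * (1 / 2) * (real n)\<^sup>2)) * exp (- (real n * B)) * M n)"
    using ln_M_ge(1)[OF assms] R assms by (subst ennreal_less_zero_iff) (intro mult_pos_pos, auto)
  also have "\<dots> \<le> Z n" by (rule Z_lower) (use assms in auto)
  finally show ?thesis .
qed

theorem Z_limit: "\<exists>\<kappa>. (\<lambda>n. ln (enn2real (Z n)) / (real n)\<^sup>2) \<longlonglongrightarrow> \<kappa>"
proof -
  obtain \<kappa> where \<kappa>: "l \<longlonglongrightarrow> \<kappa>" using l_convergent by blast
  define z where "z n = enn2real (Z n)" for n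
  have zZ: "ennreal (z n) = Z n" for n using Z_finite[of n] by (simp add: z_def)
  have zp: "z n > 0" if "n \<ge> 1" for n using Z_pos[OF that] Z_finite[of n] by (simp add: z_def enn2real_positive_iff)
  have lnM: "ln (M n) = real n * (real n - 1) * l n" if "n \<ge> 2" for n using that by (simp add: l_def)
  have up: "ln (z n) / (real n)\<^sup>2 \<le> (ln (2 * R) + B) / real n + (1 - 1 / real n) * l n" if n: "n \<ge> 2" for n
  proof -
    have Mp: "M n > 0" using ln_M_ge(1)[of n] n by simp
    have "z n \<le> (2 * R) ^ n * exp (real n * B) * M n"
      using Z_upper[of n] R Mp unfolding zZ[symmetric] by (subst (asm) ennreal_le_iff) auto
    then have "ln (z n) \<le> ln ((2 * R) ^ n * exp (real n * B) * M n)"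
      using zp[of n] n by (intro ln_mono) auto
    also have "\<dots> = real n * ln (2 * R) + real n * B + ln (M n)"
      using R Mp by (simp add: ln_mult ln_realpow algebra_simps)
    finally have "ln (z n) \<le> real n * (ln (2 * R) + B) + real n * (real n - 1) * l n"
      using lnM[OF n] by (simp add: algebra_simps)
    then have "ln (z n) / (real n)\<^sup>2 \<le> (real n * (ln (2 * R) + B) + real n * (real n - 1) * l n) / (real n)\<^sup>2"
      by (rule divide_right_mono) simp
    also have "\<dots> = (ln (2 * R) + B) / real n + (1 - 1 / real n) * l n"
      using n by (simp add: field_simps power2_eq_square)
    finally show ?thesis .
  qed
  have low: "ln (\<delta> * R / real n) / real n + (1 - 1 / real n) * ln (1 - \<delta>) - 2 * L * R * \<delta> - B / real n + (1 - 1 / real n) * l n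
      \<le> ln (z n) / (real n)\<^sup>2" if n: "n \<ge> 2" and \<delta>: "0 < \<delta>" "\<delta> < 1" for n \<delta>
  proof -
    have Mp: "M n > 0" using ln_M_ge(1)[of n] n by simp
    let ?t = "(\<delta> * R / real n) ^ n * (1 - \<delta>) ^ (n * (n - 1)) * exp (- (2 * L * R * \<delta> * (real n)\<^sup>2)) * exp (- (real n * B)) * M n"
    have tp: "?t > 0" using \<delta> R n Mp by (intro mult_pos_pos) auto
    have "?t \<le> z n" using Z_lower[of n \<delta>] n \<delta> zp[of n] unfolding zZ[symmetric] by (subst (asm) ennreal_le_iff) auto
    then have "ln ?t \<le> ln (z n)" using tp by (intro ln_mono) auto
    moreover have "ln ?t = real n * ln (\<delta> * R / real n) + real (n * (n - 1)) * ln (1 - \<delta>) - 2 * L * R * \<delta> * (real n)\<^sup>2 - real n * B + ln (M n)"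
    proof -
      have e: "ln (a ^ k * b ^ m * exp u * exp v * c) = real k * ln a + real m * ln b + u + v + ln c"
        if "a > 0" "b > 0" "c > 0" for a b c u v :: real and k m
        using that by (simp add: ln_mult ln_realpow)
      have "\<delta> * R / real n > 0" "1 - \<delta> > 0" using \<delta> R n by auto
      then show ?thesis by (subst e) (use Mp in auto)
    qed
    moreover have "real (n * (n - 1)) = real n * (real n - 1)" using n by (simp add: of_nat_diff)
    ultimately have "(real n * ln (\<delta> * R / real n) + real n * (real n - 1) * ln (1 - \<delta>) - 2 * L * R * \<delta> * (real n)\<^sup>2 - real n * B + real n * (real n - 1) * l n) / (real n)\<^sup>2 \<le> ln (z n) / (real n)\<^sup>2"
      using lnM[OF n] by (intro divide_right_mono) auto
    moreover have "(real n * ln (\<delta> * R / real n) + real n * (real n - 1) * ln (1 - \<delta>) - 2 * L * R * \<delta> * (real n)\<^sup>2 - real n * B + real n * (real n - 1) * l n) / (real n)\<^sup>2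
      = ln (\<delta> * R / real n) / real n + (1 - 1 / real n) * ln (1 - \<delta>) - 2 * L * R * \<delta> - B / real n + (1 - 1 / real n) * l n"
    proof -
      have "real n \<noteq> 0" using n by simp
      then show ?thesis by (simp add: field_simps power2_eq_square)
    qed
    ultimately show ?thesis by simp
  qed
  have one: "(\<lambda>n. 1 - 1 / real n) \<longlonglongrightarrow> 1" by real_asymp
  have lim1: "(\<lambda>n. (1 - 1 / real n) * l n) \<longlonglongrightarrow> \<kappa>" using tendsto_mult[OF one \<kappa>] by simp
  have limup: "(\<lambda>n. (ln (2 * R) + B) / real n + (1 - 1 / real n) * l n) \<longlonglongrightarrow> \<kappa>"
  proof -
    have "(\<lambda>n. (ln (2 * R) + B) / real n) \<longlonglongrightarrow> 0" by real_asymp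
    from tendsto_add[OF this lim1] show ?thesis by simp
  qed
  have limlow: "(\<lambda>n. ln (\<delta> * R / real n) / real n + (1 - 1 / real n) * ln (1 - \<delta>) - 2 * L * R * \<delta> - B / real n + (1 - 1 / real n) * l n)
     \<longlonglongrightarrow> ln (1 - \<delta>) - 2 * L * R * \<delta> + \<kappa>" if \<delta>: "0 < \<delta>" "\<delta> < 1" for \<delta>
  proof -
    have dR: "\<delta> * R > 0" using \<delta> R by simp
    have 1: "(\<lambda>n. ln (\<delta> * R / real n) / real n) \<longlonglongrightarrow> 0" using dR by real_asymp
    have 2: "(\<lambda>n. B / real n) \<longlonglongrightarrow> 0" by real_asymp
    have "(\<lambda>n. ln (\<delta> * R / real n) / real n + (1 - 1 / real n) * ln (1 - \<delta>) - 2 * L * R * \<delta> - B / real n + (1 - 1 / real n) * l n)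
      \<longlonglongrightarrow> 0 + 1 * ln (1 - \<delta>) - 2 * L * R * \<delta> - 0 + \<kappa>"
      by (intro tendsto_intros 1 2 one lim1)
    then show ?thesis by simp
  qed
  have "(\<lambda>n. ln (z n) / (real n)\<^sup>2) \<longlonglongrightarrow> \<kappa>"
  proof (rule order_tendstoI)
    fix a assume "\<kappa> < a"
    then have "eventually (\<lambda>n. (ln (2 * R) + B) / real n + (1 - 1 / real n) * l n < a) sequentially"
      using order_tendstoD(2)[OF limup] by simp
    then show "eventually (\<lambda>n. ln (z n) / (real n)\<^sup>2 < a) sequentially"
      using eventually_ge_at_top[of 2] by eventually_elim (use up in \<open>force intro: le_less_trans\<close>)
  next
    fix a assume a: "a < \<kappa>"
    have "((\<lambda>\<delta>. ln (1 - \<delta>) - 2 * L * R * \<delta> + \<kappa>) \<longlongrightarrow> ln (1 - 0) - 2 * L * R * 0 + \<kappa>) (at_right 0)"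
      by (intro tendsto_intros) auto
    then have "eventually (\<lambda>\<delta>. a < ln (1 - \<delta>) - 2 * L * R * \<delta> + \<kappa>) (at_right 0)"
      using a by (intro order_tendstoD(1)) auto
    moreover have "eventually (\<lambda>\<delta>::real. 0 < \<delta> \<and> \<delta> < 1) (at_right 0)"
      using eventually_at_right_real[of 0 1] by simp
    ultimately have "eventually (\<lambda>\<delta>. a < ln (1 - \<delta>) - 2 * L * R * \<delta> + \<kappa> \<and> 0 < \<delta> \<and> \<delta> < 1) (at_right 0)"
      by eventually_elim auto
    then obtain \<delta> where \<delta>: "a < ln (1 - \<delta>) - 2 * L * R * \<delta> + \<kappa>" "0 < \<delta>" "\<delta> < 1"
      using eventually_happens'[OF trivial_limit_at_right_real] by blast
    show "eventually (\<lambda>n. a < ln (z n) / (real n)\<^sup>2) sequentially"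
      using order_tendstoD(1)[OF limlow[OF \<delta>(2,3)] \<delta>(1)] eventually_ge_at_top[of 2]
      by eventually_elim (use low \<delta> in \<open>force intro: less_le_trans\<close>)
  qed
  then show ?thesis unfolding z_def by blast
qed

end

subsection \<open>The operator norm\<close>

lemma vec_l2norm_nonneg [simp]: "vec_l2norm v \<ge> 0"
  by (simp add: vec_l2norm_def)

lemma vec_l2norm_sq: "v \<in> carrier_vec n \<Longrightarrow> (vec_l2norm v)\<^sup>2 = (\<Sum>i<n. (cmod (v $ i))\<^sup>2)"
  by (auto simp: vec_l2norm_def L2_set_def sum_nonneg)

lemma vec_l2norm_add:
  assumes "v \<in> carrier_vec n" "w \<in> carrier_vec n"
  shows "vec_l2norm (v + w) \<le> vec_l2norm v + vec_l2norm w"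
proof -
  have "vec_l2norm (v + w) = L2_set (\<lambda>i. cmod (v $ i + w $ i)) {..<n}"
    using assms by (auto simp: vec_l2norm_def intro!: L2_set_cong)
  also have "\<dots> \<le> L2_set (\<lambda>i. cmod (v $ i) + cmod (w $ i)) {..<n}"
    by (intro L2_set_mono norm_triangle_ineq) auto
  also have "\<dots> \<le> L2_set (\<lambda>i. cmod (v $ i)) {..<n} + L2_set (\<lambda>i. cmod (w $ i)) {..<n}"
    by (rule L2_set_triangle_ineq)
  finally show ?thesis using assms by (simp add: vec_l2norm_def)
qed

lemma vec_l2norm_smult: "vec_l2norm (c \<cdot>\<^sub>v v) = cmod c * vec_l2norm v"
  by (auto simp: vec_l2norm_def L2_set_right_distrib norm_mult intro!: L2_set_cong)

lemma cmod_le_vec_l2norm: "i < dim_vec v \<Longrightarrow> cmod (v $ i) \<le> vec_l2norm v"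
  unfolding vec_l2norm_def by (intro member_le_L2_set) auto

lemma vec_l2norm_eq_0: "vec_l2norm v = 0 \<longleftrightarrow> v = 0\<^sub>v (dim_vec v)"
  by (auto simp: vec_l2norm_def L2_set_eq_0_iff intro!: eq_vecI) (metis index_zero_vec(1))

lemma mult_mat_vec_index:
  "A \<in> carrier_mat n m \<Longrightarrow> v \<in> carrier_vec m \<Longrightarrow> i < n \<Longrightarrow> (A *\<^sub>v v) $ i = (\<Sum>j<m. A $$ (i, j) * v $ j)"
  by (auto simp: scalar_prod_def atLeast0LessThan intro!: sum.cong)

lemma vec_l2norm_mult_mat_vec_le:
  assumes A: "A \<in> carrier_mat n m" and v: "v \<in> carrier_vec m"
  shows "vec_l2norm (A *\<^sub>v v) \<le> (\<Sum>i<n. \<Sum>j<m. cmod (A $$ (i, j))) * vec_l2norm v"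
proof -
  have "vec_l2norm (A *\<^sub>v v) \<le> (\<Sum>i<n. cmod ((A *\<^sub>v v) $ i))"
    using A L2_set_le_sum[of "{..<n}" "\<lambda>i. cmod ((A *\<^sub>v v) $ i)"] by (simp add: vec_l2norm_def del: index_mult_mat_vec)
  also have "\<dots> \<le> (\<Sum>i<n. \<Sum>j<m. cmod (A $$ (i, j)) * vec_l2norm v)"
  proof (rule sum_mono)
    fix i assume i: "i \<in> {..<n}"
    have "cmod ((A *\<^sub>v v) $ i) \<le> (\<Sum>j<m. cmod (A $$ (i, j) * v $ j))"
      using i by (subst mult_mat_vec_index[OF A v]) (auto intro: norm_sum)
    also have "\<dots> \<le> (\<Sum>j<m. cmod (A $$ (i, j)) * vec_l2norm v)"
      using v by (intro sum_mono) (auto simp: norm_mult intro!: mult_left_mono cmod_le_vec_l2norm)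
    finally show "cmod ((A *\<^sub>v v) $ i) \<le> (\<Sum>j<m. cmod (A $$ (i, j)) * vec_l2norm v)" .
  qed
  finally show ?thesis by (simp add: sum_distrib_right)
qed

lemma bdd_above_op_norm:
  "bdd_above {vec_l2norm (A *\<^sub>v v) |v. v \<in> carrier_vec (dim_col A) \<and> vec_l2norm v \<le> 1}"
proof (rule bdd_aboveI, safe)
  fix v :: "complex Matrix.vec" assume v: "v \<in> carrier_vec (dim_col A)" "vec_l2norm v \<le> 1"
  have "vec_l2norm (A *\<^sub>v v) \<le> (\<Sum>i<dim_row A. \<Sum>j<dim_col A. cmod (A $$ (i, j))) * vec_l2norm v"
    by (rule vec_l2norm_mult_mat_vec_le) (use v in auto)
  also have "\<dots> \<le> (\<Sum>i<dim_row A. \<Sum>j<dim_col A. cmod (A $$ (i, j))) * 1"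
    using v by (intro mult_left_mono sum_nonneg) auto
  finally show "vec_l2norm (A *\<^sub>v v) \<le> (\<Sum>i<dim_row A. \<Sum>j<dim_col A. cmod (A $$ (i, j)))" by simp
qed

lemma vec_l2norm_zero [simp]: "vec_l2norm (0\<^sub>v n) = 0"
  by (simp add: vec_l2norm_eq_0)

lemma op_norm_upper:
  "v \<in> carrier_vec (dim_col A) \<Longrightarrow> vec_l2norm v \<le> 1 \<Longrightarrow> vec_l2norm (A *\<^sub>v v) \<le> op_norm A"
  unfolding op_norm_def by (intro cSup_upper bdd_above_op_norm) auto

lemma op_norm_nonneg [simp]: "op_norm A \<ge> 0"
  by (rule order_trans[OF vec_l2norm_nonneg op_norm_upper[of "0\<^sub>v (dim_col A)"]]) auto

lemma op_norm_leI:
  assumes "\<And>v. v \<in> carrier_vec (dim_col A) \<Longrightarrow> vec_l2norm v \<le> 1 \<Longrightarrow> vec_l2norm (A *\<^sub>v v) \<le> c"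
  shows "op_norm A \<le> c"
  unfolding op_norm_def
  by (rule cSup_least) (use assms in \<open>auto intro!: exI[of _ "0\<^sub>v (dim_col A)"]\<close>)

lemma op_norm_bound:
  assumes v: "v \<in> carrier_vec (dim_col A)"
  shows "vec_l2norm (A *\<^sub>v v) \<le> op_norm A * vec_l2norm v"
proof (cases "vec_l2norm v = 0")
  case True
  have "vec_l2norm (A *\<^sub>v v) \<le> (\<Sum>i<dim_row A. \<Sum>j<dim_col A. cmod (A $$ (i, j))) * vec_l2norm v"
    by (rule vec_l2norm_mult_mat_vec_le) (use v in auto)
  then show ?thesis using True by simp
next
  case False
  define r where "r = vec_l2norm v"
  have r: "r > 0" using False vec_l2norm_nonneg[of v] by (simp add: r_def less_le)
  define u where "u = complex_of_real (1 / r) \<cdot>\<^sub>v v"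
  have u: "u \<in> carrier_vec (dim_col A)" "vec_l2norm u = 1"
    using v r unfolding u_def vec_l2norm_smult by (auto simp: r_def norm_divide)
  have vu: "v = complex_of_real r \<cdot>\<^sub>v u" using r by (simp add: u_def smult_smult_assoc)
  have "A *\<^sub>v v = complex_of_real r \<cdot>\<^sub>v (A *\<^sub>v u)"
    unfolding vu by (rule mult_mat_vec[of _ "dim_row A" "dim_col A"]) (use u in auto)
  then have "vec_l2norm (A *\<^sub>v v) = r * vec_l2norm (A *\<^sub>v u)" using r by (simp add: vec_l2norm_smult)
  also have "\<dots> \<le> r * op_norm A" using op_norm_upper[OF u(1)] u(2) r by (intro mult_left_mono) auto
  finally show ?thesis by (simp add: r_def mult.commute)
qed

lemma op_norm_add:
  assumes "A \<in> carrier_mat n m" "B \<in> carrier_mat n m"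
  shows "op_norm (A + B) \<le> op_norm A + op_norm B"
proof (rule op_norm_leI)
  fix v assume v: "v \<in> carrier_vec (dim_col (A + B))" "vec_l2norm v \<le> 1"
  then have vm: "v \<in> carrier_vec m" using assms by auto
  have "vec_l2norm ((A + B) *\<^sub>v v) = vec_l2norm (A *\<^sub>v v + B *\<^sub>v v)"
    by (subst add_mult_distrib_mat_vec[OF assms vm]) simp
  also have "\<dots> \<le> vec_l2norm (A *\<^sub>v v) + vec_l2norm (B *\<^sub>v v)"
    by (rule vec_l2norm_add[of _ n]) (use assms vm in auto)
  also have "\<dots> \<le> op_norm A + op_norm B"
    using assms vm v by (intro add_mono op_norm_upper) auto
  finally show "vec_l2norm ((A + B) *\<^sub>v v) \<le> op_norm A + op_norm B" .
qed

lemma op_norm_smult: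
  assumes "A \<in> carrier_mat n m"
  shows "op_norm (c \<cdot>\<^sub>m A) \<le> cmod c * op_norm A"
proof (rule op_norm_leI)
  fix v assume v: "v \<in> carrier_vec (dim_col (c \<cdot>\<^sub>m A))" "vec_l2norm v \<le> 1"
  then have vm: "v \<in> carrier_vec m" using assms by auto
  have "(c \<cdot>\<^sub>m A) *\<^sub>v v = c \<cdot>\<^sub>v (A *\<^sub>v v)"
    using assms vm by (intro eq_vecI) (auto simp: scalar_prod_def sum_distrib_left mult_ac)
  then show "vec_l2norm ((c \<cdot>\<^sub>m A) *\<^sub>v v) \<le> cmod c * op_norm A"
    using op_norm_upper[of v A] assms vm v by (auto simp: vec_l2norm_smult intro!: mult_left_mono)
qed

lemma op_norm_mult:
  assumes A: "A \<in> carrier_mat n m" and B: "B \<in> carrier_mat m k"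
  shows "op_norm (A * B) \<le> op_norm A * op_norm B"
proof (rule op_norm_leI)
  fix v assume v: "v \<in> carrier_vec (dim_col (A * B))" "vec_l2norm v \<le> 1"
  then have vk: "v \<in> carrier_vec k" using B by auto
  have "vec_l2norm ((A * B) *\<^sub>v v) = vec_l2norm (A *\<^sub>v (B *\<^sub>v v))"
    by (subst assoc_mult_mat_vec[OF A B vk]) simp
  also have "\<dots> \<le> op_norm A * vec_l2norm (B *\<^sub>v v)"
    using A B vk by (intro op_norm_bound) auto
  also have "\<dots> \<le> op_norm A * op_norm B"
    using B vk v by (intro mult_left_mono op_norm_upper) auto
  finally show "vec_l2norm ((A * B) *\<^sub>v v) \<le> op_norm A * op_norm B" .
qed

lemma op_norm_one: "op_norm (1\<^sub>m n) \<le> 1"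
  by (rule op_norm_leI) auto

lemma cmod_entry_le_op_norm:
  assumes A: "A \<in> carrier_mat n m" and ij: "i < n" "j < m"
  shows "cmod (A $$ (i, j)) \<le> op_norm A"
proof -
  let ?e = "unit_vec m j :: complex Matrix.vec"
  have e: "?e \<in> carrier_vec m" by simp
  have "(vec_l2norm ?e)\<^sup>2 = (\<Sum>k<m. if k = j then 1 else 0)"
    unfolding vec_l2norm_sq[OF e] using ij by (intro sum.cong) auto
  also have "\<dots> = 1" using ij by simp
  finally have "vec_l2norm ?e = 1" by (simp add: power2_eq_1_iff) (smt (verit) vec_l2norm_nonneg)
  then have "vec_l2norm (A *\<^sub>v ?e) \<le> op_norm A" using A by (intro op_norm_upper) auto
  moreover have "(A *\<^sub>v ?e) $ i = A $$ (i, j)"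
    unfolding mult_mat_vec_index[OF A e ij(1)] using ij by (simp add: unit_vec_def if_distrib cong: if_cong)
  then have "cmod (A $$ (i, j)) \<le> vec_l2norm (A *\<^sub>v ?e)"
    using cmod_le_vec_l2norm[of i "A *\<^sub>v ?e"] A ij by simp
  ultimately show ?thesis by simp
qed

lemma Re_ntrace_le_op_norm:
  assumes A: "A \<in> carrier_mat n n"
  shows "\<bar>Re (ntrace A)\<bar> \<le> op_norm A"
proof (cases "n = 0")
  case True
  then show ?thesis using A by (auto simp: ntrace_def)
next
  case False
  have "\<bar>Re (ntrace A)\<bar> \<le> cmod (ntrace A)" by (rule abs_Re_le_cmod)
  also have "\<dots> = cmod (\<Sum>i<n. A $$ (i, i)) / real n" using A by (simp add: ntrace_def norm_divide)
  also have "\<dots> \<le> (\<Sum>i<n. op_norm A) / real n"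
    by (intro divide_right_mono order_trans[OF norm_sum] sum_mono cmod_entry_le_op_norm[OF A]) auto
  finally show ?thesis using False by simp
qed

lemma vec_l2norm_unitary:
  assumes U: "unitary_mat n U" and v: "v \<in> carrier_vec n"
  shows "vec_l2norm (U *\<^sub>v v) = vec_l2norm v"
proof -
  note u = unitary_matD[OF U]
  have Uv: "U *\<^sub>v v \<in> carrier_vec n" using u(1) v by auto
  have orth: "(\<Sum>i<n. U $$ (i, j) * cnj (U $$ (i, k))) = (if j = k then 1 else 0)" if "j < n" "k < n" for j k
  proof -
    have "(mat_adjoint U * U) $$ (k, j) = (\<Sum>i<n. cnj (U $$ (i, k)) * U $$ (i, j))"
      using u(1) that by (auto simp: scalar_prod_def atLeast0LessThan intro!: sum.cong)
    moreover have "(mat_adjoint U * U) $$ (k, j) = (if j = k then 1 else 0)" unfolding u(3) using that by simp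
    moreover have "(\<Sum>i<n. cnj (U $$ (i, k)) * U $$ (i, j)) = (\<Sum>i<n. U $$ (i, j) * cnj (U $$ (i, k)))"
      by (simp add: mult.commute)
    ultimately show ?thesis by simp
  qed
  have "complex_of_real ((vec_l2norm (U *\<^sub>v v))\<^sup>2) = (\<Sum>i<n. (\<Sum>j<n. U $$ (i, j) * v $ j) * cnj (\<Sum>k<n. U $$ (i, k) * v $ k))"
    unfolding vec_l2norm_sq[OF Uv] of_real_sum complex_norm_square
    by (intro sum.cong) (auto simp: mult_mat_vec_index[OF u(1) v])
  also have "\<dots> = (\<Sum>i<n. \<Sum>j<n. \<Sum>k<n. (v $ j * cnj (v $ k)) * (U $$ (i, j) * cnj (U $$ (i, k))))"
    by (simp add: sum_product mult_ac)
  also have "\<dots> = (\<Sum>j<n. \<Sum>i<n. \<Sum>k<n. (v $ j * cnj (v $ k)) * (U $$ (i, j) * cnj (U $$ (i, k))))"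
    by (rule sum.swap)
  also have "\<dots> = (\<Sum>j<n. \<Sum>k<n. \<Sum>i<n. (v $ j * cnj (v $ k)) * (U $$ (i, j) * cnj (U $$ (i, k))))"
    by (intro sum.cong refl sum.swap)
  also have "\<dots> = (\<Sum>j<n. \<Sum>k<n. (v $ j * cnj (v $ k)) * (if j = k then 1 else 0))"
    by (intro sum.cong refl) (simp add: sum_distrib_left[symmetric] orth)
  also have "\<dots> = (\<Sum>j<n. v $ j * cnj (v $ j))" by (intro sum.cong refl) (simp add: if_distrib cong: if_cong)
  also have "\<dots> = complex_of_real ((vec_l2norm v)\<^sup>2)"
    unfolding vec_l2norm_sq[OF v] of_real_sum complex_norm_square ..
  finally have "(vec_l2norm (U *\<^sub>v v))\<^sup>2 = (vec_l2norm v)\<^sup>2" by (simp only: of_real_eq_iff)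
  then show ?thesis by (simp add: power2_eq_iff_nonneg)
qed

lemma op_norm_conj_diag_le_iff:
  assumes U: "unitary_mat n U" and q: "q \<ge> 0"
  shows "op_norm (conj_by U (real_diag n d)) \<le> q \<longleftrightarrow> (\<forall>i<n. \<bar>d i\<bar> \<le> q)"
proof -
  note u = unitary_matD[OF U]
  let ?A = "conj_by U (real_diag n d)"
  have A: "?A \<in> carrier_mat n n" using u by simp
  have Av: "?A *\<^sub>v v = U *\<^sub>v (real_diag n d *\<^sub>v (mat_adjoint U *\<^sub>v v))" if "v \<in> carrier_vec n" for v
  proof -
    have "?A *\<^sub>v v = (U * real_diag n d) *\<^sub>v (mat_adjoint U *\<^sub>v v)"
      unfolding conj_by_def by (rule assoc_mult_mat_vec[of _ n n _ n]) (use u that in \<open>auto intro: sq_carrier\<close>)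
    also have "\<dots> = U *\<^sub>v (real_diag n d *\<^sub>v (mat_adjoint U *\<^sub>v v))"
      by (rule assoc_mult_mat_vec[of _ n n _ n]) (use u that in \<open>auto intro!: mult_mat_vec_carrier\<close>)
    finally show ?thesis .
  qed
  have D: "(real_diag n d *\<^sub>v w) $ i = d i * w $ i" if "w \<in> carrier_vec n" "i < n" for w i
    unfolding mult_mat_vec_index[OF real_diag_carrier that]
    using that by (simp add: if_distrib[of "\<lambda>x. x * _"] cong: if_cong)
  show ?thesis
  proof safe
    fix i assume *: "op_norm ?A \<le> q" and i: "i < n"
    let ?v = "U *\<^sub>v unit_vec n i"
    have e: "unit_vec n i \<in> carrier_vec n" by simp
    have v: "?v \<in> carrier_vec n" using u by auto
    have Uv: "mat_adjoint U *\<^sub>v ?v = unit_vec n i"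
      using assoc_mult_mat_vec[OF u(2,1) e] u(3) by simp
    have ne: "vec_l2norm (unit_vec n i) = 1"
    proof -
      have "(vec_l2norm (unit_vec n i))\<^sup>2 = (\<Sum>k<n. if k = i then 1 else 0)"
        unfolding vec_l2norm_sq[OF e] using i by (intro sum.cong) auto
      then show ?thesis using i by (simp add: power2_eq_1_iff) (smt (verit) vec_l2norm_nonneg)
    qed
    have "\<bar>d i\<bar> = cmod ((real_diag n d *\<^sub>v unit_vec n i) $ i)"
      using D[OF e i] i by simp
    also have "\<dots> \<le> vec_l2norm (real_diag n d *\<^sub>v unit_vec n i)" using i by (intro cmod_le_vec_l2norm) simp
    also have "\<dots> = vec_l2norm (?A *\<^sub>v ?v)"
      unfolding Av[OF v] Uv by (rule vec_l2norm_unitary[OF U, symmetric]) (auto intro!: mult_mat_vec_carrier)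
    also have "\<dots> \<le> op_norm ?A"
      using v A ne vec_l2norm_unitary[OF U e] by (intro op_norm_upper) auto
    finally show "\<bar>d i\<bar> \<le> q" using * by simp
  next
    assume d: "\<forall>i<n. \<bar>d i\<bar> \<le> q"
    show "op_norm ?A \<le> q"
    proof (rule op_norm_leI)
      fix v assume "v \<in> carrier_vec (dim_col ?A)" and v1: "vec_l2norm v \<le> 1"
      then have v: "v \<in> carrier_vec n" using A by auto
      define w where "w = mat_adjoint U *\<^sub>v v"
      have w: "w \<in> carrier_vec n" unfolding w_def using u v by (auto intro!: mult_mat_vec_carrier)
      have Dw: "real_diag n d *\<^sub>v w \<in> carrier_vec n" using w by (auto intro!: mult_mat_vec_carrier)
      have "(vec_l2norm (real_diag n d *\<^sub>v w))\<^sup>2 \<le> (\<Sum>i<n. q\<^sup>2 * (cmod (w $ i))\<^sup>2)"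
        unfolding vec_l2norm_sq[OF Dw]
      proof (rule sum_mono)
        fix i assume "i \<in> {..<n}"
        then have "cmod ((real_diag n d *\<^sub>v w) $ i) \<le> q * cmod (w $ i)"
          using D[OF w] d by (auto simp: norm_mult intro!: mult_right_mono)
        from power_mono[OF this norm_ge_zero, of 2]
        show "(cmod ((real_diag n d *\<^sub>v w) $ i))\<^sup>2 \<le> q\<^sup>2 * (cmod (w $ i))\<^sup>2" by (simp add: power_mult_distrib)
      qed
      also have "\<dots> = (q * vec_l2norm w)\<^sup>2" by (simp add: vec_l2norm_sq[OF w] power_mult_distrib sum_distrib_left)
      finally have "vec_l2norm (real_diag n d *\<^sub>v w) \<le> q * vec_l2norm w"
        by (rule power2_le_imp_le) (use q in auto)
      also have "vec_l2norm w = vec_l2norm v"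
        unfolding w_def by (rule vec_l2norm_unitary[OF unitary_mat_adjoint[OF U] v])
      also have "q * vec_l2norm v \<le> q" using v1 q by (simp add: mult_left_le)
      finally show "vec_l2norm (?A *\<^sub>v v) \<le> q"
        unfolding Av[OF v] w_def[symmetric] vec_l2norm_unitary[OF U Dw] .
    qed
  qed
qed

lemma op_norm_le_iff_tr_pow:
  assumes A: "A \<in> sa_mats n" and q: "q > 0"
  shows "op_norm A \<le> q \<longleftrightarrow> (\<forall>k. tr_pow n A (2 * k) \<le> real n * q ^ (2 * k))"
proof -
  obtain U d where U: "unitary_mat n U" and "A = conj_by U (real_diag n d)"
    using spectral_theorem[OF A] by blast
  then show ?thesis
    using op_norm_conj_diag_le_iff[OF U, of q d] q powers_bounded_iff[OF q, of n d] by (simp add: tr_pow_conj_diag[OF U])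
qed

subsection \<open>Evaluation of noncommutative polynomials\<close>

lemma ncpoly_eval_dims [simp]:
  "dim_row (ncpoly_eval n A p) = n" "dim_col (ncpoly_eval n A p) = n" "ncpoly_eval n A p \<in> carrier_mat n n"
  by (simp_all add: ncpoly_eval_def)

lemma ncpoly_eval_index:
  "i < n \<Longrightarrow> j < n \<Longrightarrow> finite S \<Longrightarrow> Poly_Mapping.keys p \<subseteq> S \<Longrightarrow>
    ncpoly_eval n A p $$ (i, j) = (\<Sum>w\<in>S. Poly_Mapping.lookup p w * (word_eval n A w $$ (i, j)))"
  unfolding ncpoly_eval_def
  by (simp, rule sum.mono_neutral_left) (auto simp: in_keys_iff)

lemma ncpoly_eval_add: "ncpoly_eval n A (p + q) = ncpoly_eval n A p + ncpoly_eval n A q"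
proof (rule eq_matI)
  fix i j assume "i < dim_row (ncpoly_eval n A p + ncpoly_eval n A q)" "j < dim_col (ncpoly_eval n A p + ncpoly_eval n A q)"
  then have ij: "i < n" "j < n" by auto
  let ?S = "Poly_Mapping.keys p \<union> Poly_Mapping.keys q"
  have S: "finite ?S" "Poly_Mapping.keys (p + q) \<subseteq> ?S" using keys_add[of p q] by auto
  show "ncpoly_eval n A (p + q) $$ (i, j) = (ncpoly_eval n A p + ncpoly_eval n A q) $$ (i, j)"
    using ij ncpoly_eval_index[OF ij S] ncpoly_eval_index[OF ij S(1), of p] ncpoly_eval_index[OF ij S(1), of q]
    by (simp add: lookup_add distrib_right sum.distrib)
qed auto

lemma ncpoly_eval_diff: "ncpoly_eval n A (p - q) = ncpoly_eval n A p - ncpoly_eval n A q"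
proof -
  have "ncpoly_eval n A p = ncpoly_eval n A (p - q) + ncpoly_eval n A q"
    using ncpoly_eval_add[of n A "p - q" q] by simp
  then show ?thesis by (intro eq_matI) auto
qed

lemma ncpoly_eval_zero: "ncpoly_eval n A 0 = 0\<^sub>m n n"
  by (rule eq_matI) (auto simp: ncpoly_eval_def)

lemma ncpoly_eval_sum_index:
  "i < n \<Longrightarrow> j < n \<Longrightarrow> ncpoly_eval n A (\<Sum>a\<in>S. f a) $$ (i, j) = (\<Sum>a\<in>S. ncpoly_eval n A (f a) $$ (i, j))"
  by (induction S rule: infinite_finite_induct) (simp_all add: ncpoly_eval_zero ncpoly_eval_add)

lemma ncpoly_eval_single_index:
  "i < n \<Longrightarrow> j < n \<Longrightarrow> ncpoly_eval n A (Poly_Mapping.single w c) $$ (i, j) = c * word_eval n A w $$ (i, j)"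
  by (simp add: ncpoly_eval_def)

lemma poly_mapping_sum_single:
  "p = (\<Sum>w\<in>Poly_Mapping.keys p. Poly_Mapping.single w (Poly_Mapping.lookup p w))"
proof (rule poly_mapping_eqI)
  fix w
  have "Poly_Mapping.lookup (\<Sum>v\<in>Poly_Mapping.keys p. Poly_Mapping.single v (Poly_Mapping.lookup p v)) w
     = (\<Sum>v\<in>Poly_Mapping.keys p. if v = w then Poly_Mapping.lookup p v else 0)"
    by (simp add: lookup_sum lookup_single when_def)
  also have "\<dots> = Poly_Mapping.lookup p w" by (simp add: in_keys_iff)
  finally show "Poly_Mapping.lookup p w = Poly_Mapping.lookup (\<Sum>v\<in>Poly_Mapping.keys p. Poly_Mapping.single v (Poly_Mapping.lookup p v)) w" by simp
qed

lemma word_eval_Nil: "word_eval n A (NCWord []) = 1\<^sub>m n"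
  by (simp add: word_eval_def)

lemma word_eval_Cons: "word_eval n A (NCWord (i # is)) = A i * word_eval n A (NCWord is)"
  by (simp add: word_eval_def)

lemma word_eval_carrier:
  "(\<And>i. i \<in> set is \<Longrightarrow> A i \<in> carrier_mat n n) \<Longrightarrow> word_eval n A (NCWord is) \<in> carrier_mat n n"
  by (induction "is") (auto simp: word_eval_Nil word_eval_Cons intro!: sq_carrier)

lemma word_eval_append:
  "(\<And>i. i \<in> set is \<union> set js \<Longrightarrow> A i \<in> carrier_mat n n) \<Longrightarrow>
    word_eval n A (NCWord (is @ js)) = word_eval n A (NCWord is) * word_eval n A (NCWord js)"
proof (induction "is")
  case Nil
  then show ?case using word_eval_carrier[of js A n] by (simp add: word_eval_Nil left_mult_one_mat[of _ n n])
next
  case (Cons i "is")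
  then show ?case
    using word_eval_carrier[of "is" A n] word_eval_carrier[of js A n]
    by (simp add: word_eval_Cons sq_assoc[of _ n])
qed

lemma ncpolysD: "p \<in> ncpolys N \<Longrightarrow> w \<in> Poly_Mapping.keys p \<Longrightarrow> set (letters w) \<subseteq> {1..N}"
  by (auto simp: ncpolys_def)

lemma word_eval_carrier_ncpolys:
  assumes "\<And>i. i \<in> {1..N} \<Longrightarrow> A i \<in> carrier_mat n n" "p \<in> ncpolys N" "w \<in> Poly_Mapping.keys p"
  shows "word_eval n A w \<in> carrier_mat n n"
proof -
  have "word_eval n A (NCWord (letters w)) \<in> carrier_mat n n"
    using ncpolysD[OF assms(2,3)] assms(1) by (intro word_eval_carrier) blast
  then show ?thesis by simp
qed

lemma ncpolys_add: "p \<in> ncpolys N \<Longrightarrow> q \<in> ncpolys N \<Longrightarrow> p + q \<in> ncpolys N"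
  unfolding ncpolys_def using keys_add[of p q] by blast

lemma ncpolys_diff: "p \<in> ncpolys N \<Longrightarrow> q \<in> ncpolys N \<Longrightarrow> p - q \<in> ncpolys N"
  unfolding ncpolys_def using keys_diff[of p q] by blast

lemma ncpolys_mult: "p \<in> ncpolys N \<Longrightarrow> q \<in> ncpolys N \<Longrightarrow> p * q \<in> ncpolys N"
  unfolding ncpolys_def using keys_mult[of p q] by (fastforce simp: plus_ncword_def)

lemma ncpolys_zero: "0 \<in> ncpolys N"
  by (simp add: ncpolys_def)

lemma ncpolys_sum: "(\<And>a. a \<in> S \<Longrightarrow> f a \<in> ncpolys N) \<Longrightarrow> (\<Sum>a\<in>S. f a) \<in> ncpolys N"
  by (induction S rule: infinite_finite_induct) (auto simp: ncpolys_zero ncpolys_add)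

lemma ncpolys_const: "ncconst c \<in> ncpolys N"
  by (simp add: ncpolys_def ncconst_def zero_ncword_def)

lemma ncpolys_var: "i \<in> {1..N} \<Longrightarrow> ncvar i \<in> ncpolys N"
  by (simp add: ncpolys_def ncvar_def)

lemma ncpolys_one: "1 \<in> ncpolys N"
  using ncpolys_const[of 1 N] by (simp add: ncconst_def)

lemma ncpolys_prod_list: "(\<And>p. p \<in> set ps \<Longrightarrow> p \<in> ncpolys N) \<Longrightarrow> prod_list ps \<in> ncpolys N"
  by (induction ps) (auto simp: ncpolys_one ncpolys_mult)

lemma ncpolys_mono: "M \<le> N \<Longrightarrow> ncpolys M \<subseteq> ncpolys N"
  unfolding ncpolys_def by (auto 0 3)

lemma ncpoly_eval_mult:
  assumes A: "\<And>i. i \<in> {1..N} \<Longrightarrow> A i \<in> carrier_mat n n" and p: "p \<in> ncpolys N" and q: "q \<in> ncpolys N"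
  shows "ncpoly_eval n A (p * q) = ncpoly_eval n A p * ncpoly_eval n A q"
proof (rule eq_matI)
  let ?K = "Poly_Mapping.keys" and ?l = "Poly_Mapping.lookup"
  fix i j assume "i < dim_row (ncpoly_eval n A p * ncpoly_eval n A q)" "j < dim_col (ncpoly_eval n A p * ncpoly_eval n A q)"
  then have ij: "i < n" "j < n" by auto
  have we: "word_eval n A (a + b) $$ (i, j) = (\<Sum>k<n. word_eval n A a $$ (i, k) * word_eval n A b $$ (k, j))"
    if "a \<in> ?K p" "b \<in> ?K q" for a b
  proof -
    have ab: "set (letters a) \<subseteq> {1..N}" "set (letters b) \<subseteq> {1..N}" using ncpolysD[OF p that(1)] ncpolysD[OF q that(2)] .
    have c: "word_eval n A a \<in> carrier_mat n n" "word_eval n A b \<in> carrier_mat n n"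
      using word_eval_carrier_ncpolys[OF A p that(1)] word_eval_carrier_ncpolys[OF A q that(2)] by auto
    have "word_eval n A (a + b) = word_eval n A a * word_eval n A b"
    proof -
      have "word_eval n A (NCWord (letters a @ letters b)) = word_eval n A (NCWord (letters a)) * word_eval n A (NCWord (letters b))"
        by (rule word_eval_append) (use A ab in blast)
      then show ?thesis by (simp add: plus_ncword_def)
    qed
    then show ?thesis using c ij by (auto simp: scalar_prod_def atLeast0LessThan intro!: sum.cong)
  qed
  have "p * q = (\<Sum>a\<in>?K p. Poly_Mapping.single a (?l p a)) * (\<Sum>b\<in>?K q. Poly_Mapping.single b (?l q b))"
    using poly_mapping_sum_single[of p] poly_mapping_sum_single[of q] by simp
  also have "\<dots> = (\<Sum>a\<in>?K p. \<Sum>b\<in>?K q. Poly_Mapping.single (a + b) (?l p a * ?l q b))"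
    by (simp add: sum_product mult_single)
  finally have "ncpoly_eval n A (p * q) $$ (i, j)
     = (\<Sum>a\<in>?K p. \<Sum>b\<in>?K q. ?l p a * ?l q b * word_eval n A (a + b) $$ (i, j))"
    using ij by (simp add: ncpoly_eval_sum_index ncpoly_eval_single_index)
  also have "\<dots> = (\<Sum>a\<in>?K p. \<Sum>b\<in>?K q. \<Sum>k<n. (?l p a * word_eval n A a $$ (i, k)) * (?l q b * word_eval n A b $$ (k, j)))"
    by (intro sum.cong refl) (simp add: we sum_distrib_left mult_ac)
  also have "\<dots> = (\<Sum>a\<in>?K p. \<Sum>k<n. \<Sum>b\<in>?K q. (?l p a * word_eval n A a $$ (i, k)) * (?l q b * word_eval n A b $$ (k, j)))"
    by (intro sum.cong refl sum.swap)
  also have "\<dots> = (\<Sum>k<n. \<Sum>a\<in>?K p. \<Sum>b\<in>?K q. (?l p a * word_eval n A a $$ (i, k)) * (?l q b * word_eval n A b $$ (k, j)))"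
    by (rule sum.swap)
  also have "\<dots> = (\<Sum>k<n. ncpoly_eval n A p $$ (i, k) * ncpoly_eval n A q $$ (k, j))"
    using ij by (intro sum.cong refl) (simp add: ncpoly_eval_def sum_product)
  also have "\<dots> = (ncpoly_eval n A p * ncpoly_eval n A q) $$ (i, j)"
    using ij by (auto simp: scalar_prod_def atLeast0LessThan intro!: sum.cong)
  finally show "ncpoly_eval n A (p * q) $$ (i, j) = (ncpoly_eval n A p * ncpoly_eval n A q) $$ (i, j)" .
qed auto

lemma ncpoly_eval_const: "ncpoly_eval n A (ncconst c) = c \<cdot>\<^sub>m 1\<^sub>m n"
  by (rule eq_matI) (auto simp: ncconst_def ncpoly_eval_single_index zero_ncword_def word_eval_Nil)

lemma ncpoly_eval_const_mult:
  "ncpoly_eval n A (ncconst c * p) = c \<cdot>\<^sub>m ncpoly_eval n A p"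
proof (rule eq_matI)
  fix i j assume "i < dim_row (c \<cdot>\<^sub>m ncpoly_eval n A p)" "j < dim_col (c \<cdot>\<^sub>m ncpoly_eval n A p)"
  then have ij: "i < n" "j < n" by auto
  have "ncconst c * p = ncconst c * (\<Sum>w\<in>Poly_Mapping.keys p. Poly_Mapping.single w (Poly_Mapping.lookup p w))"
    using poly_mapping_sum_single[of p] by simp
  also have "\<dots> = (\<Sum>w\<in>Poly_Mapping.keys p. Poly_Mapping.single w (c * Poly_Mapping.lookup p w))"
    by (simp add: ncconst_def sum_distrib_left mult_single)
  finally show "ncpoly_eval n A (ncconst c * p) $$ (i, j) = (c \<cdot>\<^sub>m ncpoly_eval n A p) $$ (i, j)"
    using ij by (simp add: ncpoly_eval_sum_index ncpoly_eval_single_index)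
      (simp add: ncpoly_eval_def sum_distrib_left mult.assoc)
qed auto

lemma ncpoly_eval_var:
  "A i \<in> carrier_mat n n \<Longrightarrow> ncpoly_eval n A (ncvar i) = A i"
  by (rule eq_matI) (auto simp: ncvar_def ncpoly_eval_single_index word_eval_Nil word_eval_Cons right_mult_one_mat[of _ n n])

lemma ncpoly_eval_one: "ncpoly_eval n A 1 = 1\<^sub>m n"
  using ncpoly_eval_const[of n A 1] by (simp add: ncconst_def) (intro eq_matI, auto)

lemma ncpoly_eval_cong:
  assumes "p \<in> ncpolys N" "\<And>i. i \<in> {1..N} \<Longrightarrow> A i = B i"
  shows "ncpoly_eval n A p = ncpoly_eval n B p"
proof -
  have "word_eval n A w = word_eval n B w" if "w \<in> Poly_Mapping.keys p" for w
    unfolding word_eval_def using ncpolysD[OF assms(1) that] assms(2) by (intro foldr_cong) auto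
  then show ?thesis unfolding ncpoly_eval_def by (intro arg_cong[where f = "Matrix.mat n n"] ext sum.cong) auto
qed

lemma ncpoly_eval_star:
  assumes A: "\<And>i. i \<in> {1..N} \<Longrightarrow> A i \<in> sa_mats n" and p: "p \<in> ncpolys N"
  shows "ncpoly_eval n A (ncpoly_star p) = mat_adjoint (ncpoly_eval n A p)"
proof (rule eq_matI)
  fix i j assume "i < dim_row (mat_adjoint (ncpoly_eval n A p))" "j < dim_col (mat_adjoint (ncpoly_eval n A p))"
  then have ij: "i < n" "j < n" by auto
  have rev: "word_eval n A (NCWord (rev ws)) = mat_adjoint (word_eval n A (NCWord ws))" if "set ws \<subseteq> {1..N}" for ws
    using that
  proof (induction ws)
    case Nil
    then show ?case by (simp add: word_eval_Nil)
  next
    case (Cons k ws)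
    have c: "A l \<in> carrier_mat n n" if "l \<in> {1..N}" for l using sa_matsD(1)[OF A[OF that]] .
    have k: "A k \<in> carrier_mat n n" "mat_adjoint (A k) = A k"
      using Cons.prems sa_matsD(1,2)[OF A[of k]] by auto
    have w: "word_eval n A (NCWord ws) \<in> carrier_mat n n"
      using Cons.prems c by (intro word_eval_carrier) auto
    have "word_eval n A (NCWord (rev ws @ [k])) = word_eval n A (NCWord (rev ws)) * A k"
      using Cons.prems c k by (subst word_eval_append) (auto simp: word_eval_Nil word_eval_Cons right_mult_one_mat[of _ n n])
    then show ?case using Cons w k by (simp add: word_eval_Cons mat_adjoint_mult[of _ n n _ n])
  qed
  have wc: "word_eval n A w \<in> carrier_mat n n" if "w \<in> Poly_Mapping.keys p" for w
    using word_eval_carrier_ncpolys[OF sa_matsD(1)[OF A] p that] by auto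
  have "ncpoly_eval n A (ncpoly_star p) $$ (i, j)
     = (\<Sum>w\<in>Poly_Mapping.keys p. cnj (Poly_Mapping.lookup p w) * word_eval n A (NCWord (rev (letters w))) $$ (i, j))"
    unfolding ncpoly_star_def using ij by (simp add: ncpoly_eval_sum_index ncpoly_eval_single_index)
  also have "\<dots> = (\<Sum>w\<in>Poly_Mapping.keys p. cnj (Poly_Mapping.lookup p w * word_eval n A w $$ (j, i)))"
  proof (rule sum.cong)
    fix w assume w: "w \<in> Poly_Mapping.keys p"
    have "word_eval n A (NCWord (rev (letters w))) = mat_adjoint (word_eval n A w)"
      using rev[OF ncpolysD[OF p w]] by simp
    then show "cnj (Poly_Mapping.lookup p w) * word_eval n A (NCWord (rev (letters w))) $$ (i, j)
      = cnj (Poly_Mapping.lookup p w * word_eval n A w $$ (j, i))" using wc[OF w] ij by simp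
  qed simp
  also have "\<dots> = mat_adjoint (ncpoly_eval n A p) $$ (i, j)"
    using ij by (simp add: ncpoly_eval_def)
  finally show "ncpoly_eval n A (ncpoly_star p) $$ (i, j) = mat_adjoint (ncpoly_eval n A p) $$ (i, j)" .
qed auto

lemma ncpolys_subst:
  assumes "p \<in> ncpolys M" "\<And>i. i \<in> {1..M} \<Longrightarrow> \<sigma> i \<in> ncpolys N"
  shows "ncpoly_subst \<sigma> p \<in> ncpolys N"
  unfolding ncpoly_subst_def
proof (intro ncpolys_sum ncpolys_mult ncpolys_const ncpolys_prod_list)
  fix w q assume w: "w \<in> Poly_Mapping.keys p" and "q \<in> set (map \<sigma> (letters w))"
  then obtain i where "i \<in> set (letters w)" "q = \<sigma> i" by auto
  then show "q \<in> ncpolys N" using assms(2) ncpolysD[OF assms(1) w] by blast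
qed

lemma ncpoly_subst_diff: "ncpoly_subst \<sigma> (p - q) = ncpoly_subst \<sigma> p - ncpoly_subst \<sigma> q"
proof -
  let ?S = "Poly_Mapping.keys p \<union> Poly_Mapping.keys q"
  let ?f = "\<lambda>p w. ncconst (Poly_Mapping.lookup p w) * prod_list (map \<sigma> (letters w))"
  have S: "ncpoly_subst \<sigma> r = (\<Sum>w\<in>?S. ?f r w)" if "Poly_Mapping.keys r \<subseteq> ?S" for r
    unfolding ncpoly_subst_def using that
    by (intro sum.mono_neutral_left) (auto simp: in_keys_iff ncconst_def)
  have "ncconst (a - b) = ncconst a - ncconst b" for a b by (simp add: ncconst_def single_diff)
  then show ?thesis
    using S[of "p - q"] S[of p] S[of q] keys_diff[of p q]
    by (simp add: lookup_minus left_diff_distrib sum_subtractf)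
qed

lemma ncpoly_eval_subst:
  assumes A: "\<And>i. i \<in> {1..N} \<Longrightarrow> A i \<in> carrier_mat n n" and p: "p \<in> ncpolys M"
    and \<sigma>: "\<And>i. i \<in> {1..M} \<Longrightarrow> \<sigma> i \<in> ncpolys N"
  shows "ncpoly_eval n A (ncpoly_subst \<sigma> p) = ncpoly_eval n (\<lambda>i. ncpoly_eval n A (\<sigma> i)) p"
proof (rule eq_matI)
  let ?B = "\<lambda>i. ncpoly_eval n A (\<sigma> i)"
  fix i j assume "i < dim_row (ncpoly_eval n ?B p)" "j < dim_col (ncpoly_eval n ?B p)"
  then have ij: "i < n" "j < n" by auto
  have w: "ncpoly_eval n A (prod_list (map \<sigma> ws)) = word_eval n ?B (NCWord ws)" if "set ws \<subseteq> {1..M}" for ws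
    using that
  proof (induction ws)
    case Nil
    then show ?case by (simp add: ncpoly_eval_one word_eval_Nil)
  next
    case (Cons k ws)
    have "ncpoly_eval n A (\<sigma> k * prod_list (map \<sigma> ws)) = ncpoly_eval n A (\<sigma> k) * ncpoly_eval n A (prod_list (map \<sigma> ws))"
      using Cons.prems \<sigma> by (intro ncpoly_eval_mult[OF A] ncpolys_prod_list) auto
    then show ?case using Cons by (simp add: word_eval_Cons)
  qed
  have "ncpoly_eval n A (ncpoly_subst \<sigma> p) $$ (i, j)
    = (\<Sum>v\<in>Poly_Mapping.keys p. Poly_Mapping.lookup p v * ncpoly_eval n A (prod_list (map \<sigma> (letters v))) $$ (i, j))"
    unfolding ncpoly_subst_def using ij by (simp add: ncpoly_eval_sum_index ncpoly_eval_const_mult)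
  also have "\<dots> = ncpoly_eval n ?B p $$ (i, j)"
    using ij ncpolysD[OF p] by (simp add: ncpoly_eval_def[of n ?B] w)
  finally show "ncpoly_eval n A (ncpoly_subst \<sigma> p) $$ (i, j) = ncpoly_eval n ?B p $$ (i, j)" .
qed auto

lemma sa_tuplesD:
  assumes "A \<in> sa_tuples N n R" "i \<in> {1..N}"
  shows "A i \<in> sa_mats n" "A i \<in> carrier_mat n n" "op_norm (A i) \<le> R"
  using PiE_mem[OF assms(1)[unfolded sa_tuples_def] assms(2)] by (auto simp: sa_ball_def sa_mats_def)

lemma op_norm_zero_mat: "op_norm (0\<^sub>m n n) = 0"
proof (rule antisym)
  have "0\<^sub>m n n *\<^sub>v v = 0\<^sub>v n" if "v \<in> carrier_vec n" for v :: "complex Matrix.vec"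
    using that by (intro eq_vecI) (auto simp: scalar_prod_def)
  then show "op_norm (0\<^sub>m n n) \<le> 0" by (intro op_norm_leI) (auto simp: vec_l2norm_def L2_set_def)
qed simp

lemma word_eval_op_norm:
  assumes A: "\<And>i. i \<in> set is \<Longrightarrow> A i \<in> carrier_mat n n \<and> op_norm (A i) \<le> R" and R: "R \<ge> 0"
  shows "op_norm (word_eval n A (NCWord is)) \<le> R ^ length is"
  using A
proof (induction "is")
  case Nil
  then show ?case by (simp add: word_eval_Nil op_norm_one)
next
  case (Cons i "is")
  have c: "word_eval n A (NCWord is) \<in> carrier_mat n n" using Cons.prems by (intro word_eval_carrier) auto
  have "op_norm (A i * word_eval n A (NCWord is)) \<le> op_norm (A i) * op_norm (word_eval n A (NCWord is))"
    using Cons.prems c by (intro op_norm_mult[of _ n n _ n]) auto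
  also have "\<dots> \<le> R * R ^ length is" using Cons R by (intro mult_mono) auto
  finally show ?case by (simp add: word_eval_Cons)
qed

lemma ncpoly_eval_op_norm_le:
  assumes A: "A \<in> sa_tuples N n R" and R: "R \<ge> 0" and p: "p \<in> ncpolys N"
  shows "op_norm (ncpoly_eval n A p) \<le> (\<Sum>w\<in>Poly_Mapping.keys p. cmod (Poly_Mapping.lookup p w) * R ^ length (letters w))"
proof -
  let ?s = "\<lambda>w. Poly_Mapping.single w (Poly_Mapping.lookup p w)"
  have single: "op_norm (ncpoly_eval n A (?s w)) \<le> cmod (Poly_Mapping.lookup p w) * R ^ length (letters w)"
    if w: "w \<in> Poly_Mapping.keys p" for w
  proof -
    have c: "word_eval n A w \<in> carrier_mat n n" by (rule word_eval_carrier_ncpolys[OF sa_tuplesD(2)[OF A] p w])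
    have "ncpoly_eval n A (?s w) = Poly_Mapping.lookup p w \<cdot>\<^sub>m word_eval n A w"
      using c by (intro eq_matI) (auto simp: ncpoly_eval_single_index)
    then have "op_norm (ncpoly_eval n A (?s w)) \<le> cmod (Poly_Mapping.lookup p w) * op_norm (word_eval n A w)"
      using op_norm_smult[OF c] by simp
    also have "op_norm (word_eval n A (NCWord (letters w))) \<le> R ^ length (letters w)"
    proof (rule word_eval_op_norm[OF _ R])
      fix i assume "i \<in> set (letters w)"
      then have "i \<in> {1..N}" using ncpolysD[OF p w] by blast
      then show "A i \<in> carrier_mat n n \<and> op_norm (A i) \<le> R" using sa_tuplesD[OF A] by blast
    qed
    then have "cmod (Poly_Mapping.lookup p w) * op_norm (word_eval n A w) \<le> cmod (Poly_Mapping.lookup p w) * R ^ length (letters w)"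
      by (intro mult_left_mono) auto
    finally show ?thesis .
  qed
  have "op_norm (ncpoly_eval n A (\<Sum>w\<in>S. ?s w)) \<le> (\<Sum>w\<in>S. cmod (Poly_Mapping.lookup p w) * R ^ length (letters w))"
    if "finite S" "S \<subseteq> Poly_Mapping.keys p" for S
    using that
  proof (induction S rule: finite_induct)
    case empty
    then show ?case by (simp add: ncpoly_eval_zero op_norm_zero_mat)
  next
    case (insert w S)
    have "op_norm (ncpoly_eval n A (?s w) + ncpoly_eval n A (\<Sum>w\<in>S. ?s w))
       \<le> op_norm (ncpoly_eval n A (?s w)) + op_norm (ncpoly_eval n A (\<Sum>w\<in>S. ?s w))"
      by (rule op_norm_add[of _ n n]) auto
    then show ?case using insert single[of w] by (simp add: ncpoly_eval_add)
  qed
  from this[of "Poly_Mapping.keys p"] show ?thesis using poly_mapping_sum_single[of p] by simp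
qed

lemma zero_sa_ball: "R \<ge> 0 \<Longrightarrow> 0\<^sub>m n n \<in> sa_ball n R"
proof -
  assume R: "R \<ge> 0"
  have "op_norm (0\<^sub>m n n) \<le> R" using R by (simp add: op_norm_zero_mat)
  moreover have "0\<^sub>m n n \<in> sa_mats n" unfolding sa_mats_def by (auto intro!: eq_matI)
  ultimately show ?thesis by (simp add: sa_ball_def)
qed

lemma zero_sa_tuples: "R \<ge> 0 \<Longrightarrow> (\<lambda>i\<in>{1..N}. 0\<^sub>m n n) \<in> sa_tuples N n R"
  unfolding sa_tuples_def using zero_sa_ball by auto

lemma bdd_above_ncpoly_norm:
  assumes R: "R > 0" and p: "p \<in> ncpolys N"
  shows "bdd_above {op_norm (ncpoly_eval n A p) |n A. 1 \<le> n \<and> A \<in> sa_tuples N n R}"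
  using ncpoly_eval_op_norm_le[OF _ less_imp_le[OF R] p] by (intro bdd_aboveI) blast

lemma ncpoly_norm_upper:
  assumes "R > 0" "p \<in> ncpolys N" "n \<ge> 1" "A \<in> sa_tuples N n R"
  shows "op_norm (ncpoly_eval n A p) \<le> ncpoly_norm N R p"
  unfolding ncpoly_norm_def using assms by (intro cSup_upper bdd_above_ncpoly_norm) auto

lemma ncpoly_norm_leI:
  assumes "R > 0" "\<And>n A. n \<ge> 1 \<Longrightarrow> A \<in> sa_tuples N n R \<Longrightarrow> op_norm (ncpoly_eval n A p) \<le> c"
  shows "ncpoly_norm N R p \<le> c"
  unfolding ncpoly_norm_def
proof (rule cSup_least)
  show "{op_norm (ncpoly_eval n A p) |n A. 1 \<le> n \<and> A \<in> sa_tuples N n R} \<noteq> {}"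
    using zero_sa_tuples[OF less_imp_le[OF assms(1)], where n = 1] by auto
qed (use assms in auto)

lemma ncpoly_norm_nonneg:
  assumes "R > 0" "p \<in> ncpolys N"
  shows "ncpoly_norm N R p \<ge> 0"
  using ncpoly_norm_upper[OF assms _ zero_sa_tuples, of 1] assms(1) op_norm_nonneg order_trans
  by (metis le_refl less_imp_le)

lemma ncpoly_norm_add:
  assumes R: "R > 0" and p: "p \<in> ncpolys N" and q: "q \<in> ncpolys N"
  shows "ncpoly_norm N R (p + q) \<le> ncpoly_norm N R p + ncpoly_norm N R q"
proof (rule ncpoly_norm_leI[OF R])
  fix n A assume A: "1 \<le> n" "A \<in> sa_tuples N n R"
  have "op_norm (ncpoly_eval n A (p + q)) \<le> op_norm (ncpoly_eval n A p) + op_norm (ncpoly_eval n A q)"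
    unfolding ncpoly_eval_add by (rule op_norm_add[of _ n n]) auto
  also have "\<dots> \<le> ncpoly_norm N R p + ncpoly_norm N R q"
    by (intro add_mono ncpoly_norm_upper R p q A)
  finally show "op_norm (ncpoly_eval n A (p + q)) \<le> ncpoly_norm N R p + ncpoly_norm N R q" .
qed

lemma ncpoly_norm_minus_commute:
  assumes R: "R > 0" and p: "p \<in> ncpolys N" and q: "q \<in> ncpolys N"
  shows "ncpoly_norm N R (p - q) \<le> ncpoly_norm N R (q - p)"
proof (rule ncpoly_norm_leI[OF R])
  fix n A assume A: "1 \<le> n" "A \<in> sa_tuples N n R"
  have "ncpoly_eval n A (p - q) = (- 1) \<cdot>\<^sub>m ncpoly_eval n A (q - p)"
    unfolding ncpoly_eval_diff by (intro eq_matI) auto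
  then have "op_norm (ncpoly_eval n A (p - q)) \<le> op_norm (ncpoly_eval n A (q - p))"
    using op_norm_smult[of "ncpoly_eval n A (q - p)" n n "- 1"] by simp
  also have "\<dots> \<le> ncpoly_norm N R (q - p)" by (intro ncpoly_norm_upper R ncpolys_diff p q A)
  finally show "op_norm (ncpoly_eval n A (p - q)) \<le> ncpoly_norm N R (q - p)" .
qed

lemma ncpoly_norm_triangle:
  assumes R: "R > 0" and p: "p \<in> ncpolys N" and q: "q \<in> ncpolys N" and r: "r \<in> ncpolys N"
  shows "ncpoly_norm N R (p - r) \<le> ncpoly_norm N R (p - q) + ncpoly_norm N R (q - r)"
  using ncpoly_norm_add[OF R ncpolys_diff[OF p q] ncpolys_diff[OF q r]] by simp

lemma ncpoly_norm_zero: "R > 0 \<Longrightarrow> ncpoly_norm N R 0 = 0"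
proof (rule antisym)
  assume R: "R > 0"
  show "ncpoly_norm N R 0 \<le> 0"
  proof (rule ncpoly_norm_leI[OF R])
    fix n A
    show "op_norm (ncpoly_eval n A 0) \<le> 0" by (simp add: ncpoly_eval_zero op_norm_zero_mat)
  qed
qed (rule ncpoly_norm_nonneg[OF _ ncpolys_zero])

lemma ncpoly_norm_reverse_triangle:
  assumes R: "R > 0" and p: "p \<in> ncpolys N" and q: "q \<in> ncpolys N"
  shows "\<bar>ncpoly_norm N R p - ncpoly_norm N R q\<bar> \<le> ncpoly_norm N R (p - q)"
  using ncpoly_norm_add[OF R ncpolys_diff[OF p q] q] ncpoly_norm_add[OF R ncpolys_diff[OF q p] p]
    ncpoly_norm_minus_commute[OF R q p] by (simp add: abs_le_iff)

subsection \<open>Elements of the completion\<close>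

lemma nc_cauchyD: "s \<in> nc_cauchy N R \<Longrightarrow> s k \<in> ncpolys N"
  by (simp add: nc_cauchy_def)

lemma nc_rel_equiv:
  assumes R: "R > 0"
  shows "equiv (nc_cauchy N R) (nc_rel N R)"
proof (rule equivI)
  show "nc_rel N R \<subseteq> nc_cauchy N R \<times> nc_cauchy N R" by (auto simp: nc_rel_def)
  show "refl_on (nc_cauchy N R) (nc_rel N R)"
    by (auto simp: refl_on_def nc_rel_def ncpoly_norm_zero[OF R])
  show "sym (nc_rel N R)"
  proof (rule symI)
    fix s t assume st: "(s, t) \<in> nc_rel N R"
    then have c: "s \<in> nc_cauchy N R" "t \<in> nc_cauchy N R" and l: "(\<lambda>k. ncpoly_norm N R (s k - t k)) \<longlonglongrightarrow> 0"
      by (auto simp: nc_rel_def)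
    have "(\<lambda>k. ncpoly_norm N R (t k - s k)) \<longlonglongrightarrow> 0"
      by (rule tendsto_sandwich[OF _ _ tendsto_const l])
         (use c nc_cauchyD in \<open>auto intro!: always_eventually ncpoly_norm_nonneg[OF R] ncpoly_norm_minus_commute[OF R] ncpolys_diff\<close>)
    then show "(t, s) \<in> nc_rel N R" using c by (simp add: nc_rel_def)
  qed
  show "trans (nc_rel N R)"
  proof (rule transI)
    fix s t u assume st: "(s, t) \<in> nc_rel N R" and tu: "(t, u) \<in> nc_rel N R"
    then have c: "s \<in> nc_cauchy N R" "t \<in> nc_cauchy N R" "u \<in> nc_cauchy N R"
      and l: "(\<lambda>k. ncpoly_norm N R (s k - t k)) \<longlonglongrightarrow> 0" "(\<lambda>k. ncpoly_norm N R (t k - u k)) \<longlonglongrightarrow> 0"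
      by (auto simp: nc_rel_def)
    have "(\<lambda>k. ncpoly_norm N R (s k - u k)) \<longlonglongrightarrow> 0"
      by (rule tendsto_sandwich[OF _ _ tendsto_const tendsto_add_zero[OF l]])
         (use c nc_cauchyD in \<open>auto intro!: always_eventually ncpoly_norm_nonneg[OF R] ncpoly_norm_triangle[OF R] ncpolys_diff\<close>)
    then show "(s, u) \<in> nc_rel N R" using c by (simp add: nc_rel_def)
  qed
qed

lemma nc_alg_rep: "h \<in> nc_alg N R \<Longrightarrow> R > 0 \<Longrightarrow> \<exists>s. s \<in> h"
  unfolding nc_alg_def using in_quotient_imp_non_empty[OF nc_rel_equiv] by blast

lemma nc_alg_cauchy: "h \<in> nc_alg N R \<Longrightarrow> R > 0 \<Longrightarrow> s \<in> h \<Longrightarrow> s \<in> nc_cauchy N R"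
  unfolding nc_alg_def using in_quotient_imp_subset[OF nc_rel_equiv] by blast

lemma nc_alg_rel: "h \<in> nc_alg N R \<Longrightarrow> R > 0 \<Longrightarrow> s \<in> h \<Longrightarrow> t \<in> h \<Longrightarrow> (s, t) \<in> nc_rel N R"
  unfolding nc_alg_def by (rule in_quotient_imp_in_rel[OF nc_rel_equiv]) auto

lemma nc_norm_limit:
  assumes R: "R > 0" and h: "h \<in> nc_alg N R" and s: "s \<in> h"
  shows "(\<lambda>k. ncpoly_norm N R (s k)) \<longlonglongrightarrow> nc_norm N R h"
proof -
  have sc: "s \<in> nc_cauchy N R" by (rule nc_alg_cauchy[OF h R s])
  have "Cauchy (\<lambda>k. ncpoly_norm N R (s k))"
  proof (rule metric_CauchyI)
    fix e :: real assume "e > 0"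
    then obtain m where m: "\<And>j k. j \<ge> m \<Longrightarrow> k \<ge> m \<Longrightarrow> ncpoly_norm N R (s j - s k) < e"
      using sc unfolding nc_cauchy_def by blast
    have "dist (ncpoly_norm N R (s j)) (ncpoly_norm N R (s k)) < e" if "j \<ge> m" "k \<ge> m" for j k
      using ncpoly_norm_reverse_triangle[OF R nc_cauchyD[OF sc] nc_cauchyD[OF sc], of j k] m[OF that]
      by (simp add: dist_real_def)
    then show "\<exists>M. \<forall>m\<ge>M. \<forall>n\<ge>M. dist (ncpoly_norm N R (s m)) (ncpoly_norm N R (s n)) < e" by blast
  qed
  then obtain r where r: "(\<lambda>k. ncpoly_norm N R (s k)) \<longlonglongrightarrow> r"
    using Cauchy_convergent_iff convergent_def by blast
  have all: "(\<lambda>k. ncpoly_norm N R (t k)) \<longlonglongrightarrow> r" if t: "t \<in> h" for t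
  proof -
    have tc: "t \<in> nc_cauchy N R" by (rule nc_alg_cauchy[OF h R t])
    have l: "(\<lambda>k. ncpoly_norm N R (t k - s k)) \<longlonglongrightarrow> 0"
      using nc_alg_rel[OF h R t s] by (simp add: nc_rel_def)
    have "(\<lambda>k. ncpoly_norm N R (t k) - ncpoly_norm N R (s k)) \<longlonglongrightarrow> 0"
      by (rule Lim_null_comparison[OF always_eventually l])
         (use ncpoly_norm_reverse_triangle[OF R nc_cauchyD[OF tc] nc_cauchyD[OF sc]] in auto)
    from tendsto_add[OF this r] show ?thesis by simp
  qed
  have "nc_norm N R h = r"
    unfolding nc_norm_def using all s LIMSEQ_unique by (intro the_equality) blast+
  then show ?thesis using r by simp
qed

lemma nc_eval_limit:
  assumes R: "R > 0" and h: "h \<in> nc_alg N R" and s: "s \<in> h"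
    and n: "n \<ge> 1" and A: "A \<in> sa_tuples N n R" and ij: "i < n" "j < n"
  shows "(\<lambda>k. ncpoly_eval n A (s k) $$ (i, j)) \<longlonglongrightarrow> nc_eval n A h $$ (i, j)"
proof -
  have entry: "cmod (ncpoly_eval n A p $$ (i, j) - ncpoly_eval n A q $$ (i, j)) \<le> ncpoly_norm N R (p - q)"
    if p: "p \<in> ncpolys N" and q: "q \<in> ncpolys N" for p q
  proof -
    have "ncpoly_eval n A p $$ (i, j) - ncpoly_eval n A q $$ (i, j) = ncpoly_eval n A (p - q) $$ (i, j)"
      using ij by (simp add: ncpoly_eval_diff)
    also have "cmod \<dots> \<le> op_norm (ncpoly_eval n A (p - q))"
      by (rule cmod_entry_le_op_norm[of _ n n]) (use ij in auto)
    also have "\<dots> \<le> ncpoly_norm N R (p - q)" by (intro ncpoly_norm_upper R ncpolys_diff p q n A)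
    finally show ?thesis .
  qed
  have sc: "s \<in> nc_cauchy N R" by (rule nc_alg_cauchy[OF h R s])
  have "Cauchy (\<lambda>k. ncpoly_eval n A (s k) $$ (i, j))"
  proof (rule metric_CauchyI)
    fix e :: real assume "e > 0"
    then obtain m where m: "\<And>j k. j \<ge> m \<Longrightarrow> k \<ge> m \<Longrightarrow> ncpoly_norm N R (s j - s k) < e"
      using sc unfolding nc_cauchy_def by blast
    have "dist (ncpoly_eval n A (s k) $$ (i, j)) (ncpoly_eval n A (s l) $$ (i, j)) < e" if "k \<ge> m" "l \<ge> m" for k l
      using entry[OF nc_cauchyD[OF sc] nc_cauchyD[OF sc], of k l] m[OF that]
      by (simp add: dist_norm)
    then show "\<exists>M. \<forall>k\<ge>M. \<forall>l\<ge>M. dist (ncpoly_eval n A (s k) $$ (i, j)) (ncpoly_eval n A (s l) $$ (i, j)) < e" by blast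
  qed
  then obtain z where z: "(\<lambda>k. ncpoly_eval n A (s k) $$ (i, j)) \<longlonglongrightarrow> z"
    using Cauchy_convergent_iff convergent_def by blast
  have all: "(\<lambda>k. ncpoly_eval n A (t k) $$ (i, j)) \<longlonglongrightarrow> z" if t: "t \<in> h" for t
  proof -
    have tc: "t \<in> nc_cauchy N R" by (rule nc_alg_cauchy[OF h R t])
    have l: "(\<lambda>k. ncpoly_norm N R (t k - s k)) \<longlonglongrightarrow> 0"
      using nc_alg_rel[OF h R t s] by (simp add: nc_rel_def)
    have "(\<lambda>k. ncpoly_eval n A (t k) $$ (i, j) - ncpoly_eval n A (s k) $$ (i, j)) \<longlonglongrightarrow> 0"
      by (rule Lim_null_comparison[OF always_eventually l])
         (use entry[OF nc_cauchyD[OF tc] nc_cauchyD[OF sc]] in auto)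
    from tendsto_add[OF this z] show ?thesis by simp
  qed
  have "(THE z. \<forall>s \<in> h. (\<lambda>k. ncpoly_eval n A (s k) $$ (i, j)) \<longlonglongrightarrow> z) = z"
    using all s LIMSEQ_unique by (intro the_equality) blast+
  then show ?thesis using z ij by (simp add: nc_eval_def)
qed

definition ptau :: "nat \<Rightarrow> (nat \<Rightarrow> complex Matrix.mat) \<Rightarrow> ncpoly \<Rightarrow> real" where
  "ptau n A p = Re (ntrace (ncpoly_eval n A p))"

definition nctau :: "nat \<Rightarrow> (nat \<Rightarrow> complex Matrix.mat) \<Rightarrow> nc_elem \<Rightarrow> real" where
  "nctau n A h = Re (ntrace (nc_eval n A h))"

lemma ptau_eq: "ptau n A p = (\<Sum>i<n. Re (ncpoly_eval n A p $$ (i, i))) / real n"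
  by (simp add: ptau_def ntrace_def)

lemma ptau_diff: "ptau n A (p - q) = ptau n A p - ptau n A q"
  by (simp add: ptau_eq ncpoly_eval_diff sum_subtractf diff_divide_distrib)

lemma ptau_add: "ptau n A (p + q) = ptau n A p + ptau n A q"
  by (simp add: ptau_eq ncpoly_eval_add sum.distrib add_divide_distrib)

lemma ptau_const_mult: "ptau n A (ncconst (complex_of_real c) * p) = c * ptau n A p"
  by (simp add: ptau_eq ncpoly_eval_const_mult sum_distrib_left)

lemma ptau_le_norm:
  "R > 0 \<Longrightarrow> p \<in> ncpolys N \<Longrightarrow> n \<ge> 1 \<Longrightarrow> A \<in> sa_tuples N n R \<Longrightarrow> \<bar>ptau n A p\<bar> \<le> ncpoly_norm N R p"
  unfolding ptau_def by (rule order_trans[OF Re_ntrace_le_op_norm[of _ n] ncpoly_norm_upper]) auto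

lemma nctau_limit:
  assumes R: "R > 0" and h: "h \<in> nc_alg N R" and s: "s \<in> h"
    and n: "n \<ge> 1" and A: "A \<in> sa_tuples N n R"
  shows "(\<lambda>k. ptau n A (s k)) \<longlonglongrightarrow> nctau n A h"
proof -
  have "nctau n A h = (\<Sum>i<n. Re (nc_eval n A h $$ (i, i))) / real n"
    by (simp add: nctau_def ntrace_def) (simp add: nc_eval_def)
  then show ?thesis
    unfolding ptau_eq by (auto intro!: tendsto_intros nc_eval_limit[OF R h s n A] simp: n) (use n in auto)
qed

lemma nctau_le_norm:
  assumes R: "R > 0" and h: "h \<in> nc_alg N R" and n: "n \<ge> 1" and A: "A \<in> sa_tuples N n R"
  shows "\<bar>nctau n A h\<bar> \<le> nc_norm N R h"
proof -
  obtain s where s: "s \<in> h" using nc_alg_rep[OF h R] by blast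
  have "(\<lambda>k. \<bar>ptau n A (s k)\<bar>) \<longlonglongrightarrow> \<bar>nctau n A h\<bar>"
    by (intro tendsto_rabs nctau_limit[OF R h s n A])
  then show ?thesis
    by (rule LIMSEQ_le[OF _ nc_norm_limit[OF R h s]])
       (use ptau_le_norm[OF R nc_cauchyD[OF nc_alg_cauchy[OF h R s]] n A] in auto)
qed

lemma nc_map_rep:
  assumes R: "R > 0" and R': "R' > 0" and h: "h \<in> nc_alg N R" and s: "s \<in> h" and K: "K \<ge> 0"
    and \<phi>: "\<And>p. p \<in> ncpolys N \<Longrightarrow> \<phi> p \<in> ncpolys N'"
    and diff: "\<And>p q. \<phi> (p - q) = \<phi> p - \<phi> q"
    and norm: "\<And>p. p \<in> ncpolys N \<Longrightarrow> ncpoly_norm N' R' (\<phi> p) \<le> K * ncpoly_norm N R p"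
  shows "nc_map N' R' \<phi> h \<in> nc_alg N' R'" "\<phi> \<circ> s \<in> nc_map N' R' \<phi> h"
proof -
  have cauchy: "\<phi> \<circ> t \<in> nc_cauchy N' R'" if t: "t \<in> nc_cauchy N R" for t
    unfolding nc_cauchy_def
  proof safe
    show "(\<phi> \<circ> t) k \<in> ncpolys N'" for k using \<phi>[OF nc_cauchyD[OF t]] by simp
    fix e :: real assume "e > 0"
    then have "e / (K + 1) > 0" using K by simp
    then obtain m where m: "\<And>j k. j \<ge> m \<Longrightarrow> k \<ge> m \<Longrightarrow> ncpoly_norm N R (t j - t k) < e / (K + 1)"
      using t unfolding nc_cauchy_def by blast
    have "ncpoly_norm N' R' ((\<phi> \<circ> t) j - (\<phi> \<circ> t) k) < e" if "j \<ge> m" "k \<ge> m" for j k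
    proof -
      have c: "t j - t k \<in> ncpolys N" by (intro ncpolys_diff nc_cauchyD[OF t])
      have "ncpoly_norm N' R' ((\<phi> \<circ> t) j - (\<phi> \<circ> t) k) \<le> K * ncpoly_norm N R (t j - t k)"
        using norm[OF c] by (simp add: diff)
      also have "\<dots> \<le> (K + 1) * ncpoly_norm N R (t j - t k)"
        using ncpoly_norm_nonneg[OF R c] by (intro mult_right_mono) auto
      also have "\<dots> < (K + 1) * (e / (K + 1))" using m[OF that] K by (intro mult_strict_left_mono) auto
      finally show ?thesis using K by simp
    qed
    then show "\<exists>m. \<forall>j\<ge>m. \<forall>k\<ge>m. ncpoly_norm N' R' ((\<phi> \<circ> t) j - (\<phi> \<circ> t) k) < e" by blast
  qed
  have rel: "(\<phi> \<circ> t, \<phi> \<circ> u) \<in> nc_rel N' R'" if tu: "(t, u) \<in> nc_rel N R" for t u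
  proof -
    have c: "t \<in> nc_cauchy N R" "u \<in> nc_cauchy N R" and l: "(\<lambda>k. ncpoly_norm N R (t k - u k)) \<longlonglongrightarrow> 0"
      using tu by (auto simp: nc_rel_def)
    have cp: "t k - u k \<in> ncpolys N" for k by (intro ncpolys_diff nc_cauchyD[OF c(1)] nc_cauchyD[OF c(2)])
    have "(\<lambda>k. ncpoly_norm N' R' (\<phi> (t k - u k))) \<longlonglongrightarrow> 0"
      by (rule tendsto_sandwich[OF _ _ tendsto_const tendsto_mult_right_zero[OF l, of K]])
         (use cp in \<open>auto intro!: always_eventually ncpoly_norm_nonneg[OF R'] \<phi> norm\<close>)
    then show ?thesis using cauchy[OF c(1)] cauchy[OF c(2)] by (simp add: nc_rel_def diff)
  qed
  have sc: "s \<in> nc_cauchy N R" by (rule nc_alg_cauchy[OF h R s])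
  have eq: "nc_map N' R' \<phi> h = nc_rel N' R' `` {\<phi> \<circ> s}"
  proof -
    have "nc_rel N' R' `` {\<phi> \<circ> t} = nc_rel N' R' `` {\<phi> \<circ> s}" if "t \<in> h" for t
      by (rule equiv_class_eq[OF nc_rel_equiv[OF R'] rel[OF nc_alg_rel[OF h R that s]]])
    then have "(\<Union>t\<in>h. nc_rel N' R' `` {\<phi> \<circ> t}) = nc_rel N' R' `` {\<phi> \<circ> s}" using s by blast
    moreover have "nc_map N' R' \<phi> h = (\<Union>t\<in>h. nc_rel N' R' `` {\<phi> \<circ> t})" by (auto simp: nc_map_def)
    ultimately show ?thesis by simp
  qed
  show "nc_map N' R' \<phi> h \<in> nc_alg N' R'" unfolding eq nc_alg_def by (rule quotientI[OF cauchy[OF sc]])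
  show "\<phi> \<circ> s \<in> nc_map N' R' \<phi> h"
    unfolding eq by (rule equiv_class_self[OF nc_rel_equiv[OF R'] cauchy[OF sc]])
qed

lemma nc_map2_rep:
  assumes R: "R > 0" and g: "g \<in> nc_alg N R" and h: "h \<in> nc_alg N R" and s: "s \<in> g" and t: "t \<in> h"
    and f: "\<And>p q. p \<in> ncpolys N \<Longrightarrow> q \<in> ncpolys N \<Longrightarrow> f p q \<in> ncpolys N"
    and norm: "\<And>p q p' q'. p \<in> ncpolys N \<Longrightarrow> q \<in> ncpolys N \<Longrightarrow> p' \<in> ncpolys N \<Longrightarrow> q' \<in> ncpolys N \<Longrightarrow>
       ncpoly_norm N R (f p q - f p' q') \<le> ncpoly_norm N R (p - p') + ncpoly_norm N R (q - q')"
  shows "nc_map2 N R f g h \<in> nc_alg N R" "(\<lambda>k. f (s k) (t k)) \<in> nc_map2 N R f g h"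
proof -
  have cauchy: "(\<lambda>k. f (u k) (v k)) \<in> nc_cauchy N R" if u: "u \<in> nc_cauchy N R" and v: "v \<in> nc_cauchy N R" for u v
    unfolding nc_cauchy_def
  proof safe
    show "f (u k) (v k) \<in> ncpolys N" for k using f nc_cauchyD u v by blast
    fix e :: real assume "e > 0"
    then have "e / 2 > 0" by simp
    then obtain m1 where m1: "\<And>j k. j \<ge> m1 \<Longrightarrow> k \<ge> m1 \<Longrightarrow> ncpoly_norm N R (u j - u k) < e / 2"
      using u unfolding nc_cauchy_def by blast
    obtain m2 where m2: "\<And>j k. j \<ge> m2 \<Longrightarrow> k \<ge> m2 \<Longrightarrow> ncpoly_norm N R (v j - v k) < e / 2"
      using v \<open>e / 2 > 0\<close> unfolding nc_cauchy_def by blast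
    have "ncpoly_norm N R (f (u j) (v j) - f (u k) (v k)) < e" if "j \<ge> max m1 m2" "k \<ge> max m1 m2" for j k
      using norm[OF nc_cauchyD[OF u] nc_cauchyD[OF v] nc_cauchyD[OF u] nc_cauchyD[OF v], of j j k k]
        m1[of j k] m2[of j k] that by simp
    then show "\<exists>m. \<forall>j\<ge>m. \<forall>k\<ge>m. ncpoly_norm N R (f (u j) (v j) - f (u k) (v k)) < e" by blast
  qed
  have rel: "((\<lambda>k. f (u k) (v k)), (\<lambda>k. f (u' k) (v' k))) \<in> nc_rel N R"
    if uu: "(u, u') \<in> nc_rel N R" and vv: "(v, v') \<in> nc_rel N R" for u v u' v'
  proof -
    have c: "u \<in> nc_cauchy N R" "u' \<in> nc_cauchy N R" "v \<in> nc_cauchy N R" "v' \<in> nc_cauchy N R"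
      and l: "(\<lambda>k. ncpoly_norm N R (u k - u' k)) \<longlonglongrightarrow> 0" "(\<lambda>k. ncpoly_norm N R (v k - v' k)) \<longlonglongrightarrow> 0"
      using uu vv by (auto simp: nc_rel_def)
    have p: "u k \<in> ncpolys N" "u' k \<in> ncpolys N" "v k \<in> ncpolys N" "v' k \<in> ncpolys N" for k
      using c nc_cauchyD by blast+
    have "(\<lambda>k. ncpoly_norm N R (f (u k) (v k) - f (u' k) (v' k))) \<longlonglongrightarrow> 0"
    proof (rule tendsto_sandwich[OF _ _ tendsto_const tendsto_add_zero[OF l]])
      show "\<forall>\<^sub>F k in sequentially. 0 \<le> ncpoly_norm N R (f (u k) (v k) - f (u' k) (v' k))"
        by (intro always_eventually allI ncpoly_norm_nonneg[OF R] ncpolys_diff f p)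
      show "\<forall>\<^sub>F k in sequentially. ncpoly_norm N R (f (u k) (v k) - f (u' k) (v' k))
          \<le> ncpoly_norm N R (u k - u' k) + ncpoly_norm N R (v k - v' k)"
        by (intro always_eventually allI norm p)
    qed
    then show ?thesis using cauchy[OF c(1,3)] cauchy[OF c(2,4)] by (simp add: nc_rel_def)
  qed
  have sc: "s \<in> nc_cauchy N R" and tc: "t \<in> nc_cauchy N R"
    by (rule nc_alg_cauchy[OF g R s], rule nc_alg_cauchy[OF h R t])
  let ?w = "\<lambda>k. f (s k) (t k)"
  have eq: "nc_map2 N R f g h = nc_rel N R `` {?w}"
  proof -
    have "nc_rel N R `` {\<lambda>k. f (u k) (v k)} = nc_rel N R `` {?w}" if "u \<in> g" "v \<in> h" for u v
      by (rule equiv_class_eq[OF nc_rel_equiv[OF R] rel[OF nc_alg_rel[OF g R that(1) s] nc_alg_rel[OF h R that(2) t]]])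
    then have "(\<Union>u\<in>g. \<Union>v\<in>h. nc_rel N R `` {\<lambda>k. f (u k) (v k)}) = nc_rel N R `` {?w}" using s t by blast
    moreover have "nc_map2 N R f g h = (\<Union>u\<in>g. \<Union>v\<in>h. nc_rel N R `` {\<lambda>k. f (u k) (v k)})" by (auto simp: nc_map2_def)
    ultimately show ?thesis by simp
  qed
  show "nc_map2 N R f g h \<in> nc_alg N R" unfolding eq nc_alg_def by (rule quotientI[OF cauchy[OF sc tc]])
  show "?w \<in> nc_map2 N R f g h"
    unfolding eq by (rule equiv_class_self[OF nc_rel_equiv[OF R] cauchy[OF sc tc]])
qed

lemma nc_add_rep:
  assumes "R > 0" "g \<in> nc_alg N R" "h \<in> nc_alg N R" "s \<in> g" "t \<in> h"
  shows "nc_add N R g h \<in> nc_alg N R" "(\<lambda>k. s k + t k) \<in> nc_add N R g h"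
proof -
  have norm: "ncpoly_norm N R (p + q - (p' + q')) \<le> ncpoly_norm N R (p - p') + ncpoly_norm N R (q - q')"
    if "p \<in> ncpolys N" "q \<in> ncpolys N" "p' \<in> ncpolys N" "q' \<in> ncpolys N" for p q p' q'
  proof -
    have eq: "p + q - (p' + q') = (p - p') + (q - q')" by simp
    show ?thesis unfolding eq by (rule ncpoly_norm_add[OF assms(1) ncpolys_diff[OF that(1,3)] ncpolys_diff[OF that(2,4)]])
  qed
  show "nc_add N R g h \<in> nc_alg N R" "(\<lambda>k. s k + t k) \<in> nc_add N R g h"
    unfolding nc_add_def
    by (rule nc_map2_rep(1)[OF assms ncpolys_add norm], assumption+, rule nc_map2_rep(2)[OF assms ncpolys_add norm])
qed

lemma nc_diff_rep:
  assumes "R > 0" "g \<in> nc_alg N R" "h \<in> nc_alg N R" "s \<in> g" "t \<in> h"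
  shows "nc_diff N R g h \<in> nc_alg N R" "(\<lambda>k. s k - t k) \<in> nc_diff N R g h"
proof -
  have norm: "ncpoly_norm N R (p - q - (p' - q')) \<le> ncpoly_norm N R (p - p') + ncpoly_norm N R (q - q')"
    if "p \<in> ncpolys N" "q \<in> ncpolys N" "p' \<in> ncpolys N" "q' \<in> ncpolys N" for p q p' q'
  proof -
    have eq: "p - q - (p' - q') = (p - p') + (q' - q)" by simp
    show ?thesis unfolding eq
      using ncpoly_norm_add[OF assms(1) ncpolys_diff[OF that(1,3)] ncpolys_diff[OF that(4,2)]]
        ncpoly_norm_minus_commute[OF assms(1) that(4,2)] by linarith
  qed
  show "nc_diff N R g h \<in> nc_alg N R" "(\<lambda>k. s k - t k) \<in> nc_diff N R g h"
    unfolding nc_diff_def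
    by (rule nc_map2_rep(1)[OF assms ncpolys_diff norm], assumption+, rule nc_map2_rep(2)[OF assms ncpolys_diff norm])
qed

lemma nctau_diff:
  assumes R: "R > 0" and g: "g \<in> nc_alg N R" and h: "h \<in> nc_alg N R" and n: "n \<ge> 1" and A: "A \<in> sa_tuples N n R"
  shows "nctau n A (nc_diff N R g h) = nctau n A g - nctau n A h"
proof -
  obtain s t where s: "s \<in> g" and t: "t \<in> h" using nc_alg_rep[OF _ R] g h by metis
  note d = nc_diff_rep[OF R g h s t]
  have "(\<lambda>k. ptau n A (s k - t k)) \<longlonglongrightarrow> nctau n A (nc_diff N R g h)"
    by (rule nctau_limit[OF R d n A])
  moreover have "(\<lambda>k. ptau n A (s k - t k)) \<longlonglongrightarrow> nctau n A g - nctau n A h"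
    unfolding ptau_diff by (intro tendsto_diff nctau_limit[OF R g s n A] nctau_limit[OF R h t n A])
  ultimately show ?thesis by (rule LIMSEQ_unique)
qed

lemma nctau_add:
  assumes R: "R > 0" and g: "g \<in> nc_alg N R" and h: "h \<in> nc_alg N R" and n: "n \<ge> 1" and A: "A \<in> sa_tuples N n R"
  shows "nctau n A (nc_add N R g h) = nctau n A g + nctau n A h"
proof -
  obtain s t where s: "s \<in> g" and t: "t \<in> h" using nc_alg_rep[OF _ R] g h by metis
  note d = nc_add_rep[OF R g h s t]
  have "(\<lambda>k. ptau n A (s k + t k)) \<longlonglongrightarrow> nctau n A (nc_add N R g h)"
    by (rule nctau_limit[OF R d n A])
  moreover have "(\<lambda>k. ptau n A (s k + t k)) \<longlonglongrightarrow> nctau n A g + nctau n A h"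
    unfolding ptau_add by (intro tendsto_add nctau_limit[OF R g s n A] nctau_limit[OF R h t n A])
  ultimately show ?thesis by (rule LIMSEQ_unique)
qed

lemma nc_scale_props:
  assumes R: "R > 0" and h: "h \<in> nc_alg N R"
  shows "nc_scale N R (complex_of_real c) h \<in> nc_alg N R"
    and "n \<ge> 1 \<Longrightarrow> A \<in> sa_tuples N n R \<Longrightarrow> nctau n A (nc_scale N R (complex_of_real c) h) = c * nctau n A h"
proof -
  obtain s where s: "s \<in> h" using nc_alg_rep[OF h R] by blast
  let ?\<phi> = "\<lambda>p. ncconst (complex_of_real c) * p"
  have norm: "ncpoly_norm N R (?\<phi> p) \<le> \<bar>c\<bar> * ncpoly_norm N R p" if p: "p \<in> ncpolys N" for p
  proof (rule ncpoly_norm_leI[OF R])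
    fix n A assume A: "1 \<le> n" "A \<in> sa_tuples N n R"
    have "op_norm (ncpoly_eval n A (?\<phi> p)) \<le> \<bar>c\<bar> * op_norm (ncpoly_eval n A p)"
      unfolding ncpoly_eval_const_mult using op_norm_smult[of "ncpoly_eval n A p" n n "complex_of_real c"] by simp
    also have "\<dots> \<le> \<bar>c\<bar> * ncpoly_norm N R p" by (intro mult_left_mono ncpoly_norm_upper R p A) auto
    finally show "op_norm (ncpoly_eval n A (?\<phi> p)) \<le> \<bar>c\<bar> * ncpoly_norm N R p" .
  qed
  have "?\<phi> p \<in> ncpolys N" if "p \<in> ncpolys N" for p using that by (intro ncpolys_mult ncpolys_const)
  note rep = nc_map_rep[OF R R h s abs_ge_zero[of c] this right_diff_distrib norm]
  show sc: "nc_scale N R (complex_of_real c) h \<in> nc_alg N R" unfolding nc_scale_def by (rule rep(1))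
  assume n: "n \<ge> 1" and A: "A \<in> sa_tuples N n R"
  have "(\<lambda>k. ptau n A ((?\<phi> \<circ> s) k)) \<longlonglongrightarrow> nctau n A (nc_scale N R (complex_of_real c) h)"
    using rep unfolding nc_scale_def[symmetric] by (intro nctau_limit[OF R _ _ n A])
  moreover have "(\<lambda>k. ptau n A ((?\<phi> \<circ> s) k)) \<longlonglongrightarrow> c * nctau n A h"
    unfolding o_def ptau_const_mult by (intro tendsto_mult_left nctau_limit[OF R h s n A])
  ultimately show "nctau n A (nc_scale N R (complex_of_real c) h) = c * nctau n A h" by (rule LIMSEQ_unique)
qed

lemma nc_map_eval:
  assumes R: "R > 0" and R': "R' > 0" and h: "h \<in> nc_alg N R"
    and \<phi>: "\<And>p. p \<in> ncpolys N \<Longrightarrow> \<phi> p \<in> ncpolys N'"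
    and diff: "\<And>p q. \<phi> (p - q) = \<phi> p - \<phi> q"
    and \<Theta>: "\<And>n A. n \<ge> 1 \<Longrightarrow> A \<in> sa_tuples N' n R' \<Longrightarrow> \<Theta> n A \<in> sa_tuples N n R"
    and ev: "\<And>n A p. n \<ge> 1 \<Longrightarrow> A \<in> sa_tuples N' n R' \<Longrightarrow> p \<in> ncpolys N \<Longrightarrow>
        ncpoly_eval n A (\<phi> p) = ncpoly_eval n (\<Theta> n A) p"
  shows "nc_map N' R' \<phi> h \<in> nc_alg N' R'"
    and "n \<ge> 1 \<Longrightarrow> A \<in> sa_tuples N' n R' \<Longrightarrow> nctau n A (nc_map N' R' \<phi> h) = nctau n (\<Theta> n A) h"
proof -
  obtain s where s: "s \<in> h" using nc_alg_rep[OF h R] by blast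
  have norm: "ncpoly_norm N' R' (\<phi> p) \<le> 1 * ncpoly_norm N R p" if p: "p \<in> ncpolys N" for p
  proof (rule ncpoly_norm_leI[OF R'])
    fix n A assume A: "1 \<le> n" "A \<in> sa_tuples N' n R'"
    show "op_norm (ncpoly_eval n A (\<phi> p)) \<le> 1 * ncpoly_norm N R p"
      unfolding ev[OF A p] using ncpoly_norm_upper[OF R p A(1) \<Theta>[OF A]] by simp
  qed
  note rep = nc_map_rep[OF R R' h s zero_le_one \<phi> diff norm]
  show "nc_map N' R' \<phi> h \<in> nc_alg N' R'" by (rule rep(1))
  assume n: "n \<ge> 1" and A: "A \<in> sa_tuples N' n R'"
  have "(\<lambda>k. ptau n A ((\<phi> \<circ> s) k)) \<longlonglongrightarrow> nctau n A (nc_map N' R' \<phi> h)"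
    by (rule nctau_limit[OF R' rep n A])
  moreover have "ptau n A ((\<phi> \<circ> s) k) = ptau n (\<Theta> n A) (s k)" for k
    using ev[OF n A nc_cauchyD[OF nc_alg_cauchy[OF h R s]]] by (simp add: ptau_def)
  moreover have "(\<lambda>k. ptau n (\<Theta> n A) (s k)) \<longlonglongrightarrow> nctau n (\<Theta> n A) h"
    by (rule nctau_limit[OF R h s n \<Theta>[OF n A]])
  ultimately show "nctau n A (nc_map N' R' \<phi> h) = nctau n (\<Theta> n A) h"
    using LIMSEQ_unique by simp
qed

lemma sa_ball_mono: "R \<le> R' \<Longrightarrow> sa_ball n R \<subseteq> sa_ball n R'"
  by (auto simp: sa_ball_def)

lemma sa_tuples_mono: "R \<le> R' \<Longrightarrow> sa_tuples N n R \<subseteq> sa_tuples N n R'"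
  unfolding sa_tuples_def by (intro PiE_mono sa_ball_mono) auto

lemma nc_restrict_props:
  assumes "R\<^sub>1 > 0" "R\<^sub>1 \<le> R" and h: "h \<in> nc_alg N R"
  shows "nc_restrict N R\<^sub>1 h \<in> nc_alg N R\<^sub>1"
    and "n \<ge> 1 \<Longrightarrow> A \<in> sa_tuples N n R\<^sub>1 \<Longrightarrow> nctau n A (nc_restrict N R\<^sub>1 h) = nctau n A h"
proof -
  have R: "R > 0" using assms by simp
  have \<Theta>: "A \<in> sa_tuples N n R" if "A \<in> sa_tuples N n R\<^sub>1" for n A
    using sa_tuples_mono[OF assms(2)] that by blast
  show "nc_restrict N R\<^sub>1 h \<in> nc_alg N R\<^sub>1"
    unfolding nc_restrict_def using \<Theta> by (intro nc_map_eval(1)[OF R assms(1) h, where \<Theta> = "\<lambda>n A. A"]) auto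
  show "n \<ge> 1 \<Longrightarrow> A \<in> sa_tuples N n R\<^sub>1 \<Longrightarrow> nctau n A (nc_restrict N R\<^sub>1 h) = nctau n A h"
    unfolding nc_restrict_def using \<Theta> by (intro nc_map_eval(2)[OF R assms(1) h, where \<Theta> = "\<lambda>n A. A"]) auto
qed

definition scale_tuple :: "nat \<Rightarrow> real \<Rightarrow> (nat \<Rightarrow> complex Matrix.mat) \<Rightarrow> nat \<Rightarrow> complex Matrix.mat" where
  "scale_tuple N c A = (\<lambda>i\<in>{1..N}. complex_of_real c \<cdot>\<^sub>m A i)"

lemma sa_mats_smult: "A \<in> sa_mats n \<Longrightarrow> complex_of_real c \<cdot>\<^sub>m A \<in> sa_mats n"
proof -
  assume A: "A \<in> sa_mats n"
  note a = sa_matsD[OF A]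
  have "mat_adjoint (complex_of_real c \<cdot>\<^sub>m A) = complex_of_real c \<cdot>\<^sub>m mat_adjoint A"
    using a(1) by (intro eq_matI) auto
  then show ?thesis using a by (auto simp: sa_mats_def)
qed

lemma sa_ball_smult:
  assumes c: "c > 0" and A: "A \<in> sa_ball n R"
  shows "complex_of_real c \<cdot>\<^sub>m A \<in> sa_ball n (c * R)"
proof -
  have a: "A \<in> sa_mats n" "op_norm A \<le> R" using A by (auto simp: sa_ball_def)
  have "op_norm (complex_of_real c \<cdot>\<^sub>m A) \<le> c * op_norm A"
    using op_norm_smult[OF sa_matsD(1)[OF a(1)], of "complex_of_real c"] c by simp
  also have "\<dots> \<le> c * R" using a(2) c by (intro mult_left_mono) auto
  finally show ?thesis using sa_mats_smult[OF a(1)] by (simp add: sa_ball_def)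
qed

lemma scale_tuple_sa_tuples:
  "c > 0 \<Longrightarrow> A \<in> sa_tuples N n R \<Longrightarrow> scale_tuple N c A \<in> sa_tuples N n (c * R)"
  unfolding sa_tuples_def scale_tuple_def using sa_ball_smult by (auto simp: PiE_iff)

lemma nc_dilate_props:
  assumes R: "R > 0" and R1: "R\<^sub>1 > 0" and h: "h \<in> nc_alg N R"
  shows "nc_dilate N R R\<^sub>1 h \<in> nc_alg N R\<^sub>1"
    and "n \<ge> 1 \<Longrightarrow> A \<in> sa_tuples N n R\<^sub>1 \<Longrightarrow> nctau n A (nc_dilate N R R\<^sub>1 h) = nctau n (scale_tuple N (R / R\<^sub>1) A) h"
proof -
  let ?\<sigma> = "\<lambda>i. ncconst (complex_of_real (R / R\<^sub>1)) * ncvar i"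
  have \<sigma>: "?\<sigma> i \<in> ncpolys N" if "i \<in> {1..N}" for i using that by (intro ncpolys_mult ncpolys_const ncpolys_var)
  have \<Theta>: "scale_tuple N (R / R\<^sub>1) A \<in> sa_tuples N n R" if "A \<in> sa_tuples N n R\<^sub>1" for n A
    using scale_tuple_sa_tuples[OF _ that, of "R / R\<^sub>1"] R R1 by simp
  have ev: "ncpoly_eval n A (ncpoly_subst ?\<sigma> p) = ncpoly_eval n (scale_tuple N (R / R\<^sub>1) A) p"
    if A: "A \<in> sa_tuples N n R\<^sub>1" and p: "p \<in> ncpolys N" for n A p
  proof -
    have "ncpoly_eval n A (ncpoly_subst ?\<sigma> p) = ncpoly_eval n (\<lambda>i. ncpoly_eval n A (?\<sigma> i)) p"
      by (rule ncpoly_eval_subst[OF sa_tuplesD(2)[OF A] p \<sigma>])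
    also have "\<dots> = ncpoly_eval n (scale_tuple N (R / R\<^sub>1) A) p"
      using sa_tuplesD(2)[OF A] by (intro ncpoly_eval_cong[OF p]) (simp add: ncpoly_eval_const_mult ncpoly_eval_var scale_tuple_def)
    finally show ?thesis .
  qed
  note * = nc_map_eval[OF R R1 h, of "ncpoly_subst ?\<sigma>" N "\<lambda>n. scale_tuple N (R / R\<^sub>1)"]
  show "nc_dilate N R R\<^sub>1 h \<in> nc_alg N R\<^sub>1"
    unfolding nc_dilate_def using \<Theta> ev ncpolys_subst[OF _ \<sigma>] ncpoly_subst_diff by (intro *(1)) auto
  show "n \<ge> 1 \<Longrightarrow> A \<in> sa_tuples N n R\<^sub>1 \<Longrightarrow> nctau n A (nc_dilate N R R\<^sub>1 h) = nctau n (scale_tuple N (R / R\<^sub>1) A) h"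
    unfolding nc_dilate_def using \<Theta> ev ncpolys_subst[OF _ \<sigma>] ncpoly_subst_diff by (intro *(2)) auto
qed

lemma nc_embed_left_props:
  assumes R: "R > 0" and L: "L \<le> N" and h: "h \<in> nc_alg L R"
  shows "nc_embed_left N R h \<in> nc_alg N R"
    and "n \<ge> 1 \<Longrightarrow> A \<in> sa_tuples N n R \<Longrightarrow> nctau n A (nc_embed_left N R h) = nctau n (restrict A {1..L}) h"
proof -
  have \<Theta>: "restrict A {1..L} \<in> sa_tuples L n R" if "A \<in> sa_tuples N n R" for n A
    using that L by (auto simp: sa_tuples_def PiE_iff)
  have ev: "ncpoly_eval n A (id p) = ncpoly_eval n (restrict A {1..L}) p" if "p \<in> ncpolys L" for n A p
    unfolding id_def by (rule ncpoly_eval_cong[OF that]) simp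
  note * = nc_map_eval[OF R R h, of id N "\<lambda>n A. restrict A {1..L}"]
  have \<phi>: "id p \<in> ncpolys N" if "p \<in> ncpolys L" for p using ncpolys_mono[OF L] that by auto
  have diff: "id (p - q) = id p - id q" for p q :: ncpoly by simp
  show "nc_embed_left N R h \<in> nc_alg N R"
    unfolding nc_embed_left_def by (rule *(1)[OF \<phi> diff \<Theta> ev])
  show "n \<ge> 1 \<Longrightarrow> A \<in> sa_tuples N n R \<Longrightarrow> nctau n A (nc_embed_left N R h) = nctau n (restrict A {1..L}) h"
    unfolding nc_embed_left_def by (rule *(2)[OF \<phi> diff \<Theta> ev])
qed

lemma nc_embed_right_props:
  assumes R: "R > 0" and L: "L \<le> N" and h: "h \<in> nc_alg (N - L) R"
  shows "nc_embed_right L N R h \<in> nc_alg N R"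
    and "n \<ge> 1 \<Longrightarrow> A \<in> sa_tuples N n R \<Longrightarrow>
      nctau n A (nc_embed_right L N R h) = nctau n (\<lambda>i\<in>{1..N - L}. A (L + i)) h"
proof -
  let ?\<sigma> = "\<lambda>i. ncvar (L + i)"
  let ?\<Theta> = "\<lambda>n A. \<lambda>i\<in>{1..N - L}. A (L + i)"
  have \<sigma>: "?\<sigma> i \<in> ncpolys N" if "i \<in> {1..N - L}" for i using that L by (intro ncpolys_var) auto
  have \<Theta>: "?\<Theta> n A \<in> sa_tuples (N - L) n R" if "A \<in> sa_tuples N n R" for n A
    using that L by (auto simp: sa_tuples_def PiE_iff)
  have ev: "ncpoly_eval n A (ncpoly_subst ?\<sigma> p) = ncpoly_eval n (?\<Theta> n A) p"
    if A: "A \<in> sa_tuples N n R" and p: "p \<in> ncpolys (N - L)" for n A p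
  proof -
    have "ncpoly_eval n A (ncpoly_subst ?\<sigma> p) = ncpoly_eval n (\<lambda>i. ncpoly_eval n A (?\<sigma> i)) p"
      by (rule ncpoly_eval_subst[OF sa_tuplesD(2)[OF A] p \<sigma>])
    also have "\<dots> = ncpoly_eval n (?\<Theta> n A) p"
    proof (rule ncpoly_eval_cong[OF p])
      fix i assume i: "i \<in> {1..N - L}"
      then have "L + i \<in> {1..N}" using L by auto
      then show "ncpoly_eval n A (ncvar (L + i)) = ?\<Theta> n A i"
        using sa_tuplesD(2)[OF A] i by (simp add: ncpoly_eval_var)
    qed
    finally show ?thesis .
  qed
  note * = nc_map_eval[OF R R h, of "ncpoly_subst ?\<sigma>" N ?\<Theta>]
  show "nc_embed_right L N R h \<in> nc_alg N R"
    unfolding nc_embed_right_def using \<Theta> ev ncpolys_subst[OF _ \<sigma>] ncpoly_subst_diff by (intro *(1)) auto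
  show "n \<ge> 1 \<Longrightarrow> A \<in> sa_tuples N n R \<Longrightarrow>
      nctau n A (nc_embed_right L N R h) = nctau n (\<lambda>i\<in>{1..N - L}. A (L + i)) h"
    unfolding nc_embed_right_def using \<Theta> ev ncpolys_subst[OF _ \<sigma>] ncpoly_subst_diff by (intro *(2)) auto
qed

lemma nctau_mono:
  assumes R: "R > 0" and g: "g \<in> nc_alg N R" and h: "h \<in> nc_alg N R" and le: "nc_le N R g h"
    and n: "n \<ge> 1" and A: "A \<in> sa_tuples N n R"
  shows "nctau n A g \<le> nctau n A h"
proof -
  obtain b where b: "b \<in> nc_alg N R" and eq: "nc_diff N R h g = nc_mult N R (nc_star N R b) b"
    using le by (auto simp: nc_le_def)
  obtain s0 t0 where "s0 \<in> h" "t0 \<in> g" using nc_alg_rep[OF _ R] g h by metis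
  note d = nc_diff_rep[OF R h g this]
  obtain x where x: "x \<in> nc_diff N R h g" using d by blast
  then obtain u v where u: "u \<in> nc_star N R b" and v: "v \<in> b" and xuv: "((\<lambda>k. u k * v k), x) \<in> nc_rel N R"
    unfolding eq nc_mult_def nc_map2_def by blast
  obtain s where s: "s \<in> b" and su: "(ncpoly_star \<circ> s, u) \<in> nc_rel N R"
    using u unfolding nc_star_def nc_map_def by blast
  have Asa: "A i \<in> sa_mats n" if "i \<in> {1..N}" for i using sa_tuplesD(1)[OF A that] .
  have Ac: "A i \<in> carrier_mat n n" if "i \<in> {1..N}" for i using sa_tuplesD(2)[OF A that] .
  let ?e = "\<lambda>p i j. ncpoly_eval n A p $$ (i, j)"
  have rel: "(\<lambda>k. ?e (y k) i j - ?e (z k) i j) \<longlonglongrightarrow> 0"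
    if yz: "(y, z) \<in> nc_rel N R" and ij: "i < n" "j < n" for y z i j
  proof (rule Lim_null_comparison[OF always_eventually])
    have yc: "y \<in> nc_cauchy N R" and zc: "z \<in> nc_cauchy N R" using yz by (auto simp: nc_rel_def)
    show "(\<lambda>k. ncpoly_norm N R (y k - z k)) \<longlonglongrightarrow> 0" using yz by (simp add: nc_rel_def)
    show "\<forall>k. norm (?e (y k) i j - ?e (z k) i j) \<le> ncpoly_norm N R (y k - z k)"
    proof
      fix k
      have "?e (y k) i j - ?e (z k) i j = ncpoly_eval n A (y k - z k) $$ (i, j)"
        using ij by (simp add: ncpoly_eval_diff)
      also have "cmod \<dots> \<le> op_norm (ncpoly_eval n A (y k - z k))"
        by (rule cmod_entry_le_op_norm[of _ n n]) (use ij in auto)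
      also have "\<dots> \<le> ncpoly_norm N R (y k - z k)"
        by (intro ncpoly_norm_upper R ncpolys_diff nc_cauchyD[OF yc] nc_cauchyD[OF zc] n A)
      finally show "norm (?e (y k) i j - ?e (z k) i j) \<le> ncpoly_norm N R (y k - z k)" .
    qed
  qed
  have sc: "s k \<in> ncpolys N" and vc: "v k \<in> ncpolys N" for k
    using nc_cauchyD nc_alg_cauchy[OF b R] s v by blast+
  have uc: "u k \<in> ncpolys N" and ssc: "ncpoly_star (s k) \<in> ncpolys N" for k
    using su nc_cauchyD[of u N R k] nc_cauchyD[of "ncpoly_star \<circ> s" N R k] by (auto simp: nc_rel_def)
  define E where "E i j = nc_eval n A b $$ (i, j)" for i j
  have lv: "(\<lambda>k. ?e (v k) i j) \<longlonglongrightarrow> E i j" if "i < n" "j < n" for i j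
    unfolding E_def by (rule nc_eval_limit[OF R b v n A that])
  have ls: "(\<lambda>k. ?e (s k) i j) \<longlonglongrightarrow> E i j" if "i < n" "j < n" for i j
    unfolding E_def by (rule nc_eval_limit[OF R b s n A that])
  have lu: "(\<lambda>k. ?e (u k) i j) \<longlonglongrightarrow> cnj (E j i)" if ij: "i < n" "j < n" for i j
  proof -
    have "?e (ncpoly_star (s k)) i j = cnj (?e (s k) j i)" for k
      using ncpoly_eval_star[OF Asa sc] ij by simp
    then have "(\<lambda>k. ?e ((ncpoly_star \<circ> s) k) i j) \<longlonglongrightarrow> cnj (E j i)"
      using tendsto_cnj[OF ls[OF ij(2,1)]] by simp
    from tendsto_diff[OF this rel[OF su ij]] show ?thesis by simp
  qed
  have luv: "(\<lambda>k. ?e (u k * v k) i i) \<longlonglongrightarrow> (\<Sum>l<n. cnj (E l i) * E l i)" if i: "i < n" for i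
  proof -
    have "?e (u k * v k) i i = (\<Sum>l<n. ?e (u k) i l * ?e (v k) l i)" for k
    proof -
      have "ncpoly_eval n A (u k * v k) = ncpoly_eval n A (u k) * ncpoly_eval n A (v k)"
        by (rule ncpoly_eval_mult[OF Ac uc vc])
      then show ?thesis using i by (auto simp: scalar_prod_def atLeast0LessThan intro!: sum.cong)
    qed
    moreover have "(\<lambda>k. \<Sum>l<n. ?e (u k) i l * ?e (v k) l i) \<longlonglongrightarrow> (\<Sum>l<n. cnj (E l i) * E l i)"
      using i by (intro tendsto_sum tendsto_mult lu lv) auto
    ultimately show ?thesis by simp
  qed
  have lx: "(\<lambda>k. ?e (x k) i i) \<longlonglongrightarrow> (\<Sum>l<n. cnj (E l i) * E l i)" if i: "i < n" for i
    using tendsto_diff[OF luv[OF i] rel[OF xuv i i]] by simp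
  have "(\<lambda>k. ptau n A (x k)) \<longlonglongrightarrow> (\<Sum>i<n. Re (\<Sum>l<n. cnj (E l i) * E l i)) / real n"
    unfolding ptau_eq using n by (intro tendsto_divide tendsto_sum tendsto_Re lx tendsto_const) auto
  moreover have "(\<lambda>k. ptau n A (x k)) \<longlonglongrightarrow> nctau n A (nc_diff N R h g)"
    by (rule nctau_limit[OF R d(1) x n A])
  ultimately have "nctau n A (nc_diff N R h g) = (\<Sum>i<n. Re (\<Sum>l<n. cnj (E l i) * E l i)) / real n"
    using LIMSEQ_unique by blast
  also have "\<dots> \<ge> 0" by (intro divide_nonneg_nonneg sum_nonneg) (auto intro!: sum_nonneg add_nonneg_nonneg)
  finally show ?thesis using nctau_diff[OF R h g n A] by simp
qed

subsection \<open>The measure \<open>\<Lambda>\<^sub>n\<close> and its products\<close>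

lemma inj_on_sa_of_coords: "inj_on (sa_of_coords n) (space (herm_lborel n))"
  by (rule inj_on_inverseI[of _ "herm_coords n"]) (simp add: herm_coords_sa_of_coords)

lemma space_Lambda [simp]: "space (Lambda n) = sa_mats n"
proof -
  have "sa_of_coords n ` extensional ({..<n} \<times> {..<n}) = sa_mats n"
  proof safe
    fix A assume "A \<in> sa_mats n"
    then have "A = sa_of_coords n (herm_coords n A)" by (simp add: sa_of_coords_herm_coords)
    then show "A \<in> sa_of_coords n ` extensional ({..<n} \<times> {..<n})"
      by (rule image_eqI[where f = "sa_of_coords n"]) simp
  qed simp
  then show ?thesis by (simp add: Lambda_def space_scale_measure space_embed_measure)
qed

lemma measurable_from_Lambda:
  assumes "(\<lambda>x. f (sa_of_coords n x)) \<in> measurable (herm_lborel n) N"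
  shows "f \<in> measurable (Lambda n) N"
proof -
  have "f \<in> measurable (embed_measure (herm_lborel n) (sa_of_coords n)) N"
    by (rule measurable_embed_measure1) (rule assms)
  then show ?thesis unfolding Lambda_def by (simp add: measurable_cong_sets[OF sets_scale_measure refl])
qed

lemma measurable_sa_of_coords: "sa_of_coords n \<in> measurable (herm_lborel n) (Lambda n)"
  using measurable_embed_measure2'[OF inj_on_sa_of_coords[of n]]
  unfolding Lambda_def by (simp add: measurable_cong_sets[OF refl sets_scale_measure])

lemma measurable_into_Lambda:
  assumes A: "mat_measurable M n n A" and sa: "\<And>x. x \<in> space M \<Longrightarrow> A x \<in> sa_mats n"
  shows "A \<in> measurable M (Lambda n)"
proof -
  have "(\<lambda>x. sa_of_coords n (herm_coords n (A x))) \<in> measurable M (Lambda n)"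
    by (rule measurable_compose[OF measurable_herm_coords[OF A] measurable_sa_of_coords])
  then show ?thesis
    by (rule measurable_cong[THEN iffD1, rotated]) (simp add: sa_of_coords_herm_coords sa)
qed

lemma nn_integral_Lambda:
  assumes f: "f \<in> borel_measurable (Lambda n)"
  shows "(\<integral>\<^sup>+A. f A \<partial>Lambda n) = 2 ^ (n * (n - 1) div 2) * (\<integral>\<^sup>+x. f (sa_of_coords n x) \<partial>herm_lborel n)"
proof -
  have f': "f \<in> borel_measurable (embed_measure (herm_lborel n) (sa_of_coords n))"
    using f unfolding Lambda_def by (simp add: measurable_cong_sets[OF sets_scale_measure refl])
  show ?thesis
    unfolding Lambda_def nn_integral_scale_measure[OF f'] nn_integral_embed_measure'[OF inj_on_sa_of_coords f'] ..
qed

lemma sigma_finite_Lambda: "sigma_finite_measure (Lambda n)"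
proof
  interpret sigma_finite_measure "herm_lborel n" by (rule lborel_product.sigma_finite) simp
  obtain A :: "nat \<Rightarrow> (nat \<times> nat \<Rightarrow> real) set" where A: "range A \<subseteq> sets (herm_lborel n)"
      "(\<Union>i. A i) = space (herm_lborel n)" "\<And>i. emeasure (herm_lborel n) (A i) \<noteq> \<infinity>"
    using sigma_finite by blast
  have "(\<Union>i. sa_of_coords n ` A i) = sa_of_coords n ` space (herm_lborel n)"
    unfolding A(2)[symmetric] by blast
  also have "\<dots> = space (Lambda n)"
    by (simp add: Lambda_def space_scale_measure space_embed_measure del: space_Lambda)
  finally have un: "\<Union> (range (\<lambda>i. sa_of_coords n ` A i)) = space (Lambda n)" .
  have "emeasure (Lambda n) (sa_of_coords n ` A i) \<noteq> \<infinity>" for i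
    using A(1,3) emeasure_embed_measure_image'[OF inj_on_sa_of_coords, of "A i" n]
    by (auto simp: Lambda_def ennreal_mult_eq_top_iff power_eq_top_ennreal)
  moreover have "sa_of_coords n ` A i \<in> sets (Lambda n)" for i
    using A(1) by (auto simp: Lambda_def intro!: in_sets_embed_measure)
  ultimately show "\<exists>A. countable A \<and> A \<subseteq> sets (Lambda n) \<and> \<Union> A = space (Lambda n) \<and> (\<forall>a\<in>A. emeasure (Lambda n) a \<noteq> \<infinity>)"
    using un by (intro exI[of _ "range (\<lambda>i. sa_of_coords n ` A i)"]) auto
qed

interpretation Lambda_product: product_sigma_finite "\<lambda>_. Lambda n" for n
  by (simp add: product_sigma_finite_def sigma_finite_Lambda)

abbreviation Lambda_PiM :: "nat \<Rightarrow> nat set \<Rightarrow> (nat \<Rightarrow> complex Matrix.mat) measure" where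
  "Lambda_PiM n I \<equiv> \<Pi>\<^sub>M i\<in>I. Lambda n"

lemma mat_measurable_Lambda: "mat_measurable (Lambda n) n n (\<lambda>A. A)"
  unfolding mat_measurable_def
  using mat_measurableD(2)[OF mat_measurable_sa_of_coords[of n]]
  by (auto intro!: measurable_from_Lambda simp: sa_mats_def)

lemma mat_measurable_component:
  "i \<in> I \<Longrightarrow> mat_measurable (Lambda_PiM n I) n n (\<lambda>A. A i)"
  by (rule mat_measurable_compose[OF mat_measurable_Lambda]) simp

lemma sets_sa_ball:
  assumes R: "R > 0"
  shows "sa_ball n R \<in> sets (Lambda n)"
proof -
  have "sa_ball n R = {A \<in> space (Lambda n). \<forall>k. tr_pow n A (2 * k) \<le> real n * R ^ (2 * k)}"
    using op_norm_le_iff_tr_pow[OF _ R] by (auto simp: sa_ball_def)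
  also have "\<dots> \<in> sets (Lambda n)"
    using measurable_tr_pow[OF mat_measurable_Lambda] by measurable
  finally show ?thesis .
qed

lemma sets_sa_tuples: "R > 0 \<Longrightarrow> sa_tuples N n R \<in> sets (Lambda_PiM n {1..N})"
  unfolding sa_tuples_def by (intro sets_PiM_I_finite sets_sa_ball) auto

lemma mat_measurable_word_eval:
  "set is \<subseteq> I \<Longrightarrow> mat_measurable (Lambda_PiM n I) n n (\<lambda>A. word_eval n A (NCWord is))"
proof (induction "is")
  case Nil
  then show ?case by (simp add: word_eval_Nil mat_measurable_const)
next
  case (Cons i "is")
  then show ?case unfolding word_eval_Cons by (intro mat_measurable_mult[where m = n] mat_measurable_component) auto
qed

lemma measurable_ptau:
  assumes p: "p \<in> ncpolys N"
  shows "(\<lambda>A. ptau n A p) \<in> borel_measurable (Lambda_PiM n {1..N})"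
proof -
  have m: "(\<lambda>A. word_eval n A w $$ (i, i)) \<in> borel_measurable (Lambda_PiM n {1..N})"
    if "w \<in> Poly_Mapping.keys p" "i < n" for w i
    using mat_measurableD(2)[OF mat_measurable_word_eval[of "letters w" "{1..N}" n] that(2,2)] ncpolysD[OF p that(1)] by simp
  have "(\<lambda>A. (\<Sum>i<n. Re (\<Sum>w\<in>Poly_Mapping.keys p. Poly_Mapping.lookup p w * word_eval n A w $$ (i, i))) / real n)
      \<in> borel_measurable (Lambda_PiM n {1..N})"
    using m by (intro borel_measurable_divide borel_measurable_sum borel_measurable_Re borel_measurable_times borel_measurable_const) auto
  then show ?thesis
    by (rule measurable_cong[THEN iffD1, rotated]) (auto simp: ptau_eq ncpoly_eval_def intro!: sum.cong)
qed

lemma measurable_nctau: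
  assumes R: "R > 0" and h: "h \<in> nc_alg N R" and n: "n \<ge> 1"
  shows "(\<lambda>A. nctau n A h * indicator (sa_tuples N n R) A) \<in> borel_measurable (Lambda_PiM n {1..N})"
proof -
  obtain s where s: "s \<in> h" using nc_alg_rep[OF h R] by blast
  note [measurable] = sets_sa_tuples[OF R] measurable_ptau[OF nc_cauchyD[OF nc_alg_cauchy[OF h R s]]]
  show ?thesis
  proof (rule borel_measurable_LIMSEQ_real[where u = "\<lambda>k A. ptau n A (s k) * indicator (sa_tuples N n R) A"])
    fix A
    show "(\<lambda>k. ptau n A (s k) * indicator (sa_tuples N n R) A) \<longlonglongrightarrow> nctau n A h * indicator (sa_tuples N n R) A"
      using nctau_limit[OF R h s n] by (cases "A \<in> sa_tuples N n R") auto
  qed measurable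
qed

subsection \<open>One matrix with a polynomial potential\<close>

definition poly_potential :: "ncpoly \<Rightarrow> real \<Rightarrow> real" where
  "poly_potential p x = (\<Sum>w\<in>Poly_Mapping.keys p. Re (Poly_Mapping.lookup p w) * x ^ length (letters w))"

lemma word_eval_conj_diag:
  assumes U: "unitary_mat n U" and A: "\<And>i. i \<in> set is \<Longrightarrow> A i = conj_by U (real_diag n d)"
  shows "word_eval n A (NCWord is) = conj_by U (real_diag n (\<lambda>i. d i ^ length is))"
  using A
proof (induction "is")
  case Nil
  have "real_diag n (\<lambda>i. 1) = 1\<^sub>m n" by (intro eq_matI) auto
  then show ?case using unitary_matD[OF U] by (simp add: word_eval_Nil conj_by_def)
next
  case (Cons i "is")
  have "word_eval n A (NCWord (i # is)) = conj_by U (real_diag n d) * conj_by U (real_diag n (\<lambda>i. d i ^ length is))"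
    using Cons by (simp add: word_eval_Cons)
  also have "\<dots> = conj_by U (real_diag n d * real_diag n (\<lambda>i. d i ^ length is))"
    by (rule conj_by_mult[symmetric, OF U]) auto
  also have "real_diag n d * real_diag n (\<lambda>i. d i ^ length is) = real_diag n (\<lambda>j. d j ^ length (i # is))"
    by (simp add: real_diag_mult)
  finally show ?case .
qed

lemma ptau_one_variable:
  assumes P: "P \<in> ncpolys 1" and A: "A 1 \<in> sa_mats n" and n: "n \<ge> 1"
  shows "real n * ptau n A P = (\<Sum>w\<in>Poly_Mapping.keys P. Re (Poly_Mapping.lookup P w) * tr_pow n (A 1) (length (letters w)))"
proof -
  obtain U d where U: "unitary_mat n U" and Ud: "A 1 = conj_by U (real_diag n d)"
    using spectral_theorem[OF A] by blast
  have w: "(\<Sum>i<n. word_eval n A w $$ (i, i)) = complex_of_real (tr_pow n (A 1) (length (letters w)))"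
    if "w \<in> Poly_Mapping.keys P" for w
  proof -
    have "A i = conj_by U (real_diag n d)" if "i \<in> set (letters w)" for i
      using ncpolysD[OF P \<open>w \<in> _\<close>] that Ud by auto
    from word_eval_conj_diag[OF U this, of "letters w"]
    have "word_eval n A w = conj_by U (real_diag n (\<lambda>i. d i ^ length (letters w)))" by simp
    then show ?thesis
      unfolding Ud tr_pow_conj_diag[OF U] by (simp add: trace_conj_by[OF U])
  qed
  have "real n * ptau n A P = Re (\<Sum>i<n. \<Sum>w\<in>Poly_Mapping.keys P. Poly_Mapping.lookup P w * word_eval n A w $$ (i, i))"
    using n by (simp add: ptau_eq ncpoly_eval_def)
  also have "(\<Sum>i<n. \<Sum>w\<in>Poly_Mapping.keys P. Poly_Mapping.lookup P w * word_eval n A w $$ (i, i))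
      = (\<Sum>w\<in>Poly_Mapping.keys P. Poly_Mapping.lookup P w * (\<Sum>i<n. word_eval n A w $$ (i, i)))"
    unfolding sum_distrib_left by (rule sum.swap)
  finally show ?thesis by (simp add: w)
qed

context
  fixes R c :: real and P :: ncpoly
  assumes R: "R > 0"
begin

definition cut_weight :: "real \<Rightarrow> ennreal" where
  "cut_weight x = ennreal (exp (- (c * poly_potential P x))) * indicator {-R..R} x"

lemma eig_prod_cut_weight:
  assumes A: "A \<in> sa_mats m"
  shows "eig_prod cut_weight A =
    ennreal (exp (- (c * (\<Sum>w\<in>Poly_Mapping.keys P. Re (Poly_Mapping.lookup P w) * tr_pow m A (length (letters w)))))) * indicator (sa_ball m R) A"
proof -
  obtain U d where U: "unitary_mat m U" and Ud: "A = conj_by U (real_diag m d)"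
    using spectral_theorem[OF A] by blast
  have "eig_prod cut_weight A = (\<Prod>i<m. ennreal (exp (- (c * poly_potential P (d i)))) * indicator {-R..R} (d i))"
    unfolding Ud by (simp add: eig_prod_conj_by[OF U] eig_prod_real_diag cut_weight_def)
  also have "\<dots> = ennreal (exp (- (c * (\<Sum>i<m. poly_potential P (d i))))) * (\<Prod>i<m. indicator {-R..R} (d i))"
    by (simp add: prod.distrib prod_ennreal exp_sum sum_negf sum_distrib_left flip: sum_negf)
  also have "(\<Sum>i<m. poly_potential P (d i)) = (\<Sum>w\<in>Poly_Mapping.keys P. Re (Poly_Mapping.lookup P w) * tr_pow m A (length (letters w)))"
    unfolding poly_potential_def Ud tr_pow_conj_diag[OF U] sum_distrib_left by (rule sum.swap)
  also have "(\<Prod>i<m. indicator {-R..R} (d i)) = (indicator (sa_ball m R) A :: ennreal)"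
  proof -
    have "A \<in> sa_ball m R \<longleftrightarrow> (\<forall>i<m. d i \<in> {-R..R})"
      using op_norm_conj_diag_le_iff[OF U, of R d] R A Ud by (auto simp: sa_ball_def abs_le_iff minus_le_iff)
    then show ?thesis by (auto simp: indicator_def prod_zero_iff)
  qed
  finally show ?thesis .
qed

lemma measurable_poly_potential [measurable]: "poly_potential P \<in> borel_measurable borel"
  unfolding poly_potential_def by measurable

lemma measurable_cut_weight: "cut_weight \<in> borel_measurable borel"
  unfolding cut_weight_def by measurable

lemma measurable_eig_prod_cut_weight: "eig_prod cut_weight \<in> borel_measurable (Lambda m)"
proof -
  note [measurable] = sets_sa_ball[OF R, of m] measurable_tr_pow[OF mat_measurable_Lambda[of m]]
  have "(\<lambda>A. ennreal (exp (- (c * (\<Sum>w\<in>Poly_Mapping.keys P. Re (Poly_Mapping.lookup P w) * tr_pow m A (length (letters w)))))) * indicator (sa_ball m R) A)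
     \<in> borel_measurable (Lambda m)" by measurable
  then show ?thesis
    by (rule measurable_cong[THEN iffD1, rotated]) (simp add: eig_prod_cut_weight)
qed

lemma herm_borel_eig_prod_cut_weight: "herm_borel m (eig_prod cut_weight)"
  by (rule measurable_compose[OF measurable_sa_of_coords measurable_eig_prod_cut_weight])

end

lemma confined_log_gas_poly_potential:
  assumes R: "R > 0"
  shows "\<exists>L B. confined_log_gas R L B (poly_potential P)"
proof -
  let ?a = "\<lambda>w. Re (Poly_Mapping.lookup P w)" and ?k = "\<lambda>w. length (letters w)" and ?K = "Poly_Mapping.keys P"
  define L where "L = (\<Sum>w\<in>?K. \<bar>?a w\<bar> * (real (?k w) * R ^ (?k w - 1)))"
  define B where "B = (\<Sum>w\<in>?K. \<bar>?a w\<bar> * R ^ ?k w)"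
  have "confined_log_gas R L B (poly_potential P)"
  proof
    show "R > 0" by (rule R)
    show "L \<ge> 0" unfolding L_def using R by (intro sum_nonneg mult_nonneg_nonneg) auto
    show "\<bar>poly_potential P x\<bar> \<le> B" if "\<bar>x\<bar> \<le> R" for x
      unfolding poly_potential_def B_def
      by (rule order_trans[OF sum_abs]) (use that in \<open>auto simp: abs_mult power_abs intro!: sum_mono mult_left_mono power_mono\<close>)
    show "\<bar>poly_potential P x - poly_potential P y\<bar> \<le> L * \<bar>x - y\<bar>" if "\<bar>x\<bar> \<le> R" "\<bar>y\<bar> \<le> R" for x y
    proof -
      have "norm (poly_potential P x - poly_potential P y) \<le> L * norm (x - y)"
      proof (rule field_differentiable_bound[of "{-R..R}"])
        fix z assume z: "z \<in> {-R..R}"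
        show "(poly_potential P has_field_derivative (\<Sum>w\<in>?K. ?a w * (real (?k w) * z ^ (?k w - 1)))) (at z within {-R..R})"
          unfolding poly_potential_def by (auto intro!: derivative_eq_intros sum.cong)
        show "norm (\<Sum>w\<in>?K. ?a w * (real (?k w) * z ^ (?k w - 1))) \<le> L"
          unfolding L_def real_norm_def
          by (rule order_trans[OF sum_abs]) (use z in \<open>auto simp: abs_mult power_abs abs_le_iff intro!: sum_mono mult_left_mono power_mono\<close>)
      qed (use that in auto)
      then show ?thesis by simp
    qed
    show "poly_potential P \<in> borel_measurable borel" unfolding poly_potential_def by measurable
  qed
  then show ?thesis by blast
qed

lemma nn_integral_one_matrix:
  assumes R: "R > 0" and P: "P \<in> ncpolys 1" and n: "n \<ge> 1"
  shows "(\<integral>\<^sup>+A. ennreal (exp (- ((real n)\<^sup>2 * ptau n A P))) * indicator (sa_tuples 1 n R) A \<partial>Lambda_PiM n {1..1})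
    = 2 ^ (n * (n - 1) div 2) * (ennreal (\<Prod>k<n. pi ^ k / fact k) * confined_log_gas.Z R (poly_potential P) n)"
proof -
  obtain L B where "confined_log_gas R L B (poly_potential P)"
    using confined_log_gas_poly_potential[OF R] by blast
  then interpret confined_log_gas R L B "poly_potential P" .
  let ?\<phi> = "cut_weight R (real n) P"
  have "(\<integral>\<^sup>+A. ennreal (exp (- ((real n)\<^sup>2 * ptau n A P))) * indicator (sa_tuples 1 n R) A \<partial>Lambda_PiM n {1})
     = (\<integral>\<^sup>+A. eig_prod ?\<phi> (A 1) \<partial>Lambda_PiM n {1})"
  proof (rule nn_integral_cong)
    fix A assume A: "A \<in> space (Lambda_PiM n {1})"
    then have A1: "A 1 \<in> sa_mats n" by (auto simp: space_PiM PiE_iff)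
    have "(real n)\<^sup>2 * ptau n A P = real n * (\<Sum>w\<in>Poly_Mapping.keys P. Re (Poly_Mapping.lookup P w) * tr_pow n (A 1) (length (letters w)))"
      using ptau_one_variable[of P A n, OF P A1 n] by (simp add: power2_eq_square)
    moreover have "A \<in> sa_tuples 1 n R \<longleftrightarrow> A 1 \<in> sa_ball n R"
      using A by (auto simp: sa_tuples_def space_PiM PiE_iff)
    ultimately show "ennreal (exp (- ((real n)\<^sup>2 * ptau n A P))) * indicator (sa_tuples 1 n R) A = eig_prod ?\<phi> (A 1)"
      unfolding eig_prod_cut_weight[OF R A1] by (simp add: indicator_def)
  qed
  also have "\<dots> = (\<integral>\<^sup>+A. eig_prod ?\<phi> A \<partial>Lambda n)"
    by (rule Lambda_product.product_nn_integral_singleton[OF measurable_eig_prod_cut_weight[OF R]])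
  also have "\<dots> = 2 ^ (n * (n - 1) div 2) * (\<integral>\<^sup>+x. eig_prod ?\<phi> (sa_of_coords n x) \<partial>herm_lborel n)"
    by (rule nn_integral_Lambda[OF measurable_eig_prod_cut_weight[OF R]])
  also have "(\<integral>\<^sup>+x. eig_prod ?\<phi> (sa_of_coords n x) \<partial>herm_lborel n)
      = ennreal (\<Prod>k<n. pi ^ k / fact k) * (\<integral>\<^sup>+x. (\<Prod>i<n. ?\<phi> (x i)) * weyl_density n x \<partial>lborel_PiM {..<n})"
    by (rule weyl_integration_formula[OF n measurable_cut_weight[OF R] herm_borel_eig_prod_cut_weight[OF R]])
  also have "(\<integral>\<^sup>+x. (\<Prod>i<n. ?\<phi> (x i)) * weyl_density n x \<partial>lborel_PiM {..<n}) = Z n"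
    unfolding Z_def cut_weight_def[OF R] ..
  finally show ?thesis by simp
qed

subsection \<open>Partition functions\<close>

definition gibbs :: "nat \<Rightarrow> real \<Rightarrow> nat \<Rightarrow> ((nat \<Rightarrow> complex Matrix.mat) \<Rightarrow> real) \<Rightarrow> ennreal" where
  "gibbs N R n \<tau> = (\<integral>\<^sup>+A. ennreal (exp (- ((real n)\<^sup>2 * \<tau> A))) * indicator (sa_tuples N n R) A \<partial>Lambda_PiM n {1..N})"

definition gibbs_rate :: "nat \<Rightarrow> real \<Rightarrow> nat \<Rightarrow> ((nat \<Rightarrow> complex Matrix.mat) \<Rightarrow> real) \<Rightarrow> real" where
  "gibbs_rate N R n \<tau> = 1 / (real n)\<^sup>2 * ln (enn2real (gibbs N R n \<tau>)) + real N / 2 * ln (real n)"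

definition admissible :: "nat \<Rightarrow> real \<Rightarrow> nat \<Rightarrow> ((nat \<Rightarrow> complex Matrix.mat) \<Rightarrow> real) \<Rightarrow> bool" where
  "admissible N R n \<tau> \<longleftrightarrow>
     (\<lambda>A. \<tau> A * indicator (sa_tuples N n R) A) \<in> borel_measurable (Lambda_PiM n {1..N}) \<and>
     (\<exists>C. \<forall>A\<in>sa_tuples N n R. \<bar>\<tau> A\<bar> \<le> C)"

lemma admissible_const: "R > 0 \<Longrightarrow> admissible N R n (\<lambda>_. c)"
  unfolding admissible_def using sets_sa_tuples[of R N n] by auto

lemma admissible_add:
  assumes "admissible N R n \<sigma>" "admissible N R n \<tau>"
  shows "admissible N R n (\<lambda>A. s * \<sigma> A + t * \<tau> A)"
proof -
  let ?S = "sa_tuples N n R"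
  obtain C D where C: "\<And>A. A \<in> ?S \<Longrightarrow> \<bar>\<sigma> A\<bar> \<le> C" and D: "\<And>A. A \<in> ?S \<Longrightarrow> \<bar>\<tau> A\<bar> \<le> D"
    using assms unfolding admissible_def by blast
  have "\<bar>s * \<sigma> A + t * \<tau> A\<bar> \<le> \<bar>s\<bar> * C + \<bar>t\<bar> * D" if "A \<in> ?S" for A
    by (rule order_trans[OF abs_triangle_ineq])
       (auto simp: abs_mult intro!: add_mono mult_left_mono C[OF that] D[OF that])
  moreover have "(\<lambda>A. s * (\<sigma> A * indicator ?S A) + t * (\<tau> A * indicator ?S A)) \<in> borel_measurable (Lambda_PiM n {1..N})"
    using assms unfolding admissible_def
    by (intro borel_measurable_add borel_measurable_times[OF borel_measurable_const]) blast+
  ultimately show ?thesis unfolding admissible_def by (auto simp: algebra_simps)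
qed

lemma admissible_nctau:
  assumes "R > 0" "h \<in> nc_alg N R" "n \<ge> 1"
  shows "admissible N R n (\<lambda>A. nctau n A h)"
  unfolding admissible_def using measurable_nctau[OF assms] nctau_le_norm[OF assms] by blast

lemma admissible_ptau:
  assumes "R > 0" "p \<in> ncpolys N" "n \<ge> 1"
  shows "admissible N R n (\<lambda>A. ptau n A p)"
proof -
  note [measurable] = measurable_ptau[OF assms(2)] sets_sa_tuples[OF assms(1)]
  show ?thesis unfolding admissible_def using ptau_le_norm[OF assms] by (intro conjI) (measurable, blast)
qed

lemma measurable_gibbs:
  assumes R: "R > 0" and \<tau>: "admissible N R n \<tau>"
  shows "(\<lambda>A. ennreal (exp (- ((real n)\<^sup>2 * \<tau> A))) * indicator (sa_tuples N n R) A) \<in> borel_measurable (Lambda_PiM n {1..N})"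
proof -
  note [measurable] = sets_sa_tuples[OF R] \<tau>[unfolded admissible_def, THEN conjunct1]
  have "(\<lambda>A. ennreal (exp (- ((real n)\<^sup>2 * (\<tau> A * indicator (sa_tuples N n R) A)))) * indicator (sa_tuples N n R) A)
      \<in> borel_measurable (Lambda_PiM n {1..N})" by measurable
  also have "?this \<longleftrightarrow> ?thesis" by (intro measurable_cong) (auto split: split_indicator)
  finally show ?thesis .
qed

lemma set_lebesgue_integral_gibbs:
  assumes R: "R > 0" and \<tau>: "admissible N R n \<tau>"
  shows "set_lebesgue_integral (Lambda_PiM n {1..N}) (sa_tuples N n R) (\<lambda>A. exp (- ((real n)\<^sup>2 * \<tau> A)))
    = enn2real (gibbs N R n \<tau>)"
proof -
  note [measurable] = sets_sa_tuples[OF R] \<tau>[unfolded admissible_def, THEN conjunct1]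
  have "(\<lambda>A. exp (- ((real n)\<^sup>2 * (\<tau> A * indicator (sa_tuples N n R) A))) * indicator (sa_tuples N n R) A)
      \<in> borel_measurable (Lambda_PiM n {1..N})" by measurable
  also have "?this \<longleftrightarrow> (\<lambda>A. indicator (sa_tuples N n R) A *\<^sub>R exp (- ((real n)\<^sup>2 * \<tau> A))) \<in> borel_measurable (Lambda_PiM n {1..N})"
    by (intro measurable_cong) (auto split: split_indicator)
  finally have "set_lebesgue_integral (Lambda_PiM n {1..N}) (sa_tuples N n R) (\<lambda>A. exp (- ((real n)\<^sup>2 * \<tau> A)))
      = enn2real (\<integral>\<^sup>+A. ennreal (indicator (sa_tuples N n R) A *\<^sub>R exp (- ((real n)\<^sup>2 * \<tau> A))) \<partial>Lambda_PiM n {1..N})"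
    unfolding set_lebesgue_integral_def by (intro integral_eq_nn_integral) auto
  also have "(\<integral>\<^sup>+A. ennreal (indicator (sa_tuples N n R) A *\<^sub>R exp (- ((real n)\<^sup>2 * \<tau> A))) \<partial>Lambda_PiM n {1..N})
      = gibbs N R n \<tau>"
    unfolding gibbs_def by (intro nn_integral_cong) (auto split: split_indicator)
  finally show ?thesis .
qed

lemma gibbs_cong: "(\<And>A. A \<in> sa_tuples N n R \<Longrightarrow> \<sigma> A = \<tau> A) \<Longrightarrow> gibbs N R n \<sigma> = gibbs N R n \<tau>"
  unfolding gibbs_def by (intro nn_integral_cong) (auto split: split_indicator)

lemma gibbs_rate_cong: "(\<And>A. A \<in> sa_tuples N n R \<Longrightarrow> \<sigma> A = \<tau> A) \<Longrightarrow> gibbs_rate N R n \<sigma> = gibbs_rate N R n \<tau>"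
  unfolding gibbs_rate_def using gibbs_cong[of N n R \<sigma> \<tau>] by simp

lemma gibbs_le:
  assumes R: "R > 0" and \<sigma>: "admissible N R n \<sigma>"
    and le: "\<And>A. A \<in> sa_tuples N n R \<Longrightarrow> \<sigma> A \<le> \<tau> A + C"
  shows "gibbs N R n \<tau> \<le> ennreal (exp ((real n)\<^sup>2 * C)) * gibbs N R n \<sigma>"
  unfolding gibbs_def nn_integral_cmult[OF measurable_gibbs[OF R \<sigma>], symmetric]
proof (rule nn_integral_mono)
  fix A
  have "exp (- ((real n)\<^sup>2 * \<tau> A)) \<le> exp ((real n)\<^sup>2 * C) * exp (- ((real n)\<^sup>2 * \<sigma> A))" if "A \<in> sa_tuples N n R"
    using mult_left_mono[OF le[OF that], of "(real n)\<^sup>2"] by (simp add: exp_add[symmetric] algebra_simps)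
  then show "ennreal (exp (- ((real n)\<^sup>2 * \<tau> A))) * indicator (sa_tuples N n R) A
      \<le> ennreal (exp ((real n)\<^sup>2 * C)) * (ennreal (exp (- ((real n)\<^sup>2 * \<sigma> A))) * indicator (sa_tuples N n R) A)"
    by (auto split: split_indicator simp: ennreal_mult[symmetric])
qed

lemma one_matrix_partition_function:
  assumes R: "R > 0" and P: "P \<in> ncpolys 1" and n: "n \<ge> 1"
  shows "gibbs 1 R n (\<lambda>A. ptau n A P) = ennreal (2 ^ (n * (n - 1) div 2) * ((\<Prod>k<n. pi ^ k / fact k) *
      enn2real (confined_log_gas.Z R (poly_potential P) n)))"
    and "enn2real (confined_log_gas.Z R (poly_potential P) n) > 0"
proof -
  obtain L B where "confined_log_gas R L B (poly_potential P)"
    using confined_log_gas_poly_potential[OF R] by blast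
  then interpret confined_log_gas R L B "poly_potential P" .
  have "ennreal (enn2real (Z n)) = Z n" using Z_finite[of n] by simp
  moreover have "(2 :: ennreal) ^ k = ennreal (2 ^ k)" for k by (simp add: ennreal_power[symmetric])
  moreover have "(0::real) \<le> (\<Prod>k<n. pi ^ k / fact k)" by (intro prod_nonneg) auto
  ultimately show "gibbs 1 R n (\<lambda>A. ptau n A P) = ennreal (2 ^ (n * (n - 1) div 2) * ((\<Prod>k<n. pi ^ k / fact k) * enn2real (Z n)))"
    unfolding gibbs_def nn_integral_one_matrix[OF assms] by (simp add: ennreal_mult)
  show "enn2real (Z n) > 0" using Z_pos[OF n] Z_finite[of n] by (simp add: enn2real_positive_iff)
qed

definition sa_vol :: "nat \<Rightarrow> real \<Rightarrow> real" where
  "sa_vol n R = enn2real (emeasure (Lambda n) (sa_ball n R))"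

lemma gibbs_zero:
  assumes R: "R > 0"
  shows "gibbs N R n (\<lambda>_. 0) = emeasure (Lambda n) (sa_ball n R) ^ N"
proof -
  have "gibbs N R n (\<lambda>_. 0) = emeasure (Lambda_PiM n {1..N}) (sa_tuples N n R)"
    using sets_sa_tuples[OF R] by (simp add: gibbs_def)
  also have "\<dots> = (\<Prod>i\<in>{1..N}. emeasure (Lambda n) (sa_ball n R))"
    unfolding sa_tuples_def by (rule Lambda_product.emeasure_PiM) (auto simp: sets_sa_ball[OF R])
  finally show ?thesis by simp
qed

lemma sa_vol:
  assumes R: "R > 0" and n: "n \<ge> 1"
  shows "sa_vol n R > 0" "emeasure (Lambda n) (sa_ball n R) = ennreal (sa_vol n R)"
proof -
  have "gibbs 1 R n (\<lambda>A. ptau n A 0) = emeasure (Lambda n) (sa_ball n R)"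
    using gibbs_zero[OF R, of 1 n] by (simp add: ptau_eq ncpoly_eval_zero)
  moreover have "(\<Prod>k<n. pi ^ k / fact k) > (0::real)" by (intro prod_pos) auto
  ultimately obtain r where r: "emeasure (Lambda n) (sa_ball n R) = ennreal r" "r > 0"
    using one_matrix_partition_function[OF R ncpolys_zero n] by (metis mult_pos_pos zero_less_numeral zero_less_power)
  then show "sa_vol n R > 0" "emeasure (Lambda n) (sa_ball n R) = ennreal (sa_vol n R)"
    by (auto simp: sa_vol_def)
qed

lemma gibbs_pos_finite:
  assumes R: "R > 0" and n: "n \<ge> 1" and \<tau>: "admissible N R n \<tau>"
  shows "enn2real (gibbs N R n \<tau>) > 0" "ennreal (enn2real (gibbs N R n \<tau>)) = gibbs N R n \<tau>"
proof -
  obtain C where C: "\<And>A. A \<in> sa_tuples N n R \<Longrightarrow> \<bar>\<tau> A\<bar> \<le> C" using \<tau> by (auto simp: admissible_def)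
  have z: "gibbs N R n (\<lambda>_. 0) = ennreal (sa_vol n R ^ N)"
    using gibbs_zero[OF R] sa_vol[OF R n] by (simp add: ennreal_power)
  have "0 \<le> \<tau> A + C" if "A \<in> sa_tuples N n R" for A using C[OF that] by linarith
  from gibbs_le[OF R admissible_const[OF R], of N n 0 \<tau> C, OF this]
  have u: "gibbs N R n \<tau> \<le> ennreal (exp ((real n)\<^sup>2 * C) * sa_vol n R ^ N)"
    using z sa_vol(1)[OF R n] by (simp add: ennreal_mult)
  have "\<tau> A \<le> 0 + C" if "A \<in> sa_tuples N n R" for A using C[OF that] by linarith
  from gibbs_le[OF R \<tau>, of "\<lambda>_. 0", OF this]
  have "ennreal (sa_vol n R ^ N) \<le> ennreal (exp ((real n)\<^sup>2 * C)) * gibbs N R n \<tau>" using z by simp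
  then have "gibbs N R n \<tau> \<noteq> 0" using zero_less_power[OF sa_vol(1)[OF R n], of N] by (auto simp: ennreal_eq_0_iff not_le)
  moreover have fin: "gibbs N R n \<tau> < \<top>" using u by (auto simp: less_top[symmetric] top_unique)
  ultimately show "enn2real (gibbs N R n \<tau>) > 0" by (simp add: enn2real_positive_iff zero_less_iff_neq_zero)
  show "ennreal (enn2real (gibbs N R n \<tau>)) = gibbs N R n \<tau>" using fin by simp
qed

lemma gibbs_rate_le:
  assumes R: "R > 0" and n: "n \<ge> 1" and \<sigma>: "admissible N R n \<sigma>" and \<tau>: "admissible N R n \<tau>"
    and le: "\<And>A. A \<in> sa_tuples N n R \<Longrightarrow> \<sigma> A \<le> \<tau> A + C"
  shows "gibbs_rate N R n \<tau> \<le> gibbs_rate N R n \<sigma> + C"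
proof -
  let ?s = "enn2real (gibbs N R n \<sigma>)" and ?t = "enn2real (gibbs N R n \<tau>)"
  note s = gibbs_pos_finite[OF R n \<sigma>] and t = gibbs_pos_finite[OF R n \<tau>]
  have "ennreal ?t \<le> ennreal (exp ((real n)\<^sup>2 * C)) * ennreal ?s"
    unfolding s(2) t(2) by (rule gibbs_le[OF R \<sigma> le])
  then have "?t \<le> exp ((real n)\<^sup>2 * C) * ?s" using s(1) by (simp add: ennreal_mult[symmetric])
  then have "ln ?t \<le> ln (exp ((real n)\<^sup>2 * C) * ?s)" using s(1) t(1) by (intro ln_mono) auto
  also have "\<dots> = (real n)\<^sup>2 * C + ln ?s" using s(1) by (simp add: ln_mult)
  finally have "1 / (real n)\<^sup>2 * ln ?t \<le> 1 / (real n)\<^sup>2 * ((real n)\<^sup>2 * C + ln ?s)" by (intro mult_left_mono) auto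
  then show ?thesis using n by (simp add: gibbs_rate_def distrib_left)
qed

lemma gibbs_rate_convex:
  assumes R: "R > 0" and n: "n \<ge> 1" and \<sigma>: "admissible N R n \<sigma>" and \<tau>: "admissible N R n \<tau>"
    and t: "0 \<le> t" "t \<le> 1"
  shows "gibbs_rate N R n (\<lambda>A. t * \<sigma> A + (1 - t) * \<tau> A) \<le> t * gibbs_rate N R n \<sigma> + (1 - t) * gibbs_rate N R n \<tau>"
proof -
  define a b where "a = ln (enn2real (gibbs N R n \<sigma>))" and "b = ln (enn2real (gibbs N R n \<tau>))"
  note ps = gibbs_pos_finite[OF R n \<sigma>] and pt = gibbs_pos_finite[OF R n \<tau>]
  have ab: "gibbs N R n \<sigma> = ennreal (exp a)" "gibbs N R n \<tau> = ennreal (exp b)"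
    using ps pt by (simp_all add: a_def b_def)
  let ?\<rho> = "\<lambda>A. t * \<sigma> A + (1 - t) * \<tau> A" and ?S = "sa_tuples N n R" and ?M = "Lambda_PiM n {1..N}"
  let ?F = "\<lambda>\<tau> A. ennreal (exp (- ((real n)\<^sup>2 * \<tau> A))) * indicator ?S A"
  have \<rho>: "admissible N R n ?\<rho>" by (rule admissible_add[OF \<sigma> \<tau>])
  note pr = gibbs_pos_finite[OF R n \<rho>]
  note [measurable] = measurable_gibbs[OF R \<sigma>] measurable_gibbs[OF R \<tau>] measurable_gibbs[OF R \<rho>]
  have "ennreal (exp (- (t * a + (1 - t) * b))) * gibbs N R n ?\<rho> = (\<integral>\<^sup>+A. ennreal (exp (- (t * a + (1 - t) * b))) * ?F ?\<rho> A \<partial>?M)"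
    unfolding gibbs_def by (rule nn_integral_cmult[symmetric]) measurable
  also have "\<dots> \<le> (\<integral>\<^sup>+A. ennreal (t * exp (- a)) * ?F \<sigma> A + ennreal ((1 - t) * exp (- b)) * ?F \<tau> A \<partial>?M)"
  proof (rule nn_integral_mono)
    fix A
    let ?x = "- ((real n)\<^sup>2 * \<sigma> A) - a" and ?y = "- ((real n)\<^sup>2 * \<tau> A) - b"
    have cv: "exp ((1 - t) *\<^sub>R ?y + t *\<^sub>R ?x) \<le> (1 - t) * exp ?y + t * exp ?x"
      using t by (intro convex_onD[OF exp_convex]) auto
    have e: "exp (- (t * a + (1 - t) * b)) * exp (- ((real n)\<^sup>2 * ?\<rho> A)) = exp ((1 - t) *\<^sub>R ?y + t *\<^sub>R ?x)"
      unfolding mult_exp_exp by (rule arg_cong[where f = exp]) (simp add: algebra_simps)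
    have exy: "exp (- a) * exp (- ((real n)\<^sup>2 * \<sigma> A)) = exp ?x" "exp (- b) * exp (- ((real n)\<^sup>2 * \<tau> A)) = exp ?y"
      unfolding mult_exp_exp by (rule arg_cong[where f = exp], simp)+
    have "exp (- (t * a + (1 - t) * b)) * exp (- ((real n)\<^sup>2 * ?\<rho> A))
        \<le> t * exp (- a) * exp (- ((real n)\<^sup>2 * \<sigma> A)) + (1 - t) * exp (- b) * exp (- ((real n)\<^sup>2 * \<tau> A))"
      unfolding mult.assoc e exy using cv by linarith
    then show "ennreal (exp (- (t * a + (1 - t) * b))) * ?F ?\<rho> A
        \<le> ennreal (t * exp (- a)) * ?F \<sigma> A + ennreal ((1 - t) * exp (- b)) * ?F \<tau> A"
      using t by (auto split: split_indicator simp del: ennreal_plus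
        simp: ennreal_mult[symmetric] ennreal_plus[symmetric])
  qed
  also have "\<dots> = ennreal (t * exp (- a)) * gibbs N R n \<sigma> + ennreal ((1 - t) * exp (- b)) * gibbs N R n \<tau>"
    unfolding gibbs_def nn_integral_cmult[OF measurable_gibbs[OF R \<sigma>], symmetric] nn_integral_cmult[OF measurable_gibbs[OF R \<tau>], symmetric]
    by (rule nn_integral_add; rule borel_measurable_times_ennreal[OF borel_measurable_const]; rule measurable_gibbs[OF R \<sigma>] measurable_gibbs[OF R \<tau>])
  also have "\<dots> = 1"
    unfolding ab using t by (simp add: ennreal_mult[symmetric] ennreal_plus[symmetric] mult.assoc exp_add[symmetric] del: ennreal_plus)
  finally have "ennreal (exp (- (t * a + (1 - t) * b)) * enn2real (gibbs N R n ?\<rho>)) \<le> ennreal 1"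
    using pr by (simp add: ennreal_mult)
  then have "exp (- (t * a + (1 - t) * b)) * enn2real (gibbs N R n ?\<rho>) \<le> 1" by simp
  from mult_left_mono[OF this exp_ge_zero[of "t * a + (1 - t) * b"]]
  have "enn2real (gibbs N R n ?\<rho>) \<le> exp (t * a + (1 - t) * b)"
    unfolding mult.assoc[symmetric] mult_exp_exp by simp
  then have "ln (enn2real (gibbs N R n ?\<rho>)) \<le> t * a + (1 - t) * b"
    using pr(1) by (metis exp_ln exp_le_cancel_iff)
  then have "1 / (real n)\<^sup>2 * ln (enn2real (gibbs N R n ?\<rho>)) \<le> 1 / (real n)\<^sup>2 * (t * a + (1 - t) * b)"
    by (intro mult_left_mono) auto
  then show ?thesis unfolding gibbs_rate_def a_def[symmetric] b_def[symmetric] by (simp add: algebra_simps add_divide_distrib diff_divide_distrib)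
qed

subsection \<open>Restriction, dilation and products\<close>

lemma gibbs_mono_radius:
  assumes R: "R\<^sub>1 > 0" "R\<^sub>1 \<le> R" and eq: "\<And>A. A \<in> sa_tuples N n R\<^sub>1 \<Longrightarrow> \<sigma> A = \<tau> A"
  shows "gibbs N R\<^sub>1 n \<sigma> \<le> gibbs N R n \<tau>"
  unfolding gibbs_def
proof (rule nn_integral_mono)
  fix A
  show "ennreal (exp (- ((real n)\<^sup>2 * \<sigma> A))) * indicator (sa_tuples N n R\<^sub>1) A
      \<le> ennreal (exp (- ((real n)\<^sup>2 * \<tau> A))) * indicator (sa_tuples N n R) A"
    using sa_tuples_mono[OF R(2), of N n] eq[of A] by (auto split: split_indicator)
qed

lemma gibbs_rate_mono_radius:
  assumes R: "R\<^sub>1 > 0" "R\<^sub>1 \<le> R" and eq: "\<And>A. A \<in> sa_tuples N n R\<^sub>1 \<Longrightarrow> \<sigma> A = \<tau> A" and n: "n \<ge> 1"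
    and \<sigma>: "admissible N R\<^sub>1 n \<sigma>" and \<tau>: "admissible N R n \<tau>"
  shows "gibbs_rate N R\<^sub>1 n \<sigma> \<le> gibbs_rate N R n \<tau>"
proof -
  have R0: "R > 0" using R by simp
  note s = gibbs_pos_finite[OF R(1) n \<sigma>] and t = gibbs_pos_finite[OF R0 n \<tau>]
  have "ennreal (enn2real (gibbs N R\<^sub>1 n \<sigma>)) \<le> ennreal (enn2real (gibbs N R n \<tau>))"
    unfolding s(2) t(2) by (rule gibbs_mono_radius[OF R eq])
  then have "ln (enn2real (gibbs N R\<^sub>1 n \<sigma>)) \<le> ln (enn2real (gibbs N R n \<tau>))"
    using s(1) t(1) by (intro ln_mono) auto
  then show ?thesis unfolding gibbs_rate_def by (intro add_right_mono mult_left_mono) auto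
qed

lemma measurable_Lambda_smult:
  "(\<lambda>A. complex_of_real c \<cdot>\<^sub>m A) \<in> measurable (Lambda n) (Lambda n)"
proof (rule measurable_into_Lambda[OF mat_measurable_smult[OF mat_measurable_Lambda]])
  fix A assume "A \<in> space (Lambda n)"
  then have "A \<in> sa_mats n" unfolding space_Lambda .
  then show "complex_of_real c \<cdot>\<^sub>m A \<in> sa_mats n" by (rule sa_mats_smult)
qed (rule borel_measurable_const)

lemma nn_integral_Lambda_smult:
  assumes c: "c > 0" and f: "f \<in> borel_measurable (Lambda n)"
  shows "(\<integral>\<^sup>+A. f (complex_of_real c \<cdot>\<^sub>m A) \<partial>Lambda n) = ennreal ((1 / c) ^ (n\<^sup>2)) * (\<integral>\<^sup>+A. f A \<partial>Lambda n)"
proof -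
  let ?I = "{..<n} \<times> {..<n}"
  have sm: "(\<lambda>A. complex_of_real c \<cdot>\<^sub>m A) \<in> measurable (Lambda n) (Lambda n)"
    by (rule measurable_Lambda_smult)
  have eq: "sa_of_coords n (\<lambda>p\<in>?I. 0 + c * x p) = complex_of_real c \<cdot>\<^sub>m sa_of_coords n x" for x
    by (rule eq_matI) (auto simp: sa_of_coords_index complex_eq_iff)
  have "(\<integral>\<^sup>+x. f (sa_of_coords n x) \<partial>herm_lborel n)
      = ennreal (\<Prod>p\<in>?I. \<bar>c\<bar>) * (\<integral>\<^sup>+x. f (sa_of_coords n (\<lambda>p\<in>?I. 0 + c * x p)) \<partial>herm_lborel n)"
    by (rule lborel_PiM_affine) (use c measurable_compose[OF measurable_sa_of_coords f] in auto)
  then have "(\<integral>\<^sup>+x. f (sa_of_coords n x) \<partial>herm_lborel n)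
      = ennreal (c ^ (n\<^sup>2)) * (\<integral>\<^sup>+x. f (complex_of_real c \<cdot>\<^sub>m sa_of_coords n x) \<partial>herm_lborel n)"
    unfolding eq using c by (simp add: power2_eq_square)
  then have "ennreal ((1 / c) ^ (n\<^sup>2)) * (\<integral>\<^sup>+x. f (sa_of_coords n x) \<partial>herm_lborel n)
      = (ennreal ((1 / c) ^ (n\<^sup>2)) * ennreal (c ^ (n\<^sup>2))) * (\<integral>\<^sup>+x. f (complex_of_real c \<cdot>\<^sub>m sa_of_coords n x) \<partial>herm_lborel n)"
    by (simp add: mult.assoc)
  also have "ennreal ((1 / c) ^ (n\<^sup>2)) * ennreal (c ^ (n\<^sup>2)) = 1"
    using c by (simp add: ennreal_mult[symmetric] power_mult_distrib[symmetric])
  finally have E: "(\<integral>\<^sup>+x. f (complex_of_real c \<cdot>\<^sub>m sa_of_coords n x) \<partial>herm_lborel n)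
      = ennreal ((1 / c) ^ (n\<^sup>2)) * (\<integral>\<^sup>+x. f (sa_of_coords n x) \<partial>herm_lborel n)" by simp
  show ?thesis
    unfolding nn_integral_Lambda[OF f] nn_integral_Lambda[OF measurable_compose[OF sm f]] E
    by (rule mult.left_commute)
qed

lemma gibbs_dilate:
  assumes R: "R > 0" "R\<^sub>1 > 0" and \<tau>: "admissible N R n \<tau>"
  shows "gibbs N R\<^sub>1 n (\<lambda>A. \<tau> (scale_tuple N (R / R\<^sub>1) A)) = ennreal ((R\<^sub>1 / R) ^ (N * n\<^sup>2)) * gibbs N R n \<tau>"
proof -
  let ?F = "\<lambda>A. ennreal (exp (- ((real n)\<^sup>2 * \<tau> A))) * indicator (sa_tuples N n R) A"
  define c where "c = R / R\<^sub>1"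
  have c: "c > 0" using R by (simp add: c_def)
  have ind: "scale_tuple N c A \<in> sa_tuples N n R \<longleftrightarrow> A \<in> sa_tuples N n R\<^sub>1" if A: "A \<in> space (Lambda_PiM n {1..N})" for A
  proof
    assume "A \<in> sa_tuples N n R\<^sub>1"
    then show "scale_tuple N c A \<in> sa_tuples N n R" using scale_tuple_sa_tuples[OF c, of A N n R\<^sub>1] R by (simp add: c_def)
  next
    assume "scale_tuple N c A \<in> sa_tuples N n R"
    then have "scale_tuple N (1 / c) (scale_tuple N c A) \<in> sa_tuples N n (1 / c * R)" using c by (intro scale_tuple_sa_tuples) auto
    moreover have "scale_tuple N (1 / c) (scale_tuple N c A) = A"
    proof
      fix i
      show "scale_tuple N (1 / c) (scale_tuple N c A) i = A i"
        using A c by (cases "i \<in> {1..N}")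
          (auto simp: scale_tuple_def space_PiM PiE_iff extensional_def intro!: eq_matI)
    qed
    ultimately show "A \<in> sa_tuples N n R\<^sub>1" using R by (simp add: c_def)
  qed
  have "gibbs N R\<^sub>1 n (\<lambda>A. \<tau> (scale_tuple N c A)) = (\<integral>\<^sup>+A. ?F (\<lambda>i\<in>{1..N}. complex_of_real c \<cdot>\<^sub>m A i) \<partial>Lambda_PiM n {1..N})"
    unfolding gibbs_def scale_tuple_def[symmetric] by (intro nn_integral_cong) (simp add: ind indicator_def)
  also have "\<dots> = (\<Prod>i\<in>{1..N}. ennreal ((1 / c) ^ (n\<^sup>2))) * (\<integral>\<^sup>+A. ?F A \<partial>Lambda_PiM n {1..N})"
  proof (rule Lambda_product.PiM_nn_integral_componentwise[where T = "\<lambda>_ A. complex_of_real c \<cdot>\<^sub>m A"])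
    show "(\<lambda>A. complex_of_real c \<cdot>\<^sub>m A) \<in> measurable (Lambda n) (Lambda n)"
      by (rule measurable_Lambda_smult)
  qed (simp_all only: nn_integral_Lambda_smult[OF c] measurable_gibbs[OF R(1) \<tau>] finite_atLeastAtMost)
  also have "(\<Prod>i\<in>{1..N}. ennreal ((1 / c) ^ (n\<^sup>2))) = ennreal ((R\<^sub>1 / R) ^ (N * n\<^sup>2))"
    using R by (simp add: c_def ennreal_power power_mult[symmetric] mult.commute)
  finally show ?thesis by (simp add: gibbs_def c_def)
qed

lemma gibbs_rate_dilate:
  assumes R: "R > 0" "R\<^sub>1 > 0" and \<tau>: "admissible N R n \<tau>" and n: "n \<ge> 1"
  shows "gibbs_rate N R\<^sub>1 n (\<lambda>A. \<tau> (scale_tuple N (R / R\<^sub>1) A)) = gibbs_rate N R n \<tau> + real N * ln (R\<^sub>1 / R)"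
proof -
  have q: "R\<^sub>1 / R > 0" using R by simp
  have "enn2real (gibbs N R\<^sub>1 n (\<lambda>A. \<tau> (scale_tuple N (R / R\<^sub>1) A))) = (R\<^sub>1 / R) ^ (N * n\<^sup>2) * enn2real (gibbs N R n \<tau>)"
    unfolding gibbs_dilate[OF R \<tau>] enn2real_mult using q by simp
  moreover have "ln ((R\<^sub>1 / R) ^ (N * n\<^sup>2) * enn2real (gibbs N R n \<tau>)) = real (N * n\<^sup>2) * ln (R\<^sub>1 / R) + ln (enn2real (gibbs N R n \<tau>))"
    using gibbs_pos_finite(1)[OF R(1) n \<tau>] q by (simp add: ln_mult_pos ln_realpow del: of_nat_mult)
  ultimately show ?thesis using n by (simp add: gibbs_rate_def field_simps)
qed

lemma distr_Lambda_shift: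
  "distr (Lambda_PiM n {L + 1..L + M}) (Lambda_PiM n {1..M}) (\<lambda>A. \<lambda>i\<in>{1..M}. A (L + i)) = Lambda_PiM n {1..M}"
proof (rule Lambda_product.PiM_eqI)
  fix B assume B: "\<And>i. i \<in> {1..M} \<Longrightarrow> B i \<in> sets (Lambda n)"
  have m: "(\<lambda>A. \<lambda>i\<in>{1..M}. A (L + i)) \<in> measurable (Lambda_PiM n {L + 1..L + M}) (Lambda_PiM n {1..M})"
    by (intro measurable_restrict measurable_component_singleton) auto
  have vim: "(\<lambda>A. \<lambda>i\<in>{1..M}. A (L + i)) -` Pi\<^sub>E {1..M} B \<inter> space (Lambda_PiM n {L + 1..L + M}) = (\<Pi>\<^sub>E j\<in>{L + 1..L + M}. B (j - L))"
  proof (intro equalityI subsetI)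
    fix A assume "A \<in> (\<lambda>A. \<lambda>i\<in>{1..M}. A (L + i)) -` Pi\<^sub>E {1..M} B \<inter> space (Lambda_PiM n {L + 1..L + M})"
    then have A: "A \<in> extensional {L + 1..L + M}" "\<And>i. i \<in> {1..M} \<Longrightarrow> A (L + i) \<in> B i" by (auto simp: space_PiM PiE_iff)
    have "A j \<in> B (j - L)" if "j \<in> {L + 1..L + M}" for j
    proof -
      have "j - L \<in> {1..M}" "L + (j - L) = j" using that by auto
      then show ?thesis using A(2)[of "j - L"] by metis
    qed
    then show "A \<in> (\<Pi>\<^sub>E j\<in>{L + 1..L + M}. B (j - L))" using A(1) by (auto simp: PiE_iff)
  next
    fix A assume A: "A \<in> (\<Pi>\<^sub>E j\<in>{L + 1..L + M}. B (j - L))"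
    have "A (L + i) \<in> B i" if "i \<in> {1..M}" for i using PiE_mem[OF A, of "L + i"] that by auto
    moreover have "A \<in> space (Lambda_PiM n {L + 1..L + M})"
    proof -
      have "A j \<in> space (Lambda n)" if "j \<in> {L + 1..L + M}" for j
      proof -
        have "j - L \<in> {1..M}" using that by auto
        from sets.sets_into_space[OF B[OF this]] PiE_mem[OF A that] show ?thesis by (rule subsetD)
      qed
      then show ?thesis using A by (auto simp: space_PiM PiE_iff)
    qed
    ultimately show "A \<in> (\<lambda>A. \<lambda>i\<in>{1..M}. A (L + i)) -` Pi\<^sub>E {1..M} B \<inter> space (Lambda_PiM n {L + 1..L + M})"
      by (auto simp: PiE_iff)
  qed
  have ps: "Pi\<^sub>E {1..M} B \<in> sets (Lambda_PiM n {1..M})" using B by (intro sets_PiM_I_finite) auto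
  have "emeasure (distr (Lambda_PiM n {L + 1..L + M}) (Lambda_PiM n {1..M}) (\<lambda>A. \<lambda>i\<in>{1..M}. A (L + i))) (Pi\<^sub>E {1..M} B)
      = emeasure (Lambda_PiM n {L + 1..L + M}) (\<Pi>\<^sub>E j\<in>{L + 1..L + M}. B (j - L))"
    unfolding emeasure_distr[OF m ps] vim ..
  also have "\<dots> = (\<Prod>j\<in>{L + 1..L + M}. emeasure (Lambda n) (B (j - L)))"
    by (intro Lambda_product.emeasure_PiM B) auto
  also have "\<dots> = (\<Prod>i\<in>{1..M}. emeasure (Lambda n) (B i))"
    by (rule prod.reindex_bij_witness[of _ "\<lambda>i. L + i" "\<lambda>j. j - L"]) auto
  finally show "emeasure (distr (Lambda_PiM n {L + 1..L + M}) (Lambda_PiM n {1..M}) (\<lambda>A. \<lambda>i\<in>{1..M}. A (L + i))) (Pi\<^sub>E {1..M} B)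
      = (\<Prod>i\<in>{1..M}. emeasure (Lambda n) (B i))" .
qed auto

lemma gibbs_product:
  assumes R: "R > 0" and L: "L \<le> N" and \<sigma>: "admissible L R n \<sigma>" and \<tau>: "admissible (N - L) R n \<tau>"
  shows "gibbs N R n (\<lambda>A. \<sigma> (restrict A {1..L}) + \<tau> (\<lambda>i\<in>{1..N - L}. A (L + i))) = gibbs L R n \<sigma> * gibbs (N - L) R n \<tau>"
proof -
  define M where "M = N - L"
  have N: "N = L + M" using L by (simp add: M_def)
  let ?I = "{1..L}" and ?J = "{L + 1..L + M}"
  let ?sh = "\<lambda>A. \<lambda>i\<in>{1..M}. A (L + i)"
  let ?F = "\<lambda>A. ennreal (exp (- ((real n)\<^sup>2 * \<sigma> A))) * indicator (sa_tuples L n R) A"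
  let ?G = "\<lambda>A. ennreal (exp (- ((real n)\<^sup>2 * \<tau> A))) * indicator (sa_tuples M n R) A"
  have un: "?I \<union> ?J = {1..N}" using N by auto
  have disj: "?I \<inter> ?J = {}" by auto
  have F: "?F \<in> borel_measurable (Lambda_PiM n ?I)" by (rule measurable_gibbs[OF R \<sigma>])
  have G: "?G \<in> borel_measurable (Lambda_PiM n {1..M})" using measurable_gibbs[OF R \<tau>] by (simp add: M_def)
  have sh: "?sh \<in> measurable (Lambda_PiM n J) (Lambda_PiM n {1..M})" if "?J \<subseteq> J" for J
    using that by (intro measurable_restrict measurable_component_singleton) auto
  have rs: "(\<lambda>A. restrict A ?I) \<in> measurable (Lambda_PiM n (?I \<union> ?J)) (Lambda_PiM n ?I)"
    by (rule measurable_restrict_subset) auto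
  have ind: "A \<in> sa_tuples N n R \<longleftrightarrow> restrict A ?I \<in> sa_tuples L n R \<and> ?sh A \<in> sa_tuples M n R"
    if A: "A \<in> space (Lambda_PiM n {1..N})" for A
  proof -
    have "(\<forall>i\<in>{1..N}. A i \<in> sa_ball n R) \<longleftrightarrow> (\<forall>i\<in>?I. A i \<in> sa_ball n R) \<and> (\<forall>i\<in>{1..M}. A (L + i) \<in> sa_ball n R)" (is "?l \<longleftrightarrow> ?r")
    proof
      assume r: ?r
      show ?l
      proof
        fix i assume i: "i \<in> {1..N}"
        show "A i \<in> sa_ball n R"
        proof (cases "i \<le> L")
          case False
          then have "i - L \<in> {1..M}" "i = L + (i - L)" using i N by auto
          then show ?thesis using r by metis
        qed (use r i in auto)
      qed
    qed (use N in auto)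
    then show ?thesis using A by (auto simp: sa_tuples_def space_PiM PiE_iff)
  qed
  have H: "(\<lambda>A. ?F (restrict A ?I) * ?G (?sh A)) \<in> borel_measurable (Lambda_PiM n (?I \<union> ?J))"
    by (rule borel_measurable_times_ennreal[OF measurable_compose[OF rs F] measurable_compose[OF sh G]]) simp
  have "gibbs N R n (\<lambda>A. \<sigma> (restrict A ?I) + \<tau> (?sh A)) = (\<integral>\<^sup>+A. ?F (restrict A ?I) * ?G (?sh A) \<partial>Lambda_PiM n (?I \<union> ?J))"
    unfolding gibbs_def un
  proof (rule nn_integral_cong)
    fix A assume A: "A \<in> space (Lambda_PiM n {1..N})"
    show "ennreal (exp (- ((real n)\<^sup>2 * (\<sigma> (restrict A ?I) + \<tau> (?sh A))))) * indicator (sa_tuples N n R) A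
       = ?F (restrict A ?I) * ?G (?sh A)"
      using ind[OF A] by (auto simp: indicator_def ennreal_mult[symmetric] exp_add[symmetric] algebra_simps)
  qed
  also have "\<dots> = (\<integral>\<^sup>+x. \<integral>\<^sup>+y. ?F (restrict (merge ?I ?J (x, y)) ?I) * ?G (?sh (merge ?I ?J (x, y))) \<partial>Lambda_PiM n ?J \<partial>Lambda_PiM n ?I)"
    by (rule Lambda_product.product_nn_integral_fold[OF disj _ _ H]) auto
  also have "\<dots> = (\<integral>\<^sup>+x. \<integral>\<^sup>+y. ?F x * ?G (?sh y) \<partial>Lambda_PiM n ?J \<partial>Lambda_PiM n ?I)"
  proof (intro nn_integral_cong)
    fix x y assume x: "x \<in> space (Lambda_PiM n ?I)"
    have "restrict (merge ?I ?J (x, y)) ?I = x" using x by (auto simp: space_PiM PiE_iff extensional_def merge_def fun_eq_iff)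
    moreover have "?sh (merge ?I ?J (x, y)) = ?sh y" by (auto simp: merge_def fun_eq_iff)
    ultimately show "?F (restrict (merge ?I ?J (x, y)) ?I) * ?G (?sh (merge ?I ?J (x, y))) = ?F x * ?G (?sh y)" by simp
  qed
  also have "\<dots> = (\<integral>\<^sup>+x. ?F x * (\<integral>\<^sup>+y. ?G (?sh y) \<partial>Lambda_PiM n ?J) \<partial>Lambda_PiM n ?I)"
    by (intro nn_integral_cong nn_integral_cmult measurable_compose[OF sh G]) auto
  also have "\<dots> = gibbs L R n \<sigma> * (\<integral>\<^sup>+y. ?G (?sh y) \<partial>Lambda_PiM n ?J)"
    unfolding gibbs_def by (rule nn_integral_multc[OF F])
  also have "(\<integral>\<^sup>+y. ?G (?sh y) \<partial>Lambda_PiM n ?J) = (\<integral>\<^sup>+y. ?G y \<partial>distr (Lambda_PiM n ?J) (Lambda_PiM n {1..M}) ?sh)"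
    by (rule nn_integral_distr[symmetric, OF sh]) (use G in auto)
  also have "\<dots> = gibbs (N - L) R n \<tau>" unfolding distr_Lambda_shift gibbs_def M_def ..
  finally show ?thesis unfolding M_def .
qed

lemma gibbs_rate_product:
  assumes R: "R > 0" and L: "L \<le> N" and n: "n \<ge> 1" and \<sigma>: "admissible L R n \<sigma>" and \<tau>: "admissible (N - L) R n \<tau>"
  shows "gibbs_rate N R n (\<lambda>A. \<sigma> (restrict A {1..L}) + \<tau> (\<lambda>i\<in>{1..N - L}. A (L + i)))
    = gibbs_rate L R n \<sigma> + gibbs_rate (N - L) R n \<tau>"
proof -
  have "real N = real L + real (N - L)" using L by simp
  then show ?thesis
    unfolding gibbs_rate_def gibbs_product[OF R L \<sigma> \<tau>] enn2real_mult
    using gibbs_pos_finite(1)[OF R n \<sigma>] gibbs_pos_finite(1)[OF R n \<tau>]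
    by (simp add: ln_mult_pos add_divide_distrib distrib_right del: of_nat_diff)
qed

subsection \<open>Convergence of the one-matrix pressure\<close>

lemma weighted_cesaro_null:
  fixes x :: "nat \<Rightarrow> real"
  assumes "(\<lambda>k. x k / real k) \<longlonglongrightarrow> 0"
  shows "(\<lambda>n. (\<Sum>k<n. x k) / (real n)\<^sup>2) \<longlonglongrightarrow> 0"
proof (rule LIMSEQ_I)
  fix e :: real assume e: "e > 0"
  obtain M where M: "\<And>k. k \<ge> M \<Longrightarrow> norm (x k / real k - 0) < e / 2"
    using LIMSEQ_D[OF assms, of "e / 2"] e by auto
  define C where "C = (\<Sum>k<Suc M. \<bar>x k\<bar>)"
  have bound: "\<bar>\<Sum>k<n. x k\<bar> \<le> C + e / 2 * (real n)\<^sup>2" for n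
  proof -
    have "\<bar>x k\<bar> \<le> (if k < Suc M then \<bar>x k\<bar> else 0) + e / 2 * real n" if "k < n" for k
    proof (cases "k < Suc M")
      case False
      then have "\<bar>x k\<bar> < e / 2 * real k" using M[of k] by (simp add: field_simps)
      also have "\<dots> \<le> e / 2 * real n" using that e by (intro mult_left_mono) auto
      finally show ?thesis using False by simp
    qed (use e in simp)
    then have "(\<Sum>k<n. \<bar>x k\<bar>) \<le> (\<Sum>k<n. (if k < Suc M then \<bar>x k\<bar> else 0) + e / 2 * real n)"
      by (intro sum_mono) auto
    also have "\<dots> = (\<Sum>k\<in>{..<n} \<inter> {..<Suc M}. \<bar>x k\<bar>) + e / 2 * (real n)\<^sup>2"
      by (simp add: sum.distrib sum.inter_restrict power2_eq_square lessThan_def)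
    also have "(\<Sum>k\<in>{..<n} \<inter> {..<Suc M}. \<bar>x k\<bar>) \<le> C"
      unfolding C_def by (intro sum_mono2) auto
    finally show ?thesis using sum_abs[of x "{..<n}"] by linarith
  qed
  have "(\<lambda>n. C / (real n)\<^sup>2) \<longlonglongrightarrow> 0" by real_asymp
  then obtain M' where M': "\<And>n. n \<ge> M' \<Longrightarrow> norm (C / (real n)\<^sup>2 - 0) < e / 2"
    using LIMSEQ_D[of _ _ "e / 2"] e by (metis half_gt_zero)
  have "norm ((\<Sum>k<n. x k) / (real n)\<^sup>2 - 0) < e" if "n \<ge> max M' 1" for n
  proof -
    have n: "(real n)\<^sup>2 > 0" using that by simp
    have "\<bar>\<Sum>k<n. x k\<bar> / (real n)\<^sup>2 \<le> (C + e / 2 * (real n)\<^sup>2) / (real n)\<^sup>2"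
      using bound n by (intro divide_right_mono) auto
    also have "\<dots> = C / (real n)\<^sup>2 + e / 2" using n by (simp add: add_divide_distrib)
    also have "\<dots> < e" using M'[of n] that by (simp only: real_norm_def diff_zero) linarith
    finally show ?thesis by simp
  qed
  then show "\<exists>M. \<forall>n\<ge>M. norm ((\<Sum>k<n. x k) / (real n)\<^sup>2 - 0) < e" by blast
qed

lemma ln_fact_upper: "ln (fact k) \<le> (real k + 1) * ln (real k + 1) - real k"
proof (induction k)
  case (Suc k)
  have "ln (fact (Suc k)) = ln (real k + 1) + ln (fact k)"
    by (simp add: ln_mult_pos add.commute del: of_nat_Suc)
  also have "\<dots> \<le> (real k + 2) * ln (real k + 1) - real k" using Suc by (simp add: algebra_simps)
  also have "\<dots> \<le> (real k + 2) * ln (real k + 2) - real k - 1"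
  proof -
    have "ln ((real k + 1) / (real k + 2)) \<le> (real k + 1) / (real k + 2) - 1" by (rule ln_le_minus_one) simp
    then have "(real k + 2) * ln ((real k + 1) / (real k + 2)) \<le> (real k + 2) * ((real k + 1) / (real k + 2) - 1)"
      by (rule mult_left_mono) simp
    then have "(real k + 2) * (ln (real k + 1) - ln (real k + 2)) \<le> - 1"
      by (simp add: ln_div field_simps)
    then show ?thesis by (simp add: algebra_simps)
  qed
  finally show ?case by (simp add: algebra_simps)
qed simp

lemma ln_superfactorial_asymptotics:
  "(\<lambda>n. (\<Sum>k<n. ln (fact k)) / (real n)\<^sup>2 - ln (real n) / 2) \<longlonglongrightarrow> - 3 / 4"
proof -
  define F :: "real \<Rightarrow> real" where "F k = k\<^sup>2 / 2 * ln k - 3 / 4 * k\<^sup>2" for k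
  define x where "x k = ln (fact k) - (F (real k + 1) - F (real k))" for k
  have "(\<lambda>k. x k / real k) \<longlonglongrightarrow> 0"
  proof (rule tendsto_sandwich)
    show "\<forall>\<^sub>F k in sequentially. (real k * ln (real k) - real k - (F (real k + 1) - F (real k))) / real k \<le> x k / real k"
      unfolding x_def by (intro always_eventually allI divide_right_mono diff_right_mono ln_fact_lower) auto
    show "\<forall>\<^sub>F k in sequentially. x k / real k \<le> ((real k + 1) * ln (real k + 1) - real k - (F (real k + 1) - F (real k))) / real k"
      unfolding x_def by (intro always_eventually allI divide_right_mono diff_right_mono ln_fact_upper) auto
    show "(\<lambda>k. (real k * ln (real k) - real k - (F (real k + 1) - F (real k))) / real k) \<longlonglongrightarrow> 0"
      unfolding F_def by real_asymp
    show "(\<lambda>k. ((real k + 1) * ln (real k + 1) - real k - (F (real k + 1) - F (real k))) / real k) \<longlonglongrightarrow> 0"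
      unfolding F_def by real_asymp
  qed
  note lim = weighted_cesaro_null[OF this]
  have sum: "(\<Sum>k<n. x k) = (\<Sum>k<n. ln (fact k)) - F (real n)" for n
    by (induction n) (simp_all add: x_def F_def add.commute)
  have "(\<lambda>n. F (real n) / (real n)\<^sup>2 - ln (real n) / 2) \<longlonglongrightarrow> - 3 / 4" unfolding F_def by real_asymp
  from tendsto_add[OF lim this] show ?thesis by (simp add: sum diff_divide_distrib)
qed

lemma weyl_constant_convergent:
  "convergent (\<lambda>n. (ln (2 ^ (n * (n - 1) div 2)) + ln (\<Prod>k<n. pi ^ k / fact k)) / (real n)\<^sup>2 + ln (real n) / 2)"
proof -
  define c where "c = (ln 2 + ln pi) / 2 + 3 / 4"
  have half: "real (n * (n - 1) div 2) = real n * (real n - 1) / 2" for n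
  proof (cases n)
    case (Suc m)
    have "even (n * (n - 1))" by (cases n) auto
    then have "real (n * (n - 1) div 2) = real (n * (n - 1)) / 2" by (simp add: real_of_nat_div)
    then show ?thesis using Suc by (simp add: algebra_simps)
  qed simp
  have s: "(\<Sum>k<n. real k) = real n * (real n - 1) / 2" for n
    by (induction n) (auto simp: field_simps)
  have prod: "ln (\<Prod>k<n. pi ^ k / fact k) = real n * (real n - 1) / 2 * ln pi - (\<Sum>k<n. ln (fact k))" for n
  proof -
    have "ln (\<Prod>k<n. pi ^ k / fact k) = (\<Sum>k<n. real k * ln pi - ln (fact k))"
      by (simp add: ln_prod ln_div ln_realpow)
    then show ?thesis by (simp add: sum_subtractf sum_distrib_right[symmetric] s)
  qed
  have "(\<lambda>n. real n * (real n - 1) / 2 * (ln 2 + ln pi) / (real n)\<^sup>2) \<longlonglongrightarrow> (ln 2 + ln pi) / 2" by real_asymp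
  note lim = tendsto_diff[OF this ln_superfactorial_asymptotics]
  have eq: "(ln (2 ^ (n * (n - 1) div 2)) + ln (\<Prod>k<n. pi ^ k / fact k)) / (real n)\<^sup>2 + ln (real n) / 2
      = real n * (real n - 1) / 2 * (ln 2 + ln pi) / (real n)\<^sup>2 - ((\<Sum>k<n. ln (fact k)) / (real n)\<^sup>2 - ln (real n) / 2)" for n
    unfolding prod ln_realpow half by (simp add: add_divide_distrib diff_divide_distrib distrib_left)
  have "(\<lambda>n. (ln (2 ^ (n * (n - 1) div 2)) + ln (\<Prod>k<n. pi ^ k / fact k)) / (real n)\<^sup>2 + ln (real n) / 2) \<longlonglongrightarrow> c"
    unfolding eq c_def using lim by simp
  then show ?thesis by (rule convergentI)
qed

lemma gibbs_rate_ptau_convergent: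
  assumes R: "R > 0" and P: "P \<in> ncpolys 1"
  shows "convergent (\<lambda>n. gibbs_rate 1 R n (\<lambda>A. ptau n A P))"
proof -
  obtain L B where "confined_log_gas R L B (poly_potential P)"
    using confined_log_gas_poly_potential[OF R] by blast
  then interpret confined_log_gas R L B "poly_potential P" .
  define K :: "nat \<Rightarrow> real" where "K n = (\<Prod>k<n. pi ^ k / fact k)" for n
  have K: "K n > 0" for n unfolding K_def by (intro prod_pos) auto
  have "convergent (\<lambda>n. ln (enn2real (Z n)) / (real n)\<^sup>2)" using Z_limit by (simp add: convergent_def)
  from convergent_add[OF weyl_constant_convergent[folded K_def] this]
  have "convergent (\<lambda>n. (ln (2 ^ (n * (n - 1) div 2)) + ln (K n)) / (real n)\<^sup>2 + ln (real n) / 2 + ln (enn2real (Z n)) / (real n)\<^sup>2)" .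
  also have "?this \<longleftrightarrow> ?thesis"
  proof (intro convergent_cong eventually_sequentiallyI[of 1])
    fix n :: nat assume n: "1 \<le> n"
    have "enn2real (gibbs 1 R n (\<lambda>A. ptau n A P)) = 2 ^ (n * (n - 1) div 2) * (K n * enn2real (Z n))"
      unfolding one_matrix_partition_function(1)[OF R P n] K_def[symmetric] using less_imp_le[OF K]
      by (intro enn2real_ennreal mult_nonneg_nonneg) auto
    moreover have "ln (2 ^ (n * (n - 1) div 2) * (K n * enn2real (Z n))) = ln (2 ^ (n * (n - 1) div 2)) + (ln (K n) + ln (enn2real (Z n)))"
      using K[of n] one_matrix_partition_function(2)[OF R P n] by (simp only: ln_mult_pos mult_pos_pos zero_less_power zero_less_numeral)
    ultimately show "(ln (2 ^ (n * (n - 1) div 2)) + ln (K n)) / (real n)\<^sup>2 + ln (real n) / 2 + ln (enn2real (Z n)) / (real n)\<^sup>2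
        = gibbs_rate 1 R n (\<lambda>A. ptau n A P)"
      by (simp add: gibbs_rate_def add_divide_distrib)
  qed
  finally show ?thesis .
qed

lemma nctau_approx:
  assumes R: "R > 0" and h: "h \<in> nc_alg N R" and e: "e > 0"
  obtains p where "p \<in> ncpolys N" "\<And>n A. n \<ge> 1 \<Longrightarrow> A \<in> sa_tuples N n R \<Longrightarrow> \<bar>nctau n A h - ptau n A p\<bar> \<le> e"
proof -
  obtain s where s: "s \<in> h" using nc_alg_rep[OF h R] by blast
  have sc: "s \<in> nc_cauchy N R" by (rule nc_alg_cauchy[OF h R s])
  then obtain m where m: "\<And>j k. j \<ge> m \<Longrightarrow> k \<ge> m \<Longrightarrow> ncpoly_norm N R (s j - s k) < e"
    using e unfolding nc_cauchy_def by blast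
  have "\<bar>nctau n A h - ptau n A (s m)\<bar> \<le> e" if n: "n \<ge> 1" and A: "A \<in> sa_tuples N n R" for n A
  proof (rule LIMSEQ_le_const2)
    show "(\<lambda>j. \<bar>ptau n A (s j) - ptau n A (s m)\<bar>) \<longlonglongrightarrow> \<bar>nctau n A h - ptau n A (s m)\<bar>"
      by (intro tendsto_intros nctau_limit[OF R h s n A])
    have "\<bar>ptau n A (s j) - ptau n A (s m)\<bar> \<le> e" if "j \<ge> m" for j
      unfolding ptau_diff[symmetric]
      using ptau_le_norm[OF R ncpolys_diff[OF nc_cauchyD[OF sc] nc_cauchyD[OF sc]] n A, of j m] m[OF that order_refl] by simp
    then show "\<exists>M. \<forall>j\<ge>M. \<bar>ptau n A (s j) - ptau n A (s m)\<bar> \<le> e" by blast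
  qed
  then show thesis using that nc_cauchyD[OF sc] by blast
qed

lemma convergent_uniformly_approx:
  fixes x :: "nat \<Rightarrow> real"
  assumes "\<And>e. e > 0 \<Longrightarrow> \<exists>y. convergent y \<and> (\<forall>n\<ge>1. \<bar>x n - y n\<bar> \<le> e)"
  shows "convergent x"
proof (rule Cauchy_convergent, rule metric_CauchyI)
  fix e :: real assume e: "e > 0"
  obtain y where y: "convergent y" "\<And>n. n \<ge> 1 \<Longrightarrow> \<bar>x n - y n\<bar> \<le> e / 4" using assms[of "e / 4"] e by auto
  have "Cauchy y" using y(1) convergent_Cauchy by blast
  then obtain M where M: "\<And>j k. j \<ge> M \<Longrightarrow> k \<ge> M \<Longrightarrow> dist (y j) (y k) < e / 4" using metric_CauchyD[of y "e / 4"] e by auto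
  have "dist (x j) (x k) < e" if "j \<ge> max M 1" "k \<ge> max M 1" for j k
  proof -
    have "\<bar>y j - y k\<bar> < e / 4" "\<bar>x j - y j\<bar> \<le> e / 4" "\<bar>x k - y k\<bar> \<le> e / 4"
      using M[of j k] y(2)[of j] y(2)[of k] that by (auto simp: dist_real_def)
    then show ?thesis using e unfolding dist_real_def by linarith
  qed
  then show "\<exists>M. \<forall>j\<ge>M. \<forall>k\<ge>M. dist (x j) (x k) < e" by blast
qed

lemma gibbs_rate_dist:
  assumes R: "R > 0" and n: "n \<ge> 1" and \<sigma>: "admissible N R n \<sigma>" and \<tau>: "admissible N R n \<tau>"
    and le: "\<And>A. A \<in> sa_tuples N n R \<Longrightarrow> \<bar>\<sigma> A - \<tau> A\<bar> \<le> C"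
  shows "\<bar>gibbs_rate N R n \<sigma> - gibbs_rate N R n \<tau>\<bar> \<le> C"
proof -
  have "\<sigma> A \<le> \<tau> A + C" "\<tau> A \<le> \<sigma> A + C" if "A \<in> sa_tuples N n R" for A using le[OF that] by linarith+
  then show ?thesis using gibbs_rate_le[OF R n \<sigma> \<tau>, of C] gibbs_rate_le[OF R n \<tau> \<sigma>, of C] by fastforce
qed

lemma gibbs_rate_nctau_convergent:
  assumes R: "R > 0" and h: "h \<in> nc_alg 1 R"
  shows "convergent (\<lambda>n. gibbs_rate 1 R n (\<lambda>A. nctau n A h))"
proof (rule convergent_uniformly_approx)
  fix e :: real assume "e > 0"
  then obtain p where p: "p \<in> ncpolys 1" "\<And>n A. n \<ge> 1 \<Longrightarrow> A \<in> sa_tuples 1 n R \<Longrightarrow> \<bar>nctau n A h - ptau n A p\<bar> \<le> e"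
    using nctau_approx[OF R h] by blast
  have "\<bar>gibbs_rate 1 R n (\<lambda>A. nctau n A h) - gibbs_rate 1 R n (\<lambda>A. ptau n A p)\<bar> \<le> e" if n: "n \<ge> 1" for n
    by (rule gibbs_rate_dist[OF R n admissible_nctau[OF R h n] admissible_ptau[OF R p(1) n] p(2)[OF n]])
  then show "\<exists>y. convergent y \<and> (\<forall>n\<ge>1. \<bar>gibbs_rate 1 R n (\<lambda>A. nctau n A h) - y n\<bar> \<le> e)"
    using gibbs_rate_ptau_convergent[OF R p(1)] by blast
qed

subsection \<open>The free pressure\<close>

lemma free_pressure_eq:
  assumes R: "R > 0" and h: "h \<in> nc_alg N R"
  shows "free_pressure N R h = limsup (\<lambda>n. ereal (gibbs_rate N R n (\<lambda>A. nctau n A h)))"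
  unfolding free_pressure_def
proof (intro Limsup_eq eventually_sequentiallyI[of 1])
  fix n :: nat assume n: "1 \<le> n"
  show "ereal (1 / (real n)\<^sup>2 * ln (set_lebesgue_integral (Lambda_PiM n {1..N}) (sa_tuples N n R)
        (\<lambda>A. exp (- ((real n)\<^sup>2 * Re (ntrace (nc_eval n A h)))))) + real N / 2 * ln (real n))
      = ereal (gibbs_rate N R n (\<lambda>A. nctau n A h))"
    unfolding nctau_def[symmetric] set_lebesgue_integral_gibbs[OF R admissible_nctau[OF R h n]] gibbs_rate_def ..
qed

lemma free_pressure_cong_rate:
  assumes "R > 0" "h \<in> nc_alg N R" "\<And>n. n \<ge> 1 \<Longrightarrow> gibbs_rate N R n (\<lambda>A. nctau n A h) = r n"
  shows "free_pressure N R h = limsup (\<lambda>n. ereal (r n))"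
  unfolding free_pressure_eq[OF assms(1,2)]
  by (intro Limsup_eq eventually_sequentiallyI[of 1]) (simp add: assms(3))

lemma free_pressure_le:
  assumes "R > 0" "h \<in> nc_alg N R" "\<And>n. n \<ge> 1 \<Longrightarrow> gibbs_rate N R n (\<lambda>A. nctau n A h) \<le> r n"
  shows "free_pressure N R h \<le> limsup (\<lambda>n. ereal (r n))"
  unfolding free_pressure_eq[OF assms(1,2)]
  by (intro Limsup_mono eventually_sequentiallyI[of 1]) (simp add: assms(3))

lemma free_pressure_finite:
  assumes R: "R > 0" and h: "h \<in> nc_alg N R"
  shows "\<bar>free_pressure N R h\<bar> \<noteq> \<infinity>"
proof -
  define v where "v n = gibbs_rate 1 R n (\<lambda>_. 0)" for n
  have "convergent (\<lambda>n. gibbs_rate 1 R n (\<lambda>A. ptau n A 0))" by (rule gibbs_rate_ptau_convergent[OF R ncpolys_zero])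
  then have "convergent v" unfolding v_def by (simp add: ptau_eq ncpoly_eval_zero)
  then obtain V where V: "v \<longlonglongrightarrow> V" unfolding convergent_def by blast
  let ?C = "nc_norm N R h" and ?r = "\<lambda>n. gibbs_rate N R n (\<lambda>A. nctau n A h)"
  have r: "\<bar>?r n - real N * v n\<bar> \<le> ?C" if n: "n \<ge> 1" for n
  proof -
    have z: "enn2real (gibbs M R n (\<lambda>_. 0)) = sa_vol n R ^ M" for M
      unfolding gibbs_zero[OF R] sa_vol(2)[OF R n] using less_imp_le[OF sa_vol(1)[OF R n]] by (simp add: ennreal_power)
    have "gibbs_rate N R n (\<lambda>_. 0) = real N * v n"
      unfolding v_def gibbs_rate_def z by (simp add: ln_realpow algebra_simps)
    then show ?thesis
      using gibbs_rate_dist[OF R n admissible_nctau[OF R h n] admissible_const[OF R], of 0 ?C] nctau_le_norm[OF R h n] by simp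
  qed
  have lim: "limsup (\<lambda>n. ereal (real N * v n + c)) = ereal (real N * V + c)" for c
    by (intro lim_imp_Limsup) (auto intro!: tendsto_intros V)
  have "free_pressure N R h \<le> ereal (real N * V + ?C)"
    unfolding lim[symmetric] using r by (intro free_pressure_le[OF R h]) (auto simp: abs_le_iff algebra_simps)
  moreover have "ereal (real N * V + - ?C) \<le> free_pressure N R h"
    unfolding lim[symmetric] free_pressure_eq[OF R h]
    by (intro Limsup_mono eventually_sequentiallyI[of 1]) (use r in \<open>auto simp: abs_le_iff algebra_simps\<close>)
  ultimately show ?thesis by (cases "free_pressure N R h") auto
qed

lemma free_pressure_convex:
  assumes R: "R > 0" and g: "g \<in> nc_alg N R" and h: "h \<in> nc_alg N R" and t: "0 \<le> t" "t \<le> 1"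
  shows "free_pressure N R (nc_add N R (nc_scale N R (complex_of_real t) g) (nc_scale N R (complex_of_real (1 - t)) h))
    \<le> ereal t * free_pressure N R g + ereal (1 - t) * free_pressure N R h"
proof -
  let ?g = "nc_scale N R (complex_of_real t) g" and ?h = "nc_scale N R (complex_of_real (1 - t)) h"
  let ?a = "\<lambda>n. gibbs_rate N R n (\<lambda>A. nctau n A g)" and ?b = "\<lambda>n. gibbs_rate N R n (\<lambda>A. nctau n A h)"
  note sg = nc_scale_props[OF R g, where c = t] and sh = nc_scale_props[OF R h, where c = "1 - t"]
  have mem: "nc_add N R ?g ?h \<in> nc_alg N R"
    using nc_add_rep(1)[OF R sg(1) sh(1)] nc_alg_rep[OF sg(1) R] nc_alg_rep[OF sh(1) R] by blast
  have "free_pressure N R (nc_add N R ?g ?h) \<le> limsup (\<lambda>n. ereal (t * ?a n + (1 - t) * ?b n))"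
  proof (rule free_pressure_le[OF R mem])
    fix n :: nat assume n: "n \<ge> 1"
    have "nctau n A (nc_add N R ?g ?h) = t * nctau n A g + (1 - t) * nctau n A h" if A: "A \<in> sa_tuples N n R" for A
      unfolding nctau_add[OF R sg(1) sh(1) n A] sg(2)[OF n A] sh(2)[OF n A] ..
    then have "gibbs_rate N R n (\<lambda>A. nctau n A (nc_add N R ?g ?h))
        = gibbs_rate N R n (\<lambda>A. t * nctau n A g + (1 - t) * nctau n A h)"
      by (rule gibbs_rate_cong)
    also have "\<dots> \<le> t * ?a n + (1 - t) * ?b n"
      by (rule gibbs_rate_convex[OF R n admissible_nctau[OF R g n] admissible_nctau[OF R h n] t])
    finally show "gibbs_rate N R n (\<lambda>A. nctau n A (nc_add N R ?g ?h)) \<le> t * ?a n + (1 - t) * ?b n" .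
  qed
  also have "\<dots> = limsup (\<lambda>n. ereal t * ereal (?a n) + ereal (1 - t) * ereal (?b n))" by simp
  also have "\<dots> \<le> limsup (\<lambda>n. ereal t * ereal (?a n)) + limsup (\<lambda>n. ereal (1 - t) * ereal (?b n))"
    by (rule ereal_limsup_add_mono)
  also have "\<dots> = ereal t * free_pressure N R g + ereal (1 - t) * free_pressure N R h"
    unfolding free_pressure_eq[OF R g] free_pressure_eq[OF R h] using t by (simp only: limsup_ereal_mult_left diff_ge_0_iff_ge)
  finally show ?thesis .
qed

lemma free_pressure_le_add:
  assumes R: "R > 0" and g: "g \<in> nc_alg N R" and h: "h \<in> nc_alg N R"
    and le: "\<And>n A. n \<ge> 1 \<Longrightarrow> A \<in> sa_tuples N n R \<Longrightarrow> nctau n A h \<le> nctau n A g + C"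
  shows "free_pressure N R g \<le> free_pressure N R h + ereal C"
proof -
  have "free_pressure N R g \<le> limsup (\<lambda>n. ereal (gibbs_rate N R n (\<lambda>A. nctau n A h) + C))"
    using gibbs_rate_le[OF R _ admissible_nctau[OF R h] admissible_nctau[OF R g] le]
    by (intro free_pressure_le[OF R g]) auto
  also have "\<dots> = limsup (\<lambda>n. ereal (gibbs_rate N R n (\<lambda>A. nctau n A h)) + ereal C)" by simp
  also have "\<dots> = free_pressure N R h + ereal C"
    unfolding free_pressure_eq[OF R h] by (rule Limsup_add_ereal_right) auto
  finally show ?thesis .
qed

lemma free_pressure_antimono:
  assumes R: "R > 0" and g: "g \<in> nc_alg N R" and h: "h \<in> nc_alg N R" and le: "nc_le N R g h"
  shows "free_pressure N R h \<le> free_pressure N R g"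
  using free_pressure_le_add[OF R h g, of 0] nctau_mono[OF R g h le] by (simp add: zero_ereal_def[symmetric])

lemma free_pressure_lipschitz:
  assumes R: "R > 0" and g: "g \<in> nc_alg N R" and h: "h \<in> nc_alg N R"
  shows "\<bar>free_pressure N R g - free_pressure N R h\<bar> \<le> ereal (nc_norm N R (nc_diff N R g h))"
proof -
  have mem: "nc_diff N R g h \<in> nc_alg N R"
    using nc_diff_rep(1)[OF R g h] nc_alg_rep[OF g R] nc_alg_rep[OF h R] by blast
  let ?C = "nc_norm N R (nc_diff N R g h)"
  have d: "\<bar>nctau n A g - nctau n A h\<bar> \<le> ?C" if "n \<ge> 1" "A \<in> sa_tuples N n R" for n A
    using nctau_le_norm[OF R mem that] nctau_diff[OF R g h that] by simp
  have "free_pressure N R g \<le> free_pressure N R h + ereal ?C"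
    by (rule free_pressure_le_add[OF R g h]) (use d in \<open>auto simp: abs_le_iff algebra_simps\<close>)
  moreover have "free_pressure N R h \<le> free_pressure N R g + ereal ?C"
    by (rule free_pressure_le_add[OF R h g]) (use d in \<open>auto simp: abs_le_iff algebra_simps\<close>)
  moreover obtain a b where "free_pressure N R g = ereal a" "free_pressure N R h = ereal b"
    using free_pressure_finite[OF R g] free_pressure_finite[OF R h] by auto
  ultimately show ?thesis by (auto simp: abs_le_iff)
qed

lemma free_pressure_restrict:
  assumes R: "R\<^sub>1 > 0" "R\<^sub>1 \<le> R" and h: "h \<in> nc_alg N R"
  shows "free_pressure N R\<^sub>1 (nc_restrict N R\<^sub>1 h) \<le> free_pressure N R h"
proof -
  have R0: "R > 0" using R by simp
  note r = nc_restrict_props[OF R h]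
  show ?thesis
    unfolding free_pressure_eq[OF R0 h]
  proof (rule free_pressure_le[OF R(1) r(1)])
    fix n :: nat assume n: "n \<ge> 1"
    show "gibbs_rate N R\<^sub>1 n (\<lambda>A. nctau n A (nc_restrict N R\<^sub>1 h)) \<le> gibbs_rate N R n (\<lambda>A. nctau n A h)"
      by (rule gibbs_rate_mono_radius[OF R r(2)[OF n] n admissible_nctau[OF R(1) r(1) n] admissible_nctau[OF R0 h n]])
  qed
qed

lemma free_pressure_dilate:
  assumes R: "R > 0" "R\<^sub>1 > 0" and h: "h \<in> nc_alg N R"
  shows "free_pressure N R\<^sub>1 (nc_dilate N R R\<^sub>1 h) = free_pressure N R h + ereal (real N * ln (R\<^sub>1 / R))"
proof -
  note d = nc_dilate_props[OF R h]
  have "free_pressure N R\<^sub>1 (nc_dilate N R R\<^sub>1 h) = limsup (\<lambda>n. ereal (gibbs_rate N R n (\<lambda>A. nctau n A h) + real N * ln (R\<^sub>1 / R)))"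
  proof (rule free_pressure_cong_rate[OF R(2) d(1)])
    fix n :: nat assume n: "n \<ge> 1"
    have "gibbs_rate N R\<^sub>1 n (\<lambda>A. nctau n A (nc_dilate N R R\<^sub>1 h)) = gibbs_rate N R\<^sub>1 n (\<lambda>A. nctau n (scale_tuple N (R / R\<^sub>1) A) h)"
      by (rule gibbs_rate_cong[OF d(2)[OF n]])
    also have "\<dots> = gibbs_rate N R n (\<lambda>A. nctau n A h) + real N * ln (R\<^sub>1 / R)"
      by (rule gibbs_rate_dilate[OF R admissible_nctau[OF R(1) h n] n])
    finally show "gibbs_rate N R\<^sub>1 n (\<lambda>A. nctau n A (nc_dilate N R R\<^sub>1 h)) = gibbs_rate N R n (\<lambda>A. nctau n A h) + real N * ln (R\<^sub>1 / R)" .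
  qed
  also have "\<dots> = limsup (\<lambda>n. ereal (gibbs_rate N R n (\<lambda>A. nctau n A h)) + ereal (real N * ln (R\<^sub>1 / R)))" by simp
  also have "\<dots> = free_pressure N R h + ereal (real N * ln (R\<^sub>1 / R))"
    unfolding free_pressure_eq[OF R(1) h] by (rule Limsup_add_ereal_right) auto
  finally show ?thesis .
qed

lemma free_pressure_free_sum:
  assumes R: "R > 0" and L: "L \<le> N" and g: "g \<in> nc_alg L R" and h: "h \<in> nc_alg (N - L) R"
  shows "free_pressure N R (nc_add N R (nc_embed_left N R g) (nc_embed_right L N R h))
    = limsup (\<lambda>n. ereal (gibbs_rate L R n (\<lambda>A. nctau n A g)) + ereal (gibbs_rate (N - L) R n (\<lambda>A. nctau n A h)))"
proof -
  let ?g = "nc_embed_left N R g" and ?h = "nc_embed_right L N R h"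
  note l = nc_embed_left_props[OF R L g] and r = nc_embed_right_props[OF R L h]
  have mem: "nc_add N R ?g ?h \<in> nc_alg N R"
    using nc_add_rep(1)[OF R l(1) r(1)] nc_alg_rep[OF l(1) R] nc_alg_rep[OF r(1) R] by blast
  have "free_pressure N R (nc_add N R ?g ?h)
      = limsup (\<lambda>n. ereal (gibbs_rate L R n (\<lambda>A. nctau n A g) + gibbs_rate (N - L) R n (\<lambda>A. nctau n A h)))"
  proof (rule free_pressure_cong_rate[OF R mem])
    fix n :: nat assume n: "n \<ge> 1"
    have "nctau n A (nc_add N R ?g ?h) = nctau n (restrict A {1..L}) g + nctau n (\<lambda>i\<in>{1..N - L}. A (L + i)) h"
      if A: "A \<in> sa_tuples N n R" for A
      unfolding nctau_add[OF R l(1) r(1) n A] l(2)[OF n A] r(2)[OF n A] ..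
    then have "gibbs_rate N R n (\<lambda>A. nctau n A (nc_add N R ?g ?h))
        = gibbs_rate N R n (\<lambda>A. nctau n (restrict A {1..L}) g + nctau n (\<lambda>i\<in>{1..N - L}. A (L + i)) h)"
      by (rule gibbs_rate_cong)
    also have "\<dots> = gibbs_rate L R n (\<lambda>A. nctau n A g) + gibbs_rate (N - L) R n (\<lambda>A. nctau n A h)"
      by (rule gibbs_rate_product[OF R L n admissible_nctau[OF R g n] admissible_nctau[OF R h n]])
    finally show "gibbs_rate N R n (\<lambda>A. nctau n A (nc_add N R ?g ?h))
        = gibbs_rate L R n (\<lambda>A. nctau n A g) + gibbs_rate (N - L) R n (\<lambda>A. nctau n A h)" .
  qed
  then show ?thesis by simp
qed

lemma free_pressure_subadditive:
  assumes R: "R > 0" and L: "L \<le> N" and g: "g \<in> nc_alg L R" and h: "h \<in> nc_alg (N - L) R"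
  shows "free_pressure N R (nc_add N R (nc_embed_left N R g) (nc_embed_right L N R h))
    \<le> free_pressure L R g + free_pressure (N - L) R h"
  unfolding free_pressure_free_sum[OF assms] free_pressure_eq[OF R g] free_pressure_eq[OF R h]
  by (rule ereal_limsup_add_mono)

lemma free_pressure_additive_one:
  assumes R: "R > 0" and N: "1 \<le> N" and g: "g \<in> nc_alg 1 R" and h: "h \<in> nc_alg (N - 1) R"
  shows "free_pressure N R (nc_add N R (nc_embed_left N R g) (nc_embed_right 1 N R h))
    = free_pressure 1 R g + free_pressure (N - 1) R h"
proof -
  obtain l where "(\<lambda>n. gibbs_rate 1 R n (\<lambda>A. nctau n A g)) \<longlonglongrightarrow> l"
    using gibbs_rate_nctau_convergent[OF R g] by (auto simp: convergent_def)
  then have l: "(\<lambda>n. ereal (gibbs_rate 1 R n (\<lambda>A. nctau n A g))) \<longlonglongrightarrow> ereal l" by (rule tendsto_ereal)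
  have "free_pressure 1 R g = ereal l"
    unfolding free_pressure_eq[OF R g] using l by (intro lim_imp_Limsup) auto
  then show ?thesis
    unfolding free_pressure_free_sum[OF assms] free_pressure_eq[OF R h]
    using ereal_limsup_lim_add[OF l, of "\<lambda>n. ereal (gibbs_rate (N - 1) R n (\<lambda>A. nctau n A h))"] by auto
qed

theorem proposition2p3:
  fixes N :: nat and R :: real
  assumes N: "N \<ge> 1" and R: "R > 0"
  shows
    "(\<forall>h\<^sub>1 \<in> nc_sa N R. \<forall>h\<^sub>2 \<in> nc_sa N R. \<forall>t::real. 0 \<le> t \<and> t \<le> 1 \<longrightarrow>
        free_pressure N R
          (nc_add N R (nc_scale N R (complex_of_real t) h\<^sub>1)
                      (nc_scale N R (complex_of_real (1 - t)) h\<^sub>2))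
        \<le> ereal t * free_pressure N R h\<^sub>1 + ereal (1 - t) * free_pressure N R h\<^sub>2) \<and>
     (\<forall>h\<^sub>1 \<in> nc_sa N R. \<forall>h\<^sub>2 \<in> nc_sa N R.
        nc_le N R h\<^sub>1 h\<^sub>2 \<longrightarrow> free_pressure N R h\<^sub>1 \<ge> free_pressure N R h\<^sub>2) \<and>
     (\<forall>h\<^sub>1 \<in> nc_sa N R. \<forall>h\<^sub>2 \<in> nc_sa N R.
        \<bar>free_pressure N R h\<^sub>1 - free_pressure N R h\<^sub>2\<bar>
        \<le> ereal (nc_norm N R (nc_diff N R h\<^sub>1 h\<^sub>2))) \<and>
     (\<forall>R\<^sub>1::real. \<forall>h \<in> nc_sa N R. R > R\<^sub>1 \<and> R\<^sub>1 > 0 \<longrightarrow>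
        free_pressure N R\<^sub>1 (nc_restrict N R\<^sub>1 h) \<le> free_pressure N R h) \<and>
     (\<forall>R\<^sub>1::real. \<forall>h \<in> nc_sa N R. R\<^sub>1 > 0 \<longrightarrow>
        free_pressure N R\<^sub>1 (nc_dilate N R R\<^sub>1 h)
        = free_pressure N R h + ereal (real N * ln (R\<^sub>1 / R))) \<and>
     (\<forall>L::nat. \<forall>h\<^sub>1 \<in> nc_sa L R. \<forall>h\<^sub>2 \<in> nc_sa (N - L) R. 1 \<le> L \<and> L < N \<longrightarrow>
        free_pressure N R (nc_add N R (nc_embed_left N R h\<^sub>1) (nc_embed_right L N R h\<^sub>2))
          \<le> free_pressure L R h\<^sub>1 + free_pressure (N - L) R h\<^sub>2 \<and>
        (L = 1 \<longrightarrow>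
          free_pressure N R (nc_add N R (nc_embed_left N R h\<^sub>1) (nc_embed_right L N R h\<^sub>2))
          = free_pressure L R h\<^sub>1 + free_pressure (N - L) R h\<^sub>2))"
proof -
  have sa: "h \<in> nc_alg M R" if "h \<in> nc_sa M R" for h M using that by (simp add: nc_sa_def)
  show ?thesis
  proof (intro conjI ballI allI impI; (elim conjE)?)
    fix h\<^sub>1 h\<^sub>2 and t :: real
    assume "h\<^sub>1 \<in> nc_sa N R" "h\<^sub>2 \<in> nc_sa N R" "0 \<le> t" "t \<le> 1"
    then show "free_pressure N R
          (nc_add N R (nc_scale N R (complex_of_real t) h\<^sub>1) (nc_scale N R (complex_of_real (1 - t)) h\<^sub>2))
        \<le> ereal t * free_pressure N R h\<^sub>1 + ereal (1 - t) * free_pressure N R h\<^sub>2"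
      by (intro free_pressure_convex R sa)
  next
    fix h\<^sub>1 h\<^sub>2
    assume "h\<^sub>1 \<in> nc_sa N R" "h\<^sub>2 \<in> nc_sa N R" "nc_le N R h\<^sub>1 h\<^sub>2"
    then show "free_pressure N R h\<^sub>2 \<le> free_pressure N R h\<^sub>1"
      by (intro free_pressure_antimono R sa)
  next
    fix h\<^sub>1 h\<^sub>2
    assume "h\<^sub>1 \<in> nc_sa N R" "h\<^sub>2 \<in> nc_sa N R"
    then show "\<bar>free_pressure N R h\<^sub>1 - free_pressure N R h\<^sub>2\<bar> \<le> ereal (nc_norm N R (nc_diff N R h\<^sub>1 h\<^sub>2))"
      by (intro free_pressure_lipschitz R sa)
  next
    fix R\<^sub>1 :: real and h
    assume "h \<in> nc_sa N R" "R\<^sub>1 < R" "0 < R\<^sub>1"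
    then show "free_pressure N R\<^sub>1 (nc_restrict N R\<^sub>1 h) \<le> free_pressure N R h"
      by (intro free_pressure_restrict sa) auto
  next
    fix R\<^sub>1 :: real and h
    assume "h \<in> nc_sa N R" "0 < R\<^sub>1"
    then show "free_pressure N R\<^sub>1 (nc_dilate N R R\<^sub>1 h) = free_pressure N R h + ereal (real N * ln (R\<^sub>1 / R))"
      by (intro free_pressure_dilate R sa)
  next
    fix L h\<^sub>1 h\<^sub>2
    assume "h\<^sub>1 \<in> nc_sa L R" "h\<^sub>2 \<in> nc_sa (N - L) R" "1 \<le> L" "L < N"
    then show "free_pressure N R (nc_add N R (nc_embed_left N R h\<^sub>1) (nc_embed_right L N R h\<^sub>2))
        \<le> free_pressure L R h\<^sub>1 + free_pressure (N - L) R h\<^sub>2"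
      by (intro free_pressure_subadditive R sa) auto
  next
    fix L h\<^sub>1 h\<^sub>2
    assume h: "h\<^sub>1 \<in> nc_sa L R" "h\<^sub>2 \<in> nc_sa (N - L) R" and L: "L = 1"
    show "free_pressure N R (nc_add N R (nc_embed_left N R h\<^sub>1) (nc_embed_right L N R h\<^sub>2))
        = free_pressure L R h\<^sub>1 + free_pressure (N - L) R h\<^sub>2"
      unfolding L using h unfolding L by (intro free_pressure_additive_one R N sa)
  qed
qed

end
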